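(* Let $(T_t)_{t\ge0}$ be a Feller semigroup on $X=C_0(\mathbb{R}^d)$ whose generator $(L,\mathrm{Dom}(L))$ is given for all $\varphi\in C_0^2(\mathbb{R}^d)$ by $$L\varphi(x)=-C(x)\varphi(x)-B(x)\cdot\nabla\varphi(x)+\mathrm{tr}(A(x)\,\mathrm{Hess}\,\varphi(x)),$$ where $C(x)\ge0$, $B(x)\in\mathbb{R}^d$, $A(x)\in\mathbb{R}^{d\times d}$ is symmetric, the coefficients $A,B,C$ are bounded and continuous, and there exist $a_0,A_0\in\mathbb{R}$ with $0<a_0\le A_0<\infty$ and $a_0|z|^2\le z\cdot A(x)z\le A_0|z|^2$ for all $x,z\in\mathbb{R}^d$. Let $C^{2,\alpha}_c(\mathbb{R}^d)$, for some $\alpha\in(0,1)$, be a core for $(L,\mathrm{Dom}(L))$. Let $f_0\in\mathrm{Dom}(L)$ and let $\mu$ be a finite (non-zero) Borel measure with $\mathrm{supp}\,\mu\subset(0,1)$. Then the function $f(t,x_0)$, $t>0$, $x_0\in\mathbb{R}^d$, given by $$f(t,x_0)=\lim_{n\to\infty}\int_0^\infty\int_{\mathbb{R}^{nd}}e^{-\frac\tau n\sum_{j=1}^n\left(C(x_{j-1})+\frac14|A^{-1/2}(x_{j-1})B(x_{j-1})|^2\right)}\,e^{\frac12\sum_{j=1}^nA^{-1}(x_{j-1})B(x_{j-1})\cdot(x_{j-1}-x_j)}\,p_A(\tau/n,x_0,x_1)\cdots p_A(\tau/n,x_{n-1},x_n)\,f_0(x_n)\,p^\mu(t,\tau)\,dx_1\cdots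 dx_n\,d\tau,$$ where $$p_A(t,x,y):=\frac{1}{\sqrt{(4\pi t)^d\det A(x)}}\exp\Big(-\frac{A^{-1}(x)(x-y)\cdot(x-y)}{4t}\Big),$$ solves the Cauchy problem for the distributed order time-fractional diffusion equation $$\mathcal{D}^\mu f(t,x)=-C(x)f(t,x)-B(x)\cdot\nabla f(t,x)+\mathrm{tr}(A(x)\,\mathrm{Hess}\,f(t,x))$$ with the initial condition $f(0,x)=f_0(x)$. Moreover, the convergence is uniform with respect to $x_0\in\mathbb{R}^d$ and with respect to $t\in(0,t^*]$ for all $t^*>0$.
   Context: Spaces. $X=C_0(\mathbb{R}^d)$: Banach space (supremum norm) of continuous functions vanishing at infinity. $C_0^2(\mathbb{R}^d)=\{\varphi\in C^2(\mathbb{R}^d):\partial^\beta\varphi\in C_0(\mathbb{R}^d),|\beta|\le2\}$. $C^{2,\alpha}_c(\mathbb{R}^d)$: compactly supported $C^2$ functions whose second order partial derivatives are Hölder continuous with exponent $\alpha$. A Feller semigroup is a strongly continuous, positivity preserving, sub-Markovian ($\varphi\le1\Rightarrow T_t\varphi\le1$) semigroup on $C_0(\mathbb{R}^d)$. A core for $L$ is a subspace of $\mathrm{Dom}(L)$ on which the restriction of $L$ has closure $(L,\mathrm{Dom}(L))$. Distributed order derivative. For a function $u$ of $t$, $$\mathcal{D}^\mu u(t):=\int_0^1\Big[\Big(\frac{d}{dt}\Big)^\beta u(t)-\frac{t^{-\beta}u(0)}{\Gamma(1-\beta)}\Big]\mu(d\beta),\qquad \Big(\frac{d}{dt}\Big)^\beta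 u(t):=\frac1{\Gamma(1-\beta)}\frac{d}{dt}\int_0^t\frac{u(r)}{(t-r)^\beta}\,dr$$ (Riemann–Liouville derivative); the bracket is the Caputo derivative of order $\beta$. Solution. The Cauchy problem is understood as the abstract problem in $X$: $\mathcal{D}^\mu f(t)=Lf(t)$ for $t>0$, $f(0)=f_0$, where $L$ is the generator $(L,\mathrm{Dom}(L))$ extending the displayed differential operator. Inverse subordinator density. Let $f^\mu(s):=\int_0^1s^\beta\mu(d\beta)$, $s>0$, and let $(D^\mu_t)_{t\ge0}$ be the subordinator (one-dimensional Lévy process with a.s. non-decreasing paths) with $\mathbb{E}[e^{-sD^\mu_t}]=e^{-tf^\mu(s)}$. Put $E^\mu_t:=\inf\{\tau\ge0:D^\mu_\tau>t\}$. For $t>0$, $p^\mu(t,\cdot)$ denotes the probability density of $E^\mu_t$, which vanishes on $(-\infty,0)$. *)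

theory Defs
  imports "HOL-Probability.Probability"
begin

section \<open>The Banach space of continuous functions vanishing at infinity\<close>

text \<open>Having a type of its own for this space, with its (true) separability recorded as an
  instance of \<^class>\<open>second_countable_topology\<close>, makes the Bochner integral of the library
  available for functions with values in it.\<close>

typedef (overloaded) 'a c0fun =
  "{f :: 'a::euclidean_space \<Rightarrow>\<^sub>C real. (apply_bcontfun f \<longlongrightarrow> 0) at_infinity}"
  morphisms bcontfun_of_c0 Abs_c0fun
  by (rule exI[of _ 0]) (auto simp: zero_bcontfun.rep_eq)

definition apply_c0 :: "'a::euclidean_space c0fun \<Rightarrow> 'a \<Rightarrow> real"
  where "apply_c0 f = apply_bcontfun (bcontfun_of_c0 f)"

lemma tendsto_apply_c0: "(apply_c0 f \<longlongrightarrow> 0) at_infinity"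
  using bcontfun_of_c0[of f] by (simp add: apply_c0_def)

lemma c0fun_eqI: "(\<And>x. apply_c0 f x = apply_c0 g x) \<Longrightarrow> f = g"
  by (metis apply_c0_def bcontfun_eqI bcontfun_of_c0_inject)

lemma apply_c0_cases:
  assumes "continuous_on UNIV f" "(f \<longlongrightarrow> 0) at_infinity"
  obtains g where "f = apply_c0 g"
proof -
  obtain b where b: "\<And>x. norm x \<ge> b \<Longrightarrow> \<bar>f x\<bar> \<le> 1"
    using tendstoD[OF assms(2), of 1] by (force simp: eventually_at_infinity)
  have "bounded (f ` cball 0 b)"
    by (intro compact_imp_bounded compact_continuous_image continuous_on_subset[OF assms(1)]) auto
  then obtain K where "\<forall>x\<in>cball 0 b. \<bar>f x\<bar> \<le> K"
    by (auto simp: bounded_iff)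
  then have K: "\<And>x. norm x \<le> b \<Longrightarrow> \<bar>f x\<bar> \<le> K"
    by simp
  have "\<bar>f x\<bar> \<le> max K 1" for x
    using b[of x] K[of x] by (cases "norm x \<le> b") auto
  then have "bounded (range f)"
    unfolding bounded_iff by auto
  with assms(1) have "f \<in> bcontfun"
    by (simp add: bcontfun_def)
  then obtain g' where g': "f = apply_bcontfun g'"
    by (rule bcontfunE)
  have "f = apply_c0 (Abs_c0fun g')"
    using assms(2) by (simp add: apply_c0_def Abs_c0fun_inverse g')
  then show thesis by (rule that)
qed

instantiation c0fun :: (euclidean_space) real_normed_vector
begin

definition zero_c0fun :: "'a c0fun" where "zero_c0fun = Abs_c0fun 0"
definition plus_c0fun :: "'a c0fun \<Rightarrow> 'a c0fun \<Rightarrow> 'a c0fun"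
  where "plus_c0fun f g = Abs_c0fun (bcontfun_of_c0 f + bcontfun_of_c0 g)"
definition minus_c0fun :: "'a c0fun \<Rightarrow> 'a c0fun \<Rightarrow> 'a c0fun"
  where "minus_c0fun f g = Abs_c0fun (bcontfun_of_c0 f - bcontfun_of_c0 g)"
definition uminus_c0fun :: "'a c0fun \<Rightarrow> 'a c0fun"
  where "uminus_c0fun f = Abs_c0fun (- bcontfun_of_c0 f)"
definition scaleR_c0fun :: "real \<Rightarrow> 'a c0fun \<Rightarrow> 'a c0fun"
  where "scaleR_c0fun c f = Abs_c0fun (c *\<^sub>R bcontfun_of_c0 f)"
definition norm_c0fun :: "'a c0fun \<Rightarrow> real" where "norm_c0fun f = norm (bcontfun_of_c0 f)"
definition dist_c0fun :: "'a c0fun \<Rightarrow> 'a c0fun \<Rightarrow> real"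
  where "dist_c0fun f g = dist (bcontfun_of_c0 f) (bcontfun_of_c0 g)"
definition sgn_c0fun :: "'a c0fun \<Rightarrow> 'a c0fun" where "sgn_c0fun f = Abs_c0fun (bcontfun_of_c0 f /\<^sub>R norm (bcontfun_of_c0 f))"
definition uniformity_c0fun :: "('a c0fun \<times> 'a c0fun) filter"
  where "uniformity_c0fun = (INF e\<in>{0 <..}. principal {(x, y). dist x y < e})"
definition open_c0fun :: "'a c0fun set \<Rightarrow> bool"
  where "open_c0fun S = (\<forall>x\<in>S. \<forall>\<^sub>F (x', y) in uniformity. x' = x \<longrightarrow> y \<in> S)"

lemma bcontfun_of_c0_simps:
  "bcontfun_of_c0 (0 :: 'a c0fun) = 0"
  "bcontfun_of_c0 (f + g) = bcontfun_of_c0 f + bcontfun_of_c0 (g :: 'a c0fun)"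
  "bcontfun_of_c0 (f - g) = bcontfun_of_c0 f - bcontfun_of_c0 (g :: 'a c0fun)"
  "bcontfun_of_c0 (- f) = - bcontfun_of_c0 (f :: 'a c0fun)"
  "bcontfun_of_c0 (c *\<^sub>R f) = c *\<^sub>R bcontfun_of_c0 (f :: 'a c0fun)"
proof -
  note lim = bcontfun_of_c0[of f, simplified] bcontfun_of_c0[of g, simplified]
  show "bcontfun_of_c0 (0 :: 'a c0fun) = 0"
    by (simp add: zero_c0fun_def Abs_c0fun_inverse zero_bcontfun.rep_eq)
  show "bcontfun_of_c0 (f + g) = bcontfun_of_c0 f + bcontfun_of_c0 g"
    using tendsto_add[OF lim] by (simp add: plus_c0fun_def Abs_c0fun_inverse plus_bcontfun.rep_eq)
  show "bcontfun_of_c0 (f - g) = bcontfun_of_c0 f - bcontfun_of_c0 g"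
    using tendsto_diff[OF lim] by (simp add: minus_c0fun_def Abs_c0fun_inverse minus_bcontfun.rep_eq)
  show "bcontfun_of_c0 (- f) = - bcontfun_of_c0 f"
    using tendsto_minus[OF lim(1)] by (simp add: uminus_c0fun_def Abs_c0fun_inverse uminus_bcontfun.rep_eq)
  show "bcontfun_of_c0 (c *\<^sub>R f) = c *\<^sub>R bcontfun_of_c0 f"
    using tendsto_mult_right_zero[OF lim(1), of c]
    by (simp add: scaleR_c0fun_def Abs_c0fun_inverse scaleR_bcontfun.rep_eq)
qed

instance
proof
  fix f g h :: "'a c0fun" and a b :: real
  note [simp] = bcontfun_of_c0_inject[symmetric] bcontfun_of_c0_simps
  show "f + g + h = f + (g + h)" "f + g = g + f" "0 + f = f" "- f + f = 0" "f - g = f + - g"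
    "a *\<^sub>R (f + g) = a *\<^sub>R f + a *\<^sub>R g" "(a + b) *\<^sub>R f = a *\<^sub>R f + b *\<^sub>R f"
    "a *\<^sub>R b *\<^sub>R f = (a * b) *\<^sub>R f" "1 *\<^sub>R f = f"
    by (simp_all add: algebra_simps)
  show "dist f g = norm (f - g)"
    by (simp add: dist_c0fun_def norm_c0fun_def dist_norm)
  show "sgn f = inverse (norm f) *\<^sub>R f"
    by (simp only: sgn_c0fun_def scaleR_c0fun_def norm_c0fun_def)
  show "uniformity = (INF e\<in>{0 <..}. principal {(x, y :: 'a c0fun). dist x y < e})"
    by (rule uniformity_c0fun_def)
  show "open S \<longleftrightarrow> (\<forall>x\<in>S. \<forall>\<^sub>F (x', y) in uniformity. x' = x \<longrightarrow> y \<in> S)" for S :: "'a c0fun set"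
    by (rule open_c0fun_def)
  show "norm f = 0 \<longleftrightarrow> f = 0" "norm (f + g) \<le> norm f + norm g" "norm (a *\<^sub>R f) = \<bar>a\<bar> * norm f"
    by (simp_all add: norm_c0fun_def norm_triangle_ineq)
qed

end

lemma apply_c0_simps [simp]:
  "apply_c0 0 x = 0"
  "apply_c0 (f + g) x = apply_c0 f x + apply_c0 g x"
  "apply_c0 (f - g) x = apply_c0 f x - apply_c0 g x"
  "apply_c0 (- f) x = - apply_c0 f x"
  "apply_c0 (c *\<^sub>R f) x = c * apply_c0 f x"
  by (simp_all add: apply_c0_def bcontfun_of_c0_simps zero_bcontfun.rep_eq plus_bcontfun.rep_eq
      minus_bcontfun.rep_eq uminus_bcontfun.rep_eq scaleR_bcontfun.rep_eq)

lemma norm_c0fun_eq_SUP: "norm f = (SUP x. \<bar>apply_c0 f x\<bar>)"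
  by (simp add: norm_c0fun_def norm_bcontfun_def dist_bcontfun_def apply_c0_def
      zero_bcontfun.rep_eq)

lemma dist_apply_c0_le: "\<bar>apply_c0 f x - apply_c0 g x\<bar> \<le> dist f g"
  using dist_bounded[of "bcontfun_of_c0 f" x "bcontfun_of_c0 g"]
  by (simp add: dist_c0fun_def apply_c0_def dist_real_def)

lemma dist_c0fun_le: "(\<And>x. \<bar>apply_c0 f x - apply_c0 g x\<bar> \<le> b) \<Longrightarrow> dist f g \<le> b"
  by (auto simp: dist_c0fun_def apply_c0_def dist_real_def intro: dist_bound)

instance c0fun :: (euclidean_space) banach
proof
  fix F :: "nat \<Rightarrow> 'a c0fun"
  assume "Cauchy F"
  then have "Cauchy (\<lambda>n. bcontfun_of_c0 (F n))"
    by (simp add: Cauchy_def dist_c0fun_def)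
  then obtain g where g: "(\<lambda>n. bcontfun_of_c0 (F n)) \<longlonglongrightarrow> g"
    using Cauchy_convergent convergent_def by blast
  have "(apply_bcontfun g \<longlongrightarrow> 0) at_infinity"
  proof (rule tendstoI)
    fix e :: real assume "e > 0"
    then obtain n where n: "dist (bcontfun_of_c0 (F n)) g < e / 2"
      using tendstoD[OF g, of "e / 2"] by (force simp: eventually_sequentially)
    have "\<forall>\<^sub>F x in at_infinity. dist (apply_c0 (F n) x) 0 < e / 2"
      using \<open>e > 0\<close> by (intro tendstoD[OF tendsto_apply_c0]) auto
    then show "\<forall>\<^sub>F x in at_infinity. dist (apply_bcontfun g x) 0 < e"
    proof eventually_elim
      case (elim x)
      have "dist (apply_bcontfun (bcontfun_of_c0 (F n)) x) (apply_bcontfun g x) < e / 2"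
        using n by (rule dist_fun_lt_imp_dist_val_lt)
      with elim show ?case
        unfolding apply_c0_def dist_real_def by linarith
    qed
  qed
  then have "F \<longlonglongrightarrow> Abs_c0fun g"
    using g by (simp add: tendsto_iff dist_c0fun_def Abs_c0fun_inverse)
  then show "convergent F"
    by (rule convergentI)
qed

lemma c0fun_separable:
  "\<exists>S :: 'a::euclidean_space c0fun set. countable S \<and> (\<forall>f. \<forall>e>0. \<exists>g\<in>S. dist f g < e)"
proof -
  obtain B :: "'a set set" where B: "countable B" "topological_basis B"
    using ex_countable_basis by blast
  define Q where "Q = {P :: ('a set \<times> real) set. finite P \<and> P \<subseteq> B \<times> \<rat>}"
  have "countable Q"
    unfolding Q_def using B(1) countable_rat
    by (intro countable_Collect_finite_subset countable_SIGMA) auto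
  define near :: "'a c0fun \<Rightarrow> real \<Rightarrow> ('a set \<times> real) set \<Rightarrow> bool" where
    "near f e P \<longleftrightarrow> (\<forall>(U, v)\<in>P. \<forall>x\<in>U. \<bar>apply_c0 f x - v\<bar> < e) \<and>
       (\<forall>x. x \<notin> \<Union> (fst ` P) \<longrightarrow> \<bar>apply_c0 f x\<bar> < e)" for f e P
  define pick where "pick k P = (SOME f. near f (1 / real (Suc k)) P)" for k P
  have ex: "\<exists>P\<in>Q. near f e P" if e: "e > 0" for f e
  proof -
    define K where "K = {x. \<bar>apply_c0 f x\<bar> \<ge> e}"
    have cont: "continuous_on UNIV (apply_c0 f)"
      by (simp add: apply_c0_def[abs_def])
    have "closed K"
      unfolding K_def using cont by (intro closed_Collect_le continuous_intros) auto
    moreover have "bounded K"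
    proof -
      obtain b where "\<And>x. norm x \<ge> b \<Longrightarrow> \<bar>apply_c0 f x\<bar> < e"
        using tendstoD[OF tendsto_apply_c0 e, of f] by (auto simp: eventually_at_infinity)
      then have "norm x \<le> b" if "x \<in> K" for x
        using that unfolding K_def by (metis linorder_not_le mem_Collect_eq nle_le)
      then show ?thesis
        unfolding bounded_iff by blast
    qed
    ultimately have "compact K"
      by (simp add: compact_eq_bounded_closed)
    define G where "G = {(U, v). U \<in> B \<and> v \<in> \<rat> \<and> (\<forall>x\<in>U. \<bar>apply_c0 f x - v\<bar> < e)}"
    have cover: "\<exists>p\<in>G. x \<in> fst p" for x
    proof -
      obtain v where v: "v \<in> \<rat>" "apply_c0 f x < v" "v < apply_c0 f x + e"
        using Rats_dense_in_real[of "apply_c0 f x" "apply_c0 f x + e"] e by auto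
      have "open {y. \<bar>apply_c0 f y - v\<bar> < e}"
        using cont by (intro open_Collect_less continuous_intros) auto
      moreover have "x \<in> {y. \<bar>apply_c0 f y - v\<bar> < e}"
        using v by auto
      ultimately obtain U where "U \<in> B" "x \<in> U" "U \<subseteq> {y. \<bar>apply_c0 f y - v\<bar> < e}"
        using B(2) by (metis topological_basisE)
      then show ?thesis
        using v by (intro bexI[of _ "(U, v)"]) (auto simp: G_def)
    qed
    have op: "open (fst p)" if "p \<in> G" for p
      using that B(2) by (auto simp: G_def topological_basis_open)
    obtain P where P: "P \<subseteq> G" "finite P" "K \<subseteq> (\<Union>p\<in>P. fst p)"
      using compactE_image[OF \<open>compact K\<close>, of G fst] op cover by (metis UN_iff subsetI)
    have "near f e P"
      using P(1,3) unfolding near_def G_def K_def by (force simp: not_le)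
    moreover have "P \<in> Q"
      using P(1,2) by (auto simp: Q_def G_def)
    ultimately show ?thesis by blast
  qed
  have close: "dist f g \<le> 2 * e" if "near f e P" "near g e P" for f g e P
  proof (rule dist_c0fun_le)
    fix x
    show "\<bar>apply_c0 f x - apply_c0 g x\<bar> \<le> 2 * e"
    proof (cases "x \<in> \<Union> (fst ` P)")
      case True
      then obtain U v where "(U, v) \<in> P" "x \<in> U"
        by auto
      then have "\<bar>apply_c0 f x - v\<bar> < e" "\<bar>apply_c0 g x - v\<bar> < e"
        using that by (auto simp: near_def)
      then show ?thesis by linarith
    next
      case False
      then have "\<bar>apply_c0 f x\<bar> < e" "\<bar>apply_c0 g x\<bar> < e"
        using that unfolding near_def by blast+
      then show ?thesis by linarith
    qed
  qed
  let ?S = "(\<lambda>(k, P). pick k P) ` (UNIV \<times> Q)"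
  have "countable ?S"
    using \<open>countable Q\<close> by (intro countable_image countable_SIGMA) auto
  moreover have "\<exists>g\<in>?S. dist f g < e" if e: "e > 0" for f e
  proof -
    obtain k where k: "1 / real (Suc k) < e / 2"
      using e nat_approx_posE[of "e / 2"] by auto
    obtain P where P: "P \<in> Q" "near f (1 / real (Suc k)) P"
      using ex[of "1 / real (Suc k)" f] by auto
    have "near (pick k P) (1 / real (Suc k)) P"
      unfolding pick_def using P(2) by (rule someI)
    then have "dist f (pick k P) < e"
      using close[OF P(2)] k by fastforce
    with P(1) show ?thesis by force
  qed
  ultimately show ?thesis by blast
qed

instance c0fun :: (euclidean_space) second_countable_topology
proof
  obtain S :: "'a c0fun set" where S: "countable S" "\<And>f e. e > 0 \<Longrightarrow> \<exists>g\<in>S. dist f g < e"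
    using c0fun_separable by blast
  let ?B = "(\<lambda>(g, r). ball g r) ` (S \<times> \<rat>)"
  have "topological_basis ?B"
  proof (rule topological_basisI)
    fix U :: "'a c0fun set" and f assume "open U" "f \<in> U"
    then obtain e where e: "e > 0" "ball f e \<subseteq> U"
      by (auto simp: open_contains_ball)
    obtain g where g: "g \<in> S" "dist f g < e / 2"
      using S(2)[of "e / 2" f] e by auto
    obtain r where r: "r \<in> \<rat>" "dist f g < r" "r < e / 2"
      using Rats_dense_in_real[OF g(2)] by auto
    have "ball g r \<subseteq> U"
    proof
      fix h assume "h \<in> ball g r"
      then have "dist f h < e"
        using g r dist_triangle[of f h g] by auto
      with e show "h \<in> U" by auto
    qed
    then show "\<exists>B'\<in>?B. f \<in> B' \<and> B' \<subseteq> U"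
      using g r by (intro bexI[of _ "ball g r"]) (auto simp: dist_commute)
  qed auto
  moreover have "countable ?B"
    using S(1) countable_rat by (intro countable_image countable_SIGMA) auto
  ultimately show "\<exists>B :: 'a c0fun set set. countable B \<and> open = generate_topology B"
    by (metis topological_basis_imp_subbasis)
qed

section \<open>Semigroups, generators and cores\<close>

definition strongly_continuous_semigroup :: "(real \<Rightarrow> 'b::banach \<Rightarrow> 'b) \<Rightarrow> bool" where
  "strongly_continuous_semigroup T \<longleftrightarrow>
     (\<forall>t\<ge>0. bounded_linear (T t)) \<and>
     (\<forall>\<phi>. T 0 \<phi> = \<phi>) \<and>
     (\<forall>s\<ge>0. \<forall>t\<ge>0. \<forall>\<phi>. T (s + t) \<phi> = T s (T t \<phi>)) \<and>
     (\<forall>\<phi>. ((\<lambda>t. T t \<phi>) \<longlongrightarrow> \<phi>) (at_right 0))"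

definition feller_semigroup ::
    "(real \<Rightarrow> 'a::euclidean_space c0fun \<Rightarrow> 'a c0fun) \<Rightarrow> bool" where
  "feller_semigroup T \<longleftrightarrow>
     strongly_continuous_semigroup T \<and>
     (\<forall>t\<ge>0. \<forall>\<phi>. (\<forall>x. 0 \<le> apply_c0 \<phi> x) \<longrightarrow> (\<forall>x. 0 \<le> apply_c0 (T t \<phi>) x)) \<and>
     (\<forall>t\<ge>0. \<forall>\<phi>. (\<forall>x. apply_c0 \<phi> x \<le> 1) \<longrightarrow> (\<forall>x. apply_c0 (T t \<phi>) x \<le> 1))"

definition gen_dom :: "(real \<Rightarrow> 'b::banach \<Rightarrow> 'b) \<Rightarrow> 'b set" where
  "gen_dom T = {\<phi>. \<exists>\<psi>. ((\<lambda>t. (T t \<phi> - \<phi>) /\<^sub>R t) \<longlongrightarrow> \<psi>) (at_right 0)}"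

definition gen :: "(real \<Rightarrow> 'b::banach \<Rightarrow> 'b) \<Rightarrow> 'b \<Rightarrow> 'b" where
  "gen T \<phi> = Lim (at_right 0) (\<lambda>t. (T t \<phi> - \<phi>) /\<^sub>R t)"

text \<open>The closure of an operator is taken as the closure of its graph.\<close>

definition is_core :: "'b::banach set \<Rightarrow> (real \<Rightarrow> 'b \<Rightarrow> 'b) \<Rightarrow> bool" where
  "is_core D T \<longleftrightarrow> subspace D \<and> D \<subseteq> gen_dom T \<and>
     closure ((\<lambda>\<phi>. (\<phi>, gen T \<phi>)) ` D) = (\<lambda>\<phi>. (\<phi>, gen T \<phi>)) ` gen_dom T"

section \<open>Spaces of twice differentiable functions and the differential operator\<close>

definition partial_deriv :: "'d::finite \<Rightarrow> (real^'d \<Rightarrow> real) \<Rightarrow> real^'d \<Rightarrow> real" where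
  "partial_deriv i \<phi> x = deriv (\<lambda>h. \<phi> (x + h *\<^sub>R axis i 1)) 0"

definition C1_fun :: "(real^'d::finite \<Rightarrow> real) \<Rightarrow> bool" where
  "C1_fun \<phi> \<longleftrightarrow> continuous_on UNIV \<phi> \<and>
     (\<forall>i. (\<forall>x. (\<lambda>h. \<phi> (x + h *\<^sub>R axis i 1)) field_differentiable (at 0)) \<and>
          continuous_on UNIV (partial_deriv i \<phi>))"

definition C2_fun :: "(real^'d::finite \<Rightarrow> real) \<Rightarrow> bool" where
  "C2_fun \<phi> \<longleftrightarrow> C1_fun \<phi> \<and> (\<forall>i. C1_fun (partial_deriv i \<phi>))"

definition grad :: "(real^'d::finite \<Rightarrow> real) \<Rightarrow> real^'d \<Rightarrow> real^'d" where
  "grad \<phi> x = (\<chi> i. partial_deriv i \<phi> x)"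

definition hess :: "(real^'d::finite \<Rightarrow> real) \<Rightarrow> real^'d \<Rightarrow> real^'d^'d" where
  "hess \<phi> x = (\<chi> i j. partial_deriv i (partial_deriv j \<phi>) x)"

definition C0_2 :: "(real^'d::finite) c0fun set" where
  "C0_2 = {\<phi>. C2_fun (apply_c0 \<phi>) \<and>
     (\<forall>i. (partial_deriv i (apply_c0 \<phi>) \<longlongrightarrow> 0) at_infinity) \<and>
     (\<forall>i j. (partial_deriv i (partial_deriv j (apply_c0 \<phi>)) \<longlongrightarrow> 0) at_infinity)}"

definition Cc_2_Hoelder :: "real \<Rightarrow> (real^'d::finite) c0fun set" where
  "Cc_2_Hoelder \<alpha> = {\<phi>. C2_fun (apply_c0 \<phi>) \<and> compact (closure {x. apply_c0 \<phi> x \<noteq> 0}) \<and>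
     (\<forall>i j. \<exists>K. \<forall>x y.
        \<bar>partial_deriv i (partial_deriv j (apply_c0 \<phi>)) x
          - partial_deriv i (partial_deriv j (apply_c0 \<phi>)) y\<bar> \<le> K * dist x y powr \<alpha>)}"

definition diff_op ::
    "(real^'d::finite \<Rightarrow> real^'d^'d) \<Rightarrow> (real^'d \<Rightarrow> real^'d) \<Rightarrow> (real^'d \<Rightarrow> real) \<Rightarrow>
     (real^'d \<Rightarrow> real) \<Rightarrow> real^'d \<Rightarrow> real" where
  "diff_op A B C \<phi> x = - C x * \<phi> x - B x \<bullet> grad \<phi> x + trace (A x ** hess \<phi> x)"

section \<open>The distributed order derivative\<close>

definition measure_support :: "'a::topological_space measure \<Rightarrow> 'a set" where
  "measure_support \<mu> = {x. \<forall>U. open U \<longrightarrow> x \<in> U \<longrightarrow> emeasure \<mu> U > 0}"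

definition RL_integral ::
    "real \<Rightarrow> (real \<Rightarrow> 'b::{banach, second_countable_topology}) \<Rightarrow> real \<Rightarrow> 'b" where
  "RL_integral \<beta> u t =
     (1 / Gamma (1 - \<beta>)) *\<^sub>R (LINT r:{0..t}|lborel. (1 / (t - r) powr \<beta>) *\<^sub>R u r)"

text \<open>The derivative is only claimed to exist where the Bochner integrals behind
  \<^const>\<open>RL_integral\<close> really exist, and not on the strength of their value 0 for
  non-integrable functions.\<close>

definition has_RL_derivative ::
    "real \<Rightarrow> (real \<Rightarrow> 'b::{banach, second_countable_topology}) \<Rightarrow> real \<Rightarrow> 'b \<Rightarrow> bool" where
  "has_RL_derivative \<beta> u t v \<longleftrightarrow>
     (\<forall>\<^sub>F s in nhds t. set_integrable lborel {0..s} (\<lambda>r. (1 / (s - r) powr \<beta>) *\<^sub>R u r)) \<and>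
     (RL_integral \<beta> u has_vector_derivative v) (at t)"

text \<open>Here \<open>w \<beta>\<close> is the Riemann--Liouville derivative of order \<open>\<beta>\<close>, required to exist for
  almost every \<open>\<beta>\<close>, and the integral against \<open>\<mu>\<close> is a Bochner integral.\<close>

definition has_distributed_derivative ::
    "real measure \<Rightarrow> (real \<Rightarrow> 'b::{banach, second_countable_topology}) \<Rightarrow> real \<Rightarrow> 'b \<Rightarrow> bool" where
  "has_distributed_derivative \<mu> u t v \<longleftrightarrow>
     (\<exists>w. (AE \<beta> in \<mu>. \<beta> \<in> {0<..<1} \<longrightarrow> has_RL_derivative \<beta> u t (w \<beta>)) \<and>
          set_integrable \<mu> {0<..<1} (\<lambda>\<beta>. w \<beta> - (t powr (- \<beta>) / Gamma (1 - \<beta>)) *\<^sub>R u 0) \<and>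
          (LINT \<beta>:{0<..<1}|\<mu>. w \<beta> - (t powr (- \<beta>) / Gamma (1 - \<beta>)) *\<^sub>R u 0) = v)"

text \<open>The initial condition includes continuity at time 0; otherwise the value \<open>u 0\<close> would be
  unrelated to the solution at positive times.\<close>

definition solves_distributed_cauchy ::
    "real measure \<Rightarrow> (real \<Rightarrow> 'b::{banach, second_countable_topology} \<Rightarrow> 'b) \<Rightarrow> 'b \<Rightarrow>
     (real \<Rightarrow> 'b) \<Rightarrow> bool" where
  "solves_distributed_cauchy \<mu> T f\<^sub>0 u \<longleftrightarrow>
     u 0 = f\<^sub>0 \<and> (u \<longlongrightarrow> f\<^sub>0) (at_right 0) \<and>
     (\<forall>t>0. u t \<in> gen_dom T \<and> has_distributed_derivative \<mu> u t (gen T (u t)))"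

section \<open>Subordinators and their inverses\<close>

definition levy_process :: "'w measure \<Rightarrow> (real \<Rightarrow> 'w \<Rightarrow> real) \<Rightarrow> bool" where
  "levy_process M D \<longleftrightarrow>
     prob_space M \<and>
     (\<forall>t\<ge>0. D t \<in> borel_measurable M) \<and>
     (AE \<omega> in M. D 0 \<omega> = 0) \<and>
     (\<forall>(n::nat) \<tau>. 0 \<le> \<tau> 0 \<longrightarrow> (\<forall>i<n. \<tau> i \<le> \<tau> (Suc i)) \<longrightarrow>
        prob_space.indep_vars M (\<lambda>_. borel) (\<lambda>i \<omega>. D (\<tau> (Suc i)) \<omega> - D (\<tau> i) \<omega>) {..<n}) \<and>
     (\<forall>s\<ge>0. \<forall>h\<ge>0. distr M borel (\<lambda>\<omega>. D (s + h) \<omega> - D s \<omega>) = distr M borel (\<lambda>\<omega>. D h \<omega> - D 0 \<omega>)) \<and>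
     (\<forall>t\<ge>0. \<forall>\<epsilon>>0. ((\<lambda>s. measure M {\<omega> \<in> space M. \<bar>D s \<omega> - D t \<omega>\<bar> > \<epsilon>}) \<longlongrightarrow> 0) (at t within {0..})) \<and>
     (AE \<omega> in M. \<forall>t\<ge>0. ((\<lambda>s. D s \<omega>) \<longlongrightarrow> D t \<omega>) (at_right t) \<and>
        (t > 0 \<longrightarrow> (\<exists>l. ((\<lambda>s. D s \<omega>) \<longlongrightarrow> l) (at_left t))))"

definition subordinator :: "'w measure \<Rightarrow> (real \<Rightarrow> 'w \<Rightarrow> real) \<Rightarrow> bool" where
  "subordinator M D \<longleftrightarrow> levy_process M D \<and> (AE \<omega> in M. mono_on {0..} (\<lambda>t. D t \<omega>))"

definition laplace_exponent :: "real measure \<Rightarrow> real \<Rightarrow> real" where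
  "laplace_exponent \<mu> s = (LINT \<beta>:{0<..<1}|\<mu>. s powr \<beta>)"

definition subordinator_of ::
    "real measure \<Rightarrow> 'w measure \<Rightarrow> (real \<Rightarrow> 'w \<Rightarrow> real) \<Rightarrow> bool" where
  "subordinator_of \<mu> M D \<longleftrightarrow> subordinator M D \<and>
     (\<forall>t\<ge>0. \<forall>s>0. (LINT \<omega>|M. exp (- s * D t \<omega>)) = exp (- t * laplace_exponent \<mu> s))"

definition first_passage :: "(real \<Rightarrow> 'w \<Rightarrow> real) \<Rightarrow> real \<Rightarrow> 'w \<Rightarrow> real" where
  "first_passage D t \<omega> = Inf {\<tau>. 0 \<le> \<tau> \<and> D \<tau> \<omega> > t}"

definition is_inverse_density ::
    "'w measure \<Rightarrow> (real \<Rightarrow> 'w \<Rightarrow> real) \<Rightarrow> (real \<Rightarrow> real \<Rightarrow> real) \<Rightarrow> bool" where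
  "is_inverse_density M D p \<longleftrightarrow>
     (\<forall>t>0. distributed M lborel (first_passage D t) (\<lambda>\<tau>. ennreal (p t \<tau>)) \<and>
            (\<forall>\<tau>. 0 \<le> p t \<tau>) \<and> (\<forall>\<tau><0. p t \<tau> = 0))"

section \<open>The approximating integrals\<close>

text \<open>For symmetric positive semidefinite \<open>M\<close> exactly one matrix \<open>R\<close> has these properties.\<close>

definition matrix_sqrt :: "real^'d^'d \<Rightarrow> real^'d::finite^'d" where
  "matrix_sqrt M = (SOME R. transpose R = R \<and> (\<forall>z. 0 \<le> z \<bullet> (R *v z)) \<and> R ** R = M)"

definition p_gauss :: "(real^'d \<Rightarrow> real^'d^'d) \<Rightarrow> real \<Rightarrow> real^'d \<Rightarrow> real^'d::finite \<Rightarrow> real" where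
  "p_gauss A t x y =
     1 / sqrt ((4 * pi * t) ^ CARD('d) * det (A x)) *
     exp (- ((matrix_inv (A x) *v (x - y)) \<bullet> (x - y)) / (4 * t))"

text \<open>The integration variables \<open>x\<^sub>1, \<dots>, x\<^sub>n\<close> are the coordinates of a point \<open>x\<close> of the product
  space, and \<open>y\<close> is the path \<open>(x\<^sub>0, x\<^sub>1, \<dots>, x\<^sub>n)\<close> obtained by adding the starting point.\<close>

definition path_integrand ::
    "(real^'d::finite \<Rightarrow> real^'d^'d) \<Rightarrow> (real^'d \<Rightarrow> real^'d) \<Rightarrow> (real^'d \<Rightarrow> real) \<Rightarrow>
     (real^'d \<Rightarrow> real) \<Rightarrow> nat \<Rightarrow> real \<Rightarrow> (nat \<Rightarrow> real^'d) \<Rightarrow> real" where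
  "path_integrand A B C f\<^sub>0 n \<tau> y =
     exp (- (\<tau> / real n) * (\<Sum>j=1..n. C (y (j - 1)) +
            1 / 4 * (norm (matrix_sqrt (matrix_inv (A (y (j - 1)))) *v B (y (j - 1))))\<^sup>2)) *
     exp (1 / 2 * (\<Sum>j=1..n. (matrix_inv (A (y (j - 1))) *v B (y (j - 1))) \<bullet> (y (j - 1) - y j))) *
     (\<Prod>j=1..n. p_gauss A (\<tau> / real n) (y (j - 1)) (y j)) * f\<^sub>0 (y n)"

definition feynman_approx ::
    "(real^'d::finite \<Rightarrow> real^'d^'d) \<Rightarrow> (real^'d \<Rightarrow> real^'d) \<Rightarrow> (real^'d \<Rightarrow> real) \<Rightarrow>
     (real \<Rightarrow> real \<Rightarrow> real) \<Rightarrow> (real^'d \<Rightarrow> real) \<Rightarrow> nat \<Rightarrow> real \<Rightarrow> real^'d \<Rightarrow> real" where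
  "feynman_approx A B C p f\<^sub>0 n t x\<^sub>0 =
     (LINT \<tau>:{0..}|lborel. LINT x|(\<Pi>\<^sub>M j\<in>{1..n}. lborel).
        path_integrand A B C f\<^sub>0 n \<tau> (x(0 := x\<^sub>0)) * p t \<tau>)"

end

theory Submission
  imports Defs "HOL-Complex_Analysis.Complex_Analysis"
begin

text \<open>Write \<open>F(h)\<close> for the integral operator with the kernel of a single time step. Completing the square shows that it is
  a Gaussian average around \<open>x - h B(x)\<close>, damped by \<open>exp (-h C(x))\<close>; hence \<open>F(h)\<close> is a contraction, and a Taylor expansion
  gives \<open>(F(h) \<phi> - \<phi>)/h \<longrightarrow> L \<phi>\<close> on the core. By Chernoff's theorem \<open>F(\<tau>/n)\<^sup>n f\<^sub>0 \<longrightarrow> T\<^sub>\<tau> f\<^sub>0\<close> uniformly for bounded \<open>\<tau>\<close>, and the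
  approximations converge to \<open>u(t) = \<integral> p\<^sup>\<mu>(t,\<tau>) T\<^sub>\<tau> f\<^sub>0 d\<tau>\<close>, uniformly because the tails of \<open>p\<^sup>\<mu>(t,\<cdot>)\<close> increase with \<open>t\<close>.

  To see that \<open>u\<close> solves the equation, let \<open>J\<^sub>\<gamma>(\<sigma>,\<cdot>)\<close> be the inverse Laplace transform of \<open>s\<^sup>-\<^sup>\<gamma> exp (-\<sigma> f\<^sup>\<mu>(s))\<close>. As the support of
  \<open>\<mu>\<close> is a compact subset of \<open>(0,1)\<close>, the inversion contour can be bent into the left half plane while \<open>Re f\<^sup>\<mu>\<close> stays bounded
  below by a positive constant; so \<open>J\<^sub>\<gamma>\<close> is smooth in \<open>t\<close> and decays exponentially in \<open>\<sigma>\<close>. Uniqueness of Laplace transforms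
  identifies \<open>J\<^sub>1(\<sigma>,t)\<close> with the probability of \<open>D\<^sub>\<sigma> \<le> t\<close>, that is of \<open>E\<^sub>t > \<sigma>\<close>, and the fractional integral of \<open>J\<^sub>1\<close> of order
  \<open>1 - \<beta>\<close> with \<open>J\<^sub>2\<^sub>-\<^sub>\<beta>\<close>. Therefore \<open>u(t) = f\<^sub>0 + \<integral> J\<^sub>1(\<sigma>,t) T\<^sub>\<sigma> L f\<^sub>0 d\<sigma>\<close>, the Caputo derivative of order \<open>\<beta>\<close> of \<open>u\<close> is
  \<open>\<integral> J\<^sub>1\<^sub>-\<^sub>\<beta>(\<sigma>,t) T\<^sub>\<sigma> L f\<^sub>0 d\<sigma>\<close>, and integrating over \<open>\<beta>\<close> turns \<open>J\<^sub>1\<^sub>-\<^sub>\<beta>\<close> into \<open>- \<partial>J\<^sub>1/\<partial>\<sigma> = p\<^sup>\<mu>(t,\<sigma>)\<close>.\<close>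

no_notation fps_nth (infixl "$" 75)

section \<open>Contraction semigroups and Chernoff's theorem\<close>

text \<open>Nothing is known about how \<open>p t\<close> depends on \<open>t\<close>, so time
  derivatives of \<open>u\<close> cannot be taken under an integral against \<open>p\<close>. An
  integration by parts in \<sigma>, for which \<open>f\<^sub>0\<close> has to lie in the domain,
  replaces the density by its tail \<open>J 1\<close>; from then on time enters through contour
  integrals that can be differentiated. The contour is based at 1 and not at 0: this keeps |s| away
  from 0, where Re f^mu tends to 0 and the decay in \<sigma> would be lost. The price, a factor exp
  t, is harmless on bounded time intervals. The contour bounds still blow up as t tends to 0, so the
  initial condition needs its own estimate, Markov's inequality for \<open>D\<close> with parameter
  1/t. In Chernoff's theorem the telescoping estimate needs the domain of the squared generator,
  whereas \<open>f\<^sub>0\<close> lies in the domain only; time averages bridge this gap. Hoelder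
  continuity of the second derivatives makes the Taylor remainder of order h^(1 + \<alpha>/2)
  uniformly in space, hence o(h) in the supremum norm.\<close>

lemma has_vector_derivative_at_right_quotient:
  assumes "(F has_vector_derivative D) (at t within {t..})"
  shows "((\<lambda>h. (F (t + h) - F t) /\<^sub>R h) \<longlongrightarrow> D) (at_right (0::real))"
proof -
  have "((\<lambda>y. ((F y - F t) - (y - t) *\<^sub>R D) /\<^sub>R norm (y - t)) \<longlongrightarrow> 0) (at_right t)"
    using assms unfolding has_vector_derivative_def has_derivative_at_within
    by (auto intro: tendsto_within_subset)
  from tendsto_add[OF this tendsto_const[of D]]
  have "((\<lambda>y. ((F y - F t) - (y - t) *\<^sub>R D) /\<^sub>R norm (y - t) + D) \<longlongrightarrow> D) (at_right t)"
    by simp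
  then have "((\<lambda>y. (F y - F t) /\<^sub>R (y - t)) \<longlongrightarrow> D) (at_right t)"
    by (rule Lim_transform_eventually)
      (auto simp: eventually_at_right_field scaleR_right_diff_distrib intro!: exI[of _ "t + 1"])
  then show ?thesis
    unfolding filterlim_at_right_to_0[of _ _ t] by (simp add: add.commute)
qed

lemma norm_triangle_chain3:
  fixes a :: "'a::real_normed_vector"
  shows "norm (a - d) \<le> norm (a - b) + norm (b - c) + norm (c - d)"
proof -
  have "norm ((a - b) + (b - c) + (c - d)) \<le> norm ((a - b) + (b - c)) + norm (c - d)"
    by (rule norm_triangle_ineq)
  also have "\<dots> \<le> norm (a - b) + norm (b - c) + norm (c - d)"
    using norm_triangle_ineq[of "a - b" "b - c"] by simp
  finally show ?thesis by simp
qed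

lemma gen_domI:
  assumes "((\<lambda>t. (T t \<phi> - \<phi>) /\<^sub>R t) \<longlongrightarrow> \<psi>) (at_right 0)"
  shows "\<phi> \<in> gen_dom T" "gen T \<phi> = \<psi>"
  using assms unfolding gen_dom_def gen_def by (auto intro: tendsto_Lim)

lemma gen_tendsto:
  assumes "\<phi> \<in> gen_dom T"
  shows "((\<lambda>t. (T t \<phi> - \<phi>) /\<^sub>R t) \<longlongrightarrow> gen T \<phi>) (at_right 0)"
  using assms gen_domI(2)[of T \<phi>] unfolding gen_dom_def by auto

locale contraction_semigroup =
  fixes T :: "real \<Rightarrow> 'b::banach \<Rightarrow> 'b"
  assumes semigroup: "strongly_continuous_semigroup T"
    and contraction: "0 \<le> t \<Longrightarrow> norm (T t \<phi>) \<le> norm \<phi>"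
begin

lemma linear: "0 \<le> t \<Longrightarrow> bounded_linear (T t)"
  and T_0 [simp]: "T 0 \<phi> = \<phi>"
  and T_add: "0 \<le> s \<Longrightarrow> 0 \<le> t \<Longrightarrow> T (s + t) \<phi> = T s (T t \<phi>)"
  and at_0: "((\<lambda>t. T t \<phi>) \<longlongrightarrow> \<phi>) (at_right 0)"
  using semigroup by (auto simp: strongly_continuous_semigroup_def)

lemma T_diff: "0 \<le> t \<Longrightarrow> T t (\<phi> - \<psi>) = T t \<phi> - T t \<psi>"
  and T_plus: "0 \<le> t \<Longrightarrow> T t (\<phi> + \<psi>) = T t \<phi> + T t \<psi>"
  and T_scale: "0 \<le> t \<Longrightarrow> T t (c *\<^sub>R \<phi>) = c *\<^sub>R T t \<phi>"
  using linear by (auto simp: linear_diff linear_add linear_scale bounded_linear.linear)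

lemma T_small:
  assumes "e > 0"
  obtains d where "d > 0" "\<And>h. 0 \<le> h \<Longrightarrow> h < d \<Longrightarrow> norm (T h \<phi> - \<phi>) < e"
proof -
  obtain d where "d > 0" "\<And>h. 0 < h \<Longrightarrow> h < d \<Longrightarrow> dist (T h \<phi>) \<phi> < e"
    using tendstoD[OF at_0 assms, of \<phi>] by (auto simp: eventually_at_right_field)
  then show thesis
    using that[of d] assms by (metis T_0 cancel_comm_monoid_add_class.diff_cancel dist_norm norm_zero order_le_less)
qed

text \<open>The semigroup law factors out the smaller time, whose operator is a contraction. The
  modulus of continuity of an orbit thus depends on the time difference only, which makes orbits
  uniformly continuous on the half line.\<close>

lemma T_increment:
  assumes "0 \<le> s" "0 \<le> t"
  shows "norm (T s \<phi> - T t \<phi>) \<le> norm (T \<bar>s - t\<bar> \<phi> - \<phi>)"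
proof -
  have *: "norm (T (a + h) \<phi> - T a \<phi>) \<le> norm (T h \<phi> - \<phi>)" if "0 \<le> a" "0 \<le> h" for a h
    using contraction[of a "T h \<phi> - \<phi>"] that by (simp add: T_add T_diff)
  show ?thesis
    using *[of t "s - t"] *[of s "t - s"] assms by (cases "s \<le> t") (auto simp: norm_minus_commute)
qed

lemma continuous: "continuous_on {0..} (\<lambda>t. T t \<phi>)"
  unfolding continuous_on_iff
proof (intro ballI allI impI)
  fix t e :: real assume "t \<in> {0..}" "0 < e"
  obtain d where d: "d > 0" "\<And>h. 0 \<le> h \<Longrightarrow> h < d \<Longrightarrow> norm (T h \<phi> - \<phi>) < e"
    using T_small[OF \<open>0 < e\<close>, of \<phi>] by blast
  have "dist (T s \<phi>) (T t \<phi>) < e" if "s \<in> {0..}" "dist s t < d" for s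
    using T_increment[of s t \<phi>] d(2)[of "\<bar>s - t\<bar>"] that \<open>t \<in> {0..}\<close>
    by (auto simp: dist_norm)
  with d(1) show "\<exists>d>0. \<forall>s\<in>{0..}. dist s t < d \<longrightarrow> dist (T s \<phi>) (T t \<phi>) < e" by blast
qed

lemma gen_T:
  assumes "\<phi> \<in> gen_dom T" "0 \<le> t"
  shows "T t \<phi> \<in> gen_dom T" "gen T (T t \<phi>) = T t (gen T \<phi>)"
proof -
  have "((\<lambda>h. T t ((T h \<phi> - \<phi>) /\<^sub>R h)) \<longlongrightarrow> T t (gen T \<phi>)) (at_right 0)"
    by (rule bounded_linear.tendsto[OF linear[OF assms(2)] gen_tendsto[OF assms(1)]])
  moreover have "\<forall>\<^sub>F h in at_right 0. T t ((T h \<phi> - \<phi>) /\<^sub>R h) = (T h (T t \<phi>) - T t \<phi>) /\<^sub>R h"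
    using assms(2) by (auto simp: eventually_at_right_field T_scale T_diff T_add[symmetric] add.commute intro!: exI[of _ 1])
  ultimately have "((\<lambda>h. (T h (T t \<phi>) - T t \<phi>) /\<^sub>R h) \<longlongrightarrow> T t (gen T \<phi>)) (at_right 0)"
    by (rule Lim_transform_eventually)
  then show "T t \<phi> \<in> gen_dom T" "gen T (T t \<phi>) = T t (gen T \<phi>)"
    by (auto dest: gen_domI)
qed

text \<open>The generator is a limit from the right at time 0. Applying the contraction
  \<open>T t\<close> to it gives the right derivative at \<open>t\<close>. For \<open>s < t\<close>
  the increment is factored through \<open>T s\<close>; the additional term
  \<open>T h ?g - ?g\<close> is small by strong continuity.\<close>

lemma derivative:
  assumes \<phi>: "\<phi> \<in> gen_dom T" and t: "0 \<le> t"
  shows "((\<lambda>s. T s \<phi>) has_vector_derivative T t (gen T \<phi>)) (at t within {0..})"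
  unfolding has_vector_derivative_def has_derivative_within_alt
proof (intro conjI allI impI bounded_linear_scaleR_left)
  fix e :: real assume "0 < e"
  let ?g = "gen T \<phi>"
  obtain d1 where d1: "d1 > 0" "\<And>h. 0 \<le> h \<Longrightarrow> h < d1 \<Longrightarrow> norm (T h ?g - ?g) < e/2"
    using T_small[of "e/2"] \<open>0 < e\<close> by auto
  obtain d2 where d2: "d2 > 0" "\<And>h. 0 < h \<Longrightarrow> h < d2 \<Longrightarrow> dist ((T h \<phi> - \<phi>) /\<^sub>R h) ?g < e/2"
    using tendstoD[OF gen_tendsto[OF \<phi>], of "e/2"] \<open>0 < e\<close> by (auto simp: eventually_at_right_field)
  have inc: "norm (T h \<phi> - \<phi> - h *\<^sub>R ?g) \<le> h * (e/2)" if "0 \<le> h" "h < d2" for h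
  proof (cases "h = 0")
    case False
    then have "T h \<phi> - \<phi> - h *\<^sub>R ?g = h *\<^sub>R ((T h \<phi> - \<phi>) /\<^sub>R h - ?g)"
      by (simp add: scaleR_right_diff_distrib)
    then show ?thesis
      using d2(2)[of h] that False by (simp add: dist_norm)
  qed simp
  have "norm (T s \<phi> - T t \<phi> - (s - t) *\<^sub>R T t ?g) \<le> e * norm (s - t)"
    if s: "s \<in> {0..}" "norm (s - t) < min d1 d2" for s
  proof (cases "t \<le> s")
    case True
    define h where "h = s - t"
    have h: "0 \<le> h" "h < d2" "s = t + h"
      using True s by (auto simp: h_def)
    have "T s \<phi> - T t \<phi> - (s - t) *\<^sub>R T t ?g = T t (T h \<phi> - \<phi> - h *\<^sub>R ?g)"
      using t h by (simp add: T_add T_diff T_scale)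
    also have "norm \<dots> \<le> norm (T h \<phi> - \<phi> - h *\<^sub>R ?g)"
      by (rule contraction[OF t])
    also have "\<dots> \<le> h * (e/2)" by (rule inc) (use h in auto)
    also have "\<dots> \<le> e * h" using h \<open>0 < e\<close> by (simp add: field_simps)
    finally show ?thesis using h by simp
  next
    case False
    define h where "h = t - s"
    have h: "0 \<le> h" "h < d2" "h < d1" "t = s + h" "0 \<le> s"
      using False s by (auto simp: h_def)
    have "T s \<phi> - T t \<phi> - (s - t) *\<^sub>R T t ?g = h *\<^sub>R T s (T h ?g - ?g) - T s (T h \<phi> - \<phi> - h *\<^sub>R ?g)"
    proof -
      have tt: "T t x = T s (T h x)" for x using h by (simp add: T_add)
      have st: "s - t = - h" using h by simp
      show ?thesis unfolding tt st using h by (simp add: T_plus T_diff T_scale algebra_simps)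
    qed
    also have "norm \<dots> \<le> norm (h *\<^sub>R T s (T h ?g - ?g)) + norm (T s (T h \<phi> - \<phi> - h *\<^sub>R ?g))"
      by (rule norm_triangle_ineq4)
    also have "\<dots> \<le> h * (e/2) + h * (e/2)"
    proof (intro add_mono)
      have "norm (T s (T h ?g - ?g)) \<le> e/2"
        using contraction[of s "T h ?g - ?g"] d1(2)[of h] h by linarith
      then show "norm (h *\<^sub>R T s (T h ?g - ?g)) \<le> h * (e/2)"
        using h mult_left_mono[of "norm (T s (T h ?g - ?g))" "e/2" h] by simp
      show "norm (T s (T h \<phi> - \<phi> - h *\<^sub>R ?g)) \<le> h * (e/2)"
        using contraction[of s "T h \<phi> - \<phi> - h *\<^sub>R ?g"] inc[of h] h by linarith
    qed
    finally show ?thesis using h by (simp add: field_simps)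
  qed
  then show "\<exists>d>0. \<forall>y\<in>{0..}. norm (y - t) < d \<longrightarrow>
      norm (T y \<phi> - T t \<phi> - (y - t) *\<^sub>R T t ?g) \<le> e * norm (y - t)"
    using d1(1) d2(1) by (intro exI[of _ "min d1 d2"]) auto
qed

text \<open>The first order remainder of the orbit is the integral of
  \<open>T s (gen T \<phi>) - gen T \<phi>\<close> over \<open>{0..h}\<close>.\<close>

lemma increment_bound:
  assumes \<phi>: "\<phi> \<in> gen_dom T" and h: "0 \<le> h"
    and e: "\<And>s. 0 \<le> s \<Longrightarrow> s \<le> h \<Longrightarrow> norm (T s (gen T \<phi>) - gen T \<phi>) \<le> e"
  shows "norm (T h \<phi> - \<phi> - h *\<^sub>R gen T \<phi>) \<le> h * e"
proof -
  have "((\<lambda>s. T s \<phi> - s *\<^sub>R gen T \<phi>) has_vector_derivative (T s (gen T \<phi>) - gen T \<phi>)) (at s within {0..h})"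
    if "s \<in> {0..h}" for s
    using that by (auto intro!: derivative_eq_intros has_vector_derivative_within_subset[OF derivative[OF \<phi>]])
  then have I: "((\<lambda>s. T s (gen T \<phi>) - gen T \<phi>) has_integral
      (T h \<phi> - h *\<^sub>R gen T \<phi> - (T 0 \<phi> - 0 *\<^sub>R gen T \<phi>))) {0..h}"
    using h by (intro fundamental_theorem_of_calculus) auto
  have "0 \<le> e"
    using e[of 0] h by simp
  then have "norm (T h \<phi> - h *\<^sub>R gen T \<phi> - (T 0 \<phi> - 0 *\<^sub>R gen T \<phi>)) \<le> e * measure lborel {0..h}"
    by (rule has_integral_bound_real[OF _ finite.emptyI I]) (use e in auto)
  then show ?thesis using h by (simp add: algebra_simps)
qed

text \<open>\<open>T h\<close> shifts the interval of integration, so only its two ends contribute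
  to the difference quotient. Averages approximate \<phi>, and for \<phi> in the domain the value
  \<open>T d \<phi> - \<phi>\<close> of the generator is in the domain again; in this way averages
  reach the domain of the squared generator.\<close>

lemma average:
  defines "\<Phi> \<equiv> \<lambda>\<phi> t. integral {0..t} (\<lambda>s. T s \<phi>)"
  assumes d: "0 < d"
  shows "\<Phi> \<phi> d \<in> gen_dom T" "gen T (\<Phi> \<phi> d) = T d \<phi> - \<phi>"
    "((\<lambda>h. \<Phi> \<phi> h /\<^sub>R h) \<longlongrightarrow> \<phi>) (at_right 0)"
proof -
  have der: "(\<Phi> \<phi> has_vector_derivative T t \<phi>) (at t within {0..})" if "0 \<le> t" for t
  proof -
    have "(\<Phi> \<phi> has_vector_derivative T t \<phi>) (at t within {0..t+1})"
      unfolding \<Phi>_def using that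
      by (intro integral_has_vector_derivative continuous_on_subset[OF continuous]) auto
    moreover have "at t within {0..t+1} = at t within {0..}"
      using that by (intro at_within_nhd[of t "{..<t+1}"]) auto
    ultimately show ?thesis by simp
  qed
  have shift: "T h (\<Phi> \<phi> d) = \<Phi> \<phi> (d + h) - \<Phi> \<phi> h" if h: "0 \<le> h" for h
  proof -
    have "((\<lambda>s. T s \<phi>) has_integral \<Phi> \<phi> d) {0..d}"
      unfolding \<Phi>_def
      by (intro integrable_integral integrable_continuous_real continuous_on_subset[OF continuous]) auto
    then have "(T h \<circ> (\<lambda>s. T s \<phi>) has_integral T h (\<Phi> \<phi> d)) {0..d}"
      using linear[OF h] by (rule has_integral_linear)
    moreover have "((\<lambda>s. T (s + h) \<phi>) has_integral \<Phi> \<phi> (d + h) - \<Phi> \<phi> (0 + h)) {0..d}"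
    proof (rule fundamental_theorem_of_calculus)
      fix x assume x: "x \<in> {0..d}"
      have "((\<Phi> \<phi> \<circ> (\<lambda>s. s + h)) has_vector_derivative (1 *\<^sub>R T (x + h) \<phi>)) (at x within {0..d})"
      proof (rule vector_diff_chain_within)
        show "((\<lambda>s. s + h) has_vector_derivative 1) (at x within {0..d})"
          by (auto intro!: derivative_eq_intros)
        show "(\<Phi> \<phi> has_vector_derivative T (x + h) \<phi>) (at (x + h) within (\<lambda>s. s + h) ` {0..d})"
          using x h by (intro has_vector_derivative_within_subset[OF der]) auto
      qed
      then show "((\<lambda>s. \<Phi> \<phi> (s + h)) has_vector_derivative T (x + h) \<phi>) (at x within {0..d})"
        by (simp add: o_def)
    qed (use d in auto)
    moreover have "(T h \<circ> (\<lambda>s. T s \<phi>)) s = T (s + h) \<phi>" if "s \<in> {0..d}" for s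
      using that h by (simp add: T_add[symmetric] add.commute)
    ultimately show ?thesis
      by (metis (no_types, lifting) add_0 has_integral_cong has_integral_unique)
  qed
  have q: "((\<lambda>h. (\<Phi> \<phi> (t + h) - \<Phi> \<phi> t) /\<^sub>R h) \<longlongrightarrow> T t \<phi>) (at_right 0)" if "0 \<le> t" for t
    using that by (intro has_vector_derivative_at_right_quotient has_vector_derivative_within_subset[OF der]) auto
  have \<Phi>0: "\<Phi> \<phi> 0 = 0" by (simp add: \<Phi>_def)
  show "((\<lambda>h. \<Phi> \<phi> h /\<^sub>R h) \<longlongrightarrow> \<phi>) (at_right 0)"
    using q[of 0] by (simp add: \<Phi>0)
  have "((\<lambda>h. (\<Phi> \<phi> (d + h) - \<Phi> \<phi> d) /\<^sub>R h - \<Phi> \<phi> h /\<^sub>R h) \<longlongrightarrow> T d \<phi> - \<phi>) (at_right 0)"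
    using q[of d] q[of 0] d by (intro tendsto_diff) (auto simp: \<Phi>0)
  moreover have "\<forall>\<^sub>F h in at_right 0. (\<Phi> \<phi> (d + h) - \<Phi> \<phi> d) /\<^sub>R h - \<Phi> \<phi> h /\<^sub>R h = (T h (\<Phi> \<phi> d) - \<Phi> \<phi> d) /\<^sub>R h"
    by (auto simp: eventually_at_right_field shift scaleR_right_diff_distrib intro!: exI[of _ 1])
  ultimately have "((\<lambda>h. (T h (\<Phi> \<phi> d) - \<Phi> \<phi> d) /\<^sub>R h) \<longlongrightarrow> T d \<phi> - \<phi>) (at_right 0)"
    by (rule Lim_transform_eventually)
  then show "\<Phi> \<phi> d \<in> gen_dom T" "gen T (\<Phi> \<phi> d) = T d \<phi> - \<phi>"
    by (auto dest: gen_domI)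
qed

end

lemma gen_linear:
  assumes "contraction_semigroup T" "\<phi> \<in> gen_dom T" "\<psi> \<in> gen_dom T"
  shows "\<phi> - \<psi> \<in> gen_dom T" "gen T (\<phi> - \<psi>) = gen T \<phi> - gen T \<psi>"
    "c *\<^sub>R \<phi> \<in> gen_dom T" "gen T (c *\<^sub>R \<phi>) = c *\<^sub>R gen T \<phi>"
proof -
  interpret contraction_semigroup T by fact
  have "((\<lambda>t. (T t (\<phi> - \<psi>) - (\<phi> - \<psi>)) /\<^sub>R t) \<longlongrightarrow> gen T \<phi> - gen T \<psi>) (at_right 0)"
    by (rule Lim_transform_eventually[OF tendsto_diff[OF assms(2,3)[THEN gen_tendsto]]])
      (auto simp: eventually_at_right_field T_diff algebra_simps intro!: exI[of _ 1])
  then show "\<phi> - \<psi> \<in> gen_dom T" "gen T (\<phi> - \<psi>) = gen T \<phi> - gen T \<psi>"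
    by (auto dest: gen_domI)
  have "((\<lambda>t. (T t (c *\<^sub>R \<phi>) - c *\<^sub>R \<phi>) /\<^sub>R t) \<longlongrightarrow> c *\<^sub>R gen T \<phi>) (at_right 0)"
    by (rule Lim_transform_eventually[OF tendsto_scaleR[OF tendsto_const assms(2)[THEN gen_tendsto]]])
      (auto simp: eventually_at_right_field T_scale algebra_simps intro!: exI[of _ 1])
  then show "c *\<^sub>R \<phi> \<in> gen_dom T" "gen T (c *\<^sub>R \<phi>) = c *\<^sub>R gen T \<phi>"
    by (auto dest: gen_domI)
qed

text \<open>The Neumann series of the resolvent \<open>(1 - (F - 1)/h)\<^sup>-\<^sup>1\<close> of the difference quotient. Since it commutes
  with \<open>F\<close>, a telescoping sum compares \<open>F\<^sup>n R\<close> with \<open>R T(nh)\<close>; this takes the place of the Trotter--Kato theorem in the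
  proof of Chernoff's theorem.\<close>

definition discrete_resolvent :: "('b::banach \<Rightarrow> 'b) \<Rightarrow> real \<Rightarrow> 'b \<Rightarrow> 'b" where
  "discrete_resolvent F h \<psi> = (\<Sum>k. (h * (1 / (1 + h)) ^ Suc k) *\<^sub>R (F ^^ k) \<psi>)"

locale contraction_step =
  fixes F :: "'b::banach \<Rightarrow> 'b" and h :: real
  assumes F_linear: "bounded_linear F" and F_contraction: "norm (F \<phi>) \<le> norm \<phi>" and h: "0 < h"
begin

abbreviation "R \<equiv> discrete_resolvent F h"

lemma pow_contraction: "norm ((F ^^ k) \<phi>) \<le> norm \<phi>"
  by (induction k) (auto intro: order_trans[OF F_contraction])

lemma pow_linear: "bounded_linear (F ^^ k)"
  by (induction k) (auto simp: id_def o_def intro: bounded_linear_ident bounded_linear_compose[OF F_linear])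

text \<open>The coefficients of the Neumann series form a geometric probability distribution, so
  \<open>R\<close> is an average of powers of \<open>F\<close> and is a contraction for every
  \<open>h\<close>.\<close>

lemma weights: "(\<lambda>k. h * (1 / (1 + h)) ^ Suc k) sums 1"
proof -
  have "(\<lambda>k. (h / (1 + h)) * (1 / (1 + h)) ^ k) sums ((h / (1 + h)) * (1 / (1 - 1 / (1 + h))))"
    using h by (intro sums_mult geometric_sums) auto
  moreover have "(h / (1 + h)) * (1 / (1 - 1 / (1 + h))) = 1"
  proof -
    have "1 - 1 / (1 + h) = h / (1 + h)" using h by (simp add: field_simps)
    then show ?thesis using h by simp
  qed
  ultimately show ?thesis using h by (simp add: mult.commute)
qed

lemma R_summable_norm: "summable (\<lambda>k. norm ((h * (1 / (1 + h)) ^ Suc k) *\<^sub>R (F ^^ k) \<psi>))"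
proof (rule summable_comparison_test)
  show "summable (\<lambda>k. h * (1 / (1 + h)) ^ Suc k * norm \<psi>)"
    using weights by (intro summable_mult2) (auto simp: sums_iff)
  show "\<exists>N. \<forall>n\<ge>N. norm (norm ((h * (1 / (1 + h)) ^ Suc n) *\<^sub>R (F ^^ n) \<psi>)) \<le> h * (1 / (1 + h)) ^ Suc n * norm \<psi>"
    using h pow_contraction by (auto simp: abs_mult simp del: power_Suc intro!: mult_left_mono)
qed

lemmas R_summable = R_summable_norm[THEN summable_norm_cancel]

lemma R_sums: "(\<lambda>k. (h * (1 / (1 + h)) ^ Suc k) *\<^sub>R (F ^^ k) \<psi>) sums R \<psi>"
  unfolding discrete_resolvent_def by (rule summable_sums[OF R_summable])

lemma R_contraction: "norm (R \<psi>) \<le> norm \<psi>"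
proof -
  have "norm (R \<psi>) \<le> (\<Sum>k. norm ((h * (1 / (1 + h)) ^ Suc k) *\<^sub>R (F ^^ k) \<psi>))"
    unfolding discrete_resolvent_def by (rule summable_norm[OF R_summable_norm])
  also have "\<dots> \<le> (\<Sum>k. h * (1 / (1 + h)) ^ Suc k * norm \<psi>)"
    using h pow_contraction weights by (intro suminf_le R_summable_norm summable_mult2)
      (auto simp: sums_iff abs_mult simp del: power_Suc intro!: mult_left_mono)
  also have "\<dots> = norm \<psi>"
    using sums_mult2[OF weights, of "norm \<psi>"] by (simp add: sums_iff)
  finally show ?thesis .
qed

lemma R_diff: "R (\<phi> - \<psi>) = R \<phi> - R \<psi>"
  and R_plus: "R (\<phi> + \<psi>) = R \<phi> + R \<psi>"
  and R_scale: "R (c *\<^sub>R \<phi>) = c *\<^sub>R R \<phi>"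
  and F_R: "F (R \<phi>) = R (F \<phi>)"
proof -
  note [simp] = linear_diff linear_add linear_scale bounded_linear.linear[OF pow_linear]
  have "(\<lambda>k. (h * (1 / (1 + h)) ^ Suc k) *\<^sub>R (F ^^ k) (\<phi> - \<psi>)) sums (R \<phi> - R \<psi>)"
    using sums_diff[OF R_sums[of \<phi>] R_sums[of \<psi>]] by (simp del: power_Suc add: scaleR_right_diff_distrib)
  from sums_unique2[OF R_sums this] show "R (\<phi> - \<psi>) = R \<phi> - R \<psi>" .
  have "(\<lambda>k. (h * (1 / (1 + h)) ^ Suc k) *\<^sub>R (F ^^ k) (\<phi> + \<psi>)) sums (R \<phi> + R \<psi>)"
    using sums_add[OF R_sums[of \<phi>] R_sums[of \<psi>]] by (simp del: power_Suc add: scaleR_right_distrib)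
  from sums_unique2[OF R_sums this] show "R (\<phi> + \<psi>) = R \<phi> + R \<psi>" .
  have "(\<lambda>k. (h * (1 / (1 + h)) ^ Suc k) *\<^sub>R (F ^^ k) (c *\<^sub>R \<phi>)) sums (c *\<^sub>R R \<phi>)"
    using bounded_linear.sums[OF bounded_linear_scaleR_right[of c] R_sums[of \<phi>]]
    by (simp del: power_Suc add: ac_simps)
  from sums_unique2[OF R_sums this] show "R (c *\<^sub>R \<phi>) = c *\<^sub>R R \<phi>" .
  have "(\<lambda>k. F ((h * (1 / (1 + h)) ^ Suc k) *\<^sub>R (F ^^ k) \<phi>)) sums F (R \<phi>)"
    by (rule bounded_linear.sums[OF F_linear R_sums])
  moreover have "F ((h * (1 / (1 + h)) ^ Suc k) *\<^sub>R (F ^^ k) \<phi>) = (h * (1 / (1 + h)) ^ Suc k) *\<^sub>R (F ^^ k) (F \<phi>)" for k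
    by (simp add: linear_scale[OF bounded_linear.linear[OF F_linear]] funpow_swap1)
  ultimately have "(\<lambda>k. (h * (1 / (1 + h)) ^ Suc k) *\<^sub>R (F ^^ k) (F \<phi>)) sums F (R \<phi>)"
    by (simp only:)
  from sums_unique2[OF this R_sums] show "F (R \<phi>) = R (F \<phi>)" .
qed

text \<open>This is the resolvent equation
  \<open>R \<psi> - (F (R \<psi>) - R \<psi>) /\<^sub>R h = \<psi>\<close> solved for
  \<open>F (R \<psi>)\<close>. Applying \<open>F\<close> shifts the series by one index and costs
  the factor \<open>1 + h\<close>.\<close>

lemma F_R_eq: "F (R \<psi>) = R \<psi> + h *\<^sub>R (R \<psi> - \<psi>)"
proof -
  let ?w = "\<lambda>k. (h * (1 / (1 + h)) ^ Suc k) *\<^sub>R (F ^^ k) \<psi>"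
  have "(\<lambda>k. ?w (Suc k)) sums (R \<psi> - ?w 0)"
    using R_sums[of \<psi>] sums_Suc_iff[of ?w "R \<psi> - ?w 0"] by (simp del: power_Suc)
  moreover have "(\<lambda>k. (1 / (1 + h)) *\<^sub>R F (?w k)) sums ((1 / (1 + h)) *\<^sub>R F (R \<psi>))"
    by (intro bounded_linear.sums[OF bounded_linear_scaleR_right] bounded_linear.sums[OF F_linear] R_sums)
  moreover have "(1 / (1 + h)) *\<^sub>R F (?w k) = ?w (Suc k)" for k
    by (simp add: linear_scale[OF bounded_linear.linear[OF F_linear]])
  ultimately have "(\<lambda>k. ?w (Suc k)) sums (R \<psi> - ?w 0)" "(\<lambda>k. ?w (Suc k)) sums ((1 / (1 + h)) *\<^sub>R F (R \<psi>))"
    by (simp_all only:)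
  from sums_unique2[OF this(2,1)] have "(1 / (1 + h)) *\<^sub>R F (R \<psi>) = R \<psi> - ?w 0" .
  then have "(1 + h) *\<^sub>R ((1 / (1 + h)) *\<^sub>R F (R \<psi>)) = (1 + h) *\<^sub>R R \<psi> - h *\<^sub>R \<psi>"
    using h by (simp add: scaleR_right_diff_distrib)
  then show ?thesis using h by (simp add: algebra_simps)
qed

text \<open>\<open>R\<close> inverts 1 - (F - 1)/h, hence \<phi> is the image of
  \<open>\<phi> - (F \<phi> - \<phi>) /\<^sub>R h\<close>. The error is therefore \<open>R\<close>
  applied to the consistency error.\<close>

lemma R_approx: "norm (R (\<phi> - g) - \<phi>) \<le> norm ((F \<phi> - \<phi>) /\<^sub>R h - g)"
proof -
  have "R (\<phi> - (F \<phi> - \<phi>) /\<^sub>R h) = \<phi>"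
    using F_R_eq[of \<phi>] h by (simp add: R_diff R_scale F_R[symmetric] divide_simps)
  then have "R (\<phi> - g) - \<phi> = R (\<phi> - g) - R (\<phi> - (F \<phi> - \<phi>) /\<^sub>R h)" by simp
  also have "\<dots> = R ((F \<phi> - \<phi>) /\<^sub>R h - g)"
    unfolding R_diff[symmetric] by simp
  finally have eq: "R (\<phi> - g) - \<phi> = R ((F \<phi> - \<phi>) /\<^sub>R h - g)" .
  show ?thesis unfolding eq by (rule R_contraction)
qed

end

text \<open>One step of the comparison makes two errors: the resolvent error, controlled by
  \<open>E\<close>, and the Taylor error of the orbit, controlled by \<open>e\<close>. Both carry
  the factor \<open>h\<close>, and since \<open>F\<close> is a contraction, \<open>n\<close> of them
  simply add up.\<close>

lemma (in contraction_semigroup) telescope: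
  fixes n :: nat and h E e :: real
  assumes "contraction_step F h" and x: "x \<in> gen_dom T"
    and E: "\<And>k::nat. k < n \<Longrightarrow> norm (discrete_resolvent F h (T (k * h) (x - gen T x)) - T (k * h) x) \<le> E"
    and e: "norm (T h x - x - h *\<^sub>R gen T x) \<le> h * e"
  shows "norm (discrete_resolvent F h (T (n * h) x) - (F ^^ n) (discrete_resolvent F h x)) \<le> n * h * (E + e)"
proof -
  interpret contraction_step F h by fact
  show ?thesis using E
  proof (induction n)
    case (Suc n)
    define t where "t = real n * h"
    define y where "y = T t x"
    define r where "r = T h y - y - h *\<^sub>R T t (gen T x)"
    have t: "0 \<le> t" using h by (simp add: t_def)
    have "r = T t (T h x - x - h *\<^sub>R gen T x)"
      using t h by (simp add: r_def y_def T_diff T_scale T_add[symmetric] add.commute)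
    then have r: "norm r \<le> h * e"
      using contraction[OF t, of "T h x - x - h *\<^sub>R gen T x"] e by simp
    have Th: "T h y = y + h *\<^sub>R T t (gen T x) + r" by (simp add: r_def)
    have "R (T h y) - F (R y) = h *\<^sub>R (y - R (T t (x - gen T x))) + R r"
      using t by (simp add: Th R_plus R_scale F_R_eq T_diff R_diff y_def[symmetric] algebra_simps)
    also have "norm \<dots> \<le> h * norm (y - R (T t (x - gen T x))) + norm (R r)"
      using h norm_triangle_ineq[of "h *\<^sub>R (y - R (T t (x - gen T x)))" "R r"] by simp
    also have "\<dots> \<le> h * E + h * e"
      using Suc.prems[of n] h R_contraction[of r] r
      by (intro add_mono mult_left_mono) (auto simp: norm_minus_commute t_def y_def)
    finally have 1: "norm (R (T h y) - F (R y)) \<le> h * E + h * e" .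
    have "norm (F (R y) - F ((F ^^ n) (R x))) \<le> norm (R y - (F ^^ n) (R x))"
      using F_contraction[of "R y - (F ^^ n) (R x)"] by (simp add: linear_diff bounded_linear.linear[OF F_linear])
    also have "\<dots> \<le> n * h * (E + e)"
      using Suc.IH Suc.prems by (simp add: y_def t_def)
    finally have 2: "norm (F (R y) - F ((F ^^ n) (R x))) \<le> n * h * (E + e)" .
    have "T (Suc n * h) x = T h y"
      using t h by (simp add: y_def t_def T_add[symmetric] algebra_simps)
    then have "norm (R (T (Suc n * h) x) - (F ^^ Suc n) (R x)) \<le> (h * E + h * e) + n * h * (E + e)"
      using norm_triangle_mono[OF 1 2] by simp
    then show ?case by (simp add: algebra_simps)
  qed simp
qed

locale chernoff = contraction_semigroup T for T :: "real \<Rightarrow> 'a::banach \<Rightarrow> 'a" +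
  fixes F :: "real \<Rightarrow> 'a::banach \<Rightarrow> 'a" and D :: "'a set"
  assumes step: "0 < h \<Longrightarrow> contraction_step (F h) h"
    and core: "is_core D T"
    and consistent: "\<phi> \<in> D \<Longrightarrow> ((\<lambda>h. (F h \<phi> - \<phi>) /\<^sub>R h) \<longlongrightarrow> gen T \<phi>) (at_right 0)"
begin

text \<open>Consistency is known on the core only. The closure of the graph provides \<xi> in the
  core such that both \<xi> and its generator value are close to those of \<phi>, and the bound 1 on
  \<open>R\<close>, uniform in \<open>h\<close>, transports the convergence.\<close>

lemma resolvent_tendsto:
  assumes \<phi>: "\<phi> \<in> gen_dom T"
  shows "((\<lambda>h. discrete_resolvent (F h) h (\<phi> - gen T \<phi>)) \<longlongrightarrow> \<phi>) (at_right 0)"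
proof (rule tendstoI)
  fix e :: real assume "0 < e"
  have "(\<phi>, gen T \<phi>) \<in> closure ((\<lambda>\<phi>. (\<phi>, gen T \<phi>)) ` D)"
    using core \<phi> by (auto simp: is_core_def)
  then have "\<exists>y\<in>(\<lambda>\<phi>. (\<phi>, gen T \<phi>)) ` D. dist y (\<phi>, gen T \<phi>) < e/4"
    using \<open>0 < e\<close> unfolding closure_approachable by (auto dest!: spec[of _ "e/4"])
  then obtain \<xi> where \<xi>: "\<xi> \<in> D" "dist (\<xi>, gen T \<xi>) (\<phi>, gen T \<phi>) < e/4"
    by blast
  have d: "norm (\<xi> - \<phi>) < e/4" "norm (gen T \<xi> - gen T \<phi>) < e/4"
    using \<xi>(2) dist_fst_le[of "(\<xi>, gen T \<xi>)" "(\<phi>, gen T \<phi>)"] dist_snd_le[of "(\<xi>, gen T \<xi>)" "(\<phi>, gen T \<phi>)"]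
    by (auto simp: dist_norm)
  have "\<forall>\<^sub>F h in at_right 0. dist ((F h \<xi> - \<xi>) /\<^sub>R h) (gen T \<xi>) < e/4"
    using \<open>0 < e\<close> by (intro tendstoD[OF consistent[OF \<xi>(1)]]) auto
  then show "\<forall>\<^sub>F h in at_right 0. dist (discrete_resolvent (F h) h (\<phi> - gen T \<phi>)) \<phi> < e"
    using eventually_at_right_less
  proof eventually_elim
    case (elim h)
    interpret contraction_step "F h" h using elim by (intro step)
    have 1: "norm (R (\<xi> - gen T \<xi>) - \<xi>) < e/4"
      using R_approx[of \<xi> "gen T \<xi>"] elim(1) by (simp add: dist_norm)
    have "norm (R ((\<phi> - gen T \<phi>) - (\<xi> - gen T \<xi>))) \<le> norm ((\<phi> - \<xi>) - (gen T \<phi> - gen T \<xi>))"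
      using R_contraction[of "(\<phi> - gen T \<phi>) - (\<xi> - gen T \<xi>)"] by (simp add: algebra_simps)
    also have "\<dots> < e/2"
      using d norm_triangle_ineq4[of "\<phi> - \<xi>" "gen T \<phi> - gen T \<xi>"] by (simp add: norm_minus_commute)
    finally have 2: "norm (R (\<phi> - gen T \<phi>) - R (\<xi> - gen T \<xi>)) < e/2" by (simp add: R_diff)
    have "norm (R (\<phi> - gen T \<phi>) - \<phi>) \<le> norm (R (\<phi> - gen T \<phi>) - R (\<xi> - gen T \<xi>)) + norm (R (\<xi> - gen T \<xi>) - \<xi>) + norm (\<xi> - \<phi>)"
      by (metis norm_triangle_chain3 norm_minus_commute)
    then show ?case using 1 2 d by (simp add: dist_norm)
  qed
qed

text \<open>A finite net of times suffices for \<open>{0..m}\<close>: the convergence holds at its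
  points, and between them both orbits change little, uniformly in \<open>h\<close> because
  \<open>R\<close> is a contraction.\<close>

lemma resolvent_tendsto_uniform:
  assumes \<phi>: "\<phi> \<in> gen_dom T" and e: "0 < e"
  shows "\<forall>\<^sub>F h in at_right 0. \<forall>s\<in>{0..m}. norm (discrete_resolvent (F h) h (T s (\<phi> - gen T \<phi>)) - T s \<phi>) \<le> e"
proof -
  let ?\<psi> = "\<phi> - gen T \<phi>"
  obtain d1 where d1: "d1 > 0" "\<And>h. 0 \<le> h \<Longrightarrow> h < d1 \<Longrightarrow> norm (T h \<phi> - \<phi>) < e/3"
    using T_small[of "e/3"] e by auto
  obtain d2 where d2: "d2 > 0" "\<And>h. 0 \<le> h \<Longrightarrow> h < d2 \<Longrightarrow> norm (T h ?\<psi> - ?\<psi>) < e/3"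
    using T_small[of "e/3"] e by auto
  obtain K where K: "finite K" "K \<subseteq> {0..m}" "{0..m} \<subseteq> (\<Union>x\<in>K. ball x (min d1 d2))"
    using seq_compact_imp_totally_bounded[OF compact_imp_seq_compact[OF compact_Icc[of 0 m]], rule_format, of "min d1 d2"]
      d1(1) d2(1) by auto
  have "\<forall>\<^sub>F h in at_right 0. dist (discrete_resolvent (F h) h (T s ?\<psi>)) (T s \<phi>) < e/3" if "s \<in> K" for s
  proof -
    have "T s ?\<psi> = T s \<phi> - gen T (T s \<phi>)" "T s \<phi> \<in> gen_dom T"
      using that K(2) \<phi> by (auto simp: gen_T T_diff)
    then show ?thesis
      using tendstoD[OF resolvent_tendsto, of "T s \<phi>" "e/3"] e by simp
  qed
  then have "\<forall>\<^sub>F h in at_right 0. \<forall>s\<in>K. dist (discrete_resolvent (F h) h (T s ?\<psi>)) (T s \<phi>) < e/3"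
    using K(1) by (simp add: eventually_ball_finite)
  then show ?thesis using eventually_at_right_less
  proof eventually_elim
    case (elim h)
    interpret contraction_step "F h" h using elim by (intro step)
    show ?case
    proof
      fix s assume s: "s \<in> {0..m}"
      then obtain k where k: "k \<in> K" "\<bar>k - s\<bar> < d1" "\<bar>k - s\<bar> < d2"
        using K(3) by (auto simp: dist_real_def)
      then have "0 \<le> k" "0 \<le> s" using K(2) s by auto
      then have 1: "norm (T k \<phi> - T s \<phi>) < e/3" "norm (T k ?\<psi> - T s ?\<psi>) < e/3"
        using T_increment[of k s] d1(2)[of "\<bar>k - s\<bar>"] d2(2)[of "\<bar>k - s\<bar>"] k order_le_less_trans
        by (meson abs_ge_zero)+
      have "norm (R (T s ?\<psi> - T k ?\<psi>)) < e/3"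
        using R_contraction[of "T s ?\<psi> - T k ?\<psi>"] 1(2) by (simp add: norm_minus_commute)
      then have 2: "norm (R (T s ?\<psi>) - R (T k ?\<psi>)) < e/3" by (simp add: R_diff)
      have 3: "norm (R (T k ?\<psi>) - T k \<phi>) < e/3"
        using elim k by (auto simp: dist_norm)
      have "norm (R (T s ?\<psi>) - T s \<phi>) \<le> norm (R (T s ?\<psi>) - R (T k ?\<psi>)) + norm (R (T k ?\<psi>) - T k \<phi>) + norm (T k \<phi> - T s \<phi>)"
        by (metis norm_triangle_chain3 norm_minus_commute)
      then show "norm (R (T s ?\<psi>) - T s \<phi>) \<le> e"
        using 1 2 3 by linarith
    qed
  qed
qed

text \<open>The vector \<open>x = \<phi> - gen T \<phi>\<close> is the one whose resolvent
  approximates \<phi>. The telescoping estimate is applied to \<open>x\<close>, which has to lie in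
  the domain itself; this explains the second hypothesis.\<close>

lemma convergence_gen_dom_2:
  assumes \<phi>: "\<phi> \<in> gen_dom T" "gen T \<phi> \<in> gen_dom T" and e: "0 < e" and m: "0 < m"
  shows "\<exists>N>0. \<forall>n\<ge>N. \<forall>\<tau>\<in>{0<..m}. norm ((F (\<tau> / real n) ^^ n) \<phi> - T \<tau> \<phi>) \<le> e"
proof -
  define x where "x = \<phi> - gen T \<phi>"
  have x: "x \<in> gen_dom T"
    using gen_linear(1)[OF contraction_semigroup_axioms \<phi>] by (simp add: x_def)
  \<comment> \<open>The final sum consists of \<open>2 * e'\<close>, for replacing \<phi> by
    \<open>R x\<close> at both ends, and of \<open>m * (2 * e')\<close> from the telescoping
    estimate.\<close>
  define e' where "e' = e / (2 + 2 * m)"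
  have e': "0 < e'" using e m by (simp add: e'_def)
  obtain d where d: "d > 0" "\<And>h. 0 \<le> h \<Longrightarrow> h < d \<Longrightarrow> norm (T h (gen T x) - gen T x) < e'"
    using T_small[OF e'] by auto
  have "\<forall>\<^sub>F h in at_right 0. (\<forall>s\<in>{0..m}. norm (discrete_resolvent (F h) h (T s x) - T s \<phi>) \<le> e') \<and>
     (\<forall>s\<in>{0..m}. norm (discrete_resolvent (F h) h (T s (x - gen T x)) - T s x) \<le> e')"
    unfolding x_def
    by (intro eventually_conj resolvent_tendsto_uniform \<phi> e' x[unfolded x_def])
  then obtain d' where d': "d' > 0" "\<And>h. 0 < h \<Longrightarrow> h < d' \<Longrightarrow>
      (\<forall>s\<in>{0..m}. norm (discrete_resolvent (F h) h (T s x) - T s \<phi>) \<le> e') \<and>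
     (\<forall>s\<in>{0..m}. norm (discrete_resolvent (F h) h (T s (x - gen T x)) - T s x) \<le> e')"
    by (auto simp: eventually_at_right_field)
  define q where "q = min d d'"
  have q: "q > 0" using d(1) d'(1) by (simp add: q_def)
  obtain N :: nat where N0: "m / q < real N" using reals_Archimedean2 by blast
  have "0 < m / q" using m q by simp
  with N0 have Np: "N > 0" by (metis gr0I of_nat_0 order_less_asym)
  have "m / real N < q" using N0 q Np by (simp add: field_simps)
  with Np have N: "N > 0" "m / real N < min d d'" by (auto simp: q_def)
  have "norm ((F (\<tau> / real n) ^^ n) \<phi> - T \<tau> \<phi>) \<le> e" if n: "n \<ge> N" and \<tau>: "\<tau> \<in> {0<..m}" for n \<tau>
  proof -
    define h where "h = \<tau> / real n"
    have n0: "n > 0" using n N by simp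
    have hn: "0 < h" "n * h = \<tau>" using n0 \<tau> by (auto simp: h_def)
    have "h \<le> m / real N"
      unfolding h_def using n N \<tau> by (intro frac_le) auto
    with N have hd: "h < d" "h < d'" by auto
    interpret contraction_step "F h" h using hn by (intro step)
    have kh: "k * h \<in> {0..m}" if "k < n" for k :: nat
    proof -
      have "real k * h \<le> real n * h"
        using that hn by (intro mult_right_mono) auto
      also have "\<dots> = \<tau>" by (rule hn(2))
      finally have "real k * h \<le> \<tau>" .
      moreover have "0 \<le> real k * h" using hn by simp
      ultimately show ?thesis using \<tau> by simp
    qed
    have "norm (R (T (n * h) x) - (F h ^^ n) (R x)) \<le> n * h * (e' + e')"
    proof (rule telescope)
      show "norm (T h x - x - h *\<^sub>R gen T x) \<le> h * e'"
        using hn hd d(2) by (intro increment_bound x) (auto intro: less_imp_le)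
      show "norm (R (T (k * h) (x - gen T x)) - T (k * h) x) \<le> e'" if "k < n" for k :: nat
        using d'(2)[OF hn(1) hd(2)] kh[OF that] by blast
    qed (unfold_locales, use x in auto)
    note tel = this
    have 1: "norm (R (T \<tau> x) - (F h ^^ n) (R x)) \<le> m * (2 * e')"
    proof -
      have "\<tau> * (2 * e') \<le> m * (2 * e')" using \<tau> e' by (intro mult_right_mono) auto
      then show ?thesis using tel by (simp add: hn(2))
    qed
    have 2: "norm (R (T \<tau> x) - T \<tau> \<phi>) \<le> e'" "norm (R x - \<phi>) \<le> e'"
      using d'(2)[OF hn(1) hd(2)] \<tau> m T_0 by (force, metis T_0 atLeastAtMost_iff less_imp_le order_refl)
    have "norm ((F h ^^ n) (\<phi> - R x)) \<le> e'"
      using pow_contraction[of n "\<phi> - R x"] 2(2) by (simp add: norm_minus_commute)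
    then have 3: "norm ((F h ^^ n) \<phi> - (F h ^^ n) (R x)) \<le> e'"
      by (simp add: linear_diff bounded_linear.linear[OF pow_linear])
    have "norm ((F h ^^ n) \<phi> - T \<tau> \<phi>) \<le> norm ((F h ^^ n) \<phi> - (F h ^^ n) (R x)) + norm (R (T \<tau> x) - (F h ^^ n) (R x)) + norm (R (T \<tau> x) - T \<tau> \<phi>)"
      by (metis norm_triangle_chain3 norm_minus_commute)
    also have "\<dots> \<le> e' + m * (2 * e') + e'" using 1 2 3 by linarith
    also have "\<dots> = e' * (2 + 2 * m)" by (simp add: algebra_simps)
    also have "\<dots> = e" using m by (simp add: e'_def)
    finally show ?thesis by (simp add: h_def)
  qed
  with N show ?thesis by blast
qed

text \<open>Time averages of \<phi> lie in the domain of the squared generator and approximate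
  \<phi>. As all powers and all \<open>T \<tau>\<close> are contractions, the approximation error
  does not grow with \<open>n\<close> or \<tau>.\<close>

theorem convergence:
  assumes \<phi>: "\<phi> \<in> gen_dom T" and e: "0 < e" and m: "0 < m"
  shows "\<exists>N>0. \<forall>n\<ge>N. \<forall>\<tau>\<in>{0<..m}. norm ((F (\<tau> / real n) ^^ n) \<phi> - T \<tau> \<phi>) \<le> e"
proof -
  define \<Phi> where "\<Phi> \<phi> t = integral {0..t} (\<lambda>s. T s \<phi>)" for \<phi> t
  have "\<forall>\<^sub>F d in at_right 0. dist (\<Phi> \<phi> d /\<^sub>R d) \<phi> < e/3"
    unfolding \<Phi>_def using average(3)[of 1 \<phi>] e by (intro tendstoD) auto
  then obtain d where d: "d > 0" "dist (\<Phi> \<phi> d /\<^sub>R d) \<phi> < e/3"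
    unfolding eventually_at_right_field by (meson dense)
  define \<xi> where "\<xi> = \<Phi> \<phi> d /\<^sub>R d"
  have a: "\<Phi> \<phi> d \<in> gen_dom T" "gen T (\<Phi> \<phi> d) = T d \<phi> - \<phi>"
    using average[OF d(1), of \<phi>] by (auto simp: \<Phi>_def)
  note ax = contraction_semigroup_axioms
  have 1: "\<xi> \<in> gen_dom T" "gen T \<xi> = (T d \<phi> - \<phi>) /\<^sub>R d"
    using gen_linear(3,4)[OF ax a(1) a(1)] a(2) by (auto simp: \<xi>_def)
  have 2: "gen T \<xi> \<in> gen_dom T"
  proof -
    have "T d \<phi> \<in> gen_dom T" using d \<phi> by (intro gen_T) auto
    from gen_linear(3)[OF ax gen_linear(1)[OF ax this \<phi>] \<phi>] show ?thesis by (simp add: 1)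
  qed
  obtain N where N: "N > 0" "\<And>n \<tau>. n \<ge> N \<Longrightarrow> \<tau> \<in> {0<..m} \<Longrightarrow> norm ((F (\<tau> / real n) ^^ n) \<xi> - T \<tau> \<xi>) \<le> e/3"
    using convergence_gen_dom_2[OF 1(1) 2, of "e/3" m] e m by auto
  have "norm ((F (\<tau> / real n) ^^ n) \<phi> - T \<tau> \<phi>) \<le> e" if n: "n \<ge> N" and \<tau>: "\<tau> \<in> {0<..m}" for n \<tau>
  proof -
    interpret contraction_step "F (\<tau> / real n)" "\<tau> / real n"
      using n N \<tau> by (intro step) auto
    let ?P = "F (\<tau> / real n) ^^ n"
    have d': "norm (\<phi> - \<xi>) \<le> e/3" using d(2) by (simp add: \<xi>_def dist_norm norm_minus_commute)
    have "norm (?P (\<phi> - \<xi>)) \<le> e/3" using pow_contraction[of n "\<phi> - \<xi>"] d' by simp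
    then have 1: "norm (?P \<phi> - ?P \<xi>) \<le> e/3"
      by (simp add: linear_diff bounded_linear.linear[OF pow_linear])
    have "norm (T \<tau> (\<phi> - \<xi>)) \<le> e/3" using contraction[of \<tau> "\<phi> - \<xi>"] \<tau> d' by simp
    then have 2: "norm (T \<tau> \<phi> - T \<tau> \<xi>) \<le> e/3" using \<tau> by (simp add: T_diff)
    have "norm (?P \<phi> - T \<tau> \<phi>) \<le> norm (?P \<phi> - ?P \<xi>) + norm (?P \<xi> - T \<tau> \<xi>) + norm (T \<tau> \<phi> - T \<tau> \<xi>)"
      by (metis norm_triangle_chain3 norm_minus_commute)
    then show ?thesis using 1 2 N(2)[OF n \<tau>] by linarith
  qed
  with N(1) show ?thesis by blast
qed

end

lemma norm_c0fun_le: "(\<And>x. \<bar>apply_c0 f x\<bar> \<le> b) \<Longrightarrow> norm f \<le> b"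
  using dist_c0fun_le[of f 0 b] by simp

lemma apply_c0_le_norm: "\<bar>apply_c0 f x\<bar> \<le> norm f"
  using dist_apply_c0_le[of f x 0] by simp

text \<open>The sub-Markov property, applied to \<psi> divided by its norm, bounds
  \<open>T t \<psi>\<close> from above by the norm of \<psi>; the same for \<open>- \<psi>\<close>
  bounds it from below.\<close>

lemma feller_contraction:
  fixes T :: "real \<Rightarrow> 'a::euclidean_space c0fun \<Rightarrow> 'a c0fun"
  assumes "feller_semigroup T"
  shows "contraction_semigroup T"
proof
  show "strongly_continuous_semigroup T" using assms by (simp add: feller_semigroup_def)
  fix t :: real and \<phi> assume t: "0 \<le> t"
  interpret bounded_linear "T t"
    using assms t by (simp add: feller_semigroup_def strongly_continuous_semigroup_def)
  have le: "apply_c0 (T t \<psi>) x \<le> norm \<psi>" for \<psi> x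
  proof (cases "\<psi> = 0")
    case False
    have "\<And>y. apply_c0 (\<psi> /\<^sub>R norm \<psi>) y \<le> 1"
    proof -
      fix y
      have "apply_c0 \<psi> y \<le> norm \<psi>" using apply_c0_le_norm[of \<psi> y] by linarith
      then show "apply_c0 (\<psi> /\<^sub>R norm \<psi>) y \<le> 1" using False by (simp add: field_simps)
    qed
    then have "apply_c0 (T t (\<psi> /\<^sub>R norm \<psi>)) x \<le> 1"
      using assms t by (auto simp: feller_semigroup_def)
    then show ?thesis using False by (simp add: scaleR field_simps)
  qed (simp add: zero)
  show "norm (T t \<phi>) \<le> norm \<phi>"
  proof (rule norm_c0fun_le)
    fix x show "\<bar>apply_c0 (T t \<phi>) x\<bar> \<le> norm \<phi>"
      using le[of \<phi> x] le[of "- \<phi>" x] by (simp add: neg)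
  qed
qed

section \<open>Uniqueness of Laplace transforms\<close>

text \<open>In the variable y = exp (-t) all moments of order at least 1 on the unit interval
  vanish. By Weierstrass approximation so do the integrals of all continuous functions of y that are
  0 at y = 0; the moment of order 0 is not at hand, which is why the constant term of the polynomial
  is subtracted.\<close>

lemma exp_moments_zero_imp_integral_zero:
  fixes \<psi> :: "real \<Rightarrow> real"
  assumes \<psi>: "integrable lborel \<psi>" and supp: "\<And>t. t \<le> 0 \<Longrightarrow> \<psi> t = 0"
    and zero: "\<And>n::nat. n \<ge> 1 \<Longrightarrow> (LINT t|lborel. exp (- t) ^ n * \<psi> t) = 0"
    and c: "0 < c" "c < d"
  shows "(LINT t|lborel. indicator {c<..<d} t * \<psi> t) = 0"
proof -
  define J where "J = (LINT t|lborel. \<bar>\<psi> t\<bar>)"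
  have J: "0 \<le> J" by (simp add: J_def)
  have [measurable]: "\<psi> \<in> borel_measurable borel" using \<psi> by (simp add: integrable_completion)
  have bnd: "integrable lborel (\<lambda>t. g t * \<psi> t)"
    if "g \<in> borel_measurable borel" "\<And>t. t > 0 \<Longrightarrow> \<bar>g t\<bar> \<le> b" for g :: "real \<Rightarrow> real" and b
  proof (rule Bochner_Integration.integrable_bound)
    show "integrable lborel (\<lambda>t. b * \<psi> t)" using \<psi> by simp
    have "\<bar>g t * \<psi> t\<bar> \<le> \<bar>b * \<psi> t\<bar>" for t
      using that(2)[of t] supp[of t] abs_ge_self[of b]
      by (cases "t > 0") (auto simp: abs_mult intro!: mult_right_mono)
    then show "AE t in lborel. norm (g t * \<psi> t) \<le> norm (b * \<psi> t)" by simp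
  qed (use that in measurable)
  have pow: "integrable lborel (\<lambda>t. exp (- t) ^ n * \<psi> t)" for n
    by (rule bnd[where b = 1]) (auto simp: power_le_one)
  have cont: "(LINT t|lborel. g (exp (- t)) * \<psi> t) = 0"
    if g: "continuous_on UNIV g" "g 0 = 0" for g :: "real \<Rightarrow> real"
  proof (rule ccontr)
    assume ne: "(LINT t|lborel. g (exp (- t)) * \<psi> t) \<noteq> 0"
    define I where "I = (LINT t|lborel. g (exp (- t)) * \<psi> t)"
    \<comment> \<open>Small enough that an error of \<open>e * J\<close> is at most half of
      \<open>\<bar>I\<bar>\<close>; the 1 added to \<open>J\<close> avoids a division by
      zero.\<close>
    define e where "e = \<bar>I\<bar> / (2 * (J + 1))"
    have e: "0 < e" using ne J by (simp add: e_def I_def)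
    have [measurable]: "g \<in> borel_measurable borel"
      using g(1) by (rule borel_measurable_continuous_onI)
    obtain q where q: "real_polynomial_function q" "\<And>x. x \<in> {0..1} \<Longrightarrow> \<bar>g x - q x\<bar> < e / 2"
      using Stone_Weierstrass_real_polynomial_function[of "{0..1}" g "e/2"] e continuous_on_subset[OF g(1)]
      by auto
    obtain a n where an: "q = (\<lambda>x. \<Sum>i\<le>n. a i * x ^ i)"
      using q(1) by (auto simp: real_polynomial_function_iff_sum)
    have q0: "q 0 = a 0"
    proof -
      have "q 0 = (\<Sum>i\<le>n. if i = 0 then a 0 else 0)"
        unfolding an by (intro sum.cong) (auto simp: power_0_left)
      then show ?thesis by simp
    qed
    have qe: "q (exp (- t)) - q 0 = (\<Sum>i=1..n. a i * exp (- t) ^ i)" for t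
    proof -
      have "q (exp (- t)) = a 0 + (\<Sum>i=1..n. a i * exp (- t) ^ i)"
      proof -
        have "(\<Sum>i\<le>n. f i) = f 0 + (\<Sum>i=1..n. f i)" for f :: "nat \<Rightarrow> real"
          by (simp add: atMost_atLeast0 sum.atLeast_Suc_atMost)
        then show ?thesis unfolding an by simp
      qed
      then show ?thesis by (simp add: q0)
    qed
    have "(LINT t|lborel. (q (exp (- t)) - q 0) * \<psi> t) = (\<Sum>i=1..n. LINT t|lborel. a i * (exp (- t) ^ i * \<psi> t))"
      unfolding qe sum_distrib_right mult.assoc
      by (intro Bochner_Integration.integral_sum integrable_mult_right pow)
    also have "\<dots> = 0" using zero by simp
    finally have q_zero: "(LINT t|lborel. (q (exp (- t)) - q 0) * \<psi> t) = 0" .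
    \<comment> \<open>Removing \<open>q 0\<close> costs a second e/2, because \<open>g 0 = 0\<close>
      and \<open>q\<close> approximates \<open>g\<close> at 0 as well.\<close>
    have diff: "\<bar>g (exp (- t)) - (q (exp (- t)) - q 0)\<bar> \<le> e" if "t > 0" for t
      using q(2)[of "exp (- t)"] q(2)[of 0] g(2) that by (simp add: abs_if split: if_splits)
    have [measurable]: "q \<in> borel_measurable borel" unfolding an by measurable
    have gi: "integrable lborel (\<lambda>t. g (exp (- t)) * \<psi> t)"
    proof -
      have "compact (g ` {0..1})"
        using continuous_on_subset[OF g(1)] by (intro compact_continuous_image) auto
      then obtain b where "\<And>x. x \<in> {0..1} \<Longrightarrow> \<bar>g x\<bar> \<le> b"
        using compact_imp_bounded by (force simp: bounded_iff)
      then show ?thesis by (intro bnd[where b = b]) auto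
    qed
    have di: "integrable lborel (\<lambda>t. (g (exp (- t)) - (q (exp (- t)) - q 0)) * \<psi> t)"
      using diff by (intro bnd[where b = e]) auto
    have qi: "integrable lborel (\<lambda>t. (q (exp (- t)) - q 0) * \<psi> t)"
      using Bochner_Integration.integrable_diff[OF gi di] by (simp add: algebra_simps)
    have "I = (LINT t|lborel. (g (exp (- t)) - (q (exp (- t)) - q 0)) * \<psi> t)"
      using Bochner_Integration.integral_diff[OF gi qi] q_zero by (simp add: I_def algebra_simps)
    also have "\<bar>\<dots>\<bar> \<le> (LINT t|lborel. e * \<bar>\<psi> t\<bar>)"
    proof -
      have "\<bar>(g (exp (- t)) - (q (exp (- t)) - q 0)) * \<psi> t\<bar> \<le> e * \<bar>\<psi> t\<bar>" for t
        using diff[of t] supp[of t] by (cases "t > 0") (auto simp: abs_mult intro!: mult_right_mono)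
      then have "(LINT t|lborel. \<bar>(g (exp (- t)) - (q (exp (- t)) - q 0)) * \<psi> t\<bar>) \<le> (LINT t|lborel. e * \<bar>\<psi> t\<bar>)"
        by (intro integral_mono integrable_abs di integrable_mult_right \<psi>)
      then show ?thesis by (rule order_trans[OF integral_abs_bound])
    qed
    also have "\<dots> = e * J" by (simp add: J_def)
    finally have "\<bar>I\<bar> \<le> e * J" .
    also have "\<dots> \<le> e * (J + 1)" using e by simp
    also have "\<dots> = \<bar>I\<bar> / 2" using J by (simp add: e_def field_simps)
    finally show False using ne by (simp add: I_def)
  qed
  \<comment> \<open>Trapezoids in the variable y, increasing to the indicator of the open interval
    from \<open>exp (- d)\<close> to \<open>exp (- c)\<close>.\<close>
  define g where "g k y = min 1 (real k * max 0 (min (y - exp (- d)) (exp (- c) - y)))" for k and y :: real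
  have "(\<lambda>k. LINT t|lborel. g k (exp (- t)) * \<psi> t) \<longlonglongrightarrow> (LINT t|lborel. indicator {c<..<d} t * \<psi> t)"
  proof (rule integral_dominated_convergence[where w = "\<lambda>t. \<bar>\<psi> t\<bar>"])
    have "(\<lambda>k. g k (exp (- t))) \<longlonglongrightarrow> indicator {c<..<d} t" for t
    proof (cases "t \<in> {c<..<d}")
      case True
      define m where "m = min (exp (- t) - exp (- d)) (exp (- c) - exp (- t))"
      have m: "m > 0" using True by (simp add: m_def)
      obtain N :: nat where N: "1 / m < real N" using reals_Archimedean2 by blast
      have "g k (exp (- t)) = 1" if "k \<ge> N" for k
      proof -
        have "1 \<le> real N * m" using N m by (simp add: field_simps)
        also have "\<dots> \<le> real k * m" using that m by (intro mult_right_mono) auto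
        finally show ?thesis using m by (simp add: g_def m_def[symmetric])
      qed
      then show ?thesis
        using True by (intro tendsto_eventually) (auto simp: eventually_sequentially)
    next
      case False
      then have "min (exp (- t) - exp (- d)) (exp (- c) - exp (- t)) \<le> 0" by (auto simp: min_le_iff_disj)
      then have "g k (exp (- t)) = 0" for k by (simp add: g_def max_absorb1)
      then show ?thesis using False by simp
    qed
    then show "AE t in lborel. (\<lambda>k. g k (exp (- t)) * \<psi> t) \<longlonglongrightarrow> indicator {c<..<d} t * \<psi> t"
      by (auto intro!: tendsto_mult)
    have "\<bar>g k y\<bar> \<le> 1" for k y by (auto simp: g_def)
    then show "AE t in lborel. norm (g k (exp (- t)) * \<psi> t) \<le> \<bar>\<psi> t\<bar>" for k
      by (auto simp: abs_mult intro!: mult_left_le_one_le)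
  qed (use \<psi> in \<open>auto simp: g_def\<close>)
  moreover have "(LINT t|lborel. g k (exp (- t)) * \<psi> t) = 0" for k
  proof (rule cont)
    show "continuous_on UNIV (g k)" unfolding g_def by (intro continuous_intros)
    have "min (0 - exp (- d)) (exp (- c) - 0) \<le> 0" by (simp add: min_le_iff_disj)
    then show "g k 0 = 0" by (simp add: g_def max_absorb1)
  qed
  ultimately show ?thesis by (simp add: LIMSEQ_const_iff)
qed

text \<open>Evaluation at w = a + 1, a + 2, ... gives vanishing exponential moments, hence vanishing
  integrals over all intervals. A nonzero value would, by right continuity, keep its sign and a
  positive distance from 0 on some interval to its right.\<close>

theorem laplace_transform_zero_imp_zero:
  fixes \<phi> :: "real \<Rightarrow> real"
  assumes int: "set_integrable lborel {0<..} (\<lambda>t. exp (- a * t) * \<phi> t)"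
    and zero: "\<And>w. w > a \<Longrightarrow> (LINT t:{0<..}|lborel. exp (- w * t) * \<phi> t) = 0"
    and rc: "\<And>t. t > 0 \<Longrightarrow> (\<phi> \<longlongrightarrow> \<phi> t) (at_right t)"
    and t0: "t\<^sub>0 > 0"
  shows "\<phi> t\<^sub>0 = 0"
proof (rule ccontr)
  assume ne: "\<phi> t\<^sub>0 \<noteq> 0"
  define \<psi> where "\<psi> t = indicator {0<..} t * (exp (- a * t) * \<phi> t)" for t
  have \<psi>: "integrable lborel \<psi>"
    using int by (simp add: set_integrable_def \<psi>_def[abs_def])
  have z: "(LINT t|lborel. indicator {c<..<d} t * \<psi> t) = 0" if "0 < c" "c < d" for c d
  proof (rule exp_moments_zero_imp_integral_zero[OF \<psi> _ _ that])
    fix n :: nat assume "n \<ge> 1"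
    then have "(LINT t:{0<..}|lborel. exp (- (a + real n) * t) * \<phi> t) = 0"
      by (intro zero) auto
    moreover have "exp (- t) ^ n * \<psi> t = indicator {0<..} t *\<^sub>R (exp (- (a + real n) * t) * \<phi> t)" for t
      by (simp add: \<psi>_def exp_of_nat_mult[symmetric] mult_exp_exp algebra_simps)
    ultimately show "(LINT t|lborel. exp (- t) ^ n * \<psi> t) = 0"
      by (simp add: set_lebesgue_integral_def)
  qed (simp add: \<psi>_def)
  define e where "e = \<bar>\<phi> t\<^sub>0\<bar> / 2"
  have "e > 0" using ne by (simp add: e_def)
  then obtain b where b: "b > t\<^sub>0" "\<And>t. t\<^sub>0 < t \<Longrightarrow> t < b \<Longrightarrow> dist (\<phi> t) (\<phi> t\<^sub>0) < e"
    using tendstoD[OF rc[OF t0], of e] by (auto simp: eventually_at_right_field)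
  have lower: "sgn (\<phi> t\<^sub>0) * \<phi> t \<ge> e" if "t\<^sub>0 < t" "t < b" for t
    using b(2)[OF that] ne by (auto simp: e_def dist_real_def sgn_if abs_if split: if_splits)
  \<comment> \<open>A lower bound for the exponential weight on the interval, valid for either sign
    of \<open>a\<close>.\<close>
  define m where "m = exp (- \<bar>a\<bar> * b)"
  have m: "exp (- a * t) \<ge> m" if "t\<^sub>0 < t" "t < b" for t
  proof -
    have "a * t \<le> \<bar>a\<bar> * b"
      using that t0 mult_mono[of "a" "\<bar>a\<bar>" t b] by simp
    then show ?thesis by (simp add: m_def)
  qed
  have pos: "m > 0" by (simp add: m_def)
  have ii: "integrable lborel (\<lambda>t. sgn (\<phi> t\<^sub>0) * (indicator {t\<^sub>0<..<b} t * \<psi> t))"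
    using \<psi> by (intro integrable_mult_right integrable_real_mult_indicator[where f = \<psi>, unfolded mult.commute[of _ "indicator _ _"]]) auto
  have "(LINT t|lborel. (m * e) * indicator {t\<^sub>0<..<b} t) \<le> (LINT t|lborel. sgn (\<phi> t\<^sub>0) * (indicator {t\<^sub>0<..<b} t * \<psi> t))"
  proof (rule integral_mono[OF _ ii])
    show "integrable lborel (\<lambda>t. m * e * indicator {t\<^sub>0<..<b} t)"
      using b(1) by (intro integrable_mult_right integrable_real_indicator) auto
    show "m * e * indicator {t\<^sub>0<..<b} t \<le> sgn (\<phi> t\<^sub>0) * (indicator {t\<^sub>0<..<b} t * \<psi> t)" for t
    proof (cases "t \<in> {t\<^sub>0<..<b}")
      case True
      then have "m * e \<le> exp (- a * t) * (sgn (\<phi> t\<^sub>0) * \<phi> t)"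
        using m[of t] lower[of t] pos \<open>e > 0\<close> by (intro mult_mono) auto
      then show ?thesis using True t0 by (simp add: \<psi>_def algebra_simps)
    qed simp
  qed
  also have "\<dots> = 0" using z[OF t0 b(1)] by simp
  finally have "m * e * (b - t\<^sub>0) \<le> 0" using b(1) by simp
  moreover have "m * e * (b - t\<^sub>0) > 0" using pos \<open>e > 0\<close> b(1) by simp
  ultimately show False by linarith
qed

section \<open>Square roots of positive semidefinite matrices\<close>

text \<open>Let \<open>v\<close> maximise the quadratic form on the unit sphere of \<open>S\<close>,
  with maximum \<open>l\<close>. Then \<open>l * (y \<bullet> y) - f y \<bullet> y\<close> is a
  nonnegative form on \<open>S\<close> that vanishes at \<open>v\<close>; its first variation there
  must vanish, which is the eigenvalue equation.\<close>

lemma selfadjoint_eigenvector: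
  fixes f :: "'a::euclidean_space \<Rightarrow> 'a"
  assumes f: "linear f" and sym: "\<And>x y. f x \<bullet> y = x \<bullet> f y"
    and S: "subspace S" "f ` S \<subseteq> S" "S \<noteq> {0}"
  shows "\<exists>v\<in>S. norm v = 1 \<and> (\<exists>l. f v = l *\<^sub>R v)"
proof -
  define K where "K = S \<inter> sphere 0 1"
  obtain w where w: "w \<in> S" "w \<noteq> 0"
    using S(1,3) subspace_0 by blast
  then have "w /\<^sub>R norm w \<in> K"
    using S(1) by (auto simp: K_def subspace_scale)
  moreover have "compact K"
    unfolding K_def using S(1) by (intro closed_Int_compact closed_subspace) auto
  moreover have "continuous_on K (\<lambda>x. f x \<bullet> x)"
    using f by (intro continuous_intros linear_continuous_on linear_conv_bounded_linear[THEN iffD1])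
  ultimately obtain v where v: "v \<in> K" and max: "\<And>y. y \<in> K \<Longrightarrow> f y \<bullet> y \<le> f v \<bullet> v"
    using continuous_attains_sup[of K "\<lambda>x. f x \<bullet> x"] by blast
  define l where "l = f v \<bullet> v"
  define g where "g y = l * (y \<bullet> y) - f y \<bullet> y" for y
  have vS: "v \<in> S" "norm v = 1" using v by (auto simp: K_def)
  have g_nonneg: "0 \<le> g y" if "y \<in> S" for y
  proof (cases "y = 0")
    case False
    have "y /\<^sub>R norm y \<in> K" using that False S(1) by (auto simp: K_def subspace_scale)
    from max[OF this] have "f y \<bullet> y / (norm y)\<^sup>2 \<le> l"
      using f by (simp add: linear_scale l_def power2_eq_square divide_inverse mult_ac)
    then show ?thesis using False by (simp add: g_def field_simps power2_norm_eq_inner[symmetric])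
  qed (use f in \<open>simp add: g_def linear_0\<close>)
  have gv: "g v = 0" using vS by (simp add: g_def l_def power2_norm_eq_inner[symmetric])
  define y where "y = l *\<^sub>R v - f v"
  have y: "y \<in> S" using vS S by (auto simp: y_def subspace_diff subspace_scale)
  \<comment> \<open>Moving away from \<open>v\<close> in the direction of the defect
    \<open>y = l *\<^sub>R v - f v\<close>, the linear coefficient is twice the squared norm of that
    defect.\<close>
  have quad: "0 \<le> 2 * t * (y \<bullet> y) + t\<^sup>2 * g y" for t
  proof -
    have "v + t *\<^sub>R y \<in> S" using vS y S by (simp add: subspace_add subspace_scale)
    then have "0 \<le> g (v + t *\<^sub>R y)" by (rule g_nonneg)
    also have "g (v + t *\<^sub>R y) = g v + 2 * t * (l * (v \<bullet> y) - f v \<bullet> y) + t\<^sup>2 * g y"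
      using sym[of y v] f
      by (simp add: g_def linear_add linear_scale inner_add inner_commute power2_eq_square algebra_simps)
    also have "l * (v \<bullet> y) - f v \<bullet> y = (l *\<^sub>R v - f v) \<bullet> y" by (simp add: inner_diff_left)
    also have "l *\<^sub>R v - f v = y" by (simp add: y_def)
    finally show ?thesis using gv by simp
  qed
  have "y = 0"
  proof (rule ccontr)
    assume "y \<noteq> 0"
    then have b: "0 < y \<bullet> y" by simp
    have gy: "0 \<le> g y" by (rule g_nonneg[OF y])
    \<comment> \<open>Negative, and so small that the linear term outweighs the quadratic
      one.\<close>
    define t where "t = - (y \<bullet> y) / (g y + 1)"
    have t: "t < 0" using b gy by (simp add: t_def divide_neg_pos)
    have "- (t * g y) \<le> y \<bullet> y"
      using b gy by (simp add: t_def field_simps)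
    then have "0 < 2 * (y \<bullet> y) + t * g y" using b by linarith
    then have "t * (2 * (y \<bullet> y) + t * g y) < 0" using t by (simp add: mult_neg_pos)
    with quad[of t] show False by (simp add: power2_eq_square algebra_simps)
  qed
  then have "f v = l *\<^sub>R v" by (simp add: y_def)
  then show ?thesis using vS by blast
qed

text \<open>Induction on the dimension: by self-adjointness the orthogonal complement of an
  eigenvector within \<open>S\<close> is invariant as well.\<close>

lemma selfadjoint_orthonormal_eigenbasis:
  fixes f :: "'a::euclidean_space \<Rightarrow> 'a"
  assumes f: "linear f" and sym: "\<And>x y. f x \<bullet> y = x \<bullet> f y"
    and S: "subspace S" "f ` S \<subseteq> S"
  shows "\<exists>B. finite B \<and> pairwise orthogonal B \<and> (\<forall>b\<in>B. norm b = 1 \<and> (\<exists>l. f b = l *\<^sub>R b)) \<and> span B = S"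
  using S
proof (induction "dim S" arbitrary: S rule: less_induct)
  case less
  show ?case
  proof (cases "S = {0}")
    case True
    then show ?thesis by (intro exI[of _ "{}"]) auto
  next
    case False
    then obtain v l where v: "v \<in> S" "norm v = 1" "f v = l *\<^sub>R v"
      using selfadjoint_eigenvector[OF f sym less.prems] by blast
    define S' where "S' = {x \<in> S. x \<bullet> v = 0}"
    have sub: "subspace S'"
      using less.prems(1) by (auto simp: S'_def subspace_def inner_add)
    have inv: "f ` S' \<subseteq> S'"
      using less.prems(2) sym v(3) by (auto simp: S'_def)
    have "v \<notin> S'" using v(2) by (auto simp: S'_def)
    moreover have "S' \<subseteq> S" by (auto simp: S'_def)
    ultimately have "S' \<subset> S" using v(1) by blast
    then have "dim S' < dim S"
      using sub less.prems(1) by (intro dim_psubset) (metis span_eq_iff)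
    from less.hyps[OF this sub inv] obtain B where B: "finite B" "pairwise orthogonal B"
      "\<And>b. b \<in> B \<Longrightarrow> norm b = 1 \<and> (\<exists>l. f b = l *\<^sub>R b)" "span B = S'" by blast
    have BS: "B \<subseteq> S'" using B(4) span_superset by blast
    have "span (insert v B) = S"
    proof (rule antisym)
      show "span (insert v B) \<subseteq> S"
        using BS v(1) less.prems(1) by (intro span_minimal) (auto simp: S'_def)
      show "S \<subseteq> span (insert v B)"
      proof
        fix x assume x: "x \<in> S"
        have "x - (x \<bullet> v) *\<^sub>R v \<in> S'"
          using x v less.prems(1)
          by (auto simp: S'_def subspace_diff subspace_scale inner_diff power2_norm_eq_inner[symmetric])
        then have "x - (x \<bullet> v) *\<^sub>R v \<in> span B" using B(4) by simp
        then show "x \<in> span (insert v B)"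
          by (auto simp: span_insert intro!: exI[of _ "x \<bullet> v"])
      qed
    qed
    moreover have "pairwise orthogonal (insert v B)"
      using B(2) BS by (auto simp: pairwise_insert orthogonal_def S'_def inner_commute)
    ultimately show ?thesis
      using B v by (intro exI[of _ "insert v B"]) auto
  qed
qed

lemma symmetric_matrix_inner:
  fixes M :: "real^'n::finite^'n"
  assumes "transpose M = M"
  shows "(M *v x) \<bullet> y = x \<bullet> (M *v y)"
  by (metis assms dot_lmul_matrix transpose_matrix_vector)

text \<open>The root is diagonal in an orthonormal eigenbasis, with the square roots of the
  eigenvalues; these are nonnegative, as the form shows on the eigenvectors.\<close>

lemma exists_psd_matrix_sqrt:
  fixes M :: "real^'n::finite^'n"
  assumes sym: "transpose M = M" and psd: "\<And>z. 0 \<le> z \<bullet> (M *v z)"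
  shows "\<exists>R. transpose R = R \<and> (\<forall>z. 0 \<le> z \<bullet> (R *v z)) \<and> R ** R = M"
proof -
  obtain B where B: "finite B" "pairwise orthogonal B"
      "\<And>b. b \<in> B \<Longrightarrow> norm b = 1 \<and> (\<exists>l. M *v b = l *\<^sub>R b)" "span B = (UNIV :: (real^'n) set)"
    using selfadjoint_orthonormal_eigenbasis[OF matrix_vector_mul_linear[of M] symmetric_matrix_inner[OF sym], of UNIV]
    by auto
  then obtain l where l: "\<And>b. b \<in> B \<Longrightarrow> M *v b = l b *\<^sub>R b" by metis
  have orth: "b \<bullet> c = (if b = c then 1 else 0)" if "b \<in> B" "c \<in> B" for b c
    using that B(2,3) by (auto simp: pairwise_def orthogonal_def norm_eq_1)
  have l_nonneg: "0 \<le> l b" if "b \<in> B" for b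
    using psd[of b] l[OF that] orth[OF that that] by simp
  have expand: "(\<Sum>b\<in>B. (x \<bullet> b) *\<^sub>R b) = x" for x
    using B by (intro orthonormal_basis_expand) auto
  define g where "g x = (\<Sum>b\<in>B. (sqrt (l b) * (x \<bullet> b)) *\<^sub>R b)" for x
  have g: "linear g"
    unfolding g_def by (intro linear_compose_sum ballI)
      (auto simp: linear_iff inner_add algebra_simps)
  have gb: "g b = sqrt (l b) *\<^sub>R b" if "b \<in> B" for b
    using that B(1) by (simp add: g_def orth if_distrib[where f = "\<lambda>x. (_ * x) *\<^sub>R _"] cong: if_cong)
  have gg: "g (g x) = M *v x" for x
  proof -
    have "g (g x) = (\<Sum>b\<in>B. (sqrt (l b) * (x \<bullet> b)) *\<^sub>R g b)"
      using g by (subst (2) g_def) (simp add: linear_sum linear_scale)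
    also have "\<dots> = (\<Sum>b\<in>B. (x \<bullet> b) *\<^sub>R (M *v b))"
      using l_nonneg by (intro sum.cong) (auto simp: gb l mult_ac)
    also have "\<dots> = M *v (\<Sum>b\<in>B. (x \<bullet> b) *\<^sub>R b)"
      by (simp add: linear_sum[OF matrix_vector_mul_linear] linear_scale[OF matrix_vector_mul_linear])
    finally show ?thesis by (simp add: expand)
  qed
  have gsym: "g x \<bullet> y = x \<bullet> g y" for x y
    by (simp add: g_def inner_sum_left inner_sum_right inner_commute mult_ac)
  have R: "matrix g *v x = g x" for x by (simp add: g)
  show ?thesis
  proof (intro exI[of _ "matrix g"] conjI allI)
    have "(transpose (matrix g) *v x) \<bullet> y = (matrix g *v x) \<bullet> y" for x y
      by (simp add: transpose_matrix_vector dot_lmul_matrix R gsym)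
    then have "transpose (matrix g) *v x = matrix g *v x" for x
      using vector_eq_rdot by blast
    then show "transpose (matrix g) = matrix g" by (simp add: matrix_eq)
    show "0 \<le> z \<bullet> (matrix g *v z)" for z
      unfolding R g_def inner_sum_right using l_nonneg
      by (intro sum_nonneg) (simp add: mult.assoc)
    show "matrix g ** matrix g = M"
      by (simp add: matrix_eq matrix_vector_mul_assoc[symmetric] R gg)
  qed
qed

lemma matrix_sqrt:
  fixes M :: "real^'n::finite^'n"
  assumes "transpose M = M" "\<And>z. 0 \<le> z \<bullet> (M *v z)"
  shows "transpose (matrix_sqrt M) = matrix_sqrt M" "matrix_sqrt M ** matrix_sqrt M = M"
  using someI_ex[OF exists_psd_matrix_sqrt[OF assms]] by (auto simp: matrix_sqrt_def)

section \<open>Lebesgue measure under invertible matrices\<close>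

lemma bij_betw_axis_Basis: "bij_betw (\<lambda>i. axis i 1) (UNIV :: 'n set) (Basis :: (real^'n::finite) set)"
  by (auto simp: bij_betw_def Basis_vec_def inj_on_def axis_eq_axis)

lemma axis_one_in_Basis: "axis i 1 \<in> (Basis :: (real^'n::finite) set)"
  by (auto simp: Basis_vec_def)

lemmas prod_Basis_vec = prod.reindex_bij_betw[OF bij_betw_axis_Basis, symmetric]
lemmas sum_Basis_vec = sum.reindex_bij_betw[OF bij_betw_axis_Basis, symmetric]

lemma borel_measurable_matrix_vector_mult [measurable]:
  "(\<lambda>x. (A :: real^'n::finite^'m::finite) *v x) \<in> borel_measurable borel"
  by (intro borel_measurable_continuous_onI linear_continuous_on) (rule matrix_vector_mul_bounded_linear)

lemma nn_integral_lborel_diagonal: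
  fixes A :: "real^'n::finite^'n"
  assumes diag: "\<And>i j. i \<noteq> j \<Longrightarrow> A $ i $ j = 0" and det: "det A \<noteq> 0"
    and [measurable]: "f \<in> borel_measurable borel"
  shows "(\<integral>\<^sup>+x. f x \<partial>lborel) = ennreal \<bar>det A\<bar> * (\<integral>\<^sup>+x. f (A *v x) \<partial>lborel)"
proof -
  define c where "c b = (A *v b) \<bullet> b" for b
  have c_axis: "c (axis i 1) = A $ i $ i" for i
    by (simp add: c_def inner_axis matrix_vector_mult_basis column_def)
  have prod: "(\<Prod>i\<in>UNIV. A $ i $ i) = det A" by (simp add: det_diagonal diag)
  then have nz: "A $ i $ i \<noteq> 0" for i
    using det by (metis finite_class.finite_UNIV UNIV_I prod_zero_iff)
  have T: "A *v x = 0 + (\<Sum>j\<in>Basis. (c j * (x \<bullet> j)) *\<^sub>R j)" for x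
  proof -
    have comp: "(A *v x) $ k = (\<Sum>i\<in>UNIV. (A $ i $ i * x $ i) * (axis i 1 $ k))" for k
    proof -
      have 1: "(A *v x) $ k = (\<Sum>j\<in>UNIV. if j = k then A $ k $ k * x $ k else 0)"
      proof -
        have "(\<Sum>j\<in>UNIV. A $ k $ j * x $ j) = (\<Sum>j\<in>UNIV. if j = k then A $ k $ k * x $ k else 0)"
        proof (rule sum.cong)
          fix j show "A $ k $ j * x $ j = (if j = k then A $ k $ k * x $ k else 0)"
            using diag[of k j] by (cases "j = k") auto
        qed simp
        then show ?thesis by (simp add: matrix_vector_mult_def)
      qed
      have 2: "(\<Sum>j\<in>UNIV. if j = k then A $ k $ k * x $ k else 0) = (\<Sum>i\<in>UNIV. (A $ i $ i * x $ i) * (axis i 1 $ k))"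
        by (simp add: axis_def if_distrib[where f = "\<lambda>u. _ * u"] cong: if_cong)
      show ?thesis by (simp only: 1 2)
    qed
    have "(0 + (\<Sum>j\<in>Basis. (c j * (x \<bullet> j)) *\<^sub>R j)) $ k = (\<Sum>i\<in>UNIV. (A $ i $ i * x $ i) * (axis i 1 $ k))" for k
      by (simp add: sum_Basis_vec c_axis inner_axis)
    then show ?thesis unfolding vec_eq_iff comp by simp
  qed
  have "(\<integral>\<^sup>+x. f x \<partial>lborel) =
      (\<integral>\<^sup>+x. f x \<partial>density (distr lborel borel (\<lambda>x. 0 + (\<Sum>j\<in>Basis. (c j * (x \<bullet> j)) *\<^sub>R j))) (\<lambda>_. (\<Prod>j\<in>Basis. \<bar>c j\<bar>)))"
    by (subst lborel_affine_euclidean[of c 0]) (auto simp: Basis_vec_def c_axis nz)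
  also have "\<dots> = (\<Prod>j\<in>Basis. \<bar>c j\<bar>) * (\<integral>\<^sup>+x. f (A *v x) \<partial>lborel)"
    by (simp add: nn_integral_density nn_integral_distr nn_integral_cmult T[symmetric])
      (simp add: T nn_integral_cmult)
  also have "(\<Prod>j\<in>Basis. \<bar>c j\<bar>) = \<bar>det A\<bar>"
    by (simp add: prod_Basis_vec c_axis abs_prod prod[symmetric])
  finally show ?thesis .
qed

text \<open>A swap of coordinates permutes the side lengths of a box and preserves their product,
  and Lebesgue measure is determined by its values on boxes.\<close>

lemma nn_integral_lborel_transpose_coordinates:
  fixes f :: "real^'n::finite \<Rightarrow> ennreal" and m n :: 'n
  assumes [measurable]: "f \<in> borel_measurable borel"
  shows "(\<integral>\<^sup>+x. f (\<chi> i. x $ Transposition.transpose m n i) \<partial>lborel) = (\<integral>\<^sup>+x. f x \<partial>lborel)"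
proof -
  let ?t = "Transposition.transpose m n" and ?g = "\<lambda>x :: real^'n. \<chi> i. x $ Transposition.transpose m n i"
  have [measurable]: "?g \<in> borel_measurable borel"
    by (intro borel_measurable_continuous_onI continuous_on_vec_lambda continuous_intros)
  have "lborel = distr lborel borel ?g"
  proof (rule lborel_eqI)
    fix l u :: "real^'n" assume le: "\<And>b. b \<in> Basis \<Longrightarrow> l \<bullet> b \<le> u \<bullet> b"
    have le': "l $ i \<le> u $ i" for i using le[OF axis_one_in_Basis, of i] by (simp add: inner_axis)
    have "?g -` box l u = box (?g l) (?g u)"
    proof -
      have "(\<forall>i. l $ i < x $ ?t i \<and> x $ ?t i < u $ i) \<longleftrightarrow> (\<forall>i. l $ ?t i < x $ i \<and> x $ i < u $ ?t i)" for x :: "real^'n"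
        by (metis transpose_involutory)
      then show ?thesis by (auto simp: mem_box_cart)
    qed
    then have "emeasure (distr lborel borel ?g) (box l u) = emeasure lborel (box (?g l) (?g u))"
      by (simp add: emeasure_distr)
    also have "\<dots> = (\<Prod>b\<in>Basis. (?g u - ?g l) \<bullet> b)"
      using le' by (intro emeasure_lborel_box) (auto simp: Basis_vec_def inner_axis)
    also have "(\<Prod>b\<in>Basis. (?g u - ?g l) \<bullet> b) = (\<Prod>i\<in>UNIV. (u - l) $ ?t i)"
      by (simp add: prod_Basis_vec inner_axis)
    also have "\<dots> = (\<Prod>i\<in>UNIV. (u - l) $ i)"
      by (rule prod.reindex_bij_betw) simp
    also have "\<dots> = (\<Prod>b\<in>Basis. (u - l) \<bullet> b)"
      by (simp add: prod_Basis_vec inner_axis)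
    finally show "emeasure (distr lborel borel ?g) (box l u) = (\<Prod>b\<in>Basis. (u - l) \<bullet> b)" .
  qed simp
  then have "(\<integral>\<^sup>+x. f x \<partial>lborel) = (\<integral>\<^sup>+x. f x \<partial>distr lborel borel ?g)" by simp
  also have "\<dots> = (\<integral>\<^sup>+x. f (?g x) \<partial>lborel)" by (rule nn_integral_distr) auto
  finally show ?thesis by simp
qed

text \<open>For fixed values of the other coordinates a shear translates coordinate
  \<open>m\<close>, by an amount that does not involve it because \<open>m\<close> and
  \<open>n\<close> differ. Integrating over coordinate \<open>m\<close> first leaves translation
  invariance on the line.\<close>

lemma nn_integral_lborel_shear:
  fixes f :: "real^'n::finite \<Rightarrow> ennreal" and m n :: 'n
  assumes [measurable]: "f \<in> borel_measurable borel" and mn: "m \<noteq> n"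
  shows "(\<integral>\<^sup>+x. f (x + (c * x $ n) *\<^sub>R axis m 1) \<partial>lborel) = (\<integral>\<^sup>+x. f x \<partial>lborel)"
proof -
  interpret product_sigma_finite "\<lambda>_::real^'n. lborel :: real measure" ..
  let ?B = "Basis :: (real^'n) set" and ?m = "axis m 1 :: real^'n" and ?n = "axis n 1 :: real^'n"
  define I where "I = ?B - {?m}"
  have I: "finite I" "?m \<notin> I" "insert ?m I = ?B" by (auto simp: I_def Basis_vec_def)
  have nI: "?n \<in> I" using mn by (auto simp: I_def Basis_vec_def axis_eq_axis)
  let ?s = "\<lambda>x. \<Sum>b\<in>?B. x b *\<^sub>R b"
  have s_upd: "?s (x(?m := y)) = (\<Sum>b\<in>I. x b *\<^sub>R b) + y *\<^sub>R ?m" for x :: "real^'n \<Rightarrow> real" and y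
  proof -
    have "?s (x(?m := y)) = (\<Sum>b\<in>insert ?m I. (x(?m := y)) b *\<^sub>R b)" by (simp only: I(3))
    also have "\<dots> = y *\<^sub>R ?m + (\<Sum>b\<in>I. (x(?m := y)) b *\<^sub>R b)" using I(1,2) by simp
    also have "(\<Sum>b\<in>I. (x(?m := y)) b *\<^sub>R b) = (\<Sum>b\<in>I. x b *\<^sub>R b)"
      using I(2) by (intro sum.cong) auto
    finally show ?thesis by simp
  qed
  have s_n: "(?s x) $ n = x ?n" for x
  proof -
    have "(?s x) $ n = (?s x) \<bullet> ?n" by (simp add: inner_axis)
    also have "\<dots> = x ?n" using nI by (subst inner_sum_left_Basis) (auto simp: I_def)
    finally show ?thesis .
  qed
  have F: "(\<integral>\<^sup>+x. h x \<partial>lborel) = (\<integral>\<^sup>+x. (\<integral>\<^sup>+y. h (?s (x(?m := y))) \<partial>lborel) \<partial>Pi\<^sub>M I (\<lambda>_. lborel))"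
    if [measurable]: "h \<in> borel_measurable borel" for h :: "real^'n \<Rightarrow> ennreal"
  proof -
    have [measurable]: "(\<lambda>x. h (?s x)) \<in> borel_measurable (Pi\<^sub>M ?B (\<lambda>_. lborel))" by measurable
    have "(\<integral>\<^sup>+x. h x \<partial>lborel) = (\<integral>\<^sup>+x. h (?s x) \<partial>Pi\<^sub>M ?B (\<lambda>_. lborel))"
      by (subst lborel_eq) (simp add: nn_integral_distr)
    also have "\<dots> = (\<integral>\<^sup>+x. (\<integral>\<^sup>+y. h (?s (x(?m := y))) \<partial>lborel) \<partial>Pi\<^sub>M I (\<lambda>_. lborel))"
      by (subst I(3)[symmetric], subst product_nn_integral_insert) (use I in \<open>auto simp: I(3)\<close>)
    finally show ?thesis .
  qed
  have upd: "(x(?m := y)) ?n = x ?n" for x :: "real^'n \<Rightarrow> real" and y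
    using mn by (simp add: axis_eq_axis)
  have "(\<integral>\<^sup>+x. f (x + (c * x $ n) *\<^sub>R ?m) \<partial>lborel) =
      (\<integral>\<^sup>+x. (\<integral>\<^sup>+y. f (?s (x(?m := y)) + (c * (?s (x(?m := y))) $ n) *\<^sub>R ?m) \<partial>lborel) \<partial>Pi\<^sub>M I (\<lambda>_. lborel))"
    by (rule F) measurable
  also have "\<dots> = (\<integral>\<^sup>+x. (\<integral>\<^sup>+y. f (?s (x(?m := y)) + (c * x ?n) *\<^sub>R ?m) \<partial>lborel) \<partial>Pi\<^sub>M I (\<lambda>_. lborel))"
    by (simp only: s_n upd)
  also have "\<dots> = (\<integral>\<^sup>+x. (\<integral>\<^sup>+y. f (?s (x(?m := y))) \<partial>lborel) \<partial>Pi\<^sub>M I (\<lambda>_. lborel))"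
  proof (rule nn_integral_cong)
    fix x :: "real^'n \<Rightarrow> real"
    let ?k = "\<lambda>y. f ((\<Sum>b\<in>I. x b *\<^sub>R b) + y *\<^sub>R ?m)"
    have "(\<integral>\<^sup>+y. ?k y \<partial>lborel) = ennreal \<bar>1\<bar> * (\<integral>\<^sup>+y. ?k (c * x ?n + 1 * y) \<partial>lborel)"
      by (rule nn_integral_real_affine) auto
    then show "(\<integral>\<^sup>+y. f (?s (x(?m := y)) + (c * x ?n) *\<^sub>R ?m) \<partial>lborel) = (\<integral>\<^sup>+y. f (?s (x(?m := y))) \<partial>lborel)"
      unfolding s_upd by (simp add: algebra_simps)
  qed
  also have "\<dots> = (\<integral>\<^sup>+x. f x \<partial>lborel)" by (subst F) auto
  finally show ?thesis .
qed

text \<open>Every matrix is a product of elementary ones, and the formula is multiplicative. A zero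
  row is excluded by the determinant; there remain diagonal matrices, swaps and shears.\<close>

lemma nn_integral_lborel_matrix:
  fixes A :: "real^'n::finite^'n"
  assumes "det A \<noteq> 0" "f \<in> borel_measurable borel"
  shows "(\<integral>\<^sup>+x. f x \<partial>lborel) = ennreal \<bar>det A\<bar> * (\<integral>\<^sup>+x. f (A *v x) \<partial>lborel)"
proof -
  have "\<forall>f\<in>borel_measurable borel. det A \<noteq> 0 \<longrightarrow>
      (\<integral>\<^sup>+x. f x \<partial>lborel) = ennreal \<bar>det A\<bar> * (\<integral>\<^sup>+x. f (A *v x) \<partial>lborel)"
  proof (induction A rule: induct_matrix_elementary)
    case (1 A B)
    show ?case
    proof (intro ballI impI)
      fix f :: "real^'n \<Rightarrow> ennreal" assume [measurable]: "f \<in> borel_measurable borel" and det: "det (A ** B) \<noteq> 0"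
      then have dets: "det A \<noteq> 0" "det B \<noteq> 0" by (auto simp: det_mul)
      have "(\<integral>\<^sup>+x. f x \<partial>lborel) = ennreal \<bar>det A\<bar> * (\<integral>\<^sup>+x. f (A *v x) \<partial>lborel)"
        by (rule 1(1)[rule_format]) (use dets in auto)
      also have "(\<integral>\<^sup>+x. f (A *v x) \<partial>lborel) = ennreal \<bar>det B\<bar> * (\<integral>\<^sup>+x. f (A *v (B *v x)) \<partial>lborel)"
        by (rule 1(2)[rule_format, of "\<lambda>x. f (A *v x)"]) (use dets in auto)
      finally show "(\<integral>\<^sup>+x. f x \<partial>lborel) = ennreal \<bar>det (A ** B)\<bar> * (\<integral>\<^sup>+x. f ((A ** B) *v x) \<partial>lborel)"
        by (simp add: matrix_vector_mul_assoc det_mul abs_mult ennreal_mult mult.assoc)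
    qed
  next
    case (2 A i)
    then have "det A = 0" by (rule det_zero_row)
    then show ?case by simp
  next
    case (3 A)
    then show ?case using nn_integral_lborel_diagonal by blast
  next
    case (4 m n)
    let ?A = "(\<chi> i j. mat 1 $ i $ Transposition.transpose m n j) :: real^'n^'n"
    have "?A *v x = (\<chi> i. x $ Transposition.transpose m n i)" for x
    proof -
      have "(\<Sum>j\<in>UNIV. (if i = Transposition.transpose m n j then 1 else 0) * x $ j) = x $ Transposition.transpose m n i" for i
      proof -
        have "(i = Transposition.transpose m n j) = (j = Transposition.transpose m n i)" for j
          by (metis transpose_involutory)
        then show ?thesis by (simp add: if_distrib[where f = "\<lambda>u. u * _"] cong: if_cong)
      qed
      then show ?thesis by (simp add: matrix_vector_mult_def mat_def vec_eq_iff)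
    qed
    moreover have "\<bar>det ?A\<bar> = 1"
      using det_permute_columns[of "Transposition.transpose m n" "mat 1 :: real^'n^'n"] 4
      by (simp add: permutes_swap_id sign_swap_id)
    ultimately show ?case by (simp add: nn_integral_lborel_transpose_coordinates)
  next
    case (5 m n c)
    let ?A = "(\<chi> i j. if i = m \<and> j = n then c else of_bool (i = j)) :: real^'n^'n"
    have "?A *v x = x + (c * x $ n) *\<^sub>R axis m 1" for x
    proof -
      have "(\<Sum>j\<in>UNIV. (if i = m \<and> j = n then c else of_bool (i = j)) * x $ j) = x $ i + (if i = m then c * x $ n else 0)" for i
      proof -
        have "(\<Sum>j\<in>UNIV. (if i = m \<and> j = n then c else of_bool (i = j)) * x $ j)
          = (\<Sum>j\<in>UNIV. (if j = i then x $ i else 0) + (if j = n then (if i = m then c * x $ n else 0) else 0))"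
          using 5 by (intro sum.cong) auto
        then show ?thesis by (simp add: sum.distrib)
      qed
      then show ?thesis by (simp add: matrix_vector_mult_def vec_eq_iff axis_def)
    qed
    moreover have "det ?A = 1"
    proof -
      have "?A = (\<chi> k. if k = m then row m (mat 1) + c *s row n (mat 1) else row k (mat 1))"
        using 5 by (auto simp: vec_eq_iff row_def mat_def)
      then show ?thesis using det_row_operation[OF 5, of "mat 1" c] by simp
    qed
    ultimately show ?case using 5 by (simp add: nn_integral_lborel_shear)
  qed
  with assms show ?thesis by blast
qed

lemma lborel_matrix_affine:
  fixes A :: "real^'n::finite^'n"
  assumes det: "det A \<noteq> 0"
  shows "lborel = density (distr lborel borel (\<lambda>x. c + A *v x)) (\<lambda>_. ennreal \<bar>det A\<bar>)"
proof (rule measure_eqI)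
  fix X :: "(real^'n) set" assume "X \<in> sets lborel"
  then have [measurable]: "X \<in> sets borel" by simp
  have "emeasure lborel X = emeasure (distr lborel borel ((+) c)) X"
    by (simp add: lborel_distr_plus)
  also have "\<dots> = (\<integral>\<^sup>+x. indicator X (c + x) \<partial>lborel)"
    by (simp add: nn_integral_indicator[symmetric] nn_integral_distr del: nn_integral_indicator)
  also have "\<dots> = ennreal \<bar>det A\<bar> * (\<integral>\<^sup>+x. indicator X (c + A *v x) \<partial>lborel)"
    by (rule nn_integral_lborel_matrix[OF det]) measurable
  also have "\<dots> = emeasure (density (distr lborel borel (\<lambda>x. c + A *v x)) (\<lambda>_. ennreal \<bar>det A\<bar>)) X"
    by (simp add: emeasure_density nn_integral_cmult nn_integral_distr mult.commute)
  finally show "emeasure lborel X = emeasure (density (distr lborel borel (\<lambda>x. c + A *v x)) (\<lambda>_. ennreal \<bar>det A\<bar>)) X" .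
qed simp

lemma
  fixes A :: "real^'n::finite^'n" and f :: "real^'n \<Rightarrow> real"
  assumes det: "det A \<noteq> 0" and [measurable]: "f \<in> borel_measurable borel"
  shows integrable_lborel_matrix_affine: "integrable lborel f \<longleftrightarrow> integrable lborel (\<lambda>x. f (c + A *v x))"
    and integral_lborel_matrix_affine: "(LINT x|lborel. f x) = \<bar>det A\<bar> * (LINT x|lborel. f (c + A *v x))"
proof -
  show "integrable lborel f \<longleftrightarrow> integrable lborel (\<lambda>x. f (c + A *v x))"
    by (subst lborel_matrix_affine[OF det, of c]) (use det in \<open>simp add: integrable_density integrable_distr_eq\<close>)
  show "(LINT x|lborel. f x) = \<bar>det A\<bar> * (LINT x|lborel. f (c + A *v x))"
    by (subst lborel_matrix_affine[OF det, of c]) (simp add: integral_density integral_distr)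
qed

section \<open>Moments of the standard Gaussian\<close>

text \<open>The product form makes moments factor into one-dimensional ones; \<open>gauss_eq\<close>
  gives the radial form that matches the kernel.\<close>

definition gauss :: "'a::euclidean_space \<Rightarrow> real" where
  "gauss v = (\<Prod>b\<in>Basis. std_normal_density (v \<bullet> b))"

lemma norm_sq_eq_sum_Basis: "(norm (v :: 'a::euclidean_space))\<^sup>2 = (\<Sum>b\<in>Basis. (v \<bullet> b)\<^sup>2)"
  unfolding power2_norm_eq_inner by (subst euclidean_inner) (simp add: power2_eq_square)

lemma gauss_eq: "gauss (v :: 'a::euclidean_space) = exp (- (norm v)\<^sup>2 / 2) / sqrt ((2 * pi) ^ DIM('a))"
proof -
  have g: "gauss v = (1 / sqrt (2 * pi)) ^ DIM('a) * exp (\<Sum>b\<in>Basis. - (v \<bullet> b)\<^sup>2 / 2)"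
    unfolding gauss_def std_normal_density_def prod.distrib by (simp add: exp_sum)
  have "(\<Sum>b\<in>Basis. - (v \<bullet> b)\<^sup>2 / 2) = (\<Sum>b\<in>Basis. (-1/2) * (v \<bullet> b)\<^sup>2)"
    by (rule sum.cong) auto
  then have "(\<Sum>b\<in>Basis. - (v \<bullet> b)\<^sup>2 / 2) = (-1/2) * (\<Sum>b\<in>Basis. (v \<bullet> b)\<^sup>2)"
    by (simp only: sum_distrib_left)
  then have e: "(\<Sum>b\<in>Basis. - (v \<bullet> b)\<^sup>2 / 2) = (-1/2) * (norm v)\<^sup>2"
    by (simp only: norm_sq_eq_sum_Basis[of v])
  have half: "(-1/2) * x = - x / 2" for x :: real by simp
  show ?thesis
    unfolding g e half by (simp only: power_one_over real_sqrt_power times_divide_eq_left mult_1)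
qed

lemma gauss_pos: "0 < gauss v" by (auto simp: gauss_def intro!: prod_pos normal_density_pos)
lemma gauss_nonneg [simp]: "0 \<le> gauss v" using gauss_pos[of v] by simp

lemma borel_measurable_gauss [measurable]: "gauss \<in> borel_measurable borel"
  unfolding gauss_def[abs_def] by measurable

lemma has_bochner_integral_lborel_prod:
  fixes f :: "'a::euclidean_space \<Rightarrow> real \<Rightarrow> real"
  assumes f: "\<And>b. b \<in> Basis \<Longrightarrow> integrable lborel (f b)"
  shows "has_bochner_integral lborel (\<lambda>v. \<Prod>b\<in>Basis. f b (v \<bullet> b)) (\<Prod>b\<in>Basis. LINT x|lborel. f b x)"
proof -
  interpret product_sigma_finite "\<lambda>_::'a. lborel :: real measure" ..
  have [measurable]: "b \<in> Basis \<Longrightarrow> f b \<in> borel_measurable borel" for b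
    using f[of b] borel_measurable_integrable by fastforce
  have [measurable]: "(\<lambda>x. \<Sum>b\<in>Basis. x b *\<^sub>R b :: 'a) \<in> Pi\<^sub>M Basis (\<lambda>_. lborel) \<rightarrow>\<^sub>M borel"
    by measurable
  have [measurable]: "(\<lambda>v. \<Prod>b\<in>Basis. f b (v \<bullet> b)) \<in> borel_measurable borel"
    by measurable
  have eq: "(\<Prod>b\<in>Basis. f b ((\<Sum>c\<in>Basis. x c *\<^sub>R c) \<bullet> b)) = (\<Prod>b\<in>Basis. f b (x b))" for x :: "'a \<Rightarrow> real"
    by (intro prod.cong) auto
  have "has_bochner_integral (Pi\<^sub>M Basis (\<lambda>_. lborel)) (\<lambda>x. \<Prod>b\<in>Basis. f b (x b)) (\<Prod>b\<in>Basis. LINT x|lborel. f b x)"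
    using product_integrable_prod[OF finite_Basis f] product_integral_prod[OF finite_Basis f]
    by (simp add: has_bochner_integral_iff)
  then show ?thesis
    by (subst lborel_eq) (simp add: has_bochner_integral_iff integrable_distr_eq integral_distr eq)
qed

lemma has_bochner_integral_gauss_monomial:
  "has_bochner_integral lborel (\<lambda>v::'a::euclidean_space. gauss v * (\<Prod>b\<in>Basis. (v \<bullet> b) ^ k b))
     (\<Prod>b\<in>Basis. LINT x|lborel. std_normal_density x * x ^ k b)"
  using has_bochner_integral_lborel_prod[of "\<lambda>b x. std_normal_density x * x ^ k b"]
  by (simp add: integrable_std_normal_moment prod.distrib gauss_def)

lemma prod_Basis_power_delta:
  fixes v :: "'a::euclidean_space"
  assumes "c \<in> Basis"
  shows "(\<Prod>b\<in>Basis. (v \<bullet> b) ^ (if b = c then n else 0)) = (v \<bullet> c) ^ n"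
proof -
  have "(\<Prod>b\<in>Basis. (v \<bullet> b) ^ (if b = c then n else 0)) = (\<Prod>b\<in>Basis. if b = c then (v \<bullet> c) ^ n else 1)"
    by (intro prod.cong) auto
  then show ?thesis using assms by simp
qed

lemma std_normal_moments:
  "(LINT x|lborel. std_normal_density x * x ^ 0) = 1"
  "(LINT x|lborel. std_normal_density x * x ^ 1) = 0"
  "(LINT x|lborel. std_normal_density x * x ^ 2) = 1"
  using integral_std_normal_moment_even[of 0] integral_std_normal_moment_odd[of 0] integral_std_normal_moment_even[of 1]
  by simp_all

lemma has_bochner_integral_gauss: "has_bochner_integral lborel gauss (1 :: real)"
  using has_bochner_integral_gauss_monomial[of "\<lambda>_. 0"] std_normal_moments(1) by simp

lemma has_bochner_integral_gauss_coordinate: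
  assumes "b \<in> Basis"
  shows "has_bochner_integral lborel (\<lambda>v::'a::euclidean_space. gauss v * (v \<bullet> b)) 0"
proof -
  have "(\<Prod>e\<in>Basis. LINT x|lborel. std_normal_density x * x ^ (if e = b then 1 else 0)) = 0"
    using assms std_normal_moments(2) by (intro prod_zero) (auto intro!: bexI[of _ b])
  then show ?thesis
    using has_bochner_integral_gauss_monomial[of "\<lambda>e. if e = b then 1 else 0"]
    by (simp only: prod_Basis_power_delta[OF assms] power_one_right)
qed

lemma has_bochner_integral_gauss_coordinates:
  assumes b: "b \<in> Basis" "c \<in> Basis"
  shows "has_bochner_integral lborel (\<lambda>v::'a::euclidean_space. gauss v * ((v \<bullet> b) * (v \<bullet> c))) (if b = c then 1 else 0)"
proof -
  let ?k = "\<lambda>e. (if e = b then 1 else 0) + (if e = c then 1 else 0) :: nat"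
  have "(\<Prod>e\<in>Basis. LINT x|lborel. std_normal_density x * x ^ ?k e) = (if b = c then 1 else 0)"
  proof (cases "b = c")
    case True
    have "(LINT x|lborel. std_normal_density x * x ^ ?k e) = 1" for e
    proof (cases "e = b")
      case True
      then have "?k e = 2" using \<open>b = c\<close> by simp
      then show ?thesis using std_normal_moments(3) by (simp only:)
    next
      case False
      then have "?k e = 0" using \<open>b = c\<close> by simp
      then show ?thesis using std_normal_moments(1) by (simp only:)
    qed
    then show ?thesis using True by simp
  next
    case False
    then have "?k b = 1" by simp
    then have "(LINT x|lborel. std_normal_density x * x ^ ?k b) = 0" using std_normal_moments(2) by (simp only:)
    then show ?thesis using False b by (auto intro!: prod_zero bexI[of _ b])
  qed
  moreover have "(\<Prod>e\<in>Basis. (v \<bullet> e) ^ ?k e) = (v \<bullet> b) * (v \<bullet> c)" for v :: 'a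
    by (simp only: power_add prod.distrib prod_Basis_power_delta[OF b(1)] prod_Basis_power_delta[OF b(2)] power_one_right)
  ultimately show ?thesis
    using has_bochner_integral_gauss_monomial[of ?k] by simp
qed

lemma has_bochner_integral_gauss_linear:
  "has_bochner_integral lborel (\<lambda>v::'a::euclidean_space. gauss v * (p \<bullet> v)) 0"
proof -
  have "has_bochner_integral lborel (\<lambda>v. \<Sum>b\<in>Basis. (p \<bullet> b) * (gauss v * (v \<bullet> b))) (\<Sum>b\<in>(Basis::'a set). (p \<bullet> b) * 0)"
    by (intro has_bochner_integral_sum has_bochner_integral_mult_right has_bochner_integral_gauss_coordinate)
  moreover have "(\<Sum>b\<in>Basis. (p \<bullet> b) * (gauss v * (v \<bullet> b))) = gauss v * (p \<bullet> v)" for v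
    by (subst euclidean_inner[of p v]) (simp add: sum_distrib_left mult_ac)
  ultimately show ?thesis by simp
qed

lemma has_bochner_integral_gauss_bilinear:
  "has_bochner_integral lborel (\<lambda>v::'a::euclidean_space. gauss v * ((p \<bullet> v) * (q \<bullet> v))) (p \<bullet> q)"
proof -
  have "has_bochner_integral lborel (\<lambda>v. \<Sum>b\<in>Basis. \<Sum>c\<in>Basis. ((p \<bullet> b) * (q \<bullet> c)) * (gauss v * ((v \<bullet> b) * (v \<bullet> c))))
      (\<Sum>b\<in>(Basis::'a set). \<Sum>c\<in>Basis. ((p \<bullet> b) * (q \<bullet> c)) * (if b = c then 1 else 0))"
    by (intro has_bochner_integral_sum has_bochner_integral_mult_right has_bochner_integral_gauss_coordinates)
  moreover have "(\<Sum>b\<in>Basis. \<Sum>c\<in>Basis. ((p \<bullet> b) * (q \<bullet> c)) * (gauss v * ((v \<bullet> b) * (v \<bullet> c)))) = gauss v * ((p \<bullet> v) * (q \<bullet> v))" for v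
  proof -
    have "(p \<bullet> v) * (q \<bullet> v) = (\<Sum>b\<in>Basis. \<Sum>c\<in>Basis. ((p \<bullet> b) * (v \<bullet> b)) * ((q \<bullet> c) * (v \<bullet> c)))"
      by (subst euclidean_inner[of p v], subst euclidean_inner[of q v]) (rule sum_product)
    then show ?thesis by (simp add: sum_distrib_left mult_ac)
  qed
  moreover have "(\<Sum>b\<in>(Basis::'a set). \<Sum>c\<in>Basis. ((p \<bullet> b) * (q \<bullet> c)) * (if b = c then 1 else 0)) = p \<bullet> q"
    by (subst euclidean_inner[of p q]) (simp add: if_distrib[where f = "\<lambda>u. _ * u"] cong: if_cong)
  ultimately show ?thesis by simp
qed

lemma integrable_gauss_norm4: "integrable lborel (\<lambda>v::'a::euclidean_space. gauss v * norm v ^ 4)"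
proof -
  have mono: "integrable lborel (\<lambda>v::'a. gauss v * ((v \<bullet> b)\<^sup>2 * (v \<bullet> c)\<^sup>2))" if b: "b \<in> Basis" "c \<in> Basis" for b c
  proof -
    let ?k = "\<lambda>e. (if e = b then 2 else 0) + (if e = c then 2 else 0) :: nat"
    have "(\<Prod>e\<in>Basis. (v \<bullet> e) ^ ?k e) = (v \<bullet> b)\<^sup>2 * (v \<bullet> c)\<^sup>2" for v :: 'a
      by (simp only: power_add prod.distrib prod_Basis_power_delta[OF b(1)] prod_Basis_power_delta[OF b(2)])
    then show ?thesis
      using has_bochner_integral_gauss_monomial[of ?k] by (simp add: has_bochner_integral_iff)
  qed
  have n4: "norm v ^ 4 = (\<Sum>b\<in>Basis. (v \<bullet> b)\<^sup>2) * (\<Sum>b\<in>Basis. (v \<bullet> b)\<^sup>2)" for v :: 'a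
  proof -
    have "norm v ^ 4 = (norm v)\<^sup>2 * (norm v)\<^sup>2" by (simp add: power2_eq_square power4_eq_xxxx mult_ac)
    also have "(norm v)\<^sup>2 = (\<Sum>b\<in>Basis. (v \<bullet> b)\<^sup>2)"
      by (rule norm_sq_eq_sum_Basis)
    finally show ?thesis .
  qed
  have "gauss v * norm v ^ 4 = (\<Sum>b\<in>Basis. \<Sum>c\<in>Basis. gauss v * ((v \<bullet> b)\<^sup>2 * (v \<bullet> c)\<^sup>2))" for v :: 'a
    unfolding n4 unfolding sum_product unfolding sum_distrib_left ..
  then show ?thesis using mono by (simp add: Bochner_Integration.integrable_sum)
qed

lemma integrable_gauss_bounded:
  fixes f :: "'a::euclidean_space \<Rightarrow> real"
  assumes "f \<in> borel_measurable borel" "\<And>v. \<bar>f v\<bar> \<le> K"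
  shows "integrable lborel (\<lambda>v. gauss v * f v)"
proof (rule Bochner_Integration.integrable_bound)
  show "integrable lborel (\<lambda>v::'a. K * gauss v)"
    using has_bochner_integral_gauss by (intro integrable_mult_right) (rule integrable.intros)
  show "AE v in lborel. norm (gauss v * f v) \<le> norm (K * gauss v)"
  proof (rule AE_I2)
    fix v :: 'a
    have "\<bar>gauss v * f v\<bar> \<le> K * gauss v"
      using assms(2)[of v] mult_right_mono[of "\<bar>f v\<bar>" K "gauss v"] by (simp add: abs_mult mult.commute)
    then show "norm (gauss v * f v) \<le> norm (K * gauss v)" unfolding real_norm_def by linarith
  qed
qed (use assms in measurable)

text \<open>The Taylor remainder grows like 1 + |v| to the power 2 + \<alpha>, which the fourth
  power dominates.\<close>

lemma integrable_gauss_shifted_norm4: "integrable lborel (\<lambda>v::'a::euclidean_space. gauss v * (1 + norm v) ^ 4)"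
proof (rule Bochner_Integration.integrable_bound)
  show "integrable lborel (\<lambda>v::'a. 8 * gauss v + 8 * (gauss v * norm v ^ 4))"
    using has_bochner_integral_gauss integrable_gauss_norm4
    by (intro Bochner_Integration.integrable_add integrable_mult_right) (auto intro: integrable.intros)
  have "(1 + norm v) ^ 4 \<le> 8 * (1 + norm v ^ 4)" for v :: 'a
  proof -
    have sq: "(1 + x)\<^sup>2 \<le> 2 * (1 + x\<^sup>2)" for x :: real
      using zero_le_power2[of "1 - x"] by (simp add: power2_eq_square algebra_simps)
    have "(1 + norm v) ^ 4 = ((1 + norm v)\<^sup>2)\<^sup>2" by simp
    also have "\<dots> \<le> (2 * (1 + (norm v)\<^sup>2))\<^sup>2" by (intro power_mono sq) auto
    also have "\<dots> = 4 * (1 + (norm v)\<^sup>2)\<^sup>2" by (simp only: power_mult_distrib) simp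
    also have "\<dots> \<le> 4 * (2 * (1 + ((norm v)\<^sup>2)\<^sup>2))" by (intro mult_left_mono sq) auto
    finally show ?thesis by simp
  qed
  then have le: "gauss v * (1 + norm v) ^ 4 \<le> gauss v * (8 * (1 + norm v ^ 4))" for v :: 'a
    by (intro mult_left_mono) auto
  show "AE v::'a in lborel. norm (gauss v * (1 + norm v) ^ 4) \<le> norm (8 * gauss v + 8 * (gauss v * norm v ^ 4))"
  proof (rule AE_I2)
    fix v :: 'a
    have "0 \<le> gauss v * (1 + norm v) ^ 4" by simp
    then show "norm (gauss v * (1 + norm v) ^ 4) \<le> norm (8 * gauss v + 8 * (gauss v * norm v ^ 4))"
      using le[of v] unfolding real_norm_def by (simp add: distrib_left mult.left_commute)
  qed
qed measurable

section \<open>Taylor expansion with Hoelder remainder\<close>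

lemma C1_fun_partial_derivative:
  assumes "C1_fun \<phi>"
  shows "((\<lambda>h. \<phi> (y + h *\<^sub>R axis i 1)) has_field_derivative partial_deriv i \<phi> (y + t *\<^sub>R axis i 1)) (at t)"
proof -
  let ?z = "y + t *\<^sub>R axis i 1"
  have "((\<lambda>h. \<phi> (?z + h *\<^sub>R axis i 1)) has_field_derivative partial_deriv i \<phi> ?z) (at (0::real))"
    using assms unfolding C1_fun_def partial_deriv_def
    by (metis field_differentiable_derivI)
  then have "((\<lambda>h. \<phi> (?z + (h - t) *\<^sub>R axis i 1)) has_field_derivative partial_deriv i \<phi> ?z) (at t)"
    using DERIV_shift[of "\<lambda>h. \<phi> (?z + (h - t) *\<^sub>R axis i 1)" "partial_deriv i \<phi> ?z" 0 t]
    by simp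
  then show ?thesis by (simp add: algebra_simps)
qed

lemma C1_fun_coordinate_increment:
  assumes \<phi>: "C1_fun \<phi>" and B: "\<And>s. \<bar>s\<bar> \<le> \<bar>t\<bar> \<Longrightarrow> \<bar>partial_deriv i \<phi> (y + s *\<^sub>R axis i 1) - c\<bar> \<le> e"
  shows "\<bar>\<phi> (y + t *\<^sub>R axis i 1) - \<phi> y - t * c\<bar> \<le> e * \<bar>t\<bar>"
proof -
  have "norm ((\<phi> (y + t *\<^sub>R axis i 1) - t * c) - (\<phi> (y + 0 *\<^sub>R axis i 1) - 0 * c)) \<le> e * norm (t - 0)"
  proof (rule field_differentiable_bound[where S = "{- \<bar>t\<bar>..\<bar>t\<bar>}"
        and f' = "\<lambda>s. partial_deriv i \<phi> (y + s *\<^sub>R axis i 1) - c"])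
    show "((\<lambda>s. \<phi> (y + s *\<^sub>R axis i 1) - s * c) has_field_derivative partial_deriv i \<phi> (y + s *\<^sub>R axis i 1) - c)
        (at s within {- \<bar>t\<bar>..\<bar>t\<bar>})" for s
      by (rule has_field_derivative_at_within)
        (auto intro!: derivative_eq_intros C1_fun_partial_derivative[OF \<phi>])
  qed (use B in auto)
  then show ?thesis by simp
qed

text \<open>\<open>C1_fun\<close> speaks of partial derivatives only. Their continuity yields the
  total derivative: the coordinates are changed one after another, with the mean value inequality
  for each change.\<close>

lemma C1_fun_has_derivative:
  assumes \<phi>: "C1_fun (\<phi> :: real^'d::finite \<Rightarrow> real)"
  shows "(\<phi> has_derivative (\<lambda>w. grad \<phi> x \<bullet> w)) (at x)"
proof -
  \<comment> \<open>\<open>r S w\<close> is the part of the increment \<open>w\<close> in which only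
    the coordinates from \<open>S\<close> have been changed so far.\<close>
  define r where "r S w = (\<chi> i. if i \<in> S then w $ i else 0)" for S and w :: "real^'d"
  have r_norm: "norm (r S w + s *\<^sub>R axis i 1) \<le> norm w" if "i \<notin> S" "\<bar>s\<bar> \<le> \<bar>w $ i\<bar>" for S w s i
    using that by (intro norm_le_componentwise_cart) (auto simp: r_def axis_def)
  have key: "\<exists>d>0. \<forall>w. norm w < d \<longrightarrow> \<bar>\<phi> (x + r S w) - \<phi> x - (\<Sum>i\<in>S. w $ i * partial_deriv i \<phi> x)\<bar> \<le> e * norm w"
    if "finite S" "e > 0" for S e
    using that
  proof (induction S arbitrary: e rule: finite_induct)
    case empty
    have "r {} w = 0" for w by (simp add: r_def vec_eq_iff)
    then show ?case using empty by (intro exI[of _ 1]) auto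
  next
    case (insert i S)
    obtain d1 where d1: "d1 > 0" "\<And>w. norm w < d1 \<Longrightarrow>
        \<bar>\<phi> (x + r S w) - \<phi> x - (\<Sum>i\<in>S. w $ i * partial_deriv i \<phi> x)\<bar> \<le> (e/2) * norm w"
      using insert.IH[of "e/2"] insert.prems by auto
    have "continuous_on UNIV (partial_deriv i \<phi>)" using \<phi> by (simp add: C1_fun_def)
    then obtain d2 where d2: "d2 > 0" "\<And>z. dist z x < d2 \<Longrightarrow> dist (partial_deriv i \<phi> z) (partial_deriv i \<phi> x) < e/2"
      unfolding continuous_on_iff using insert.prems by (metis UNIV_I half_gt_zero)
    have "\<bar>\<phi> (x + r (insert i S) w) - \<phi> x - (\<Sum>i\<in>insert i S. w $ i * partial_deriv i \<phi> x)\<bar> \<le> e * norm w"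
      if w: "norm w < min d1 d2" for w
    proof -
      have ri: "r (insert i S) w = r S w + (w $ i) *\<^sub>R axis i 1"
        using insert.hyps by (auto simp: r_def vec_eq_iff axis_def)
      have 1: "\<bar>\<phi> ((x + r S w) + (w $ i) *\<^sub>R axis i 1) - \<phi> (x + r S w) - w $ i * partial_deriv i \<phi> x\<bar> \<le> (e/2) * \<bar>w $ i\<bar>"
      proof (rule C1_fun_coordinate_increment[OF \<phi>])
        fix s assume s: "\<bar>s\<bar> \<le> \<bar>w $ i\<bar>"
        have "dist (x + r S w + s *\<^sub>R axis i 1) x \<le> norm w"
          using r_norm[OF insert.hyps(2) s] by (simp add: dist_norm add.assoc)
        then show "\<bar>partial_deriv i \<phi> (x + r S w + s *\<^sub>R axis i 1) - partial_deriv i \<phi> x\<bar> \<le> e/2"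
          using d2(2)[of "x + r S w + s *\<^sub>R axis i 1"] w by (simp add: dist_real_def)
      qed
      also have "(e/2) * \<bar>w $ i\<bar> \<le> (e/2) * norm w"
        using insert.prems by (intro mult_left_mono component_le_norm_cart) auto
      finally have 1: "\<bar>\<phi> (x + r (insert i S) w) - \<phi> (x + r S w) - w $ i * partial_deriv i \<phi> x\<bar> \<le> (e/2) * norm w"
        by (simp add: ri add.assoc)
      have 2: "\<bar>\<phi> (x + r S w) - \<phi> x - (\<Sum>i\<in>S. w $ i * partial_deriv i \<phi> x)\<bar> \<le> (e/2) * norm w"
        using d1(2) w by simp
      have "\<phi> (x + r (insert i S) w) - \<phi> x - (\<Sum>i\<in>insert i S. w $ i * partial_deriv i \<phi> x) =
          (\<phi> (x + r (insert i S) w) - \<phi> (x + r S w) - w $ i * partial_deriv i \<phi> x)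
          + (\<phi> (x + r S w) - \<phi> x - (\<Sum>i\<in>S. w $ i * partial_deriv i \<phi> x))"
        unfolding sum.insert[OF insert.hyps] by (simp add: algebra_simps)
      also have "\<bar>\<dots>\<bar> \<le> (e/2) * norm w + (e/2) * norm w"
        by (rule order_trans[OF abs_triangle_ineq add_mono[OF 1 2]])
      finally show ?thesis by simp
    qed
    then show ?case using d1(1) d2(1) by (intro exI[of _ "min d1 d2"]) auto
  qed
  have rU: "r UNIV w = w" for w by (simp add: r_def vec_eq_iff)
  have g: "(\<Sum>i\<in>UNIV. w $ i * partial_deriv i \<phi> x) = grad \<phi> x \<bullet> w" for w
    by (simp add: grad_def inner_vec_def mult.commute)
  show ?thesis
    unfolding has_derivative_at_alt
  proof (intro conjI allI impI bounded_linear_inner_right)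
    fix e :: real assume "0 < e"
    from key[OF finite_class.finite_UNIV this, unfolded rU g]
    obtain d where d: "d > 0" "\<And>w. norm w < d \<Longrightarrow> \<bar>\<phi> (x + w) - \<phi> x - grad \<phi> x \<bullet> w\<bar> \<le> e * norm w" by auto
    show "\<exists>d>0. \<forall>y. norm (y - x) < d \<longrightarrow> norm (\<phi> y - \<phi> x - grad \<phi> x \<bullet> (y - x)) \<le> e * norm (y - x)"
      using d(1) d(2)[of "_ - x"] by (intro exI[of _ d]) auto
  qed
qed

lemma C1_fun_line_derivative:
  assumes "C1_fun (\<phi> :: real^'d::finite \<Rightarrow> real)"
  shows "((\<lambda>s. \<phi> (x + s *\<^sub>R w)) has_field_derivative grad \<phi> (x + s *\<^sub>R w) \<bullet> w) (at s)"
proof -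
  have "((\<lambda>s. x + s *\<^sub>R w) has_derivative (\<lambda>h. h *\<^sub>R w)) (at s)"
    by (auto intro!: derivative_eq_intros)
  from diff_chain_at[OF this C1_fun_has_derivative[OF assms]]
  have "((\<lambda>s. \<phi> (x + s *\<^sub>R w)) has_derivative (\<lambda>h. h * (grad \<phi> (x + s *\<^sub>R w) \<bullet> w))) (at s)"
    by (simp add: o_def)
  moreover have "(\<lambda>h. h * c) = (*) c" for c :: real by (auto simp: mult.commute)
  ultimately show ?thesis by (simp add: has_field_derivative_def)
qed

lemma hess_quadratic_form:
  "w \<bullet> (hess \<phi> x *v w) = (\<Sum>i\<in>UNIV. \<Sum>j\<in>UNIV. partial_deriv i (partial_deriv j \<phi>) x * w $ i * w $ j)"
  by (simp add: hess_def inner_vec_def matrix_vector_mult_def sum_distrib_left mult_ac)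

lemma C2_fun_line_second_derivative:
  assumes "C2_fun (\<phi> :: real^'d::finite \<Rightarrow> real)"
  shows "((\<lambda>s. grad \<phi> (x + s *\<^sub>R w) \<bullet> w) has_field_derivative w \<bullet> (hess \<phi> (x + s *\<^sub>R w) *v w)) (at s)"
proof -
  have "C1_fun (partial_deriv j \<phi>)" for j using assms by (simp add: C2_fun_def)
  from C1_fun_line_derivative[OF this]
  have "((\<lambda>s. \<Sum>j\<in>UNIV. partial_deriv j \<phi> (x + s *\<^sub>R w) * w $ j) has_field_derivative
      (\<Sum>j\<in>UNIV. (grad (partial_deriv j \<phi>) (x + s *\<^sub>R w) \<bullet> w) * w $ j)) (at s)"
    by (intro DERIV_sum DERIV_cmult_right)
  moreover have "(\<Sum>j\<in>UNIV. (grad (partial_deriv j \<phi>) y \<bullet> w) * w $ j) = w \<bullet> (hess \<phi> y *v w)" for y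
    unfolding hess_quadratic_form by (subst sum.swap) (simp add: grad_def inner_vec_def sum_distrib_right)
  ultimately show ?thesis by (simp add: grad_def inner_vec_def)
qed

text \<open>Along the segment from x to x + w the second derivative is the Hessian form, which by
  the Hoelder condition stays within \<open>M\<close> of its value at x. Two applications of the
  mean value inequality give the bound; the squared dimension counts the entries of the
  Hessian.\<close>

lemma taylor_Hoelder:
  assumes \<phi>: "C2_fun (\<phi> :: real^'d::finite \<Rightarrow> real)" and \<alpha>: "0 < \<alpha>" and K: "0 \<le> K"
    and H: "\<And>i j x y. \<bar>partial_deriv i (partial_deriv j \<phi>) x - partial_deriv i (partial_deriv j \<phi>) y\<bar> \<le> K * dist x y powr \<alpha>"
  shows "\<bar>\<phi> (x + w) - \<phi> x - grad \<phi> x \<bullet> w - 1/2 * (w \<bullet> (hess \<phi> x *v w))\<bar> \<le> K * (CARD('d))\<^sup>2 * (norm w)\<^sup>2 * norm w powr \<alpha>"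
proof -
  define q where "q s = w \<bullet> (hess \<phi> (x + s *\<^sub>R w) *v w)" for s
  define M where "M = K * (CARD('d))\<^sup>2 * (norm w)\<^sup>2 * norm w powr \<alpha>"
  have C1: "C1_fun \<phi>" using \<phi> by (simp add: C2_fun_def)
  have q: "\<bar>q s - q 0\<bar> \<le> M" if s: "s \<in> {0..1}" for s
  proof -
    have "q s - q 0 = (\<Sum>i\<in>UNIV. \<Sum>j\<in>UNIV. (partial_deriv i (partial_deriv j \<phi>) (x + s *\<^sub>R w) - partial_deriv i (partial_deriv j \<phi>) x) * w $ i * w $ j)"
      by (simp add: q_def hess_quadratic_form sum_subtractf[symmetric] algebra_simps)
    also have "\<bar>\<dots>\<bar> \<le> (\<Sum>i\<in>(UNIV::'d set). \<Sum>j\<in>(UNIV::'d set). K * norm w powr \<alpha> * (norm w * norm w))"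
    proof (intro order_trans[OF sum_abs] sum_mono)
      fix i j :: 'd
      have "\<bar>partial_deriv i (partial_deriv j \<phi>) (x + s *\<^sub>R w) - partial_deriv i (partial_deriv j \<phi>) x\<bar> \<le> K * dist (x + s *\<^sub>R w) x powr \<alpha>"
        by (rule H)
      also have "\<dots> \<le> K * norm w powr \<alpha>"
        using s \<alpha> K by (intro mult_left_mono powr_mono2) (auto simp: dist_norm mult_left_le_one_le)
      finally have 1: "\<bar>partial_deriv i (partial_deriv j \<phi>) (x + s *\<^sub>R w) - partial_deriv i (partial_deriv j \<phi>) x\<bar> \<le> K * norm w powr \<alpha>" .
      have "\<bar>w $ i\<bar> * \<bar>w $ j\<bar> \<le> norm w * norm w"
        by (intro mult_mono component_le_norm_cart) auto
      from mult_mono[OF 1 this]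
      show "\<bar>(partial_deriv i (partial_deriv j \<phi>) (x + s *\<^sub>R w) - partial_deriv i (partial_deriv j \<phi>) x) * w $ i * w $ j\<bar>
          \<le> K * norm w powr \<alpha> * (norm w * norm w)"
        using K by (simp add: abs_mult mult.assoc)
    qed
    also have "\<dots> = M" by (simp add: M_def power2_eq_square)
    finally show ?thesis .
  qed
  have d1: "\<bar>(grad \<phi> (x + s *\<^sub>R w) \<bullet> w - s * q 0) - (grad \<phi> x \<bullet> w)\<bar> \<le> M" if s: "s \<in> {0..1}" for s
  proof -
    have "norm ((grad \<phi> (x + s *\<^sub>R w) \<bullet> w - s * q 0) - (grad \<phi> (x + 0 *\<^sub>R w) \<bullet> w - 0 * q 0)) \<le> M * norm (s - 0)"
    proof (rule field_differentiable_bound[where S = "{0..1}" and f' = "\<lambda>s. q s - q 0"])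
      show "((\<lambda>s. grad \<phi> (x + s *\<^sub>R w) \<bullet> w - s * q 0) has_field_derivative q s - q 0) (at s within {0..1})" for s
        unfolding q_def by (rule has_field_derivative_at_within)
          (auto intro!: derivative_eq_intros C2_fun_line_second_derivative[OF \<phi>])
    qed (use q s in auto)
    also have "\<dots> \<le> M * 1"
      using s K by (intro mult_left_mono) (auto simp: M_def)
    finally show ?thesis by simp
  qed
  have "norm ((\<phi> (x + 1 *\<^sub>R w) - 1 * (grad \<phi> x \<bullet> w) - 1\<^sup>2 / 2 * q 0) - (\<phi> (x + 0 *\<^sub>R w) - 0 * (grad \<phi> x \<bullet> w) - 0\<^sup>2 / 2 * q 0)) \<le> M * norm (1 - 0 :: real)"
  proof (rule field_differentiable_bound[where S = "{0..1}" and f' = "\<lambda>s. grad \<phi> (x + s *\<^sub>R w) \<bullet> w - grad \<phi> x \<bullet> w - s * q 0"])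
    show "((\<lambda>s. \<phi> (x + s *\<^sub>R w) - s * (grad \<phi> x \<bullet> w) - s\<^sup>2 / 2 * q 0) has_field_derivative
        grad \<phi> (x + s *\<^sub>R w) \<bullet> w - grad \<phi> x \<bullet> w - s * q 0) (at s within {0..1})" for s
      by (rule has_field_derivative_at_within)
        (auto intro!: derivative_eq_intros C1_fun_line_derivative[OF C1])
  qed (use d1 in \<open>auto simp: algebra_simps\<close>)
  then show ?thesis by (simp add: M_def q_def)
qed

section \<open>Compactly supported functions\<close>

lemma partial_deriv_zero_outside_support:
  assumes "x \<notin> closure {y. \<phi> y \<noteq> 0}"
  shows "partial_deriv i \<phi> x = 0"
proof -
  have op: "open (- closure {y. \<phi> y \<noteq> 0})" by (intro open_Compl closed_closure)
  have "((\<lambda>h::real. x + h *\<^sub>R axis i 1) \<longlongrightarrow> x + 0 *\<^sub>R axis i 1) (nhds 0)"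
    by (intro tendsto_intros filterlim_ident)
  then have "\<forall>\<^sub>F h::real in nhds 0. x + h *\<^sub>R axis i 1 \<in> - closure {y. \<phi> y \<noteq> 0}"
    by (rule topological_tendstoD[OF _ op]) (use assms in simp)
  then have "\<forall>\<^sub>F h::real in nhds 0. \<phi> (x + h *\<^sub>R axis i 1) = 0"
  proof eventually_elim
    case (elim h)
    then have "x + h *\<^sub>R axis i 1 \<notin> closure {y. \<phi> y \<noteq> 0}" by simp
    then have "x + h *\<^sub>R axis i 1 \<notin> {y. \<phi> y \<noteq> 0}" by (rule contra_subsetD[OF closure_subset])
    then show ?case by simp
  qed
  then have "deriv (\<lambda>h. \<phi> (x + h *\<^sub>R axis i 1)) 0 = deriv (\<lambda>h::real. 0) 0"
    by (intro deriv_cong_ev) auto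
  then show ?thesis by (simp add: partial_deriv_def)
qed

lemma compact_support_bounded:
  fixes g :: "'a::euclidean_space \<Rightarrow> real"
  assumes g: "continuous_on UNIV g" and K: "compact K" "\<And>x. x \<notin> K \<Longrightarrow> g x = 0"
  shows "\<exists>b\<ge>0. \<forall>x. \<bar>g x\<bar> \<le> b" "(g \<longlongrightarrow> 0) at_infinity"
proof -
  have "compact (g ` K)" using K(1) continuous_on_subset[OF g] by (intro compact_continuous_image) auto
  then obtain b where b: "\<And>x. x \<in> K \<Longrightarrow> \<bar>g x\<bar> \<le> b"
    using compact_imp_bounded by (force simp: bounded_iff)
  have "\<bar>g x\<bar> \<le> \<bar>b\<bar>" for x using b[of x] K(2)[of x] by (cases "x \<in> K") auto
  then show "\<exists>b\<ge>0. \<forall>x. \<bar>g x\<bar> \<le> b" by (intro exI[of _ "\<bar>b\<bar>"]) auto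
  obtain c where c: "\<And>x. x \<in> K \<Longrightarrow> norm x \<le> c" using compact_imp_bounded[OF K(1)] by (auto simp: bounded_iff)
  have "\<forall>\<^sub>F x in at_infinity. g x = 0"
    unfolding eventually_at_infinity
  proof (intro exI[of _ "c + 1"] allI impI)
    fix x :: 'a assume "c + 1 \<le> norm x"
    then have "x \<notin> K" using c[of x] by auto
    then show "g x = 0" by (rule K(2))
  qed
  then show "(g \<longlongrightarrow> 0) at_infinity" by (rule tendsto_eventually)
qed

lemma Cc_2_Hoelder_support:
  assumes "\<phi> \<in> Cc_2_Hoelder \<alpha>"
  obtains K where "compact K" "\<And>x. x \<notin> K \<Longrightarrow> apply_c0 \<phi> x = 0"
    "\<And>i x. x \<notin> K \<Longrightarrow> partial_deriv i (apply_c0 \<phi>) x = 0"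
    "\<And>i j x. x \<notin> K \<Longrightarrow> partial_deriv i (partial_deriv j (apply_c0 \<phi>)) x = 0"
proof
  let ?K = "closure {x. apply_c0 \<phi> x \<noteq> 0}"
  show "compact ?K" using assms by (simp add: Cc_2_Hoelder_def)
  show "apply_c0 \<phi> x = 0" if "x \<notin> ?K" for x
    using that closure_subset[of "{x. apply_c0 \<phi> x \<noteq> 0}"] by blast
  show 1: "partial_deriv i (apply_c0 \<phi>) x = 0" if "x \<notin> ?K" for i x
    using that by (rule partial_deriv_zero_outside_support)
  show "partial_deriv i (partial_deriv j (apply_c0 \<phi>)) x = 0" if "x \<notin> ?K" for i j x
  proof (rule partial_deriv_zero_outside_support)
    have "{y. partial_deriv j (apply_c0 \<phi>) y \<noteq> 0} \<subseteq> ?K" using 1 by blast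
    then have "closure {y. partial_deriv j (apply_c0 \<phi>) y \<noteq> 0} \<subseteq> ?K" by (rule closure_minimal) simp
    with that show "x \<notin> closure {y. partial_deriv j (apply_c0 \<phi>) y \<noteq> 0}" by blast
  qed
qed

text \<open>The differential expression for the generator is given on \<open>C0_2\<close>; the
  inclusion makes it available on the core.\<close>

lemma Cc_2_Hoelder_subset_C0_2: "Cc_2_Hoelder \<alpha> \<subseteq> C0_2"
proof
  fix \<phi> :: "(real^'d::finite) c0fun" assume \<phi>: "\<phi> \<in> Cc_2_Hoelder \<alpha>"
  then obtain K where K: "compact K"
    "\<And>i x. x \<notin> K \<Longrightarrow> partial_deriv i (apply_c0 \<phi>) x = 0"
    "\<And>i j x. x \<notin> K \<Longrightarrow> partial_deriv i (partial_deriv j (apply_c0 \<phi>)) x = 0"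
    by (rule Cc_2_Hoelder_support) blast
  have C2: "C2_fun (apply_c0 \<phi>)" using \<phi> by (simp add: Cc_2_Hoelder_def)
  then show "\<phi> \<in> C0_2"
    using compact_support_bounded(2)[OF _ K(1,2)] compact_support_bounded(2)[OF _ K(1,3)]
    by (auto simp: C0_2_def C2_fun_def C1_fun_def)
qed

section \<open>The Gaussian step operator\<close>

lemma continuous_on_matrix_vector_mult:
  fixes f :: "'a::topological_space \<Rightarrow> real^'n::finite^'m::finite"
  assumes "continuous_on S f" "continuous_on S g"
  shows "continuous_on S (\<lambda>x. f x *v g x)"
  unfolding matrix_vector_mult_def using assms
  by (intro continuous_on_vec_lambda continuous_on_sum continuous_on_mult continuous_on_component)

lemma continuous_on_det:
  fixes f :: "'a::topological_space \<Rightarrow> real^'n::finite^'n"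
  assumes "continuous_on S f"
  shows "continuous_on S (\<lambda>x. det (f x))"
  unfolding det_def using assms
  by (intro continuous_on_sum continuous_on_mult continuous_on_const continuous_on_prod continuous_on_component)

lemma borel_measurable_matrix_vector_mult2 [measurable (raw)]:
  fixes f :: "'a \<Rightarrow> real^'n::finite^'m::finite"
  assumes "f \<in> borel_measurable M" "g \<in> borel_measurable M"
  shows "(\<lambda>x. f x *v g x) \<in> borel_measurable M"
  using assms
  by (rule borel_measurable_continuous_Pair)
    (intro continuous_on_matrix_vector_mult continuous_on_fst continuous_on_snd continuous_on_id)

text \<open>Dominated convergence speaks of sequences; this criterion carries its conclusion over to
  the filter at infinity.\<close>

lemma tendsto_at_infinity_sequentiallyI:
  fixes f :: "'a::real_normed_vector \<Rightarrow> 'b::metric_space"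
  assumes "\<And>X. filterlim X at_infinity sequentially \<Longrightarrow> (\<lambda>n. f (X n)) \<longlonglongrightarrow> L"
  shows "(f \<longlongrightarrow> L) at_infinity"
proof (rule ccontr)
  assume "\<not> (f \<longlongrightarrow> L) at_infinity"
  then obtain e where e: "e > 0" "\<And>b. \<exists>x. b \<le> norm x \<and> \<not> dist (f x) L < e"
    unfolding tendsto_iff eventually_at_infinity by blast
  have "\<forall>n::nat. \<exists>x. real n \<le> norm x \<and> \<not> dist (f x) L < e" using e(2) by blast
  from choice[OF this] obtain X where X: "\<And>n::nat. real n \<le> norm (X n)" "\<And>n. \<not> dist (f (X n)) L < e" by blast
  have "filterlim X at_infinity sequentially"
    unfolding filterlim_at_infinity_conv_norm_at_top
    by (rule filterlim_at_top_mono[OF filterlim_real_sequentially]) (use X in auto)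
  from tendstoD[OF assms[OF this] e(1)] X(2) show False by (auto simp: eventually_sequentially)
qed

lemma det_scaleR:
  fixes M :: "real^'n::finite^'n"
  shows "det (c *\<^sub>R M) = c ^ CARD('n) * det M"
proof -
  have "c *\<^sub>R M = (\<chi> i. c *s (M $ i))" by (simp add: vec_eq_iff)
  then show ?thesis using det_rows_mul[of "\<lambda>_. c" "\<lambda>i. M $ i"] by simp
qed

locale diffusion_coefficients =
  fixes A :: "real^'d::finite \<Rightarrow> real^'d^'d" and B :: "real^'d \<Rightarrow> real^'d" and C :: "real^'d \<Rightarrow> real"
    and a\<^sub>0 A\<^sub>0 :: real
  assumes C_nonneg: "\<And>x. C x \<ge> 0"
    and A_symmetric: "\<And>x. transpose (A x) = A x"
    and bounded_coeffs: "bounded (range A)" "bounded (range B)" "bounded (range C)"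
    and continuous_coeffs: "continuous_on UNIV A" "continuous_on UNIV B" "continuous_on UNIV C"
    and elliptic: "0 < a\<^sub>0" "a\<^sub>0 \<le> A\<^sub>0"
          "\<And>x z. a\<^sub>0 * (norm z)\<^sup>2 \<le> z \<bullet> (A x *v z) \<and> z \<bullet> (A x *v z) \<le> A\<^sub>0 * (norm z)\<^sup>2"
begin

abbreviation AI where "AI x \<equiv> matrix_inv (A x)"

text \<open>Any symmetric square root will do: it is the substitution matrix of Gaussian integrals
  whose moments depend on it only through \<open>S x ** S x = A x\<close>. The root in the integrand
  is a different one, \<open>matrix_sqrt\<close> of the inverse matrix, and enters through the norm
  computed in \<open>norm_sqrt_AI\<close>.\<close>

definition S where "S x = (SOME R. transpose R = R \<and> R ** R = A x)"

lemma A_nonneg: "0 \<le> z \<bullet> (A x *v z)"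
  using elliptic(1) elliptic(3)[of z x] by (meson less_imp_le mult_nonneg_nonneg order_trans zero_le_power2)

lemma S: "transpose (S x) = S x" "S x ** S x = A x"
proof -
  have "\<exists>R. transpose R = R \<and> R ** R = A x"
    using exists_psd_matrix_sqrt[OF A_symmetric A_nonneg] by blast
  from someI_ex[OF this] show "transpose (S x) = S x" "S x ** S x = A x" by (auto simp: S_def)
qed

lemma AI: "AI x ** A x = mat 1" "A x ** AI x = mat 1"
proof -
  have "z = 0" if "A x *v z = 0" for z
    using elliptic(1) elliptic(3)[of z x] that by (simp add: mult_le_0_iff)
  then have "invertible (A x)"
    using matrix_left_invertible_ker[of "A x"] by (auto simp: invertible_left_inverse)
  then have "A x ** AI x = mat 1 \<and> AI x ** A x = mat 1"
    unfolding invertible_def matrix_inv_def by (rule someI_ex)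
  then show "AI x ** A x = mat 1" "A x ** AI x = mat 1" by auto
qed

lemma AI_A [simp]: "AI x *v (A x *v z) = z" "A x *v (AI x *v z) = z"
  by (simp_all add: matrix_vector_mul_assoc AI)

lemma det_A_pos: "0 < det (A x)"
proof -
  have "det (A x) = det (S x) * det (S x)" by (simp flip: S(2) add: det_mul)
  moreover have "det (A x) \<noteq> 0"
    using AI(1)[of x] by (metis det_I det_mul mult_zero_right zero_neq_one)
  ultimately show ?thesis by (metis zero_less_mult_iff linorder_neqE_linordered_idom mult_eq_0_iff)
qed

lemma abs_det_S: "\<bar>det (S x)\<bar> = sqrt (det (A x))"
proof -
  have "det (A x) = (det (S x))\<^sup>2" by (simp flip: S(2) add: det_mul power2_eq_square)
  then show ?thesis by simp
qed

lemma S_inner: "(S x *v y) \<bullet> z = y \<bullet> (S x *v z)"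
  by (rule symmetric_matrix_inner[OF S(1)])

lemma AI_symmetric: "transpose (AI x) = AI x"
proof -
  have "transpose (AI x) ** A x = mat 1"
    using arg_cong[OF AI(2)[of x], of transpose] by (simp add: matrix_transpose_mul A_symmetric transpose_mat)
  then show ?thesis by (metis AI(2) matrix_mul_assoc matrix_mul_lid matrix_mul_rid)
qed

lemma AI_nonneg: "0 \<le> z \<bullet> (AI x *v z)"
  using A_nonneg[of "AI x *v z" x] by (simp add: inner_commute)

lemma AI_inner: "(AI x *v y) \<bullet> z = y \<bullet> (AI x *v z)"
  by (rule symmetric_matrix_inner[OF AI_symmetric])

lemma S_AI_S: "S x *v (AI x *v (S x *v v)) = v"
proof -
  have "S x *v (S x *v (AI x *v (S x *v v))) = S x *v v"
  proof -
    have "S x *v (S x *v u) = A x *v u" for u by (simp add: matrix_vector_mul_assoc S(2))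
    then show ?thesis by (simp only: AI_A)
  qed
  moreover have "u = w" if "S x *v u = S x *v w" for u w
  proof -
    have "A x *v u = A x *v w" using that by (simp flip: S(2) matrix_vector_mul_assoc)
    then show ?thesis by (metis AI_A(1))
  qed
  ultimately show ?thesis by blast
qed

lemma norm_sqrt_AI: "(norm (matrix_sqrt (AI x) *v b))\<^sup>2 = b \<bullet> (AI x *v b)"
proof -
  note s = matrix_sqrt[OF AI_symmetric AI_nonneg, of x]
  have "(norm (matrix_sqrt (AI x) *v b))\<^sup>2 = b \<bullet> (matrix_sqrt (AI x) *v (matrix_sqrt (AI x) *v b))"
    by (simp add: power2_norm_eq_inner symmetric_matrix_inner[OF s(1)])
  then show ?thesis by (simp add: matrix_vector_mul_assoc s(2))
qed

lemma norm_S: "norm (S x *v v) \<le> sqrt A\<^sub>0 * norm v"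
proof -
  have "(norm (S x *v v))\<^sup>2 = v \<bullet> (A x *v v)"
    by (simp add: power2_norm_eq_inner S_inner matrix_vector_mul_assoc S(2))
  also have "\<dots> \<le> A\<^sub>0 * (norm v)\<^sup>2" using elliptic(3) by blast
  finally have "sqrt ((norm (S x *v v))\<^sup>2) \<le> sqrt (A\<^sub>0 * (norm v)\<^sup>2)" by (rule real_sqrt_le_mono)
  then show ?thesis by (simp add: real_sqrt_mult)
qed

lemma norm_AI: "norm (AI x *v z) \<le> norm z / a\<^sub>0"
proof (cases "AI x *v z = 0")
  case False
  let ?u = "AI x *v z"
  have "a\<^sub>0 * (norm ?u)\<^sup>2 \<le> ?u \<bullet> z" using elliptic(3)[of ?u x] by simp
  also have "\<dots> \<le> norm ?u * norm z" by (rule norm_cauchy_schwarz)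
  finally have "norm ?u * (a\<^sub>0 * norm ?u) \<le> norm ?u * norm z" by (simp add: power2_eq_square mult_ac)
  then have "a\<^sub>0 * norm ?u \<le> norm z" using False by simp
  then show ?thesis using elliptic(1) by (simp add: field_simps)
qed (use elliptic(1) in simp)

text \<open>The identity A^-1(y) - A^-1(x) = A^-1(y) (A(x) - A(y)) A^-1(x), together with
  ellipticity, which bounds A^-1(y) by \<open>1 / a\<^sub>0\<close> uniformly in y.\<close>

lemma continuous_AI: "continuous_on UNIV AI"
proof -
  have vec: "continuous_on UNIV (\<lambda>x. AI x *v z)" for z
  proof (rule continuous_at_imp_continuous_on, intro ballI)
    fix x
    have eq: "AI y *v z - AI x *v z = AI y *v ((A x - A y) *v (AI x *v z))" for y
      by (simp add: matrix_vector_mult_diff_rdistrib matrix_vector_mult_diff_distrib)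
    have "((\<lambda>y. (A x - A y) *v (AI x *v z)) \<longlongrightarrow> (A x - A x) *v (AI x *v z)) (at x)"
    proof -
      have "continuous_on UNIV (\<lambda>y. (A x - A y) *v (AI x *v z))"
        by (intro continuous_on_matrix_vector_mult continuous_intros continuous_coeffs)
      then have "isCont (\<lambda>y. (A x - A y) *v (AI x *v z)) x" by (simp add: continuous_on_eq_continuous_at)
      then show ?thesis unfolding isCont_def .
    qed
    then have lim: "((\<lambda>y. norm ((A x - A y) *v (AI x *v z)) / a\<^sub>0) \<longlongrightarrow> 0) (at x)"
      by (auto intro!: tendsto_divide_zero tendsto_norm_zero simp: matrix_vector_mult_0)
    have "((\<lambda>y. AI y *v z - AI x *v z) \<longlongrightarrow> 0) (at x)"
      by (rule Lim_null_comparison[OF _ lim]) (auto simp: eq norm_AI intro!: always_eventually)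
    then show "isCont (\<lambda>x. AI x *v z) x" by (simp add: isCont_def LIM_zero_iff)
  qed
  have entry: "AI x = (\<chi> i j. (AI x *v axis j 1) $ i)" for x
    by (simp add: vec_eq_iff matrix_vector_mult_basis column_def)
  have "continuous_on UNIV (\<lambda>x. (\<chi> i j. (AI x *v axis j 1) $ i))"
    by (intro continuous_on_vec_lambda continuous_on_component vec)
  then show ?thesis by (simp flip: entry)
qed

definition kernel :: "real \<Rightarrow> real^'d \<Rightarrow> real^'d \<Rightarrow> real" where
  "kernel h x y = exp (- h * (C x + 1/4 * (norm (matrix_sqrt (AI x) *v B x))\<^sup>2)) *
     exp (1/2 * ((AI x *v B x) \<bullet> (x - y))) * p_gauss A h x y"

lemma measurable_coeffs [measurable]:
  "A \<in> borel_measurable borel" "B \<in> borel_measurable borel" "C \<in> borel_measurable borel"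
  "AI \<in> borel_measurable borel" "(\<lambda>x. det (A x)) \<in> borel_measurable borel"
  using continuous_coeffs continuous_AI continuous_on_det[OF continuous_coeffs(1)]
  by (auto intro: borel_measurable_continuous_onI)

lemma measurable_kernel [measurable (raw)]:
  assumes [measurable]: "h \<in> borel_measurable M" "x \<in> borel_measurable M" "y \<in> borel_measurable M"
  shows "(\<lambda>\<omega>. kernel (h \<omega>) (x \<omega>) (y \<omega>)) \<in> borel_measurable M"
proof -
  have [measurable]: "(\<lambda>\<omega>. AI (x \<omega>)) \<in> borel_measurable M" "(\<lambda>\<omega>. det (A (x \<omega>))) \<in> borel_measurable M"
    by (rule measurable_compose[OF assms(2)], measurable)+
  show ?thesis
    unfolding kernel_def norm_sqrt_AI p_gauss_def by measurable
qed

lemma kernel_nonneg: "0 < h \<Longrightarrow> 0 \<le> kernel h x y"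
  using det_A_pos[of x] by (simp add: kernel_def p_gauss_def)

text \<open>Completing the square turns the drift factors into a translation of the Gaussian by \<open>h B(x)\<close>.\<close>

lemma kernel_eq:
  assumes h: "0 < h"
  shows "kernel h x y = exp (- h * C x) *
     (exp (- ((AI x *v (x - y - h *\<^sub>R B x)) \<bullet> (x - y - h *\<^sub>R B x)) / (4 * h)) / sqrt ((4 * pi * h) ^ CARD('d) * det (A x)))"
proof -
  define w where "w = x - y"
  define b where "b = B x"
  have "(AI x *v (w - h *\<^sub>R b)) \<bullet> (w - h *\<^sub>R b) =
     (AI x *v w) \<bullet> w - 2 * h * ((AI x *v b) \<bullet> w) + h\<^sup>2 * (b \<bullet> (AI x *v b))"
    using AI_inner[of x w b] AI_inner[of x b b]
    by (simp add: matrix_vector_mult_diff_distrib matrix_vector_mult_scaleR inner_diff_left inner_diff_right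
        power2_eq_square algebra_simps inner_commute)
  then have "- ((AI x *v (w - h *\<^sub>R b)) \<bullet> (w - h *\<^sub>R b)) / (4 * h) =
     - h * (1/4 * (b \<bullet> (AI x *v b))) + 1/2 * ((AI x *v b) \<bullet> w) + - ((AI x *v w) \<bullet> w) / (4 * h)"
    using h by (simp add: field_simps power2_eq_square)
  then have "exp (- h * C x) * exp (- ((AI x *v (w - h *\<^sub>R b)) \<bullet> (w - h *\<^sub>R b)) / (4 * h)) =
     exp (- h * (C x + 1/4 * (b \<bullet> (AI x *v b)))) * exp (1/2 * ((AI x *v b) \<bullet> w)) * exp (- ((AI x *v w) \<bullet> w) / (4 * h))"
    by (simp add: exp_add[symmetric] algebra_simps)
  then show ?thesis
    unfolding kernel_def p_gauss_def norm_sqrt_AI w_def[symmetric] b_def[symmetric] by simp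
qed

text \<open>The Gaussian \<open>p_gauss\<close> at time h has covariance \<open>2 * h\<close> times
  \<open>A x\<close>, whence the factor \<open>sqrt (2 * h)\<close>; the determinant of the
  substitution cancels the normalisation.\<close>

lemma kernel_substitution:
  assumes h: "0 < h"
  shows "\<bar>det (sqrt (2 * h) *\<^sub>R S x)\<bar> * kernel h x ((x - h *\<^sub>R B x) + (sqrt (2 * h) *\<^sub>R S x) *v v) = exp (- h * C x) * gauss v"
proof -
  let ?w = "x - ((x - h *\<^sub>R B x) + (sqrt (2 * h) *\<^sub>R S x) *v v) - h *\<^sub>R B x"
  have w: "?w = - (sqrt (2 * h) *\<^sub>R (S x *v v))"
    by (simp add: scaleR_matrix_vector_assoc)
  have "(AI x *v ?w) \<bullet> ?w = (2 * h) * ((S x *v (AI x *v (S x *v v))) \<bullet> v)"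
    unfolding w using h
    by (simp add: matrix_vector_mult_scaleR S_inner[symmetric] linear_neg[OF matrix_vector_mul_linear] mult.assoc[symmetric])
  then have q: "- ((AI x *v ?w) \<bullet> ?w) / (4 * h) = - (norm v)\<^sup>2 / 2"
    using h by (simp add: S_AI_S power2_norm_eq_inner)
  have d: "\<bar>det (sqrt (2 * h) *\<^sub>R S x)\<bar> = sqrt ((2 * h) ^ CARD('d) * det (A x))"
  proof -
    have r1: "\<bar>sqrt (2 * h) ^ CARD('d)\<bar> = sqrt (2 * h) ^ CARD('d)"
      using h by (intro abs_of_nonneg zero_le_power real_sqrt_ge_zero) simp
    have r2: "sqrt ((2 * h) ^ CARD('d) * det (A x)) = sqrt (2 * h) ^ CARD('d) * sqrt (det (A x))"
      by (simp only: real_sqrt_mult real_sqrt_power)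
    show ?thesis by (simp only: det_scaleR abs_mult abs_det_S r1 r2)
  qed
  have "(4 * pi * h) ^ CARD('d) * det (A x) = (2 * pi) ^ CARD('d) * ((2 * h) ^ CARD('d) * det (A x))"
  proof -
    have e: "4 * pi * h = (2 * pi) * (2 * h)" by simp
    show ?thesis unfolding e power_mult_distrib[of "2 * pi" "2 * h"] by (rule mult.assoc)
  qed
  then have s: "sqrt ((4 * pi * h) ^ CARD('d) * det (A x)) = sqrt ((2 * pi) ^ CARD('d)) * sqrt ((2 * h) ^ CARD('d) * det (A x))"
    by (simp only: real_sqrt_mult)
  have p: "sqrt ((2 * h) ^ CARD('d) * det (A x)) \<noteq> 0"
    using h det_A_pos[of x] by (simp add: less_imp_neq[symmetric])
  show ?thesis
    unfolding kernel_eq[OF h] q d s gauss_eq using p by simp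
qed

lemma
  fixes f :: "real^'d \<Rightarrow> real"
  assumes h: "0 < h" and [measurable]: "f \<in> borel_measurable borel" and f: "\<And>y. \<bar>f y\<bar> \<le> K"
  shows integrable_kernel: "integrable lborel (\<lambda>y. kernel h x y * f y)"
    and integral_kernel: "(LINT y|lborel. kernel h x y * f y) =
      exp (- h * C x) * (LINT v|lborel. gauss v * f (x - h *\<^sub>R B x + sqrt (2 * h) *\<^sub>R (S x *v v)))"
proof -
  let ?M = "sqrt (2 * h) *\<^sub>R S x" and ?c = "x - h *\<^sub>R B x"
  have det: "det ?M \<noteq> 0"
    using h det_A_pos[of x] abs_det_S[of x] by (auto simp: det_scaleR)
  have M: "?M *v v = sqrt (2 * h) *\<^sub>R (S x *v v)" for v by (simp add: scaleR_matrix_vector_assoc)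
  have [measurable]: "(\<lambda>v. f (?c + ?M *v v)) \<in> borel_measurable borel" by measurable
  have eq: "kernel h x (?c + ?M *v v) * f (?c + ?M *v v) =
      (exp (- h * C x) / \<bar>det ?M\<bar>) * (gauss v * f (?c + ?M *v v))" for v
    using kernel_substitution[OF h, of x v] det by (simp add: field_simps)
  have int: "integrable lborel (\<lambda>v. gauss v * f (?c + ?M *v v))"
    by (rule integrable_gauss_bounded[where K = K]) (use f in auto)
  show "integrable lborel (\<lambda>y. kernel h x y * f y)"
    by (subst integrable_lborel_matrix_affine[OF det, of _ ?c]) (use int in \<open>auto simp: eq\<close>)
  show "(LINT y|lborel. kernel h x y * f y) = exp (- h * C x) * (LINT v|lborel. gauss v * f (?c + sqrt (2 * h) *\<^sub>R (S x *v v)))"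
    by (subst integral_lborel_matrix_affine[OF det, of _ ?c]) (use det in \<open>auto simp: eq[unfolded M] M\<close>)
qed

lemma kernel_mass:
  assumes h: "0 < h"
  shows "integrable lborel (kernel h x)" "(LINT y|lborel. kernel h x y) = exp (- h * C x)"
    "(\<integral>\<^sup>+y. ennreal (kernel h x y) \<partial>lborel) = ennreal (exp (- h * C x))"
proof -
  show i: "integrable lborel (kernel h x)" using integrable_kernel[OF h, of "\<lambda>_. 1" 1 x] by simp
  show m: "(LINT y|lborel. kernel h x y) = exp (- h * C x)"
    using integral_kernel[OF h, of "\<lambda>_. 1" 1 x] by (simp add: has_bochner_integral_integral_eq[OF has_bochner_integral_gauss])
  show "(\<integral>\<^sup>+y. ennreal (kernel h x y) \<partial>lborel) = ennreal (exp (- h * C x))"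
    using nn_integral_eq_integral[OF i] kernel_nonneg[OF h] m by simp
qed

definition step_fun :: "real \<Rightarrow> (real^'d \<Rightarrow> real) \<Rightarrow> real^'d \<Rightarrow> real" where
  "step_fun h f x = (LINT y|lborel. kernel h x y * f y)"

lemma continuous_kernel:
  assumes h: "0 < h"
  shows "continuous_on UNIV (\<lambda>x. kernel h x y)"
proof -
  have "(4 * pi * h) ^ CARD('d) * det (A x) \<noteq> 0" for x using h det_A_pos[of x] by (simp add: less_imp_neq[symmetric])
  then show ?thesis
    unfolding kernel_eq[OF h] using h
    by (intro continuous_intros continuous_on_matrix_vector_mult continuous_coeffs continuous_AI continuous_on_det) auto
qed

lemma measurable_apply_c0 [measurable]: "apply_c0 \<phi> \<in> borel_measurable borel"
  by (intro borel_measurable_continuous_onI) (simp add: apply_c0_def[abs_def])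

text \<open>At converging points the kernels converge pointwise and their masses
  \<open>exp (- h * C x)\<close> converge too. Scheffe's lemma then gives convergence in mean
  without a common dominating function, and the integrated function is bounded.\<close>

lemma step_fun_continuous:
  assumes h: "0 < h"
  shows "continuous_on UNIV (step_fun h (apply_c0 \<phi>))"
  unfolding continuous_on_sequentially
proof (intro allI ballI impI, elim conjE)
  fix X :: "nat \<Rightarrow> real^'d" and x assume X: "X \<longlonglongrightarrow> x"
  have lim: "(\<lambda>n. g (X n)) \<longlonglongrightarrow> g x" if "continuous_on UNIV g" for g :: "real^'d \<Rightarrow> real"
    using continuous_on_tendsto_compose[OF that X] by auto
  have "(\<lambda>n. \<integral>\<^sup>+y. ennreal (norm (kernel h (X n) y - kernel h x y)) \<partial>lborel) \<longlonglongrightarrow> 0"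
  proof (rule Scheffe_lemma1)
    have "(\<lambda>n. ennreal (exp (- h * C (X n)))) \<longlonglongrightarrow> ennreal (exp (- h * C x))"
      by (intro tendsto_ennrealI lim continuous_intros continuous_coeffs)
    then have "limsup (\<lambda>n. ennreal (exp (- h * C (X n)))) = ennreal (exp (- h * C x))"
      by (intro lim_imp_Limsup) auto
    then show "limsup (\<lambda>n. \<integral>\<^sup>+y. ennreal (norm (kernel h (X n) y)) \<partial>lborel) \<le> (\<integral>\<^sup>+y. ennreal (norm (kernel h x y)) \<partial>lborel)"
      using kernel_nonneg[OF h] kernel_mass(3)[OF h] by simp
  qed (auto intro!: kernel_mass h lim continuous_kernel)
  then have L: "(\<lambda>n. ennreal (norm \<phi>) * (\<integral>\<^sup>+y. ennreal (norm (kernel h (X n) y - kernel h x y)) \<partial>lborel)) \<longlonglongrightarrow> 0"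
    using tendsto_mult_ennreal[OF tendsto_const[of "ennreal (norm \<phi>)"]] by fastforce
  have bound: "ennreal (norm (step_fun h (apply_c0 \<phi>) (X n) - step_fun h (apply_c0 \<phi>) x))
      \<le> ennreal (norm \<phi>) * (\<integral>\<^sup>+y. ennreal (norm (kernel h (X n) y - kernel h x y)) \<partial>lborel)" for n
  proof -
    have eq: "step_fun h (apply_c0 \<phi>) (X n) - step_fun h (apply_c0 \<phi>) x = (LINT y|lborel. (kernel h (X n) y - kernel h x y) * apply_c0 \<phi> y)"
      unfolding step_fun_def left_diff_distrib
      by (rule Bochner_Integration.integral_diff[symmetric])
        (auto intro!: integrable_kernel h apply_c0_le_norm)
    have "ennreal (norm (step_fun h (apply_c0 \<phi>) (X n) - step_fun h (apply_c0 \<phi>) x)) \<le> (\<integral>\<^sup>+y. ennreal (norm ((kernel h (X n) y - kernel h x y) * apply_c0 \<phi> y)) \<partial>lborel)"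
      unfolding eq by (rule integral_norm_bound_ennreal)
        (unfold left_diff_distrib, auto intro!: Bochner_Integration.integrable_diff integrable_kernel h apply_c0_le_norm)
    also have "\<dots> \<le> (\<integral>\<^sup>+y. ennreal (norm \<phi>) * ennreal (norm (kernel h (X n) y - kernel h x y)) \<partial>lborel)"
    proof (rule nn_integral_mono)
      fix y
      have "norm ((kernel h (X n) y - kernel h x y) * apply_c0 \<phi> y) = norm (kernel h (X n) y - kernel h x y) * \<bar>apply_c0 \<phi> y\<bar>"
        by (simp add: abs_mult)
      also have "\<dots> \<le> norm (kernel h (X n) y - kernel h x y) * norm \<phi>"
        by (intro mult_left_mono apply_c0_le_norm norm_ge_zero)
      finally have "norm ((kernel h (X n) y - kernel h x y) * apply_c0 \<phi> y) \<le> norm \<phi> * norm (kernel h (X n) y - kernel h x y)"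
        by (simp only: mult.commute)
      then show "ennreal (norm ((kernel h (X n) y - kernel h x y) * apply_c0 \<phi> y)) \<le> ennreal (norm \<phi>) * ennreal (norm (kernel h (X n) y - kernel h x y))"
        by (subst ennreal_mult[symmetric, OF norm_ge_zero norm_ge_zero]) (rule ennreal_leI)
    qed
    also have "\<dots> = ennreal (norm \<phi>) * (\<integral>\<^sup>+y. ennreal (norm (kernel h (X n) y - kernel h x y)) \<partial>lborel)"
      by (rule nn_integral_cmult) measurable
    finally show ?thesis .
  qed
  have "(\<lambda>n. ennreal (norm (step_fun h (apply_c0 \<phi>) (X n) - step_fun h (apply_c0 \<phi>) x))) \<longlonglongrightarrow> 0"
    by (rule tendsto_sandwich[where f = "\<lambda>_. 0", OF _ _ tendsto_const L]) (use bound in auto)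
  then have "(\<lambda>n. ennreal (norm (step_fun h (apply_c0 \<phi>) (X n) - step_fun h (apply_c0 \<phi>) x))) \<longlonglongrightarrow> ennreal 0"
    by simp
  then have "(\<lambda>n. norm (step_fun h (apply_c0 \<phi>) (X n) - step_fun h (apply_c0 \<phi>) x)) \<longlonglongrightarrow> 0"
    by (subst (asm) tendsto_ennreal_iff) auto
  from LIM_zero_cancel[OF tendsto_norm_zero_cancel[OF this]]
  show "(step_fun h (apply_c0 \<phi>) \<circ> X) \<longlonglongrightarrow> step_fun h (apply_c0 \<phi>) x"
    unfolding o_def .
qed

lemma bounded_drift: "\<exists>b\<ge>0. \<forall>x. norm (B x) \<le> b"
proof -
  obtain b where b: "\<And>x. norm (B x) \<le> b"
    using bounded_coeffs(2) unfolding bounded_iff by blast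
  have "0 \<le> b" using norm_ge_zero[of "B 0"] b[of 0] by linarith
  with b show ?thesis by blast
qed

text \<open>After the substitution the argument is x plus terms that are bounded in x for every
  fixed v, so it escapes to infinity together with x.\<close>

lemma step_fun_at_infinity:
  assumes h: "0 < h"
  shows "(step_fun h (apply_c0 \<phi>) \<longlongrightarrow> 0) at_infinity"
proof (rule tendsto_at_infinity_sequentiallyI)
  fix X :: "nat \<Rightarrow> real^'d" assume X: "filterlim X at_infinity sequentially"
  obtain b where b: "0 \<le> b" "\<And>x. norm (B x) \<le> b" using bounded_drift by blast
  let ?y = "\<lambda>n v. X n - h *\<^sub>R B (X n) + sqrt (2 * h) *\<^sub>R (S (X n) *v v)"
  have "(\<lambda>n. LINT v|lborel. gauss v * apply_c0 \<phi> (?y n v)) \<longlonglongrightarrow> (LINT v|(lborel :: (real^'d) measure). gauss v * 0)"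
  proof (rule integral_dominated_convergence[where w = "\<lambda>v. norm \<phi> * gauss v"])
    show "integrable lborel (\<lambda>v::real^'d. norm \<phi> * gauss v)"
      using has_bochner_integral_gauss by (intro integrable_mult_right) (rule integrable.intros)
    have "(\<lambda>n. apply_c0 \<phi> (?y n v)) \<longlonglongrightarrow> 0" for v
    proof (rule filterlim_compose[OF tendsto_apply_c0])
      have "norm (X n) - (h * b + sqrt (2 * h) * (sqrt A\<^sub>0 * norm v)) \<le> norm (?y n v)" for n
      proof -
        have "norm (X n) = norm (?y n v + h *\<^sub>R B (X n) - sqrt (2 * h) *\<^sub>R (S (X n) *v v))" by simp
        also have "\<dots> \<le> norm (?y n v) + norm (h *\<^sub>R B (X n)) + norm (sqrt (2 * h) *\<^sub>R (S (X n) *v v))"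
          by (rule order_trans[OF norm_triangle_ineq4 add_right_mono[OF norm_triangle_ineq]])
        finally have "norm (X n) \<le> norm (?y n v) + norm (h *\<^sub>R B (X n)) + norm (sqrt (2 * h) *\<^sub>R (S (X n) *v v))" .
        moreover have "norm (h *\<^sub>R B (X n)) \<le> h * b" using h b by simp
        moreover have "norm (sqrt (2 * h) *\<^sub>R (S (X n) *v v)) \<le> sqrt (2 * h) * (sqrt A\<^sub>0 * norm v)"
          using h norm_S[of "X n" v] by (simp add: mult_left_mono)
        ultimately show ?thesis by linarith
      qed
      moreover have "filterlim (\<lambda>n. norm (X n) - (h * b + sqrt (2 * h) * (sqrt A\<^sub>0 * norm v))) at_top sequentially"
        using X unfolding filterlim_at_infinity_conv_norm_at_top
        by (simp add: filterlim_tendsto_add_at_top[OF tendsto_const, of _ _ "- _", simplified])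
      ultimately show "filterlim (\<lambda>n. ?y n v) at_infinity sequentially"
        unfolding filterlim_at_infinity_conv_norm_at_top
        by (elim filterlim_at_top_mono) auto
    qed
    then show "AE v in lborel. (\<lambda>n. gauss v * apply_c0 \<phi> (?y n v)) \<longlonglongrightarrow> gauss v * 0"
      by (intro AE_I2 tendsto_intros)
    show "AE v in lborel. norm (gauss v * apply_c0 \<phi> (?y n v)) \<le> norm \<phi> * gauss v" for n
      by (intro AE_I2) (simp add: abs_mult mult.commute[of "norm \<phi>"] apply_c0_le_norm mult_left_mono)
  qed measurable
  then have lim: "(\<lambda>n. LINT v|lborel. gauss v * apply_c0 \<phi> (?y n v)) \<longlonglongrightarrow> 0" by simp
  have eq: "step_fun h (apply_c0 \<phi>) (X n) = exp (- h * C (X n)) * (LINT v|lborel. gauss v * apply_c0 \<phi> (?y n v))" for n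
    unfolding step_fun_def by (rule integral_kernel[OF h _ apply_c0_le_norm]) measurable
  show "(\<lambda>n. step_fun h (apply_c0 \<phi>) (X n)) \<longlonglongrightarrow> 0"
  proof (rule Lim_null_comparison[OF _ tendsto_norm_zero[OF lim]], rule always_eventually, rule allI)
    fix n
    have "exp (- h * C (X n)) \<le> 1" using h C_nonneg by simp
    then show "norm (step_fun h (apply_c0 \<phi>) (X n)) \<le> norm (LINT v|lborel. gauss v * apply_c0 \<phi> (?y n v))"
      unfolding eq by (simp add: abs_mult mult_left_le_one_le)
  qed
qed

text \<open>For positive \<open>h\<close> such a function exists and is unique; for other
  \<open>h\<close> nothing is claimed about the choice.\<close>

definition gauss_step :: "real \<Rightarrow> (real^'d) c0fun \<Rightarrow> (real^'d) c0fun" where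
  "gauss_step h \<phi> = (SOME \<psi>. apply_c0 \<psi> = step_fun h (apply_c0 \<phi>))"

lemma apply_gauss_step:
  assumes h: "0 < h"
  shows "apply_c0 (gauss_step h \<phi>) = step_fun h (apply_c0 \<phi>)"
proof -
  have "\<exists>\<psi>. apply_c0 \<psi> = step_fun h (apply_c0 \<phi>)"
    by (rule apply_c0_cases[OF step_fun_continuous[OF h] step_fun_at_infinity[OF h], of \<phi>]) metis
  from someI_ex[OF this] show ?thesis by (simp add: gauss_step_def)
qed

lemma contraction_gauss_step:
  assumes h: "0 < h"
  shows "contraction_step (gauss_step h) h"
proof (rule contraction_step.intro)
  show c: "norm (gauss_step h \<phi>) \<le> norm \<phi>" for \<phi>
  proof (rule norm_c0fun_le)
    fix x
    have "norm (step_fun h (apply_c0 \<phi>) x) \<le> (LINT y|lborel. norm (kernel h x y * apply_c0 \<phi> y))"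
      unfolding step_fun_def by (rule integral_norm_bound)
    also have "\<dots> \<le> (LINT y|lborel. kernel h x y * norm \<phi>)"
      using kernel_nonneg[OF h]
      by (intro integral_mono integrable_norm integrable_kernel h apply_c0_le_norm)
        (auto simp: abs_mult intro!: mult_left_mono apply_c0_le_norm integrable_kernel[OF h, of "\<lambda>_. norm \<phi>" "norm \<phi>"])
    also have "\<dots> = exp (- h * C x) * norm \<phi>" using kernel_mass[OF h] by simp
    also have "\<dots> \<le> norm \<phi>" using h C_nonneg[of x] by (intro mult_left_le_one_le) auto
    finally show "\<bar>apply_c0 (gauss_step h \<phi>) x\<bar> \<le> norm \<phi>" by (simp add: apply_gauss_step[OF h])
  qed
  have i: "integrable lborel (\<lambda>y. kernel h x y * apply_c0 \<phi> y)" for x \<phi>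
    by (rule integrable_kernel[OF h _ apply_c0_le_norm]) measurable
  show "bounded_linear (gauss_step h)"
  proof (rule bounded_linear_intro[where K = 1])
    show "gauss_step h (\<phi> + \<psi>) = gauss_step h \<phi> + gauss_step h \<psi>" for \<phi> \<psi>
      by (rule c0fun_eqI) (simp add: apply_gauss_step[OF h] step_fun_def distrib_left i)
    show "gauss_step h (r *\<^sub>R \<phi>) = r *\<^sub>R gauss_step h \<phi>" for r \<phi>
      by (rule c0fun_eqI) (simp add: apply_gauss_step[OF h] step_fun_def mult.left_commute)
    show "norm (gauss_step h \<phi>) \<le> norm \<phi> * 1" for \<phi> using c by simp
  qed
qed (rule h)

end

section \<open>Consistency of the Gaussian step with the differential operator\<close>

context diffusion_coefficients
begin

text \<open>Under the Gaussian the vector \<open>S x *v v\<close> has covariance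
  \<open>S x ** transpose (S x) = A x\<close>.\<close>

lemma has_bochner_integral_gauss_trace:
  "has_bochner_integral lborel (\<lambda>v. gauss v * ((S x *v v) \<bullet> (H *v (S x *v v)))) (trace (A x ** H))"
proof -
  have row: "S x $ i \<bullet> S x $ j = A x $ i $ j" for i j
  proof -
    have "S x $ i \<bullet> S x $ j = (S x ** transpose (S x)) $ i $ j"
      by (simp add: matrix_matrix_mult_def transpose_def inner_vec_def)
    then show ?thesis by (simp add: S)
  qed
  have "has_bochner_integral lborel (\<lambda>v. \<Sum>i\<in>UNIV. \<Sum>j\<in>UNIV. H $ i $ j * (gauss v * ((S x $ i \<bullet> v) * (S x $ j \<bullet> v))))
     (\<Sum>i\<in>UNIV. \<Sum>j\<in>UNIV. H $ i $ j * (S x $ i \<bullet> S x $ j))"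
    by (intro has_bochner_integral_sum has_bochner_integral_mult_right has_bochner_integral_gauss_bilinear)
  moreover have "(\<Sum>i\<in>UNIV. \<Sum>j\<in>UNIV. H $ i $ j * (gauss v * ((S x $ i \<bullet> v) * (S x $ j \<bullet> v)))) =
      gauss v * ((S x *v v) \<bullet> (H *v (S x *v v)))" for v
  proof -
    have "(S x *v v) \<bullet> (H *v (S x *v v)) = (\<Sum>i\<in>UNIV. (S x $ i \<bullet> v) * (\<Sum>j\<in>UNIV. H $ i $ j * (S x $ j \<bullet> v)))"
      by (simp add: inner_vec_def[of "S x *v v"] matrix_vector_mul_component inner_vec_def[of "H $ _"])
    then show ?thesis by (simp only: sum_distrib_left mult_ac)
  qed
  moreover have "(\<Sum>i\<in>UNIV. \<Sum>j\<in>UNIV. H $ i $ j * (S x $ i \<bullet> S x $ j)) = trace (A x ** H)"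
  proof -
    have sym: "A x $ i $ j = A x $ j $ i" for i j
      using arg_cong[OF A_symmetric[of x], of "\<lambda>M. M $ j $ i"] by (simp add: transpose_def)
    have "trace (A x ** H) = (\<Sum>i\<in>UNIV. \<Sum>j\<in>UNIV. A x $ i $ j * H $ j $ i)"
      by (simp add: trace_def matrix_matrix_mult_def)
    moreover have "(\<Sum>i\<in>UNIV. \<Sum>j\<in>UNIV. A x $ i $ j * H $ j $ i) = (\<Sum>j\<in>UNIV. \<Sum>i\<in>UNIV. A x $ i $ j * H $ j $ i)"
      by (rule sum.swap)
    moreover have "(\<Sum>j\<in>UNIV. \<Sum>i\<in>UNIV. A x $ i $ j * H $ j $ i) = (\<Sum>i\<in>UNIV. \<Sum>j\<in>UNIV. H $ i $ j * (S x $ i \<bullet> S x $ j))"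
      unfolding row by (intro sum.cong refl) (simp add: sym mult.commute)
    ultimately show ?thesis by simp
  qed
  ultimately show ?thesis by simp
qed

definition displacement :: "real \<Rightarrow> real^'d \<Rightarrow> real^'d \<Rightarrow> real^'d" where
  "displacement h x v = sqrt (2 * h) *\<^sub>R (S x *v v) - h *\<^sub>R B x"

lemma measurable_displacement [measurable]: "displacement h x \<in> borel_measurable borel"
  unfolding displacement_def[abs_def] by measurable

lemma has_bochner_integral_displacement_linear:
  "has_bochner_integral lborel (\<lambda>v. gauss v * (g \<bullet> displacement h x v)) (- h * (B x \<bullet> g))"
proof -
  have "has_bochner_integral lborel (\<lambda>v. sqrt (2 * h) * (gauss v * ((S x *v g) \<bullet> v)) + (- h * (B x \<bullet> g)) * gauss v)
      (sqrt (2 * h) * 0 + (- h * (B x \<bullet> g)) * 1)"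
    by (intro has_bochner_integral_add has_bochner_integral_mult_right has_bochner_integral_gauss_linear has_bochner_integral_gauss)
  moreover have "sqrt (2 * h) * (gauss v * ((S x *v g) \<bullet> v)) + (- h * (B x \<bullet> g)) * gauss v = gauss v * (g \<bullet> displacement h x v)" for v
    unfolding S_inner[of x g v] displacement_def
    by (simp add: inner_diff_right inner_commute[of g "B x"] algebra_simps)
  ultimately show ?thesis by simp
qed

text \<open>The mixed terms are odd in v and vanish. The factor \<open>2 * h\<close> will meet the
  1/2 of the Taylor expansion, which leaves \<open>h * trace (A x ** H)\<close> as in the
  generator.\<close>

lemma has_bochner_integral_displacement_quadratic:
  assumes h: "0 < h"
  shows "has_bochner_integral lborel (\<lambda>v. gauss v * (displacement h x v \<bullet> (H *v displacement h x v)))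
     (2 * h * trace (A x ** H) + h\<^sup>2 * (B x \<bullet> (H *v B x)))"
proof -
  let ?p = "S x *v (H *v B x) + S x *v (transpose H *v B x)"
  have "has_bochner_integral lborel (\<lambda>v. (2 * h) * (gauss v * ((S x *v v) \<bullet> (H *v (S x *v v)))) +
        (- h * sqrt (2 * h)) * (gauss v * (?p \<bullet> v)) + (h\<^sup>2 * (B x \<bullet> (H *v B x))) * gauss v)
      ((2 * h) * trace (A x ** H) + (- h * sqrt (2 * h)) * 0 + (h\<^sup>2 * (B x \<bullet> (H *v B x))) * 1)"
    by (intro has_bochner_integral_add has_bochner_integral_mult_right has_bochner_integral_gauss_linear
        has_bochner_integral_gauss has_bochner_integral_gauss_trace)
  moreover have "(2 * h) * (gauss v * ((S x *v v) \<bullet> (H *v (S x *v v)))) +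
        (- h * sqrt (2 * h)) * (gauss v * (?p \<bullet> v)) + (h\<^sup>2 * (B x \<bullet> (H *v B x))) * gauss v
      = gauss v * (displacement h x v \<bullet> (H *v displacement h x v))" for v
  proof -
    define u where "u = S x *v v"
    define b where "b = B x"
    define s where "s = sqrt (2 * h)"
    have ss: "s * s = 2 * h" using h by (simp add: s_def)
    have p: "?p \<bullet> v = u \<bullet> (H *v b) + b \<bullet> (H *v u)"
      by (simp add: inner_add_left S_inner u_def b_def transpose_matrix_vector dot_lmul_matrix inner_commute[of "H *v B x"])
    have d: "displacement h x v \<bullet> (H *v displacement h x v) = (s *\<^sub>R u - h *\<^sub>R b) \<bullet> (H *v (s *\<^sub>R u - h *\<^sub>R b))"
      by (simp add: displacement_def u_def b_def s_def)
    have q: "displacement h x v \<bullet> (H *v displacement h x v) = (s * s) * (u \<bullet> (H *v u)) - h * s * (u \<bullet> (H *v b) + b \<bullet> (H *v u)) + h\<^sup>2 * (b \<bullet> (H *v b))"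
      unfolding d by (simp add: matrix_vector_mult_diff_distrib matrix_vector_mult_scaleR inner_diff_left inner_diff_right
          power2_eq_square algebra_simps)
    show ?thesis
      unfolding p q ss unfolding u_def[symmetric] b_def[symmetric] s_def[symmetric] by (simp add: algebra_simps)
  qed
  ultimately show ?thesis by simp
qed

lemma norm_displacement:
  assumes h: "0 < h" "h \<le> 1" and b: "\<And>x. norm (B x) \<le> b"
  shows "norm (displacement h x v) \<le> sqrt h * ((sqrt (2 * A\<^sub>0) + b) * (1 + norm v))"
proof -
  have b0: "0 \<le> b" using b[of 0] norm_ge_zero[of "B 0"] by linarith
  \<comment> \<open>For \<open>h \<le> 1\<close> the drift, of order h, is absorbed by the diffusive
    scale sqrt h.\<close>
  have hs: "h \<le> sqrt h" using h by (simp add: real_le_rsqrt power2_eq_square mult_left_le)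
  have "norm (displacement h x v) \<le> sqrt (2 * h) * norm (S x *v v) + h * norm (B x)"
    unfolding displacement_def using h by (intro order_trans[OF norm_triangle_ineq4]) simp
  also have "\<dots> \<le> sqrt (2 * h) * (sqrt A\<^sub>0 * norm v) + sqrt h * b"
    using h hs b[of x] b0 by (intro add_mono mult_left_mono norm_S mult_mono) auto
  also have "\<dots> = sqrt h * (sqrt (2 * A\<^sub>0) * norm v + b)"
    by (simp add: real_sqrt_mult algebra_simps)
  also have "\<dots> \<le> sqrt h * ((sqrt (2 * A\<^sub>0) + b) * (1 + norm v))"
  proof (intro mult_left_mono)
    have "0 \<le> sqrt (2 * A\<^sub>0)" using elliptic(1,2) by simp
    then show "sqrt (2 * A\<^sub>0) * norm v + b \<le> (sqrt (2 * A\<^sub>0) + b) * (1 + norm v)"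
      using b0 by (simp add: algebra_simps)
  qed (use h in simp)
  finally show ?thesis .
qed

lemma step_fun_displacement:
  assumes h: "0 < h"
  shows "step_fun h (apply_c0 \<phi>) x = exp (- h * C x) * (LINT v|lborel. gauss v * apply_c0 \<phi> (x + displacement h x v))"
  unfolding step_fun_def
  by (subst integral_kernel[OF h _ apply_c0_le_norm]) (auto simp: displacement_def algebra_simps)

lemma exp_minus_bounds:
  fixes y :: real
  assumes "0 \<le> y"
  shows "\<bar>exp (- y) - 1\<bar> \<le> y" "\<bar>exp (- y) - 1 + y\<bar> \<le> y\<^sup>2"
proof -
  have 1: "1 - y \<le> exp (- y)" using exp_ge_add_one_self[of "- y"] by simp
  have 2: "exp (- y) \<le> 1" using assms by simp
  show "\<bar>exp (- y) - 1\<bar> \<le> y" using 1 2 by linarith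
  have "exp (- y) * (1 + y) \<le> exp (- y) * exp y"
    using exp_ge_add_one_self[of y] by (intro mult_left_mono) auto
  also have "\<dots> = 1" by (simp add: exp_minus)
  also have "1 \<le> (1 - y + y\<^sup>2) * (1 + y)" using assms by (simp add: power2_eq_square algebra_simps)
  finally have "exp (- y) \<le> 1 - y + y\<^sup>2" using assms by (simp add: mult_le_cancel_right)
  then show "\<bar>exp (- y) - 1 + y\<bar> \<le> y\<^sup>2" using 1 by linarith
qed

text \<open>The displacement is of order sqrt h, so a remainder of order 2 + \<alpha> in it is of
  order h times h^(\<alpha>/2). The constant is independent of x because the Hoelder constants are
  global and the coefficients are bounded.\<close>

lemma taylor_expectation:
  assumes \<phi>: "\<phi> \<in> Cc_2_Hoelder \<alpha>" and \<alpha>: "0 < \<alpha>" "\<alpha> < 1"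
  shows "\<exists>c\<ge>0. \<forall>h x. 0 < h \<longrightarrow> h \<le> 1 \<longrightarrow>
     \<bar>(LINT v|lborel. gauss v * apply_c0 \<phi> (x + displacement h x v)) -
       (apply_c0 \<phi> x - h * (B x \<bullet> grad (apply_c0 \<phi>) x) + h * trace (A x ** hess (apply_c0 \<phi>) x)
        + h\<^sup>2 / 2 * (B x \<bullet> (hess (apply_c0 \<phi>) x *v B x)))\<bar> \<le> c * (h * h powr (\<alpha>/2))"
proof -
  let ?\<phi> = "apply_c0 \<phi>"
  have C2: "C2_fun ?\<phi>" using \<phi> by (simp add: Cc_2_Hoelder_def)
  obtain b where b: "0 \<le> b" "\<And>x. norm (B x) \<le> b" using bounded_drift by blast
  have "\<forall>i j. \<exists>K. \<forall>x y. \<bar>partial_deriv i (partial_deriv j ?\<phi>) x - partial_deriv i (partial_deriv j ?\<phi>) y\<bar> \<le> K * dist x y powr \<alpha>"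
    using \<phi> by (simp add: Cc_2_Hoelder_def)
  then obtain K' where K': "\<And>i j x y. \<bar>partial_deriv i (partial_deriv j ?\<phi>) x - partial_deriv i (partial_deriv j ?\<phi>) y\<bar> \<le> K' i j * dist x y powr \<alpha>"
    by metis
  \<comment> \<open>One Hoelder constant for all pairs of indices: the sum dominates each of the
    finitely many.\<close>
  define K where "K = (\<Sum>i\<in>UNIV. \<Sum>j\<in>UNIV. \<bar>K' i j\<bar>)"
  have K0: "0 \<le> K" by (simp add: K_def sum_nonneg)
  have K'K: "K' i j \<le> K" for i j
  proof -
    have "\<bar>K' i j\<bar> \<le> (\<Sum>j\<in>UNIV. \<bar>K' i j\<bar>)" by (rule member_le_sum) auto
    moreover have "(\<Sum>j\<in>UNIV. \<bar>K' i j\<bar>) \<le> K" unfolding K_def by (rule member_le_sum) (auto simp: sum_nonneg)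
    ultimately show ?thesis by linarith
  qed
  have K: "\<bar>partial_deriv i (partial_deriv j ?\<phi>) x - partial_deriv i (partial_deriv j ?\<phi>) y\<bar> \<le> K * dist x y powr \<alpha>" for i j x y
    using mult_right_mono[OF K'K[of i j], of "dist x y powr \<alpha>"] K'[of i j x y] by simp
  define M where "M = sqrt (2 * A\<^sub>0) + b"
  have M0: "0 \<le> M" using b elliptic(1,2) by (simp add: M_def)
  define N where "N = (LINT v|(lborel :: (real^'d) measure). gauss v * (1 + norm v) ^ 4)"
  define c where "c = K * (CARD('d))\<^sup>2 * (M\<^sup>2 * M powr \<alpha>) * N"
  have N0: "0 \<le> N" unfolding N_def by (rule integral_nonneg_AE) auto
  have c0: "0 \<le> c" using K0 N0 by (simp add: c_def)
  have main: "\<bar>(LINT v|lborel. gauss v * ?\<phi> (x + displacement h x v)) -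
       (?\<phi> x - h * (B x \<bullet> grad ?\<phi> x) + h * trace (A x ** hess ?\<phi> x) + h\<^sup>2 / 2 * (B x \<bullet> (hess ?\<phi> x *v B x)))\<bar> \<le> c * (h * h powr (\<alpha>/2))"
    if h: "0 < h" "h \<le> 1" for h x
  proof -
    define w where "w = displacement h x"
    define H where "H = hess ?\<phi> x"
    define P where "P v = ?\<phi> x + grad ?\<phi> x \<bullet> w v + 1/2 * (w v \<bullet> (H *v w v))" for v
    have [measurable]: "w \<in> borel_measurable borel" by (simp add: w_def)
    have Pint: "has_bochner_integral lborel (\<lambda>v. gauss v * P v)
       (?\<phi> x - h * (B x \<bullet> grad ?\<phi> x) + h * trace (A x ** H) + h\<^sup>2 / 2 * (B x \<bullet> (H *v B x)))"
    proof -
      have "has_bochner_integral lborel (\<lambda>v. ?\<phi> x * gauss v + gauss v * (grad ?\<phi> x \<bullet> w v) + 1/2 * (gauss v * (w v \<bullet> (H *v w v))))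
          (?\<phi> x * 1 + - h * (B x \<bullet> grad ?\<phi> x) + 1/2 * (2 * h * trace (A x ** H) + h\<^sup>2 * (B x \<bullet> (H *v B x))))"
        unfolding w_def
        by (intro has_bochner_integral_add has_bochner_integral_mult_right has_bochner_integral_gauss
            has_bochner_integral_displacement_linear has_bochner_integral_displacement_quadratic h)
      then show ?thesis by (simp add: P_def algebra_simps)
    qed
    have fint: "integrable lborel (\<lambda>v. gauss v * ?\<phi> (x + w v))"
      by (rule integrable_gauss_bounded[OF _ apply_c0_le_norm]) measurable
    have R: "\<bar>?\<phi> (x + w v) - P v\<bar> \<le> K * (CARD('d))\<^sup>2 * (M\<^sup>2 * M powr \<alpha>) * (h * h powr (\<alpha>/2)) * (1 + norm v) ^ 4" for v
    proof -
      have wM: "norm (w v) \<le> sqrt h * (M * (1 + norm v))"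
        unfolding w_def M_def by (rule norm_displacement[OF h b(2)])
      have "\<bar>?\<phi> (x + w v) - P v\<bar> \<le> K * (CARD('d))\<^sup>2 * (norm (w v))\<^sup>2 * norm (w v) powr \<alpha>"
        using taylor_Hoelder[OF C2 \<alpha>(1) K0 K, of x "w v"] by (simp add: P_def H_def algebra_simps)
      also have "\<dots> = (K * (CARD('d))\<^sup>2) * ((norm (w v))\<^sup>2 * norm (w v) powr \<alpha>)" by simp
      also have "\<dots> \<le> (K * (CARD('d))\<^sup>2) * ((M\<^sup>2 * M powr \<alpha>) * (h * h powr (\<alpha>/2)) * (1 + norm v) ^ 4)"
      proof (intro mult_left_mono)
        have "(norm (w v))\<^sup>2 * norm (w v) powr \<alpha> \<le> (sqrt h * (M * (1 + norm v)))\<^sup>2 * (sqrt h * (M * (1 + norm v))) powr \<alpha>"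
          using wM \<alpha> by (intro mult_mono power_mono powr_mono2) auto
        also have "(sqrt h * (M * (1 + norm v)))\<^sup>2 = h * (M\<^sup>2 * (1 + norm v)\<^sup>2)"
          using h by (simp add: power_mult_distrib)
        also have "(sqrt h * (M * (1 + norm v))) powr \<alpha> = sqrt h powr \<alpha> * (M powr \<alpha> * (1 + norm v) powr \<alpha>)"
          using h M0 by (simp add: powr_mult)
        also have "sqrt h powr \<alpha> = h powr (\<alpha>/2)"
          using h by (simp add: powr_half_sqrt[symmetric] powr_powr)
        finally have 1: "(norm (w v))\<^sup>2 * norm (w v) powr \<alpha> \<le> h * (M\<^sup>2 * (1 + norm v)\<^sup>2) * (h powr (\<alpha>/2) * (M powr \<alpha> * (1 + norm v) powr \<alpha>))" .
        have "(1 + norm v) powr \<alpha> \<le> (1 + norm v) powr 2" using \<alpha> by (intro powr_mono) auto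
        also have "\<dots> = (1 + norm v)\<^sup>2" using norm_ge_zero[of v] by (simp add: powr_numeral add_nonneg_pos)
        finally have 2: "(1 + norm v) powr \<alpha> \<le> (1 + norm v)\<^sup>2" .
        have "h * (M\<^sup>2 * (1 + norm v)\<^sup>2) * (h powr (\<alpha>/2) * (M powr \<alpha> * (1 + norm v) powr \<alpha>))
            \<le> h * (M\<^sup>2 * (1 + norm v)\<^sup>2) * (h powr (\<alpha>/2) * (M powr \<alpha> * (1 + norm v)\<^sup>2))"
          using h 2 by (intro mult_left_mono) auto
        also have "\<dots> = (M\<^sup>2 * M powr \<alpha>) * (h * h powr (\<alpha>/2)) * (1 + norm v) ^ 4"
          by (simp add: power2_eq_square power4_eq_xxxx mult_ac)
        finally show "(norm (w v))\<^sup>2 * norm (w v) powr \<alpha> \<le> (M\<^sup>2 * M powr \<alpha>) * (h * h powr (\<alpha>/2)) * (1 + norm v) ^ 4"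
          using 1 by linarith
      qed (use K0 in simp)
      finally show ?thesis by (simp add: mult_ac)
    qed
    let ?k = "K * (CARD('d))\<^sup>2 * (M\<^sup>2 * M powr \<alpha>) * (h * h powr (\<alpha>/2))"
    have dint: "integrable lborel (\<lambda>v. gauss v * (?\<phi> (x + w v) - P v))"
      using Bochner_Integration.integrable_diff[OF fint integrable.intros[OF Pint]] by (simp add: right_diff_distrib)
    have "(LINT v|lborel. gauss v * ?\<phi> (x + w v)) - (LINT v|lborel. gauss v * P v) = (LINT v|lborel. gauss v * (?\<phi> (x + w v) - P v))"
      using Bochner_Integration.integral_diff[OF fint integrable.intros[OF Pint]] by (simp add: right_diff_distrib)
    moreover have "(LINT v|lborel. \<bar>gauss v * (?\<phi> (x + w v) - P v)\<bar>) \<le> (LINT v|(lborel :: (real^'d) measure). ?k * (gauss v * (1 + norm v) ^ 4))"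
    proof (rule Bochner_Integration.integral_mono)
      show "integrable lborel (\<lambda>v. \<bar>gauss v * (?\<phi> (x + w v) - P v)\<bar>)" using dint by (rule integrable_abs)
      show "integrable lborel (\<lambda>v::real^'d. ?k * (gauss v * (1 + norm v) ^ 4))"
        by (intro integrable_mult_right integrable_gauss_shifted_norm4)
      fix v
      have "\<bar>gauss v * (?\<phi> (x + w v) - P v)\<bar> = gauss v * \<bar>?\<phi> (x + w v) - P v\<bar>" by (simp add: abs_mult)
      moreover have "\<dots> \<le> gauss v * (?k * (1 + norm v) ^ 4)"
        by (rule mult_left_mono[OF R]) simp
      ultimately show "\<bar>gauss v * (?\<phi> (x + w v) - P v)\<bar> \<le> ?k * (gauss v * (1 + norm v) ^ 4)"
        by (simp add: mult.left_commute)
    qed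
    moreover have "(LINT v|(lborel :: (real^'d) measure). ?k * (gauss v * (1 + norm v) ^ 4)) = c * (h * h powr (\<alpha>/2))"
      by (subst integral_mult_right_zero) (simp only: N_def c_def mult_ac)
    moreover have "\<bar>(LINT v|lborel. gauss v * (?\<phi> (x + w v) - P v))\<bar> \<le> (LINT v|lborel. \<bar>gauss v * (?\<phi> (x + w v) - P v)\<bar>)"
      by (rule integral_abs_bound)
    ultimately have "\<bar>(LINT v|lborel. gauss v * ?\<phi> (x + w v)) - (LINT v|lborel. gauss v * P v)\<bar> \<le> c * (h * h powr (\<alpha>/2))"
      by linarith
    then show ?thesis
      unfolding has_bochner_integral_integral_eq[OF Pint] by (simp add: w_def H_def)
  qed
  show ?thesis using c0 main by blast
qed

text \<open>Uniformity in x comes from the compact support of \<phi>: the drift and diffusion part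
  \<open>L\<close> and the quadratic drift term \<open>Q\<close> are continuous with compact
  support, hence bounded.\<close>

theorem gauss_step_consistent:
  assumes \<phi>: "\<phi> \<in> Cc_2_Hoelder \<alpha>" and \<alpha>: "0 < \<alpha>" "\<alpha> < 1"
    and \<psi>: "\<And>x. apply_c0 \<psi> x = diff_op A B C (apply_c0 \<phi>) x"
  shows "((\<lambda>h. (gauss_step h \<phi> - \<phi>) /\<^sub>R h) \<longlongrightarrow> \<psi>) (at_right 0)"
proof -
  let ?\<phi> = "apply_c0 \<phi>"
  define L where "L x = - (B x \<bullet> grad ?\<phi> x) + trace (A x ** hess ?\<phi> x)" for x
  define Q where "Q x = B x \<bullet> (hess ?\<phi> x *v B x)" for x
  obtain U where U: "compact U" "\<And>x. x \<notin> U \<Longrightarrow> ?\<phi> x = 0" "\<And>i x. x \<notin> U \<Longrightarrow> partial_deriv i ?\<phi> x = 0"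
    "\<And>i j x. x \<notin> U \<Longrightarrow> partial_deriv i (partial_deriv j ?\<phi>) x = 0"
    by (rule Cc_2_Hoelder_support[OF \<phi>]) blast
  have C2: "C2_fun ?\<phi>" using \<phi> by (simp add: Cc_2_Hoelder_def)
  have cont: "continuous_on UNIV (partial_deriv i ?\<phi>)" "continuous_on UNIV (partial_deriv i (partial_deriv j ?\<phi>))" for i j
    using C2 by (auto simp: C2_fun_def C1_fun_def)
  have cg: "continuous_on UNIV (grad ?\<phi>)" "continuous_on UNIV (hess ?\<phi>)"
    unfolding grad_def[abs_def] hess_def[abs_def] by (intro continuous_on_vec_lambda cont)+
  have zero: "grad ?\<phi> x = 0" "hess ?\<phi> x = 0" if "x \<notin> U" for x
    using U(3,4)[OF that] by (auto simp: grad_def hess_def vec_eq_iff)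
  have "continuous_on UNIV L"
    unfolding L_def trace_def matrix_matrix_mult_def vec_lambda_beta
    by (intro continuous_intros continuous_on_component continuous_coeffs cg)
  then obtain M1 where M1: "0 \<le> M1" "\<And>x. \<bar>L x\<bar> \<le> M1"
    using compact_support_bounded(1)[OF _ U(1), of L] zero by (auto simp: L_def trace_def matrix_matrix_mult_def)
  have "continuous_on UNIV Q"
    unfolding Q_def by (intro continuous_intros continuous_on_matrix_vector_mult continuous_coeffs cg)
  moreover have Q_zero: "Q x = 0" if "x \<notin> U" for x using zero(2)[OF that] by (simp add: Q_def)
  ultimately obtain M2 where M2: "0 \<le> M2" "\<And>x. \<bar>Q x\<bar> \<le> M2"
    using compact_support_bounded(1)[OF _ U(1), of Q] Q_zero by blast
  obtain c where c: "0 \<le> c" "\<And>h x. 0 < h \<Longrightarrow> h \<le> 1 \<Longrightarrow>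
     \<bar>(LINT v|lborel. gauss v * ?\<phi> (x + displacement h x v)) -
       (?\<phi> x - h * (B x \<bullet> grad ?\<phi> x) + h * trace (A x ** hess ?\<phi> x) + h\<^sup>2 / 2 * Q x)\<bar> \<le> c * (h * h powr (\<alpha>/2))"
    using taylor_expectation[OF \<phi> \<alpha>] unfolding Q_def by blast
  obtain m where m: "\<And>x. C x \<le> m"
    using bounded_coeffs(3) unfolding bounded_iff by (metis abs_le_iff rangeI real_norm_def)
  have m0: "0 \<le> m" using C_nonneg[of 0] m[of 0] by linarith
  \<comment> \<open>In this order: the Taylor part, the error of \<open>1 - h * C x\<close> as an
    approximation of the damping factor, and the product of the damping error with
    \<open>h * L x\<close>.\<close>
  define e where "e h = (h / 2 * M2 + c * h powr (\<alpha>/2)) + h * m\<^sup>2 * norm \<phi> + h * m * M1" for h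
  have bound: "norm ((gauss_step h \<phi> - \<phi>) /\<^sub>R h - \<psi>) \<le> e h" if h: "0 < h" "h \<le> 1" for h
  proof (rule norm_c0fun_le)
    fix x
    define E where "E = (LINT v|lborel. gauss v * ?\<phi> (x + displacement h x v))"
    define y where "y = h * C x"
    have y: "0 \<le> y" "y \<le> h * m" using h C_nonneg[of x] m[of x] by (auto simp: y_def)
    have E: "\<bar>E - ?\<phi> x - h * L x\<bar> \<le> h * (h / 2 * M2 + c * h powr (\<alpha>/2))"
    proof -
      define D where "D = E - (?\<phi> x - h * (B x \<bullet> grad ?\<phi> x) + h * trace (A x ** hess ?\<phi> x) + h\<^sup>2 / 2 * Q x)"
      have "E - ?\<phi> x - h * L x = D + h\<^sup>2 / 2 * Q x"
        by (simp add: D_def L_def algebra_simps)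
      moreover have "\<bar>D\<bar> \<le> c * (h * h powr (\<alpha>/2))" unfolding D_def E_def by (rule c(2)[OF h])
      moreover have "\<bar>h\<^sup>2 / 2 * Q x\<bar> \<le> h\<^sup>2 / 2 * M2" unfolding abs_mult using M2(2)[of x] by (intro mult_mono) auto
      ultimately have "\<bar>E - ?\<phi> x - h * L x\<bar> \<le> c * (h * h powr (\<alpha>/2)) + h\<^sup>2 / 2 * M2" by linarith
      then show ?thesis by (simp add: power2_eq_square algebra_simps)
    qed
    have F: "apply_c0 (gauss_step h \<phi>) x = exp (- y) * E"
      by (simp add: apply_gauss_step[OF h(1)] step_fun_displacement[OF h(1)] E_def y_def)
    have psi: "apply_c0 \<psi> x = L x - C x * ?\<phi> x"
      by (simp add: \<psi> diff_op_def L_def)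
    have split: "apply_c0 (gauss_step h \<phi>) x - ?\<phi> x - h * apply_c0 \<psi> x =
        exp (- y) * (E - ?\<phi> x - h * L x) + (exp (- y) - 1 + y) * ?\<phi> x + (exp (- y) - 1) * (h * L x)"
      unfolding F psi by (simp add: y_def algebra_simps)
    have "\<bar>apply_c0 (gauss_step h \<phi>) x - ?\<phi> x - h * apply_c0 \<psi> x\<bar> \<le>
        \<bar>exp (- y) * (E - ?\<phi> x - h * L x)\<bar> + \<bar>(exp (- y) - 1 + y) * ?\<phi> x\<bar> + \<bar>(exp (- y) - 1) * (h * L x)\<bar>"
      unfolding split by (rule order_trans[OF abs_triangle_ineq add_right_mono[OF abs_triangle_ineq]])
    moreover have "\<bar>exp (- y) * (E - ?\<phi> x - h * L x)\<bar> \<le> 1 * (h * (h / 2 * M2 + c * h powr (\<alpha>/2)))"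
      unfolding abs_mult using E y by (intro mult_mono) auto
    moreover have "\<bar>(exp (- y) - 1 + y) * ?\<phi> x\<bar> \<le> (h * m)\<^sup>2 * norm \<phi>"
      unfolding abs_mult
      by (intro mult_mono apply_c0_le_norm order_trans[OF exp_minus_bounds(2)[OF y(1)] power_mono[OF y(2) y(1)]]) auto
    moreover have "\<bar>(exp (- y) - 1) * (h * L x)\<bar> \<le> (h * m) * (h * M1)"
      unfolding abs_mult using y exp_minus_bounds(1)[OF y(1)] M1 h m0 by (intro mult_mono) auto
    ultimately have "\<bar>apply_c0 (gauss_step h \<phi>) x - ?\<phi> x - h * apply_c0 \<psi> x\<bar> \<le>
       1 * (h * (h / 2 * M2 + c * h powr (\<alpha>/2))) + (h * m)\<^sup>2 * norm \<phi> + (h * m) * (h * M1)" by linarith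
    also have "\<dots> = h * e h" by (simp add: e_def power2_eq_square algebra_simps)
    finally have *: "\<bar>apply_c0 (gauss_step h \<phi>) x - ?\<phi> x - h * apply_c0 \<psi> x\<bar> \<le> h * e h" .
    have "apply_c0 ((gauss_step h \<phi> - \<phi>) /\<^sub>R h - \<psi>) x = (apply_c0 (gauss_step h \<phi>) x - ?\<phi> x - h * apply_c0 \<psi> x) / h"
      using h by (simp add: divide_simps)
    then show "\<bar>apply_c0 ((gauss_step h \<phi> - \<phi>) /\<^sub>R h - \<psi>) x\<bar> \<le> e h"
      using * h by (simp add: divide_le_eq mult.commute)
  qed
  have "(e \<longlongrightarrow> (0 / 2 * M2 + c * 0) + 0 * m\<^sup>2 * norm \<phi> + 0 * m * M1) (at_right 0)"
    unfolding e_def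
    by (intro tendsto_intros tendsto_ident_at tendsto_zero_powrI[OF tendsto_ident_at tendsto_const])
      (use \<alpha> in \<open>auto simp: eventually_at_right_field intro!: exI[of _ 1]\<close>)
  then have "(e \<longlongrightarrow> 0) (at_right 0)" by simp
  moreover have "\<forall>\<^sub>F h in at_right 0. norm ((gauss_step h \<phi> - \<phi>) /\<^sub>R h - \<psi>) \<le> e h"
    using bound by (auto simp: eventually_at_right_field intro!: exI[of _ 1])
  ultimately have "((\<lambda>h. (gauss_step h \<phi> - \<phi>) /\<^sub>R h - \<psi>) \<longlongrightarrow> 0) (at_right 0)"
    by (rule Lim_null_comparison[rotated])
  then show ?thesis by (simp add: LIM_zero_iff)
qed

end

section \<open>Path integrals as iterates of the Gaussian step\<close>

context diffusion_coefficients
begin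

definition path_weight :: "real \<Rightarrow> nat \<Rightarrow> (nat \<Rightarrow> real^'d) \<Rightarrow> real" where
  "path_weight h n y = (\<Prod>j=1..n. kernel h (y (j - 1)) (y j))"

lemma path_weight_Suc: "path_weight h (Suc n) y = path_weight h n y * kernel h (y n) (y (Suc n))"
  by (simp add: path_weight_def)

lemma path_weight_nonneg: "0 < h \<Longrightarrow> 0 \<le> path_weight h n y"
  unfolding path_weight_def by (intro prod_nonneg ballI kernel_nonneg)

lemma path_weight_cong: "(\<And>k. k \<le> n \<Longrightarrow> y k = z k) \<Longrightarrow> path_weight h n y = path_weight h n z"
  unfolding path_weight_def by (intro prod.cong refl arg_cong2[where f = "kernel h"]) auto

text \<open>Index 0 carries the fixed starting point and is not a coordinate of the product space,
  hence the case distinction.\<close>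

lemma measurable_path_coordinate:
  fixes k n :: nat
  assumes "k \<le> n"
  shows "(\<lambda>x. (x(0 := x\<^sub>0)) k) \<in> (\<Pi>\<^sub>M j\<in>{1..n}. lborel) \<rightarrow>\<^sub>M (borel :: (real^'d) measure)"
proof (cases "k = 0")
  case False
  then have "(\<lambda>x. x k) \<in> (\<Pi>\<^sub>M j\<in>{1..n}. lborel) \<rightarrow>\<^sub>M (lborel :: (real^'d) measure)"
    using assms by (intro measurable_component_singleton) (auto simp: Suc_le_eq)
  then show ?thesis using False by simp
qed simp

lemma measurable_path_weight:
  assumes [measurable]: "h \<in> borel_measurable N" and X: "X \<in> N \<rightarrow>\<^sub>M (\<Pi>\<^sub>M j\<in>{1..n}. lborel)"
  shows "(\<lambda>\<omega>. path_weight (h \<omega>) n ((X \<omega>)(0 := x\<^sub>0))) \<in> borel_measurable N"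
  unfolding path_weight_def
proof (rule borel_measurable_prod)
  fix j assume "j \<in> {1..n}"
  then have "(\<lambda>\<omega>. ((X \<omega>)(0 := x\<^sub>0)) (j - 1)) \<in> borel_measurable N" "(\<lambda>\<omega>. ((X \<omega>)(0 := x\<^sub>0)) j) \<in> borel_measurable N"
    using measurable_compose[OF X measurable_path_coordinate[of "j - 1" n x\<^sub>0]]
      measurable_compose[OF X measurable_path_coordinate[of j n x\<^sub>0]] by auto
  then show "(\<lambda>\<omega>. kernel (h \<omega>) (((X \<omega>)(0 := x\<^sub>0)) (j - 1)) (((X \<omega>)(0 := x\<^sub>0)) j)) \<in> borel_measurable N"
    by (intro measurable_kernel assms(1))
qed

lemma path_update:
  assumes "n < k"
  shows "path_weight h n ((x(k := y))(0 := x\<^sub>0)) = path_weight h n (x(0 := x\<^sub>0))"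
    "((x(k := y))(0 := x\<^sub>0)) n = (x(0 := x\<^sub>0)) n"
  using assms by (auto intro!: path_weight_cong)

text \<open>Integrating over the last point leaves the factor \<open>exp (- h * C)\<close> at the
  previous one, which is at most 1 since \<open>C\<close> is nonnegative.\<close>

lemma nn_integral_path_weight:
  assumes h: "0 < h"
  shows "(\<integral>\<^sup>+x. ennreal (path_weight h n (x(0 := x\<^sub>0))) \<partial>(\<Pi>\<^sub>M j\<in>{1..n}. lborel)) \<le> 1"
proof (induction n)
  case 0
  show ?case by (simp add: PiM_empty nn_integral_count_space_finite path_weight_def)
next
  case (Suc n)
  interpret product_sigma_finite "\<lambda>_::nat. lborel :: (real^'d) measure" ..
  have ins: "{1..Suc n} = insert (Suc n) {1..n}" by auto
  have m: "(\<lambda>x. ennreal (path_weight h (Suc n) (x(0 := x\<^sub>0)))) \<in> borel_measurable (\<Pi>\<^sub>M j\<in>insert (Suc n) {1..n}. lborel)"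
    using measurable_path_weight[of "\<lambda>_. h" "\<Pi>\<^sub>M j\<in>{1..Suc n}. lborel" "\<lambda>x. x" "Suc n" x\<^sub>0] unfolding ins by simp
  have "(\<integral>\<^sup>+x. ennreal (path_weight h (Suc n) (x(0 := x\<^sub>0))) \<partial>(\<Pi>\<^sub>M j\<in>{1..Suc n}. lborel)) =
     (\<integral>\<^sup>+x. (\<integral>\<^sup>+y. ennreal (path_weight h (Suc n) ((x(Suc n := y))(0 := x\<^sub>0))) \<partial>lborel) \<partial>(\<Pi>\<^sub>M j\<in>{1..n}. lborel))"
    unfolding ins by (rule product_nn_integral_insert[OF _ _ m]) auto
  moreover have "\<dots> \<le> (\<integral>\<^sup>+x. ennreal (path_weight h n (x(0 := x\<^sub>0))) \<partial>(\<Pi>\<^sub>M j\<in>{1..n}. lborel))"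
  proof (rule nn_integral_mono)
    fix x
    have "(\<integral>\<^sup>+y. ennreal (path_weight h (Suc n) ((x(Suc n := y))(0 := x\<^sub>0))) \<partial>lborel) =
        (\<integral>\<^sup>+y. ennreal (path_weight h n (x(0 := x\<^sub>0))) * ennreal (kernel h ((x(0 := x\<^sub>0)) n) y) \<partial>lborel)"
      unfolding path_weight_Suc path_update[OF lessI]
      by (simp add: ennreal_mult[OF path_weight_nonneg[OF h] kernel_nonneg[OF h]])
    also have "\<dots> = ennreal (path_weight h n (x(0 := x\<^sub>0))) * ennreal (exp (- h * C ((x(0 := x\<^sub>0)) n)))"
      by (subst nn_integral_cmult) (simp_all only: kernel_mass(3)[OF h], measurable)
    also have "\<dots> \<le> ennreal (path_weight h n (x(0 := x\<^sub>0))) * 1"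
      using h C_nonneg[of "(x(0 := x\<^sub>0)) n"] by (intro mult_left_mono) (auto simp del: fun_upd_apply)
    finally show "(\<integral>\<^sup>+y. ennreal (path_weight h (Suc n) ((x(Suc n := y))(0 := x\<^sub>0))) \<partial>lborel)
        \<le> ennreal (path_weight h n (x(0 := x\<^sub>0)))" by simp
  qed
  ultimately have "(\<integral>\<^sup>+x. ennreal (path_weight h (Suc n) (x(0 := x\<^sub>0))) \<partial>(\<Pi>\<^sub>M j\<in>{1..Suc n}. lborel))
      \<le> (\<integral>\<^sup>+x. ennreal (path_weight h n (x(0 := x\<^sub>0))) \<partial>(\<Pi>\<^sub>M j\<in>{1..n}. lborel))"
    by (simp only:)
  then show ?case using Suc by (rule order_trans)
qed

lemma integrable_path:
  assumes h: "0 < h"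
  shows "integrable (\<Pi>\<^sub>M j\<in>{1..n}. lborel) (\<lambda>x. path_weight h n (x(0 := x\<^sub>0)) * apply_c0 \<phi> ((x(0 := x\<^sub>0)) n))"
proof (rule integrableI_bounded)
  let ?P = "\<Pi>\<^sub>M j\<in>{1..n}. (lborel :: (real^'d) measure)"
  have m: "(\<lambda>x. path_weight h n (x(0 := x\<^sub>0))) \<in> borel_measurable ?P"
    using measurable_path_weight[of "\<lambda>_. h" ?P "\<lambda>x. x" n x\<^sub>0] by simp
  have m2: "(\<lambda>x. apply_c0 \<phi> ((x(0 := x\<^sub>0)) n)) \<in> borel_measurable ?P"
    by (rule measurable_compose[OF measurable_path_coordinate[OF order_refl] measurable_apply_c0])
  show "(\<lambda>x. path_weight h n (x(0 := x\<^sub>0)) * apply_c0 \<phi> ((x(0 := x\<^sub>0)) n)) \<in> borel_measurable ?P"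
    by (rule borel_measurable_times[OF m m2])
  have "(\<integral>\<^sup>+x. ennreal (norm (path_weight h n (x(0 := x\<^sub>0)) * apply_c0 \<phi> ((x(0 := x\<^sub>0)) n))) \<partial>?P)
      \<le> (\<integral>\<^sup>+x. ennreal (norm \<phi>) * ennreal (path_weight h n (x(0 := x\<^sub>0))) \<partial>?P)"
  proof (rule nn_integral_mono)
    fix x :: "nat \<Rightarrow> real^'d"
    let ?z = "x(0 := x\<^sub>0)"
    have "norm (path_weight h n ?z * apply_c0 \<phi> (?z n)) = path_weight h n ?z * \<bar>apply_c0 \<phi> (?z n)\<bar>"
      using path_weight_nonneg[OF h, of n ?z] by (simp only: real_norm_def abs_mult abs_of_nonneg)
    moreover have "\<dots> \<le> path_weight h n ?z * norm \<phi>"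
      by (intro mult_left_mono apply_c0_le_norm path_weight_nonneg h)
    ultimately have "norm (path_weight h n ?z * apply_c0 \<phi> (?z n)) \<le> norm \<phi> * path_weight h n ?z" by (simp only: mult.commute)
    then show "ennreal (norm (path_weight h n ?z * apply_c0 \<phi> (?z n))) \<le> ennreal (norm \<phi>) * ennreal (path_weight h n ?z)"
      by (subst ennreal_mult[symmetric, OF norm_ge_zero path_weight_nonneg[OF h]]) (rule ennreal_leI)
  qed
  also have "\<dots> = ennreal (norm \<phi>) * (\<integral>\<^sup>+x. ennreal (path_weight h n (x(0 := x\<^sub>0))) \<partial>?P)"
    by (rule nn_integral_cmult) (use m in measurable)
  also have "\<dots> \<le> ennreal (norm \<phi>) * 1"
    by (intro mult_left_mono nn_integral_path_weight h) auto
  also have "\<dots> < \<infinity>" by simp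
  finally show "(\<integral>\<^sup>+x. ennreal (norm (path_weight h n (x(0 := x\<^sub>0)) * apply_c0 \<phi> ((x(0 := x\<^sub>0)) n))) \<partial>?P) < \<infinity>" .
qed

text \<open>Integrating over the last point replaces \<phi> by \<open>gauss_step h \<phi>\<close>
  and shortens the path by one; the induction therefore runs over all \<phi> simultaneously.\<close>

lemma integral_path:
  assumes h: "0 < h"
  shows "(LINT x|(\<Pi>\<^sub>M j\<in>{1..n}. lborel). path_weight h n (x(0 := x\<^sub>0)) * apply_c0 \<phi> ((x(0 := x\<^sub>0)) n))
    = apply_c0 ((gauss_step h ^^ n) \<phi>) x\<^sub>0"
proof (induction n arbitrary: \<phi>)
  case 0
  show ?case by (simp add: PiM_empty lebesgue_integral_count_space_finite path_weight_def)
next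
  case (Suc n)
  interpret product_sigma_finite "\<lambda>_::nat. lborel :: (real^'d) measure" ..
  have ins: "{1..Suc n} = insert (Suc n) {1..n}" by auto
  let ?g = "\<lambda>x. path_weight h (Suc n) (x(0 := x\<^sub>0)) * apply_c0 \<phi> ((x(0 := x\<^sub>0)) (Suc n))"
  have "integral\<^sup>L (\<Pi>\<^sub>M j\<in>{1..Suc n}. lborel) ?g = (LINT x|(\<Pi>\<^sub>M j\<in>{1..n}. lborel). LINT y|lborel. ?g (x(Suc n := y)))"
    using integrable_path[OF h, of "Suc n" x\<^sub>0 \<phi>] unfolding ins
    by (intro product_integral_insert) auto
  moreover have "(LINT y|lborel. ?g (x(Suc n := y))) = path_weight h n (x(0 := x\<^sub>0)) * apply_c0 (gauss_step h \<phi>) ((x(0 := x\<^sub>0)) n)" for x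
  proof -
    have "?g (x(Suc n := y)) = path_weight h n (x(0 := x\<^sub>0)) * (kernel h ((x(0 := x\<^sub>0)) n) y * apply_c0 \<phi> y)" for y
      unfolding path_weight_Suc path_update[OF lessI] by simp
    then show ?thesis
      unfolding apply_gauss_step[OF h] step_fun_def by (simp only: integral_mult_right_zero)
  qed
  ultimately have "integral\<^sup>L (\<Pi>\<^sub>M j\<in>{1..Suc n}. lborel) ?g =
      (LINT x|(\<Pi>\<^sub>M j\<in>{1..n}. lborel). path_weight h n (x(0 := x\<^sub>0)) * apply_c0 (gauss_step h \<phi>) ((x(0 := x\<^sub>0)) n))"
    by (simp only:)
  then show ?case unfolding Suc.IH by (simp only: funpow_Suc_right o_apply)
qed

lemma path_integrand_eq:
  "path_integrand A B C f n \<tau> y = path_weight (\<tau> / real n) n y * f (y n)"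
proof -
  have "exp (- (\<tau> / real n) * (\<Sum>j=1..n. C (y (j - 1)) + 1 / 4 * (norm (matrix_sqrt (AI (y (j - 1))) *v B (y (j - 1))))\<^sup>2)) =
    (\<Prod>j=1..n. exp (- (\<tau> / real n) * (C (y (j - 1)) + 1 / 4 * (norm (matrix_sqrt (AI (y (j - 1))) *v B (y (j - 1))))\<^sup>2)))"
    by (simp only: sum_distrib_left exp_sum finite_atLeastAtMost)
  moreover have "exp (1 / 2 * (\<Sum>j=1..n. (AI (y (j - 1)) *v B (y (j - 1))) \<bullet> (y (j - 1) - y j))) =
    (\<Prod>j=1..n. exp (1 / 2 * ((AI (y (j - 1)) *v B (y (j - 1))) \<bullet> (y (j - 1) - y j))))"
    by (simp only: sum_distrib_left exp_sum finite_atLeastAtMost)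
  ultimately show ?thesis
    unfolding path_integrand_def path_weight_def kernel_def by (simp only: prod.distrib)
qed

lemma integral_path_integrand:
  assumes "0 < \<tau>" "0 < n"
  shows "(LINT x|(\<Pi>\<^sub>M j\<in>{1..n}. lborel). path_integrand A B C (apply_c0 \<phi>) n \<tau> (x(0 := x\<^sub>0)) * q) =
     apply_c0 ((gauss_step (\<tau> / real n) ^^ n) \<phi>) x\<^sub>0 * q"
  using integral_path[of "\<tau> / real n" n x\<^sub>0 \<phi>] assms
  by (simp add: path_integrand_eq del: fun_upd_apply)

text \<open>Measurability in \<tau> comes from the representation as a parameter integral with
  jointly measurable integrand. The indicator removes \<tau> \<le> 0, where
  \<open>gauss_step\<close> is unspecified.\<close>

lemma measurable_gauss_step_iterate:
  "(\<lambda>\<tau>. indicator {0<..} \<tau> * apply_c0 ((gauss_step (\<tau> / real n) ^^ n) \<phi>) x\<^sub>0) \<in> borel_measurable borel"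
proof (cases "n = 0")
  case False
  interpret product_sigma_finite "\<lambda>_::nat. lborel :: (real^'d) measure" ..
  interpret P: sigma_finite_measure "\<Pi>\<^sub>M j\<in>{1..n}. (lborel :: (real^'d) measure)"
    by (rule sigma_finite) simp
  let ?P = "\<Pi>\<^sub>M j\<in>{1..n}. (lborel :: (real^'d) measure)"
  have m1: "(\<lambda>\<omega>. path_weight (fst \<omega> / real n) n ((snd \<omega>)(0 := x\<^sub>0))) \<in> borel_measurable (borel \<Otimes>\<^sub>M ?P)"
    by (rule measurable_path_weight) measurable
  have m2: "(\<lambda>\<omega>. apply_c0 \<phi> (((snd \<omega>)(0 := x\<^sub>0)) n)) \<in> borel_measurable (borel \<Otimes>\<^sub>M ?P)"
    by (rule measurable_compose[OF measurable_snd measurable_compose[OF measurable_path_coordinate[OF order_refl] measurable_apply_c0]])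
  have "(\<lambda>\<tau>. LINT x|?P. path_weight (\<tau> / real n) n (x(0 := x\<^sub>0)) * apply_c0 \<phi> ((x(0 := x\<^sub>0)) n)) \<in> borel_measurable borel"
    using borel_measurable_times[OF m1 m2]
    by (intro P.borel_measurable_lebesgue_integral) (simp add: case_prod_beta' del: fun_upd_apply)
  then have "(\<lambda>\<tau>. indicator {0<..} \<tau> * (LINT x|?P. path_weight (\<tau> / real n) n (x(0 := x\<^sub>0)) * apply_c0 \<phi> ((x(0 := x\<^sub>0)) n))) \<in> borel_measurable (borel :: real measure)"
    by measurable
  moreover have "indicator {0<..} \<tau> * (LINT x|?P. path_weight (\<tau> / real n) n (x(0 := x\<^sub>0)) * apply_c0 \<phi> ((x(0 := x\<^sub>0)) n))
      = indicator {0<..} \<tau> * apply_c0 ((gauss_step (\<tau> / real n) ^^ n) \<phi>) x\<^sub>0" for \<tau> :: real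
    using integral_path[of "\<tau> / real n" n x\<^sub>0 \<phi>] False by (cases "0 < \<tau>") (auto simp del: fun_upd_apply)
  ultimately show ?thesis by (simp only:)
qed simp

end

section \<open>Differentiation under the integral sign\<close>

text \<open>The mean value inequality on the convex set \<open>U\<close> dominates the difference
  quotients by a multiple of \<open>w\<close>, so dominated convergence applies along sequences. The
  bilinear map \<open>m\<close> covers real parameters with \<open>scaleR\<close> and complex ones
  with multiplication at once.\<close>

lemma has_derivative_lebesgue_integral:
  fixes f D :: "'k::real_normed_vector \<Rightarrow> 'a \<Rightarrow> 'b::{banach, second_countable_topology}"
    and m :: "'k \<Rightarrow> 'b \<Rightarrow> 'b"
  assumes m: "bounded_bilinear m" and U: "open U" "convex U" "t\<^sub>0 \<in> U"
    and int: "\<And>t. t \<in> U \<Longrightarrow> integrable M (f t)"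
    and D: "D t\<^sub>0 \<in> borel_measurable M"
    and der: "AE x in M. \<forall>t\<in>U. ((\<lambda>t. f t x) has_derivative (\<lambda>h. m h (D t x))) (at t)"
    and bound: "AE x in M. \<forall>t\<in>U. norm (D t x) \<le> w x" and w: "integrable M w"
  shows "integrable M (D t\<^sub>0)" "((\<lambda>t. LINT x|M. f t x) has_derivative (\<lambda>h. m h (LINT x|M. D t\<^sub>0 x))) (at t\<^sub>0)"
proof -
  interpret m: bounded_bilinear m by fact
  obtain K where K: "K > 0" "\<And>a b. norm (m a b) \<le> norm a * norm b * K"
    using m.pos_bounded by blast
  show Dint: "integrable M (D t\<^sub>0)"
  proof (rule Bochner_Integration.integrable_bound[OF w D])
    show "AE x in M. norm (D t\<^sub>0 x) \<le> norm (w x)"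
      using bound
    proof eventually_elim
      case (elim x)
      then have "norm (D t\<^sub>0 x) \<le> w x" using U(3) by blast
      then show ?case unfolding real_norm_def by linarith
    qed
  qed
  let ?E = "\<lambda>t x. (1 / norm (t - t\<^sub>0)) *\<^sub>R (f t x - (f t\<^sub>0 x + m (t - t\<^sub>0) (D t\<^sub>0 x)))"
  have mint: "integrable M (\<lambda>x. m h (D t\<^sub>0 x))" "(LINT x|M. m h (D t\<^sub>0 x)) = m h (LINT x|M. D t\<^sub>0 x)" for h
    using integrable_bounded_linear[OF m.bounded_linear_right Dint] integral_bounded_linear[OF m.bounded_linear_right Dint]
    by auto
  have Eint: "(LINT x|M. ?E t x) = (1 / norm (t - t\<^sub>0)) *\<^sub>R ((LINT x|M. f t x) - ((LINT x|M. f t\<^sub>0 x) + m (t - t\<^sub>0) (LINT x|M. D t\<^sub>0 x)))"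
    if "t \<in> U" for t
    using int[OF that] int[OF U(3)] mint(1)[of "t - t\<^sub>0"] mint(2)[of "t - t\<^sub>0"] by simp
  have lim: "((\<lambda>t. LINT x|M. ?E t x) \<longlongrightarrow> 0) (at t\<^sub>0 within U)"
    unfolding tendsto_at_iff_sequentially
  proof (intro allI impI)
    fix X assume X: "\<forall>i. X i \<in> U - {t\<^sub>0}" "X \<longlonglongrightarrow> t\<^sub>0"
    have "(\<lambda>i. LINT x|M. ?E (X i) x) \<longlonglongrightarrow> (LINT x|M. 0)"
    proof (rule integral_dominated_convergence[where w = "\<lambda>x. 2 * K * w x"])
      show "integrable M (\<lambda>x. 2 * K * w x)" using w by simp
      show "?E (X i) \<in> borel_measurable M" for i
        using int[of "X i"] int[OF U(3)] mint(1)[of "X i - t\<^sub>0"] X(1) by (intro borel_measurable_integrable) auto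
      show "AE x in M. (\<lambda>i. ?E (X i) x) \<longlonglongrightarrow> 0"
        using der
      proof eventually_elim
        case (elim x)
        then have "((\<lambda>t. ?E t x) \<longlongrightarrow> 0) (at t\<^sub>0)"
          using U(3) by (auto simp: has_derivative_within)
        moreover have "filterlim X (at t\<^sub>0) sequentially"
          using X by (auto simp: filterlim_at)
        ultimately show ?case by (rule filterlim_compose)
      qed
      show "AE x in M. norm (?E (X i) x) \<le> 2 * K * w x" for i
        using der bound
      proof eventually_elim
        case (elim x)
        let ?t = "X i"
        have t: "?t \<in> U" "norm (?t - t\<^sub>0) > 0" using X(1) by auto
        have w0: "0 \<le> w x" using elim(2) U(3) norm_ge_zero order_trans by blast
        have "norm (f ?t x - f t\<^sub>0 x) \<le> (K * w x) * norm (?t - t\<^sub>0)"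
        proof (rule differentiable_bound[OF U(2) _ _ t(1) U(3)])
          fix t assume tU: "t \<in> U"
          then show "((\<lambda>t. f t x) has_derivative (\<lambda>h. m h (D t x))) (at t within U)"
            using elim(1) by (blast intro: has_derivative_at_withinI)
          show "onorm (\<lambda>h. m h (D t x)) \<le> K * w x"
          proof (rule onorm_bound)
            fix h
            have "norm (m h (D t x)) \<le> norm h * norm (D t x) * K" by (rule K(2))
            also have "\<dots> \<le> norm h * w x * K"
              using elim(2) tU K(1) by (intro mult_right_mono mult_left_mono) auto
            finally show "norm (m h (D t x)) \<le> K * w x * norm h" by (simp add: mult_ac)
          qed (use K w0 in auto)
        qed
        moreover have "norm (m (?t - t\<^sub>0) (D t\<^sub>0 x)) \<le> (K * w x) * norm (?t - t\<^sub>0)"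
        proof -
          have "norm (m (?t - t\<^sub>0) (D t\<^sub>0 x)) \<le> norm (?t - t\<^sub>0) * norm (D t\<^sub>0 x) * K" by (rule K(2))
          also have "\<dots> \<le> norm (?t - t\<^sub>0) * w x * K"
            using elim(2) U(3) K(1) by (intro mult_right_mono mult_left_mono) auto
          finally show ?thesis by (simp add: mult_ac)
        qed
        moreover have "norm (f ?t x - (f t\<^sub>0 x + m (?t - t\<^sub>0) (D t\<^sub>0 x))) \<le> norm (f ?t x - f t\<^sub>0 x) + norm (m (?t - t\<^sub>0) (D t\<^sub>0 x))"
          unfolding diff_diff_eq[symmetric] by (rule norm_triangle_ineq4)
        ultimately have "norm (f ?t x - (f t\<^sub>0 x + m (?t - t\<^sub>0) (D t\<^sub>0 x))) \<le> 2 * K * w x * norm (?t - t\<^sub>0)" by linarith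
        then show ?case using t(2) by (simp add: divide_le_eq)
      qed
    qed simp
    then show "((\<lambda>t. LINT x|M. ?E t x) \<circ> X) \<longlonglongrightarrow> 0" by (simp add: o_def)
  qed
  have "((\<lambda>t. (1 / norm (t - t\<^sub>0)) *\<^sub>R ((LINT x|M. f t x) - ((LINT x|M. f t\<^sub>0 x) + m (t - t\<^sub>0) (LINT x|M. D t\<^sub>0 x)))) \<longlongrightarrow> 0) (at t\<^sub>0 within U)"
    by (rule Lim_transform_within[OF lim zero_less_one]) (use Eint in auto)
  then have "((\<lambda>t. LINT x|M. f t x) has_derivative (\<lambda>h. m h (LINT x|M. D t\<^sub>0 x))) (at t\<^sub>0 within U)"
    unfolding has_derivative_within using m.bounded_linear_left by blast
  then show "((\<lambda>t. LINT x|M. f t x) has_derivative (\<lambda>h. m h (LINT x|M. D t\<^sub>0 x))) (at t\<^sub>0)"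
    using at_within_open[OF U(3,1)] by simp
qed

corollary has_vector_derivative_lebesgue_integral:
  fixes f D :: "real \<Rightarrow> 'a \<Rightarrow> 'b::{banach, second_countable_topology}"
  assumes "open U" "convex U" "t\<^sub>0 \<in> U" "\<And>t. t \<in> U \<Longrightarrow> integrable M (f t)" "D t\<^sub>0 \<in> borel_measurable M"
    and "AE x in M. \<forall>t\<in>U. ((\<lambda>t. f t x) has_vector_derivative D t x) (at t)"
    and "AE x in M. \<forall>t\<in>U. norm (D t x) \<le> w x" "integrable M w"
  shows "((\<lambda>t. LINT x|M. f t x) has_vector_derivative (LINT x|M. D t\<^sub>0 x)) (at t\<^sub>0)"
  using has_derivative_lebesgue_integral(2)[where m = scaleR and f = f and D = D and U = U and w = w, OF bounded_bilinear_scaleR assms(1-5)] assms(6-)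
  by (simp add: has_vector_derivative_def)

corollary has_field_derivative_lebesgue_integral:
  fixes f D :: "complex \<Rightarrow> 'a \<Rightarrow> complex"
  assumes "open U" "convex U" "t\<^sub>0 \<in> U" "\<And>t. t \<in> U \<Longrightarrow> integrable M (f t)" "D t\<^sub>0 \<in> borel_measurable M"
    and "AE x in M. \<forall>t\<in>U. ((\<lambda>t. f t x) has_field_derivative D t x) (at t)"
    and "AE x in M. \<forall>t\<in>U. norm (D t x) \<le> w x" "integrable M w"
  shows "((\<lambda>t. LINT x|M. f t x) has_field_derivative (LINT x|M. D t\<^sub>0 x)) (at t\<^sub>0)"
  using has_derivative_lebesgue_integral(2)[where m = "\<lambda>h d. d * h" and f = f and D = D and U = U and w = w,
      OF bounded_bilinear.flip[OF bounded_bilinear_mult] assms(1-5)] assms(6-)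
  by (simp add: has_field_derivative_def)

section \<open>The Laplace exponent in a sector\<close>

text \<open>The angle \<open>\<theta>\<close> is chosen so that the ray \<open>arg s = \<theta>\<close> lies in the left half plane, whereas \<open>s\<^sup>\<beta>\<close> still has
  positive real part on it for all orders \<open>\<beta>\<close> carrying mass.\<close>

locale order_mixture =
  fixes \<mu> :: "real measure" and b\<^sub>0 b\<^sub>1 \<theta> :: real
  assumes finite_\<mu>: "finite_measure \<mu>" and sets_\<mu> [measurable_cong]: "sets \<mu> = sets borel"
    and \<mu>_nonzero: "emeasure \<mu> (space \<mu>) \<noteq> 0"
    and b: "0 < b\<^sub>0" "b\<^sub>0 \<le> b\<^sub>1" "b\<^sub>1 < 1"
    and supp: "AE \<beta> in \<mu>. \<beta> \<in> {b\<^sub>0..b\<^sub>1}"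
    and \<theta>: "pi / 2 < \<theta>" "\<theta> < pi" "b\<^sub>1 * \<theta> < pi / 2"
begin

sublocale finite_measure \<mu> by (rule finite_\<mu>)

text \<open>The function f^mu continued to the plane cut along the nonpositive reals, by the
  principal branch of s^\<beta>. As \<mu> is concentrated on \<open>{b\<^sub>0..b\<^sub>1}\<close>,
  integrating over its whole space agrees with integrating over (0,1).\<close>

definition cexponent :: "complex \<Rightarrow> complex" where
  "cexponent s = (LINT \<beta>|\<mu>. exp (of_real \<beta> * Ln s))"

lemma norm_exp_Ln: "s \<noteq> 0 \<Longrightarrow> norm (exp (of_real \<beta> * Ln s)) = norm s powr \<beta>"
  by (simp add: powr_def norm_exp_eq_Re)

lemma powr_bound: "0 < a \<Longrightarrow> \<beta> \<in> {b\<^sub>0..b\<^sub>1} \<Longrightarrow> a powr \<beta> \<le> max 1 a"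
proof -
  assume a: "0 < a" and \<beta>: "\<beta> \<in> {b\<^sub>0..b\<^sub>1}"
  show "a powr \<beta> \<le> max 1 a"
  proof (cases "a \<le> 1")
    case True
    then show ?thesis using a \<beta> b by (simp add: powr_le1 max_absorb1)
  next
    case False
    then have "a powr \<beta> \<le> a powr 1" using \<beta> b by (intro powr_mono) auto
    then show ?thesis using False a by (simp add: max_absorb2)
  qed
qed

lemma norm_exp_Ln_bound:
  assumes "s \<noteq> 0" "\<beta> \<in> {b\<^sub>0..b\<^sub>1}"
  shows "norm (exp (of_real \<beta> * Ln s)) \<le> max 1 (norm s)"
  unfolding norm_exp_Ln[OF assms(1)] using assms by (intro powr_bound) auto

lemma integrable_cexponent:
  assumes "s \<noteq> 0"
  shows "integrable \<mu> (\<lambda>\<beta>. exp (of_real \<beta> * Ln s))"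
proof (rule integrable_const_bound)
  show "AE \<beta> in \<mu>. norm (exp (of_real \<beta> * Ln s)) \<le> max 1 (norm s)"
    using supp by eventually_elim (rule norm_exp_Ln_bound[OF assms])
qed measurable

lemma cexponent_has_field_derivative:
  assumes s: "s \<notin> \<real>\<^sub>\<le>\<^sub>0"
  shows "\<exists>d. (cexponent has_field_derivative d) (at s)"
proof -
  have "open (- (\<real>\<^sub>\<le>\<^sub>0 :: complex set))" by (intro open_Compl closed_nonpos_Reals_complex)
  then obtain e where e: "e > 0" "ball s e \<subseteq> - \<real>\<^sub>\<le>\<^sub>0" using s by (auto simp: open_contains_ball)
  \<comment> \<open>The ball has to avoid the cut and to keep a positive distance from 0, where the
    derivative of s^\<beta> is unbounded.\<close>
  define r where "r = min (e/2) (norm s / 2)"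
  have s0: "norm s > 0" using s by auto
  have r: "r > 0" "r < e" "r < norm s" using e s0 by (auto simp: r_def min_less_iff_disj)
  let ?U = "ball s r"
  have U: "t \<notin> \<real>\<^sub>\<le>\<^sub>0" "t \<noteq> 0" "norm s - r \<le> norm t" "norm t \<le> norm s + r" if "t \<in> ?U" for t
  proof -
    show "t \<notin> \<real>\<^sub>\<le>\<^sub>0" using that e(2) r(2) by (auto simp: subset_iff)
    then show "t \<noteq> 0" by auto
    show "norm s - r \<le> norm t" "norm t \<le> norm s + r"
      using that norm_triangle_ineq2[of s t] norm_triangle_ineq2[of t s] by (auto simp: dist_norm norm_minus_commute)
  qed
  have "((\<lambda>t. LINT \<beta>|\<mu>. exp (of_real \<beta> * Ln t)) has_field_derivative (LINT \<beta>|\<mu>. of_real \<beta> * (exp (of_real \<beta> * Ln s) / s))) (at s)"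
  proof (rule has_field_derivative_lebesgue_integral[where U = ?U and D = "\<lambda>t \<beta>. of_real \<beta> * (exp (of_real \<beta> * Ln t) / t)"
        and w = "\<lambda>_. max 1 (norm s + r) / (norm s - r)"])
    show "integrable \<mu> (\<lambda>\<beta>. exp (of_real \<beta> * Ln t))" if "t \<in> ?U" for t
      using U(2)[OF that] by (rule integrable_cexponent)
    show "AE \<beta> in \<mu>. \<forall>t\<in>?U. ((\<lambda>t. exp (of_real \<beta> * Ln t)) has_field_derivative of_real \<beta> * (exp (of_real \<beta> * Ln t) / t)) (at t)"
    proof (intro AE_I2 ballI)
      fix \<beta> t assume t: "t \<in> ?U"
      show "((\<lambda>t. exp (of_real \<beta> * Ln t)) has_field_derivative of_real \<beta> * (exp (of_real \<beta> * Ln t) / t)) (at t)"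
        using U(1,2)[OF t] by (auto intro!: derivative_eq_intros simp: field_simps)
    qed
    show "AE \<beta> in \<mu>. \<forall>t\<in>?U. norm (of_real \<beta> * (exp (of_real \<beta> * Ln t) / t)) \<le> max 1 (norm s + r) / (norm s - r)"
      using supp
    proof eventually_elim
      case (elim \<beta>)
      show ?case
      proof
        fix t assume t: "t \<in> ?U"
        have "norm (exp (of_real \<beta> * Ln t)) \<le> max 1 (norm t)"
          by (rule norm_exp_Ln_bound[OF U(2)[OF t] elim])
        also have "\<dots> \<le> max 1 (norm s + r)" using U(4)[OF t] by linarith
        finally have 1: "norm (exp (of_real \<beta> * Ln t)) / norm t \<le> max 1 (norm s + r) / (norm s - r)"
          using U(3)[OF t] r by (intro frac_le) auto
        have "norm (of_real \<beta> * (exp (of_real \<beta> * Ln t) / t)) = \<bar>\<beta>\<bar> * (norm (exp (of_real \<beta> * Ln t)) / norm t)"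
          by (simp add: norm_mult norm_divide)
        also have "\<dots> \<le> 1 * (norm (exp (of_real \<beta> * Ln t)) / norm t)"
          using elim b by (intro mult_right_mono) auto
        finally show "norm (of_real \<beta> * (exp (of_real \<beta> * Ln t) / t)) \<le> max 1 (norm s + r) / (norm s - r)"
          using 1 by linarith
      qed
    qed
  qed (use r in auto)
  then show ?thesis unfolding cexponent_def[abs_def] by blast
qed

lemma cexponent_holomorphic: "cexponent holomorphic_on - \<real>\<^sub>\<le>\<^sub>0"
  unfolding holomorphic_on_def field_differentiable_def
  using cexponent_has_field_derivative has_field_derivative_at_within by blast

lemma cexponent_cnj:
  assumes "s \<notin> \<real>\<^sub>\<le>\<^sub>0"
  shows "cexponent (cnj s) = cnj (cexponent s)"
proof -
  have eq: "exp (of_real \<beta> * Ln (cnj s)) = cnj (exp (of_real \<beta> * Ln s))" for \<beta>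
    using assms by (simp add: exp_cnj cnj_Ln)
  show ?thesis unfolding cexponent_def eq by (rule Bochner_Integration.integral_cnj)
qed

text \<open>This is cos (\<theta>/2), the minimum over r > 0 of |1 + r e^(i \<theta>)| / (1 + r),
  attained at r = 1.\<close>

definition sector_bound :: real where "sector_bound = sqrt ((1 + cos \<theta>) / 2)"

lemma cos_\<theta>: "cos \<theta> < 0" "- 1 < cos \<theta>"
proof -
  show "cos \<theta> < 0" using \<theta> cos_monotone_0_pi[of "pi/2" \<theta>] by (simp add: pi_ge_zero)
  show "- 1 < cos \<theta>" using \<theta> cos_monotone_0_pi[of \<theta> pi] by simp
qed

lemma sector_bound: "0 < sector_bound" "sector_bound \<le> 1"
  using cos_\<theta> by (auto simp: sector_bound_def)

text \<open>In the coordinate \<open>z\<close> with \<open>s = 1 + e\<^sup>z\<close>, the two rays of the inversion contour based at \<open>s = 1\<close> become the horizontal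
  lines \<open>Im z = \<plusminus>\<theta>\<close>.\<close>

definition sc :: "complex \<Rightarrow> complex" where "sc z = 1 + exp z"

lemma sc_not_nonpos:
  assumes "\<bar>Im z\<bar> < pi"
  shows "sc z \<notin> \<real>\<^sub>\<le>\<^sub>0"
proof
  assume "sc z \<in> \<real>\<^sub>\<le>\<^sub>0"
  then have *: "Im (exp z) = 0" "Re (exp z) \<le> -1"
    by (auto simp: sc_def complex_nonpos_Reals_iff)
  then have "sin (Im z) = 0" by (simp add: Im_exp)
  then have "Im z = 0" using assms sin_gt_zero[of "Im z"] sin_gt_zero[of "- Im z"] by (cases "Im z" "0::real" rule: linorder_cases) auto
  then show False using *(2) by (simp add: Re_exp) (smt (verit) exp_gt_zero)
qed

lemma cos_le:
  assumes "\<bar>Im z\<bar> \<le> \<theta>"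
  shows "cos \<theta> \<le> cos (Im z)"
  using assms \<theta> cos_mono_le_eq[of \<theta> "\<bar>Im z\<bar>"] by simp

lemma norm_sc:
  assumes "\<bar>Im z\<bar> \<le> \<theta>"
  shows "sector_bound * (1 + exp (Re z)) \<le> norm (sc z)"
proof -
  define r where "r = exp (Re z)"
  define k where "k = cos \<theta>"
  have r: "r > 0" by (simp add: r_def)
  have "(norm (sc z))\<^sup>2 = (1 + r * cos (Im z))\<^sup>2 + (r * sin (Im z))\<^sup>2"
    by (simp add: sc_def cmod_power2 Re_exp Im_exp r_def)
  also have "\<dots> = 1 + 2 * r * cos (Im z) + r\<^sup>2 * ((cos (Im z))\<^sup>2 + (sin (Im z))\<^sup>2)"
  proof -
    have "(1 + r * c)\<^sup>2 + (r * s)\<^sup>2 = 1 + 2 * r * c + r\<^sup>2 * (c\<^sup>2 + s\<^sup>2)" for c s :: real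
      by (simp add: power2_eq_square algebra_simps)
    then show ?thesis .
  qed
  also have "\<dots> = 1 + 2 * r * cos (Im z) + r\<^sup>2" by simp
  finally have n: "(norm (sc z))\<^sup>2 = 1 + 2 * r * cos (Im z) + r\<^sup>2" .
  have "r * k \<le> r * cos (Im z)" using cos_le[OF assms] r by (simp add: k_def)
  moreover have "0 \<le> (1 - k) / 2 * (1 - r)\<^sup>2" using cos_\<theta> by (simp add: k_def)
  moreover have "(1 + k) / 2 * (1 + r)\<^sup>2 + (1 - k) / 2 * (1 - r)\<^sup>2 = 1 + 2 * (r * k) + r\<^sup>2"
    by (simp add: power2_eq_square field_simps)
  ultimately have "(1 + k) / 2 * (1 + r)\<^sup>2 \<le> (norm (sc z))\<^sup>2"
    unfolding n by linarith
  then have "(sector_bound * (1 + r))\<^sup>2 \<le> (norm (sc z))\<^sup>2"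
    using cos_\<theta> by (simp add: power_mult_distrib sector_bound_def k_def)
  then show ?thesis unfolding r_def by (rule power2_le_imp_le) simp
qed

lemma sc_nonzero: "\<bar>Im z\<bar> \<le> \<theta> \<Longrightarrow> sc z \<noteq> 0"
  using sc_not_nonpos[of z] \<theta> by auto

text \<open>Adding 1 turns a number towards the positive axis. In terms of cosines:
  \<open>norm (sc z)\<close> is at least \<open>r - 1\<close>, and multiplying by the negative
  number \<open>cos \<theta>\<close> leads to
  \<open>cos \<theta> * norm (sc z) \<le> Re (sc z)\<close>.\<close>

lemma Arg_sc:
  assumes "\<bar>Im z\<bar> \<le> \<theta>"
  shows "\<bar>Arg (sc z)\<bar> \<le> \<theta>"
proof -
  define r where "r = exp (Re z)"
  define k where "k = cos \<theta>"
  have r: "r > 0" by (simp add: r_def)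
  have "r - 1 \<le> norm (sc z)"
    using norm_triangle_ineq2[of "exp z" "- 1"] by (simp add: sc_def r_def add.commute)
  then have "k * norm (sc z) \<le> k * (r - 1)"
    using cos_\<theta> by (intro mult_left_mono_neg) (auto simp: k_def)
  moreover have "r * k \<le> r * cos (Im z)" using cos_le[OF assms] r by (simp add: k_def)
  moreover have "- 1 < k" using cos_\<theta> by (simp add: k_def)
  moreover have "Re (sc z) = 1 + r * cos (Im z)" by (simp add: sc_def Re_exp r_def)
  ultimately have "k * norm (sc z) \<le> Re (sc z)" by (simp add: algebra_simps)
  moreover have nz: "sc z \<noteq> 0" by (rule sc_nonzero[OF assms])
  ultimately have "cos \<theta> \<le> cos (Arg (sc z))"
    by (simp add: cos_Arg pos_le_divide_eq k_def)
  then have "cos \<theta> \<le> cos \<bar>Arg (sc z)\<bar>" by simp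
  then show ?thesis
    using \<theta> Arg_bounded[of "sc z"] cos_mono_le_eq[of \<theta> "\<bar>Arg (sc z)\<bar>"] by auto
qed

text \<open>A lower bound for Re f^mu on the strip: |s|^\<beta> is at least
  \<open>sector_bound\<close>, because that number is at most 1 and \<beta> is below 1; the argument
  of s^\<beta> is at most \<open>b\<^sub>1 * \<theta>\<close> in absolute value, less than a right
  angle; integration contributes the total mass.\<close>

definition decay_rate :: real where
  "decay_rate = sector_bound * cos (b\<^sub>1 * \<theta>) * measure \<mu> (space \<mu>)"

lemma decay_rate_pos: "0 < decay_rate"
proof -
  have "0 < cos (b\<^sub>1 * \<theta>)"
    using b \<theta> by (intro cos_gt_zero_pi) (auto intro: order.strict_trans2[of _ 0])
  moreover have "0 < measure \<mu> (space \<mu>)"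
    using \<mu>_nonzero by (simp add: emeasure_eq_measure zero_less_measure_iff)
  ultimately show ?thesis using sector_bound by (simp add: decay_rate_def)
qed

lemma Re_cexponent:
  assumes z: "\<bar>Im z\<bar> \<le> \<theta>"
  shows "decay_rate \<le> Re (cexponent (sc z))"
proof -
  have nz: "sc z \<noteq> 0" by (rule sc_nonzero[OF z])
  have int: "integrable \<mu> (\<lambda>\<beta>. exp (of_real \<beta> * Ln (sc z)))" by (rule integrable_cexponent[OF nz])
  have "decay_rate = (LINT \<beta>|\<mu>. sector_bound * cos (b\<^sub>1 * \<theta>))"
    by (simp add: decay_rate_def mult.commute)
  also have "\<dots> \<le> (LINT \<beta>|\<mu>. Re (exp (of_real \<beta> * Ln (sc z))))"
  proof (rule integral_mono_AE)
    show "AE \<beta> in \<mu>. sector_bound * cos (b\<^sub>1 * \<theta>) \<le> Re (exp (of_real \<beta> * Ln (sc z)))"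
      using supp
    proof eventually_elim
      case (elim \<beta>)
      have Re: "Re (exp (of_real \<beta> * Ln (sc z))) = norm (sc z) powr \<beta> * cos (\<beta> * Arg (sc z))"
        using nz by (simp add: Re_exp powr_def Arg_def)
      have "sector_bound \<le> sector_bound * (1 + exp (Re z))" using sector_bound by simp
      then have n: "sector_bound \<le> norm (sc z)" using norm_sc[OF z] by linarith
      have "sector_bound powr 1 \<le> sector_bound powr \<beta>"
        using sector_bound elim b by (intro powr_mono') auto
      then have "sector_bound \<le> sector_bound powr \<beta>" using sector_bound by simp
      also have "\<dots> \<le> norm (sc z) powr \<beta>" using n sector_bound elim b by (intro powr_mono2) auto
      finally have p: "sector_bound \<le> norm (sc z) powr \<beta>" .
      have "\<bar>\<beta> * Arg (sc z)\<bar> \<le> b\<^sub>1 * \<theta>"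
        unfolding abs_mult using elim b Arg_sc[OF z] by (intro mult_mono) auto
      then have "cos (b\<^sub>1 * \<theta>) \<le> cos \<bar>\<beta> * Arg (sc z)\<bar>"
        using \<theta> b by (intro cos_monotone_0_pi_le) auto
      then have c: "cos (b\<^sub>1 * \<theta>) \<le> cos (\<beta> * Arg (sc z))" by simp
      have "0 \<le> cos (b\<^sub>1 * \<theta>)"
      proof (rule cos_ge_zero)
        have "0 \<le> b\<^sub>1 * \<theta>" using b \<theta> pi_gt_zero by (intro mult_nonneg_nonneg) linarith+
        then show "- (pi / 2) \<le> b\<^sub>1 * \<theta>" using pi_gt_zero by linarith
        show "b\<^sub>1 * \<theta> \<le> pi / 2" using \<theta> by simp
      qed
      then show ?case unfolding Re using p c sector_bound by (intro mult_mono) auto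
    qed
  qed (use int in auto)
  also have "\<dots> = Re (cexponent (sc z))"
    using int by (simp add: cexponent_def)
  finally show ?thesis .
qed

end

section \<open>Laplace inversion along a sectorial contour\<close>

lemma integrable_exp_minus_abs: "integrable lborel (\<lambda>x::real. exp (- \<bar>x\<bar>))"
proof -
  have 1: "integrable lborel (\<lambda>x::real. indicator {0<..} x * exp (- x))"
    using has_bochner_integral_I0i_power_exp_m[of 0]
    by (auto simp: has_bochner_integral_iff mult.commute)
  from lborel_integrable_real_affine[OF this, of "-1" 0]
  have 2: "integrable lborel (\<lambda>x::real. indicator {..<0} x * exp x)"
    by (simp add: indicator_def)
  show ?thesis
  proof (rule Bochner_Integration.integrable_bound[OF Bochner_Integration.integrable_add[OF 1 2]])
    show "AE x in lborel. norm (exp (- \<bar>x\<bar>)) \<le> norm (indicator {0<..} x * exp (- x) + indicator {..<0} x * exp x :: real)"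
      using AE_lborel_singleton[of "0::real"] by eventually_elim (auto simp: indicator_def abs_if)
  qed measurable
qed

lemma continuous_integrable_exp_minus_abs:
  fixes f :: "real \<Rightarrow> 'b::{banach, second_countable_topology}"
  assumes "f \<in> borel_measurable borel" "\<And>x. norm (f x) \<le> K * exp (- \<bar>x\<bar>)"
  shows "integrable lborel f"
proof (rule Bochner_Integration.integrable_bound)
  show "integrable lborel (\<lambda>x::real. K * exp (- \<bar>x\<bar>))"
    using integrable_exp_minus_abs by (rule integrable_mult_right)
  show "AE x in lborel. norm (f x) \<le> norm (K * exp (- \<bar>x\<bar>))"
    using assms(2) by (intro AE_I2) (metis abs_ge_self order_trans real_norm_def)
qed (use assms(1) in simp)

text \<open>Both ends of the contour become exponential decay in x: near the base point through the
  factor \<open>exp x\<close> of ds, at infinity through the surplus power in the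
  denominator.\<close>

lemma rational_exp_bound:
  fixes x p :: real
  assumes p: "0 < p"
  shows "exp x / ((1 + exp x) * (exp x + p)) \<le> (1 + 1 / p) * exp (- \<bar>x\<bar>)"
proof -
  define r where "r = exp x"
  have r: "0 < r" by (simp add: r_def)
  have "r / ((1 + r) * (r + p)) \<le> (1 + 1 / p) * exp (- \<bar>x\<bar>)"
  proof (cases "x \<le> 0")
    case True
    then have "exp (- \<bar>x\<bar>) = r" by (simp add: r_def)
    moreover have "r / ((1 + r) * (r + p)) \<le> r / (1 * p)"
      using r p by (intro frac_le mult_mono) auto
    moreover have "r / (1 * p) \<le> (1 + 1 / p) * r" using r by (simp add: field_simps)
    ultimately show ?thesis by simp
  next
    case False
    then have e: "exp (- \<bar>x\<bar>) = 1 / r" by (simp add: r_def exp_minus divide_inverse)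
    have "r / ((1 + r) * (r + p)) \<le> r / (r * r)"
      using r p by (intro frac_le mult_mono) auto
    also have "\<dots> = 1 * (1 / r)" using r by simp
    also have "\<dots> \<le> (1 + 1 / p) * (1 / r)" using r p by (intro mult_right_mono) auto
    finally show ?thesis unfolding e .
  qed
  then show ?thesis by (simp add: r_def)
qed

lemma contour_integral_horizontal:
  fixes f :: "complex \<Rightarrow> complex"
  assumes f: "continuous_on (closed_segment (Complex a y) (Complex b y)) f" and ab: "a < b"
  shows "contour_integral (linepath (Complex a y) (Complex b y)) f = (LINT x:{a..b}|lborel. f (Complex x y))"
proof -
  let ?l = "linepath (Complex a y) (Complex b y)"
  have l: "?l t = Complex (a + (b - a) * t) y" for t
    by (simp add: linepath_def complex_eq_iff algebra_simps)
  have d: "Complex b y - Complex a y = of_real (b - a)" by (simp add: complex_eq_iff)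
  have cont: "continuous_on {0..1} (\<lambda>t. f (?l t) * of_real (b - a))"
  proof -
    have "continuous_on {0..1} (\<lambda>t. f (?l t))"
    proof (rule continuous_on_compose2[OF f])
      show "continuous_on {0..1} ?l" by (rule continuous_on_linepath)
      show "?l ` {0..1} \<subseteq> closed_segment (Complex a y) (Complex b y)"
        unfolding linepath_image_01 ..
    qed
    then show ?thesis by (intro continuous_intros)
  qed
  have "contour_integral ?l f = integral {0..1} (\<lambda>t. f (?l t) * of_real (b - a))"
    by (simp add: contour_integral_integral d)
  also have "\<dots> = (LINT t:{0..1}|lborel. f (?l t) * of_real (b - a))"
    by (rule set_borel_integral_eq_integral(2)[symmetric])
      (rule borel_integrable_compact[OF compact_Icc cont, unfolded set_integrable_def[symmetric]])
  also have "\<dots> = (b - a) *\<^sub>R (LINT t|lborel. indicator {a..b} (a + (b - a) * t) *\<^sub>R f (Complex (a + (b - a) * t) y))"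
  proof -
    have "indicator {0..1} t = (indicator {a..b} (a + (b - a) * t) :: real)" for t
    proof -
      have "a \<le> a + (b - a) * t \<longleftrightarrow> 0 \<le> t" using ab by (simp add: zero_le_mult_iff)
      moreover have "a + (b - a) * t \<le> b \<longleftrightarrow> t \<le> 1"
        using ab mult_le_cancel_left_pos[of "b - a" t 1] by (simp add: algebra_simps)
      ultimately show ?thesis by (simp add: indicator_def)
    qed
    then show ?thesis
      unfolding set_lebesgue_integral_def l
      by (subst integral_scaleR_right[symmetric]) (simp add: scaleR_conv_of_real mult_ac)
  qed
  also have "\<dots> = (LINT x:{a..b}|lborel. f (Complex x y))"
    unfolding set_lebesgue_integral_def
    using lborel_integral_real_affine[of "b - a" "\<lambda>x. indicator {a..b} x *\<^sub>R f (Complex x y)" a] ab by simp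
  finally show ?thesis .
qed

context order_mixture
begin

definition F :: "real \<Rightarrow> real \<Rightarrow> complex \<Rightarrow> complex" where
  "F \<gamma> \<sigma> z = exp (- of_real \<gamma> * Ln (sc z)) * exp (- of_real \<sigma> * cexponent (sc z))"

abbreviation "strip \<equiv> {z. \<bar>Im z\<bar> < pi}"

lemma open_strip: "open strip" and convex_strip: "convex strip"
proof -
  have eq: "strip = {z. Im z < pi} \<inter> {z. Im z > - pi}" by auto
  show "open strip" unfolding eq by (intro open_Int open_halfspace_Im_lt open_halfspace_Im_gt)
  show "convex strip" unfolding eq by (intro convex_Int convex_halfspace_Im_lt convex_halfspace_Im_gt)
qed

lemma F_holomorphic: "F \<gamma> \<sigma> holomorphic_on strip"
proof -
  have sc: "sc holomorphic_on strip" unfolding sc_def[abs_def] by (intro holomorphic_intros)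
  have "(cexponent \<circ> sc) holomorphic_on strip"
    by (rule holomorphic_on_compose_gen[OF sc cexponent_holomorphic]) (use sc_not_nonpos in auto)
  then have 1: "(\<lambda>z. cexponent (sc z)) holomorphic_on strip" by (simp add: o_def)
  have "(Ln \<circ> sc) holomorphic_on strip"
    by (rule holomorphic_on_compose_gen[OF sc, of _ "- \<real>\<^sub>\<le>\<^sub>0"]) (use sc_not_nonpos in \<open>auto intro!: holomorphic_intros\<close>)
  then have 2: "(\<lambda>z. Ln (sc z)) holomorphic_on strip" by (simp add: o_def)
  show ?thesis unfolding F_def[abs_def] by (intro holomorphic_intros 1 2)
qed

lemma F_cnj:
  assumes "\<bar>Im z\<bar> < pi"
  shows "F \<gamma> \<sigma> (cnj z) = cnj (F \<gamma> \<sigma> z)"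
proof -
  have "sc (cnj z) = cnj (sc z)" by (simp add: sc_def exp_cnj)
  then show ?thesis
    unfolding F_def using sc_not_nonpos[OF assms] by (simp add: cexponent_cnj exp_cnj cnj_Ln)
qed

text \<open>For \<gamma> at least 1 the factor s^(-\<gamma>) supplies the decay of order 1/|s| that
  the Cauchy integrals need. For smaller \<gamma> boundedness is enough, because there e^(ts)
  provides the decay.\<close>

lemma norm_F:
  assumes z: "\<bar>Im z\<bar> \<le> \<theta>" and \<sigma>: "0 \<le> \<sigma>" and \<gamma>: "0 \<le> \<gamma>" "\<gamma> \<le> 2"
  shows "norm (F \<gamma> \<sigma> z) \<le> exp (- decay_rate * \<sigma>) / sector_bound\<^sup>2"
    and "1 \<le> \<gamma> \<Longrightarrow> norm (F \<gamma> \<sigma> z) \<le> exp (- decay_rate * \<sigma>) / sector_bound\<^sup>2 / (1 + exp (Re z))"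
proof -
  let ?k = sector_bound and ?r = "1 + exp (Re z)"
  have nz: "sc z \<noteq> 0" by (rule sc_nonzero[OF z])
  have 1: "norm (exp (- of_real \<gamma> * Ln (sc z))) = norm (sc z) powr (- \<gamma>)"
    using norm_exp_Ln[OF nz, of "- \<gamma>"] by simp
  have 2: "norm (exp (- of_real \<sigma> * cexponent (sc z))) \<le> exp (- decay_rate * \<sigma>)"
    using Re_cexponent[OF z] \<sigma> by (simp add: norm_exp_eq_Re mult.commute mult_left_mono)
  have r: "1 < ?r" by simp
  have "norm (sc z) powr (- \<gamma>) \<le> (?k * ?r) powr (- \<gamma>)"
    using norm_sc[OF z] sector_bound r \<gamma> by (intro powr_mono2') (auto intro!: mult_pos_pos add_pos_pos)
  also have "(?k * ?r) powr (- \<gamma>) = ?k powr (- \<gamma>) * ?r powr (- \<gamma>)"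
    using sector_bound r by (simp add: powr_mult)
  finally have 3: "norm (sc z) powr (- \<gamma>) \<le> ?k powr (- \<gamma>) * ?r powr (- \<gamma>)" .
  have "?k powr (- \<gamma>) \<le> ?k powr (- 2)" using sector_bound \<gamma> by (intro powr_mono') auto
  also have "?k powr (- 2) = 1 / ?k\<^sup>2"
    using sector_bound by (simp add: powr_minus powr_numeral divide_inverse)
  finally have 4: "?k powr (- \<gamma>) \<le> 1 / ?k\<^sup>2" .
  have gen: "norm (F \<gamma> \<sigma> z) \<le> exp (- decay_rate * \<sigma>) / ?k\<^sup>2 * q" if q: "?r powr (- \<gamma>) \<le> q" for q
  proof -
    have q0: "0 \<le> q" using q powr_ge_zero order_trans by blast
    have "norm (F \<gamma> \<sigma> z) = norm (sc z) powr (- \<gamma>) * norm (exp (- of_real \<sigma> * cexponent (sc z)))"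
      unfolding F_def norm_mult 1 ..
    also have "\<dots> \<le> (1 / ?k\<^sup>2 * q) * exp (- decay_rate * \<sigma>)"
      using order_trans[OF 3 mult_mono[OF 4 q]] 2 q0 by (intro mult_mono) auto
    finally show ?thesis by (simp add: mult_ac)
  qed
  have "?r powr (- \<gamma>) \<le> ?r powr 0" using r \<gamma> by (intro powr_mono) auto
  then show "norm (F \<gamma> \<sigma> z) \<le> exp (- decay_rate * \<sigma>) / ?k\<^sup>2"
    using gen[of 1] r by simp
  show "norm (F \<gamma> \<sigma> z) \<le> exp (- decay_rate * \<sigma>) / ?k\<^sup>2 / ?r" if "1 \<le> \<gamma>"
  proof -
    have "?r powr (- \<gamma>) \<le> ?r powr (- 1)" using r that by (intro powr_mono) auto
    also have "\<dots> = 1 / ?r" using r by (simp add: powr_minus divide_inverse)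
    finally show ?thesis using gen[of "1 / ?r"] by simp
  qed
qed

lemma continuous_F_horizontal: "\<bar>y\<bar> < pi \<Longrightarrow> continuous_on UNIV (\<lambda>x. F \<gamma> \<sigma> (Complex x y))"
  by (rule continuous_on_compose2[OF holomorphic_on_imp_continuous_on[OF F_holomorphic]])
    (auto intro!: continuous_intros simp: Complex_eq)

text \<open>On the rays \<open>exp z\<close> lies in the left half plane, so the cross term in its
  squared distance to the positive number \<open>p\<close> is nonnegative.\<close>

lemma norm_exp_minus_real:
  assumes z: "\<bar>Im z\<bar> = \<theta>" and p: "0 < p"
  shows "(exp (Re z) + p) / 2 \<le> norm (exp z - of_real p)"
proof -
  define r where "r = exp (Re z)"
  have r: "r > 0" by (simp add: r_def)
  have c: "cos (Im z) = cos \<theta>" using z by (metis cos_abs_real)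
  have "(norm (exp z - of_real p))\<^sup>2 = (r * cos (Im z) - p)\<^sup>2 + (r * sin (Im z))\<^sup>2"
    by (simp add: cmod_power2 Re_exp Im_exp r_def)
  also have "\<dots> = r\<^sup>2 * ((cos (Im z))\<^sup>2 + (sin (Im z))\<^sup>2) - 2 * (r * p) * cos (Im z) + p\<^sup>2"
  proof -
    have "(r * c - p)\<^sup>2 + (r * s)\<^sup>2 = r\<^sup>2 * (c\<^sup>2 + s\<^sup>2) - 2 * (r * p) * c + p\<^sup>2" for c s :: real
      by (simp add: power2_eq_square algebra_simps)
    then show ?thesis .
  qed
  also have "\<dots> = r\<^sup>2 + 2 * (r * p) * (- cos \<theta>) + p\<^sup>2" unfolding sin_cos_squared_add2 unfolding c by simp
  finally have n: "(norm (exp z - of_real p))\<^sup>2 = r\<^sup>2 + 2 * (r * p) * (- cos \<theta>) + p\<^sup>2" .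
  have "0 \<le> 2 * (r * p) * (- cos \<theta>)" using r p cos_\<theta> by (intro mult_nonneg_nonneg) auto
  moreover have "((r + p) / 2)\<^sup>2 \<le> r\<^sup>2 + p\<^sup>2"
  proof -
    have "0 \<le> (r - p)\<^sup>2 + 2 * r\<^sup>2 + 2 * p\<^sup>2" by simp
    then show ?thesis by (simp add: power2_eq_square field_simps)
  qed
  ultimately have "((r + p) / 2)\<^sup>2 \<le> (norm (exp z - of_real p))\<^sup>2" unfolding n by linarith
  then show ?thesis unfolding r_def by (rule power2_le_imp_le) simp
qed

text \<open>The Cauchy integrand F ds / (s - w) for \<open>w = 1 + p\<close>: in the coordinate z
  the difference s - w becomes \<open>exp z - p\<close>, and ds contributes the factor
  \<open>exp z\<close>.\<close>

definition \<Phi> :: "real \<Rightarrow> real \<Rightarrow> real \<Rightarrow> complex \<Rightarrow> complex" where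
  "\<Phi> \<gamma> \<sigma> p z = F \<gamma> \<sigma> z * exp z / (exp z - of_real p)"

lemma exp_eq_real_strip:
  assumes "0 < p" "\<bar>Im z\<bar> < pi" "exp z = of_real p"
  shows "z = of_real (ln p)"
proof -
  have "Ln (exp z) = z" using assms(2) by (intro Ln_exp) auto
  then show ?thesis using assms by (simp add: Ln_of_real)
qed

lemma \<Phi>_holomorphic:
  assumes "0 < p"
  shows "\<Phi> \<gamma> \<sigma> p holomorphic_on (strip - {of_real (ln p)})"
  unfolding \<Phi>_def[abs_def]
  by (intro holomorphic_intros holomorphic_on_subset[OF F_holomorphic]) (use exp_eq_real_strip[OF assms] in auto)

text \<open>The factor \<open>exp z\<close> of ds cancels the derivative of \<open>exp z - p\<close>
  at its simple zero.\<close>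

lemma residue_\<Phi>:
  assumes p: "0 < p"
  shows "residue (\<Phi> \<gamma> \<sigma> p) (of_real (ln p)) = F \<gamma> \<sigma> (of_real (ln p))"
proof (rule residue_simple'[OF open_strip _ \<Phi>_holomorphic[OF p]])
  let ?z = "of_real (ln p) :: complex"
  show z: "?z \<in> strip" by simp
  have ez: "exp ?z = of_real p" using p by (simp add: exp_of_real)
  have "(exp has_field_derivative exp ?z) (at ?z)" by (rule DERIV_exp)
  then have "((\<lambda>w. (exp w - exp ?z) / (w - ?z)) \<longlongrightarrow> exp ?z) (at ?z)"
    by (simp add: has_field_derivative_iff)
  then have 1: "((\<lambda>w. inverse ((exp w - exp ?z) / (w - ?z))) \<longlongrightarrow> inverse (exp ?z)) (at ?z)"
    by (intro tendsto_inverse) auto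
  have "isCont (\<lambda>w. F \<gamma> \<sigma> w * exp w) ?z"
    using holomorphic_on_imp_continuous_on[OF F_holomorphic] z open_strip
    by (intro continuous_intros) (simp add: continuous_on_eq_continuous_at)
  then have "((\<lambda>w. F \<gamma> \<sigma> w * exp w) \<longlongrightarrow> F \<gamma> \<sigma> ?z * exp ?z) (at ?z)" by (simp add: isCont_def)
  from tendsto_mult[OF this 1]
  have lim: "((\<lambda>w. F \<gamma> \<sigma> w * exp w * inverse ((exp w - exp ?z) / (w - ?z))) \<longlongrightarrow> F \<gamma> \<sigma> ?z * exp ?z * inverse (exp ?z)) (at ?z)" .
  have "F \<gamma> \<sigma> ?z * exp ?z * inverse (exp ?z) = F \<gamma> \<sigma> ?z" by (simp add: mult.assoc)
  moreover have "\<Phi> \<gamma> \<sigma> p w * (w - ?z) = F \<gamma> \<sigma> w * exp w * inverse ((exp w - exp ?z) / (w - ?z))" for w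
    unfolding \<Phi>_def ez by (simp add: divide_inverse mult_ac)
  ultimately show "((\<lambda>w. \<Phi> \<gamma> \<sigma> p w * (w - ?z)) \<longlongrightarrow> F \<gamma> \<sigma> ?z) (at ?z)"
    using lim by (simp only:)
qed

lemma norm_\<Phi>_horizontal:
  assumes \<gamma>: "1 \<le> \<gamma>" "\<gamma> \<le> 2" and \<sigma>: "0 \<le> \<sigma>" and p: "0 < p" and z: "\<bar>Im z\<bar> = \<theta>"
  shows "norm (\<Phi> \<gamma> \<sigma> p z) \<le> 2 * (1 + 1 / p) * (exp (- decay_rate * \<sigma>) / sector_bound\<^sup>2) * exp (- \<bar>Re z\<bar>)"
proof -
  define r where "r = exp (Re z)"
  define c where "c = exp (- decay_rate * \<sigma>) / sector_bound\<^sup>2"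
  have r: "r > 0" and c: "0 \<le> c" by (auto simp: r_def c_def)
  have nF: "norm (F \<gamma> \<sigma> z) \<le> c / (1 + r)"
    using norm_F(2)[of z \<sigma> \<gamma>] assms by (simp add: c_def r_def)
  have ne: "(r + p) / 2 \<le> norm (exp z - of_real p)"
    unfolding r_def by (rule norm_exp_minus_real[OF z p])
  have "norm (\<Phi> \<gamma> \<sigma> p z) = norm (F \<gamma> \<sigma> z) * r / norm (exp z - of_real p)"
    by (simp add: \<Phi>_def norm_mult norm_divide r_def)
  also have "\<dots> \<le> (c / (1 + r)) * r / ((r + p) / 2)"
    using nF ne r p c by (intro frac_le mult_right_mono) auto
  also have "\<dots> = 2 * c * (r / ((1 + r) * (r + p)))" by (simp add: field_simps)
  also have "\<dots> \<le> 2 * c * ((1 + 1 / p) * exp (- \<bar>Re z\<bar>))"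
  proof (intro mult_left_mono)
    show "r / ((1 + r) * (r + p)) \<le> (1 + 1 / p) * exp (- \<bar>Re z\<bar>)"
      unfolding r_def by (rule rational_exp_bound[OF p])
  qed (use c in simp)
  finally show ?thesis by (simp only: c_def mult_ac)
qed

lemma integrable_\<Phi>_horizontal:
  assumes "1 \<le> \<gamma>" "\<gamma> \<le> 2" "0 \<le> \<sigma>" "0 < p" "\<bar>y\<bar> = \<theta>"
  shows "integrable lborel (\<lambda>x. \<Phi> \<gamma> \<sigma> p (Complex x y))"
proof (rule continuous_integrable_exp_minus_abs)
  have y: "\<bar>y\<bar> < pi" using assms \<theta> by simp
  have ne: "exp (Complex x y) - of_real p \<noteq> 0" for x
  proof -
    have "0 < (exp x + p) / 2" using assms by (simp add: add_pos_pos)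
    also have "\<dots> \<le> norm (exp (Complex x y) - of_real p)"
      using norm_exp_minus_real[of "Complex x y" p] assms by simp
    finally show ?thesis by auto
  qed
  have ne': "exp (of_real x + \<i> * of_real y) \<noteq> of_real p" for x
    using ne[of x] by (simp add: Complex_eq)
  have "continuous_on UNIV (\<lambda>x. \<Phi> \<gamma> \<sigma> p (Complex x y))"
    unfolding \<Phi>_def by (intro continuous_intros continuous_F_horizontal y) (auto intro!: continuous_intros simp: Complex_eq ne')
  then show "(\<lambda>x. \<Phi> \<gamma> \<sigma> p (Complex x y)) \<in> borel_measurable borel" by (rule borel_measurable_continuous_onI)
  show "norm (\<Phi> \<gamma> \<sigma> p (Complex x y)) \<le> (2 * (1 + 1 / p) * (exp (- decay_rate * \<sigma>) / sector_bound\<^sup>2)) * exp (- \<bar>x\<bar>)" for x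
    using norm_\<Phi>_horizontal[of \<gamma> \<sigma> p "Complex x y"] assms by simp
qed

text \<open>Residue theorem on growing rectangles whose horizontal sides are Im z = -\<theta> and Im
  z = \<theta>. Values on the lower side are conjugate to those on the upper one, which is traversed
  from right to left, so together they give -2i times an imaginary part; the vertical sides vanish
  in the limit.\<close>

theorem contour_identity:
  assumes \<gamma>: "1 \<le> \<gamma>" "\<gamma> \<le> 2" and \<sigma>: "0 \<le> \<sigma>" and p: "0 < p"
  shows "of_real (Im (LINT x|lborel. \<Phi> \<gamma> \<sigma> p (Complex x \<theta>))) = - of_real pi * F \<gamma> \<sigma> (of_real (ln p))"
proof -
  let ?f = "\<Phi> \<gamma> \<sigma> p" and ?z = "of_real (ln p) :: complex"
  have \<theta>0: "0 < \<theta>" using \<theta> pi_gt_zero by linarith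
  define c where "c = exp (- decay_rate * \<sigma>) / sector_bound\<^sup>2"
  have c: "0 \<le> c" by (simp add: c_def)
  define I where "I n = (LINT x:{- real n..real n}|lborel. ?f (Complex x \<theta>))" for n
  define V where "V n = contour_integral (linepath (Complex (real n) (- \<theta>)) (Complex (real n) \<theta>)) ?f
      + contour_integral (linepath (Complex (- real n) \<theta>) (Complex (- real n) (- \<theta>))) ?f" for n
  have I_lim: "I \<longlonglongrightarrow> (LINT x|lborel. ?f (Complex x \<theta>))"
    unfolding I_def[abs_def] set_lebesgue_integral_def
  proof (rule integral_dominated_convergence[where w = "\<lambda>x. norm (?f (Complex x \<theta>))"])
    have int: "integrable lborel (\<lambda>x. ?f (Complex x \<theta>))"
      using assms \<theta>0 by (intro integrable_\<Phi>_horizontal) auto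
    then show "integrable lborel (\<lambda>x. norm (?f (Complex x \<theta>)))" by simp
    have [measurable]: "(\<lambda>x. ?f (Complex x \<theta>)) \<in> borel_measurable lborel" using int by simp
    show "(\<lambda>x. ?f (Complex x \<theta>)) \<in> borel_measurable lborel" by measurable
    show "(\<lambda>x. indicator {- real n..real n} x *\<^sub>R ?f (Complex x \<theta>)) \<in> borel_measurable lborel" for n by measurable
    show "AE x in lborel. (\<lambda>n. indicator {- real n..real n} x *\<^sub>R ?f (Complex x \<theta>)) \<longlonglongrightarrow> ?f (Complex x \<theta>)"
    proof (rule AE_I2)
      fix x :: real
      obtain N :: nat where N: "\<bar>x\<bar> \<le> real N" using real_arch_simple by blast
      show "(\<lambda>n. indicator {- real n..real n} x *\<^sub>R ?f (Complex x \<theta>)) \<longlonglongrightarrow> ?f (Complex x \<theta>)"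
      proof (rule tendsto_eventually)
        show "\<forall>\<^sub>F n in sequentially. indicator {- real n..real n} x *\<^sub>R ?f (Complex x \<theta>) = ?f (Complex x \<theta>)"
          using eventually_ge_at_top[of N]
        proof eventually_elim
          case (elim n)
          then have "\<bar>x\<bar> \<le> real n" using N by linarith
          then have "x \<in> {- real n..real n}" by auto
          then show ?case by simp
        qed
      qed
    qed
    show "AE x in lborel. norm (indicator {- real n..real n} x *\<^sub>R ?f (Complex x \<theta>)) \<le> norm (?f (Complex x \<theta>))" for n
      by (intro AE_I2) (auto simp: indicator_def)
  qed
  \<comment> \<open>From this index on the pole \<open>ln p\<close> lies inside the rectangle, and
    |exp z - p| is at least \<open>exp N / 2\<close> on the right side and \<open>p / 2\<close> on
    the left side.\<close>
  obtain n\<^sub>0 :: nat where n\<^sub>0: "\<bar>ln p\<bar> + ln 2 < real n\<^sub>0" using reals_Archimedean2 by blast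
  have main: "- (2 * \<i>) * of_real (Im (I n)) + V n = 2 * of_real pi * \<i> * F \<gamma> \<sigma> ?z" 
    and vbound: "norm (V n) \<le> 4 * \<theta> * (2 * c / (1 + exp (real n)) + c * exp (- real n) * (2 / p))"
    if n: "n \<ge> n\<^sub>0" for n
  proof -
    define N where "N = real n"
    have N: "\<bar>ln p\<bar> + ln 2 < N" using n n\<^sub>0 by (simp add: N_def)
    have ln2: "0 < ln (2::real)" by simp
    have N0: "0 < N" and lp: "\<bar>ln p\<bar> < N" using N ln2 by linarith+
    define a1 a2 a3 a4 where "a1 = Complex (- N) (- \<theta>)" and "a2 = Complex N (- \<theta>)" and "a3 = Complex N \<theta>" and "a4 = Complex (- N) \<theta>"
    have rect: "rectpath a1 a3 = linepath a1 a2 +++ linepath a2 a3 +++ linepath a3 a4 +++ linepath a4 a1"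
      by (simp add: rectpath_def Let_def a1_def a2_def a3_def a4_def)
    have im: "path_image (rectpath a1 a3) \<subseteq> strip - {?z}"
    proof
      fix z assume "z \<in> path_image (rectpath a1 a3)"
      then have "(Re z \<in> {-N, N} \<and> Im z \<in> {-\<theta>..\<theta>}) \<or> (Im z \<in> {-\<theta>, \<theta>} \<and> Re z \<in> {-N..N})"
        using N0 \<theta>0 by (subst (asm) path_image_rectpath) (auto simp: a1_def a3_def)
      then show "z \<in> strip - {?z}" using \<theta> \<theta>0 lp by auto
    qed
    have segs: "closed_segment a1 a2 \<subseteq> strip - {?z}" "closed_segment a2 a3 \<subseteq> strip - {?z}"
      "closed_segment a3 a4 \<subseteq> strip - {?z}" "closed_segment a4 a1 \<subseteq> strip - {?z}"
      using im by (simp_all add: rect path_image_join)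
    have cont: "continuous_on (strip - {?z}) ?f" by (rule holomorphic_on_imp_continuous_on[OF \<Phi>_holomorphic[OF p]])
    note conts = continuous_on_subset[OF cont segs(1)] continuous_on_subset[OF cont segs(2)]
      continuous_on_subset[OF cont segs(3)] continuous_on_subset[OF cont segs(4)]
    note ci = contour_integrable_continuous_linepath[OF conts(1)] contour_integrable_continuous_linepath[OF conts(2)]
      contour_integrable_continuous_linepath[OF conts(3)] contour_integrable_continuous_linepath[OF conts(4)]
    have split: "contour_integral (rectpath a1 a3) ?f = contour_integral (linepath a1 a2) ?f + (contour_integral (linepath a2 a3) ?f
        + (contour_integral (linepath a3 a4) ?f + contour_integral (linepath a4 a1) ?f))"
      unfolding rect using ci by (simp add: contour_integrable_joinI)
    have "contour_integral (rectpath a1 a3) ?f = 2 * pi * \<i> * (\<Sum>q\<in>{?z}. winding_number (rectpath a1 a3) q * residue ?f q)"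
    proof (rule Residue_theorem[OF open_strip convex_connected[OF convex_strip] _ \<Phi>_holomorphic[OF p] _ _ im])
      show "\<forall>z. z \<notin> strip \<longrightarrow> winding_number (rectpath a1 a3) z = 0"
      proof (intro allI impI)
        fix z assume "z \<notin> strip"
        then have "z \<notin> cbox a1 a3" using \<theta> by (auto simp: in_cbox_complex_iff a1_def a3_def)
        then show "winding_number (rectpath a1 a3) z = 0"
          using N0 \<theta>0 by (intro winding_number_rectpath_outside) (auto simp: a1_def a3_def)
      qed
    qed auto
    moreover have "winding_number (rectpath a1 a3) ?z = 1"
      using lp \<theta>0 by (intro winding_number_rectpath) (auto simp: in_box_complex_iff a1_def a3_def)
    ultimately have res: "contour_integral (rectpath a1 a3) ?f = 2 * of_real pi * \<i> * F \<gamma> \<sigma> ?z"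
      by (simp add: residue_\<Phi>[OF p])
    have top: "contour_integral (linepath a3 a4) ?f = - I n"
    proof -
      have "contour_integral (linepath a4 a3) ?f = I n"
        unfolding a3_def a4_def I_def N_def[symmetric] using N0 conts(3)
        by (intro contour_integral_horizontal) (auto simp: a3_def a4_def closed_segment_commute)
      moreover have "contour_integral (linepath a3 a4) ?f = - contour_integral (linepath a4 a3) ?f"
        by (rule contour_integral_reverse_linepath) (rule conts(3))
      ultimately show ?thesis by simp
    qed
    have bottom: "contour_integral (linepath a1 a2) ?f = cnj (I n)"
    proof -
      have "contour_integral (linepath a1 a2) ?f = (LINT x:{- N..N}|lborel. ?f (Complex x (- \<theta>)))"
        unfolding a1_def a2_def using N0 conts(1)
        by (intro contour_integral_horizontal) (auto simp: a1_def a2_def)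
      moreover have "?f (Complex x (- \<theta>)) = cnj (?f (Complex x \<theta>))" for x
      proof -
        have cn: "Complex x (- \<theta>) = cnj (Complex x \<theta>)" by (simp add: complex_eq_iff)
        have "\<bar>Im (Complex x \<theta>)\<bar> < pi" using \<theta> \<theta>0 by simp
        then show ?thesis unfolding cn \<Phi>_def by (simp add: F_cnj exp_cnj del: complex_cnj)
      qed
      moreover have "(LINT x:{- N..N}|lborel. cnj (?f (Complex x \<theta>))) = cnj (I n)"
      proof -
        have "indicator {- N..N} x *\<^sub>R cnj (?f (Complex x \<theta>)) = cnj (indicator {- N..N} x *\<^sub>R ?f (Complex x \<theta>))" for x :: real
          by simp
        then show ?thesis
          unfolding I_def set_lebesgue_integral_def N_def[symmetric] by (simp only: Bochner_Integration.integral_cnj)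
      qed
      ultimately show ?thesis by simp
    qed
    have Veq: "V n = contour_integral (linepath a2 a3) ?f + contour_integral (linepath a4 a1) ?f"
      by (simp add: V_def a1_def a2_def a3_def a4_def N_def)
    have "- (2 * \<i>) * of_real (Im (I n)) = cnj (I n) - I n" by (simp add: complex_eq_iff)
    note Im_eq = this
    show "- (2 * \<i>) * of_real (Im (I n)) + V n = 2 * of_real pi * \<i> * F \<gamma> \<sigma> ?z"
      unfolding Im_eq Veq res[symmetric] split top bottom by (simp add: algebra_simps)
    have eN: "2 * p \<le> exp N" "exp (- N) \<le> p / 2"
    proof -
      have "exp (ln p + ln 2) \<le> exp N" by (subst exp_le_cancel_iff) (use N in linarith)
      then show "2 * p \<le> exp N" using p by (simp add: exp_add)
      have "exp (- N) \<le> exp (ln p - ln 2)" by (subst exp_le_cancel_iff) (use N in linarith)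
      then show "exp (- N) \<le> p / 2" using p by (simp add: exp_diff)
    qed
    \<comment> \<open>On the right side the quotient of \<open>exp z\<close> and
      \<open>exp z - p\<close> is bounded and \<open>F\<close> decays; on the left side
      \<open>F\<close> is merely bounded and the factor \<open>exp z\<close> of ds is small.\<close>
    have right: "norm (?f z) \<le> 2 * c / (1 + exp N)" if z: "Re z = N" "\<bar>Im z\<bar> \<le> \<theta>" for z
    proof -
      have nF: "norm (F \<gamma> \<sigma> z) \<le> c / (1 + exp N)" using norm_F(2)[OF z(2) \<sigma>, of \<gamma>] \<gamma> z by (simp add: c_def)
      have "exp N - p \<le> norm (exp z - of_real p)"
        using norm_triangle_ineq2[of "exp z" "of_real p"] p z by simp
      then have d: "exp N / 2 \<le> norm (exp z - of_real p)" using eN by linarith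
      have "norm (?f z) = norm (F \<gamma> \<sigma> z) * exp N / norm (exp z - of_real p)"
        by (simp add: \<Phi>_def norm_mult norm_divide z)
      also have "\<dots> \<le> (c / (1 + exp N)) * exp N / (exp N / 2)"
        using nF d c by (intro frac_le mult_right_mono) (auto intro!: divide_nonneg_nonneg add_nonneg_nonneg)
      finally show ?thesis by (simp add: mult.commute)
    qed
    have left: "norm (?f z) \<le> c * exp (- N) * (2 / p)" if z: "Re z = - N" "\<bar>Im z\<bar> \<le> \<theta>" for z
    proof -
      have nF: "norm (F \<gamma> \<sigma> z) \<le> c" using norm_F(1)[OF z(2) \<sigma>, of \<gamma>] \<gamma> by (simp add: c_def)
      have "p - exp (- N) \<le> norm (of_real p - exp z)"
        using norm_triangle_ineq2[of "of_real p" "exp z"] p z by simp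
      then have d: "p / 2 \<le> norm (exp z - of_real p)" using eN by (simp add: norm_minus_commute)
      have "norm (?f z) = norm (F \<gamma> \<sigma> z) * exp (- N) / norm (exp z - of_real p)"
        by (simp add: \<Phi>_def norm_mult norm_divide z)
      also have "\<dots> \<le> c * exp (- N) / (p / 2)"
        using nF d c p by (intro frac_le mult_right_mono) auto
      finally show ?thesis by simp
    qed
    have seg_right: "Re z = N \<and> \<bar>Im z\<bar> \<le> \<theta>" if "z \<in> closed_segment a2 a3" for z
      using that \<theta>0 by (simp add: a2_def a3_def closed_segment_same_Re closed_segment_eq_real_ivl abs_le_iff) 
    have seg_left: "Re z = - N \<and> \<bar>Im z\<bar> \<le> \<theta>" if "z \<in> closed_segment a4 a1" for z
      using that \<theta>0 by (simp add: a1_def a4_def closed_segment_same_Re closed_segment_eq_real_ivl abs_le_iff)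
    have "norm (contour_integral (linepath a2 a3) ?f) \<le> (2 * c / (1 + exp N)) * norm (a3 - a2)"
      using c right seg_right by (intro contour_integral_bound_linepath ci) (auto intro!: divide_nonneg_nonneg add_nonneg_nonneg)
    moreover have "norm (contour_integral (linepath a4 a1) ?f) \<le> (c * exp (- N) * (2 / p)) * norm (a1 - a4)"
      using c p left seg_left by (intro contour_integral_bound_linepath ci) auto
    moreover have "norm (a3 - a2) = 2 * \<theta>" "norm (a1 - a4) = 2 * \<theta>"
      using \<theta>0 by (simp_all add: a1_def a2_def a3_def a4_def cmod_def real_sqrt_mult)
    ultimately have "norm (V n) \<le> (2 * c / (1 + exp N)) * (2 * \<theta>) + (c * exp (- N) * (2 / p)) * (2 * \<theta>)"
      unfolding Veq by (intro order_trans[OF norm_triangle_ineq]) simp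
    also have "\<dots> \<le> 4 * \<theta> * (2 * c / (1 + exp N) + c * exp (- N) * (2 / p))"
    proof -
      have "0 \<le> 2 * c / (1 + exp N) + c * exp (- N) * (2 / p)"
        using c p by (auto intro!: divide_nonneg_nonneg add_nonneg_nonneg)
      then have "(2 * \<theta>) * (2 * c / (1 + exp N) + c * exp (- N) * (2 / p)) \<le> (4 * \<theta>) * (2 * c / (1 + exp N) + c * exp (- N) * (2 / p))"
        using \<theta>0 by (intro mult_right_mono) auto
      then show ?thesis by (simp only: distrib_left mult.commute[of "2 * \<theta>"])
    qed
    finally show "norm (V n) \<le> 4 * \<theta> * (2 * c / (1 + exp (real n)) + c * exp (- real n) * (2 / p))"
      by (simp add: N_def)
  qed
  have e0: "(\<lambda>n. exp (- real n)) \<longlonglongrightarrow> 0"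
    by (rule filterlim_compose[OF exp_at_bot]) (simp add: filterlim_uminus_at_bot filterlim_real_sequentially)
  have "(\<lambda>n. 2 * c / (1 + exp (real n))) \<longlonglongrightarrow> 0"
    by (rule tendsto_divide_0[OF tendsto_const])
      (intro filterlim_at_top_imp_at_infinity filterlim_tendsto_add_at_top[OF tendsto_const] filterlim_compose[OF exp_at_top filterlim_real_sequentially])
  then have "(\<lambda>n. 4 * \<theta> * (2 * c / (1 + exp (real n)) + c * exp (- real n) * (2 / p))) \<longlonglongrightarrow> 4 * \<theta> * (0 + c * 0 * (2 / p))"
    by (intro tendsto_intros e0)
  then have "V \<longlonglongrightarrow> 0"
    by (intro Lim_null_comparison[of V]) (use vbound in \<open>auto simp: eventually_sequentially\<close>)
  then have "(\<lambda>n. - (2 * \<i>) * of_real (Im (I n)) + V n) \<longlonglongrightarrow> - (2 * \<i>) * of_real (Im (LINT x|lborel. ?f (Complex x \<theta>))) + 0"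
    by (intro tendsto_intros I_lim)
  moreover have "(\<lambda>n. - (2 * \<i>) * of_real (Im (I n)) + V n) \<longlonglongrightarrow> 2 * of_real pi * \<i> * F \<gamma> \<sigma> ?z"
    by (rule tendsto_eventually) (use main in \<open>auto simp: eventually_sequentially\<close>)
  ultimately have "- (2 * \<i>) * of_real (Im (LINT x|lborel. ?f (Complex x \<theta>))) + 0 = 2 * of_real pi * \<i> * F \<gamma> \<sigma> ?z"
    by (rule LIMSEQ_unique)
  moreover have "2 * of_real pi * \<i> * F \<gamma> \<sigma> ?z = (- (2 * \<i>)) * (- of_real pi * F \<gamma> \<sigma> ?z)"
    by (simp add: mult_ac)
  ultimately have eq: "- (2 * \<i>) * of_real (Im (LINT x|lborel. ?f (Complex x \<theta>))) = (- (2 * \<i>)) * (- of_real pi * F \<gamma> \<sigma> ?z)"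
    by simp
  have "- (2 * \<i>) \<noteq> 0" by simp
  from iffD1[OF mult_left_cancel[OF this] eq] show ?thesis .
qed

end

lemma has_bochner_integral_exp_half_line:
  fixes a :: real
  assumes "0 < a"
  shows "has_bochner_integral lborel (\<lambda>t. indicator {0<..} t * exp (- a * t)) (1 / a)"
proof -
  have 1: "has_bochner_integral lborel (\<lambda>x::real. indicator {0<..} x * exp (- x)) 1"
    using has_bochner_integral_I0i_power_exp_m[of 0] by (simp add: mult.commute)
  have i: "indicator {0<..} (0 + a * t) = (indicator {0<..} t :: real)" for t
    using assms by (simp add: indicator_def zero_less_mult_iff)
  show ?thesis
    using lborel_has_bochner_integral_real_affine_iff[of a "\<lambda>x::real. indicator {0<..} x * exp (- x)" 1 0] 1 assms
    by (simp add: i[simplified] divide_inverse)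
qed

lemma has_bochner_integral_cexp_half_line:
  fixes z :: complex
  assumes z: "0 < Re z"
  shows "has_bochner_integral lborel (\<lambda>t. indicator {0<..} t *\<^sub>R exp (- z * of_real t)) (1 / z)"
proof -
  have z0: "z \<noteq> 0" using z by auto
  have n: "norm (indicator {0<..} t *\<^sub>R exp (- z * of_real t)) = indicator {0<..} t * exp (- Re z * t)" for t :: real
    by (simp add: norm_exp_eq_Re indicator_def)
  have re: "integrable lborel (\<lambda>t. indicator {0<..} t * exp (- Re z * t))"
    using has_bochner_integral_exp_half_line[OF z] by (simp add: has_bochner_integral_iff)
  have m: "(\<lambda>t::real. indicator {0<..} t *\<^sub>R exp (- z * of_real t)) \<in> borel_measurable lborel"
  proof -
    have "(\<lambda>t::real. exp (- z * of_real t)) \<in> borel_measurable borel"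
      by (intro borel_measurable_continuous_onI continuous_intros)
    then show ?thesis by measurable
  qed
  have int: "integrable lborel (\<lambda>t. indicator {0<..} t *\<^sub>R exp (- z * of_real t))"
    by (rule Bochner_Integration.integrable_bound[OF re m]) (use n in simp)
  have fin: "(LINT t|lborel. indicator {0..real k} t *\<^sub>R exp (- z * of_real t)) = (1 - exp (- z * of_real (real k))) / z" for k
  proof -
    have "((\<lambda>t. - exp (- z * of_real t) / z) has_vector_derivative exp (- z * of_real t)) (at t within {0..real k})" for t
    proof -
      have "((\<lambda>u. - exp (- z * u) / z) has_field_derivative exp (- z * of_real t)) (at (of_real t))"
        using z0 by (auto intro!: derivative_eq_intros)
      then show ?thesis by (rule has_vector_derivative_real_field[THEN has_vector_derivative_at_within])
    qed
    then have "has_bochner_integral lborel (\<lambda>t. indicator {0..real k} t *\<^sub>R exp (- z * of_real t))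
        (- exp (- z * of_real (real k)) / z - - exp (- z * of_real 0) / z)"
      by (intro has_bochner_integral_FTC_Icc) (auto intro!: continuous_intros)
    then show ?thesis by (simp add: has_bochner_integral_iff diff_divide_distrib)
  qed
  have "(\<lambda>k. LINT t|lborel. indicator {0..real k} t *\<^sub>R exp (- z * of_real t)) \<longlonglongrightarrow> (LINT t|lborel. indicator {0<..} t *\<^sub>R exp (- z * of_real t))"
  proof (rule integral_dominated_convergence[where w = "\<lambda>t. indicator {0<..} t * exp (- Re z * t)"])
    have [measurable]: "(\<lambda>t::real. exp (- z * of_real t)) \<in> borel_measurable borel"
      by (intro borel_measurable_continuous_onI continuous_intros)
    show "(\<lambda>t. indicator {0..real k} t *\<^sub>R exp (- z * of_real t)) \<in> borel_measurable lborel" for k by measurable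
    show "AE t in lborel. (\<lambda>k. indicator {0..real k} t *\<^sub>R exp (- z * of_real t)) \<longlonglongrightarrow> indicator {0<..} t *\<^sub>R exp (- z * of_real t)"
      using AE_lborel_singleton[of "0::real"]
    proof eventually_elim
      case (elim t)
      obtain N :: nat where N: "\<bar>t\<bar> \<le> real N" using real_arch_simple by blast
      show ?case
      proof (rule tendsto_eventually)
        show "\<forall>\<^sub>F k in sequentially. indicator {0..real k} t *\<^sub>R exp (- z * of_real t) = indicator {0<..} t *\<^sub>R exp (- z * of_real t)"
          using eventually_ge_at_top[of N]
        proof eventually_elim
          case (elim k)
          then have "\<bar>t\<bar> \<le> real k" using N by linarith
          then show ?case using \<open>t \<noteq> 0\<close> by (auto simp: indicator_def)
        qed
      qed
    qed
    show "AE t in lborel. norm (indicator {0..real k} t *\<^sub>R exp (- z * of_real t)) \<le> indicator {0<..} t * exp (- Re z * t)" for k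
      using AE_lborel_singleton[of "0::real"] by eventually_elim (auto simp: indicator_def norm_exp_eq_Re)
  qed (use re m in auto)
  moreover have "(\<lambda>k. (1 - exp (- z * of_real (real k))) / z) \<longlonglongrightarrow> (1 - 0) / z"
  proof (intro tendsto_intros z0)
    have "(\<lambda>k. exp (- (Re z * real k))) \<longlonglongrightarrow> 0"
      by (rule filterlim_compose[OF exp_at_bot])
        (simp add: filterlim_uminus_at_bot filterlim_tendsto_pos_mult_at_top[OF tendsto_const z filterlim_real_sequentially])
    then have "(\<lambda>k. norm (exp (- z * of_real (real k)))) \<longlonglongrightarrow> 0" by (simp add: norm_exp_eq_Re)
    then show "(\<lambda>k. exp (- z * of_real (real k))) \<longlonglongrightarrow> 0" by (rule tendsto_norm_zero_cancel)
  qed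
  ultimately have "(LINT t|lborel. indicator {0<..} t *\<^sub>R exp (- z * of_real t)) = (1 - 0) / z"
    unfolding fin by (rule LIMSEQ_unique)
  then show ?thesis using int by (simp add: has_bochner_integral_iff)
qed

section \<open>The inverse transforms \<open>J\<close>: bounds, derivatives, Laplace
  transforms\<close>

context order_mixture
begin

abbreviation ray :: "real \<Rightarrow> complex" where "ray x \<equiv> Complex x \<theta>"

lemma \<theta>_pos: "0 < \<theta>" using \<theta> pi_gt_zero by linarith

lemma ray_strip: "\<bar>Im (ray x)\<bar> \<le> \<theta>" "\<bar>Im (ray x)\<bar> < pi" using \<theta> \<theta>_pos by auto

text \<open>Integrand of the Bromwich integral on the upper ray; the last factor is ds/dz.\<close>

definition G :: "real \<Rightarrow> real \<Rightarrow> real \<Rightarrow> real \<Rightarrow> complex" where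
  "G \<gamma> \<sigma> t x = exp (of_real t * sc (ray x)) * F \<gamma> \<sigma> (ray x) * exp (ray x)"

text \<open>\<open>J \<gamma> \<sigma>\<close> is the inverse Laplace transform of \<open>s \<mapsto> s\<^sup>-\<^sup>\<gamma> exp (-\<sigma> f\<^sup>\<mu>(s))\<close>; by symmetry only the upper half of the contour is
  needed.\<close>

definition J :: "real \<Rightarrow> real \<Rightarrow> real \<Rightarrow> real" where
  "J \<gamma> \<sigma> t = Im (LINT x|lborel. G \<gamma> \<sigma> t x) / pi"

lemma measurable_ray [measurable]:
  "(\<lambda>x. sc (ray x)) \<in> borel_measurable borel" "(\<lambda>x. Ln (sc (ray x))) \<in> borel_measurable borel"
  "(\<lambda>x. cexponent (sc (ray x))) \<in> borel_measurable borel" "(\<lambda>x. exp (ray x)) \<in> borel_measurable borel"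
proof -
  have c: "continuous_on UNIV (\<lambda>x. sc (ray x))"
    unfolding sc_def Complex_eq by (intro continuous_intros)
  show "(\<lambda>x. exp (ray x)) \<in> borel_measurable borel"
    unfolding Complex_eq by (intro borel_measurable_continuous_onI continuous_intros)
  show "(\<lambda>x. sc (ray x)) \<in> borel_measurable borel" using c by (rule borel_measurable_continuous_onI)
  have n: "sc (ray x) \<notin> \<real>\<^sub>\<le>\<^sub>0" for x by (rule sc_not_nonpos[OF ray_strip(2)])
  show "(\<lambda>x. Ln (sc (ray x))) \<in> borel_measurable borel"
    by (intro borel_measurable_continuous_onI continuous_on_Ln' c) (use n in auto)
  show "(\<lambda>x. cexponent (sc (ray x))) \<in> borel_measurable borel"
    by (intro borel_measurable_continuous_onI continuous_on_compose2[OF holomorphic_on_imp_continuous_on[OF cexponent_holomorphic] c])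
      (use n in auto)
qed

lemma measurable_G [measurable (raw)]:
  assumes [measurable]: "\<gamma> \<in> borel_measurable M" "\<sigma> \<in> borel_measurable M" "t \<in> borel_measurable M" "x \<in> borel_measurable M"
  shows "(\<lambda>\<omega>. G (\<gamma> \<omega>) (\<sigma> \<omega>) (t \<omega>) (x \<omega>)) \<in> borel_measurable M"
proof -
  have [measurable]: "(\<lambda>\<omega>. sc (ray (x \<omega>))) \<in> borel_measurable M" "(\<lambda>\<omega>. Ln (sc (ray (x \<omega>)))) \<in> borel_measurable M"
    "(\<lambda>\<omega>. cexponent (sc (ray (x \<omega>)))) \<in> borel_measurable M" "(\<lambda>\<omega>. exp (ray (x \<omega>))) \<in> borel_measurable M"
    by (rule measurable_compose[OF assms(4)], measurable)+
  show ?thesis unfolding G_def F_def by measurable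
qed

lemma measurable_J [measurable (raw)]:
  assumes [measurable]: "\<gamma> \<in> borel_measurable M" "\<sigma> \<in> borel_measurable M" "t \<in> borel_measurable M"
  shows "(\<lambda>\<omega>. J (\<gamma> \<omega>) (\<sigma> \<omega>) (t \<omega>)) \<in> borel_measurable M"
proof -
  have "(\<lambda>\<omega>. LINT x|lborel. G (\<gamma> \<omega>) (\<sigma> \<omega>) (t \<omega>) x) \<in> borel_measurable M"
    by (rule lborel.borel_measurable_lebesgue_integral) measurable
  then show ?thesis unfolding J_def by measurable
qed

definition \<kappa> :: real where "\<kappa> = - cos \<theta>"

lemma \<kappa>: "0 < \<kappa>" "\<kappa> \<le> 1" using cos_\<theta> by (auto simp: \<kappa>_def)

text \<open>Meant for times between \<open>t\<^sub>1\<close> and \<open>t\<^sub>2\<close>: the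
  factor \<open>exp t\<^sub>2\<close> is due to the base point 1 of the contour, the term with
  \<open>t\<^sub>1\<close> to the decay of e^(ts) along the ray, the denominator to
  \<open>norm_F\<close>.\<close>

definition G_const :: "real \<Rightarrow> real \<Rightarrow> real" where
  "G_const t\<^sub>1 t\<^sub>2 = exp t\<^sub>2 * (1 + 2 / (\<kappa> * t\<^sub>1)\<^sup>2) / sector_bound\<^sup>2"

lemma G_const_nonneg: "0 \<le> G_const t\<^sub>1 t\<^sub>2" by (simp add: G_const_def)

text \<open>Along the ray the real part of t s is \<open>t - t * (\<kappa> * exp x)\<close>. The
  integrand thus decays doubly exponentially to the right, uniformly only for t bounded away from 0;
  to the left it decays like ds.\<close>

lemma norm_G:
  assumes t: "0 < t\<^sub>1" "t\<^sub>1 \<le> t" "t \<le> t\<^sub>2" and \<sigma>: "0 \<le> \<sigma>" and \<gamma>: "0 \<le> \<gamma>" "\<gamma> \<le> 2"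
  shows "norm (G \<gamma> \<sigma> t x) \<le> G_const t\<^sub>1 t\<^sub>2 * exp (- decay_rate * \<sigma>) * exp (- \<bar>x\<bar>)"
proof -
  have nF: "norm (F \<gamma> \<sigma> (ray x)) \<le> exp (- decay_rate * \<sigma>) / sector_bound\<^sup>2"
    by (rule norm_F(1)[OF ray_strip(1) \<sigma> \<gamma>])
  have "Re (of_real t * sc (ray x)) = t - t * (\<kappa> * exp x)"
    by (simp add: sc_def Re_exp \<kappa>_def algebra_simps)
  then have "norm (exp (of_real t * sc (ray x))) = exp t * exp (- (t * (\<kappa> * exp x)))"
    by (simp only: norm_exp_eq_Re exp_add[symmetric]) simp
  moreover have "exp (- (t * (\<kappa> * exp x))) \<le> exp (- (t\<^sub>1 * (\<kappa> * exp x)))"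
    using t \<kappa> by (simp add: mult_right_mono)
  moreover have "exp t \<le> exp t\<^sub>2" using t by simp
  ultimately have nE: "norm (exp (of_real t * sc (ray x))) \<le> exp t\<^sub>2 * exp (- (t\<^sub>1 * (\<kappa> * exp x)))"
    by (auto intro: mult_mono)
  define y where "y = t\<^sub>1 * (\<kappa> * exp x)"
  have y: "0 < y" using t \<kappa> by (simp add: y_def)
  have e: "exp (- y) * exp x \<le> (1 + 2 / (\<kappa> * t\<^sub>1)\<^sup>2) * exp (- \<bar>x\<bar>)"
  proof (cases "x \<le> 0")
    case True
    have "exp (- y) * exp x \<le> 1 * exp x" using y by (intro mult_right_mono) auto
    also have "\<dots> \<le> (1 + 2 / (\<kappa> * t\<^sub>1)\<^sup>2) * exp x" by (intro mult_right_mono) auto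
    finally show ?thesis using True by simp
  next
    case False
    \<comment> \<open>Since \<open>y\<close> is proportional to \<open>exp x\<close>, a quadratic
      bound leaves \<open>exp (- x)\<close> after multiplication by \<open>exp x\<close>.\<close>
    have "y\<^sup>2 / 2 \<le> exp y"
      using exp_lower_Taylor_quadratic[of y] y by simp
    then have "exp (- y) \<le> 2 / y\<^sup>2"
      using y by (simp add: exp_minus field_simps)
    then have "exp (- y) * exp x \<le> (2 / y\<^sup>2) * exp x" by (intro mult_right_mono) auto
    also have "\<dots> = (2 / (\<kappa> * t\<^sub>1)\<^sup>2) * exp (- x)"
      using t \<kappa> by (simp add: y_def power_mult_distrib exp_minus field_simps power2_eq_square)
    also have "\<dots> \<le> (1 + 2 / (\<kappa> * t\<^sub>1)\<^sup>2) * exp (- x)" by (intro mult_right_mono) auto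
    finally show ?thesis using False by simp
  qed
  have "norm (G \<gamma> \<sigma> t x) = norm (exp (of_real t * sc (ray x))) * norm (F \<gamma> \<sigma> (ray x)) * exp x"
    by (simp add: G_def norm_mult)
  also have "\<dots> \<le> (exp t\<^sub>2 * exp (- y)) * (exp (- decay_rate * \<sigma>) / sector_bound\<^sup>2) * exp x"
    using nE nF by (intro mult_right_mono mult_mono) (auto simp: y_def)
  also have "\<dots> = (exp t\<^sub>2 * (exp (- decay_rate * \<sigma>) / sector_bound\<^sup>2)) * (exp (- y) * exp x)" by simp
  also have "\<dots> \<le> (exp t\<^sub>2 * (exp (- decay_rate * \<sigma>) / sector_bound\<^sup>2)) * ((1 + 2 / (\<kappa> * t\<^sub>1)\<^sup>2) * exp (- \<bar>x\<bar>))"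
    using e by (intro mult_left_mono) auto
  finally show ?thesis by (simp add: G_const_def mult_ac)
qed

lemma integrable_G:
  assumes "0 < t" "0 \<le> \<sigma>" "0 \<le> \<gamma>" "\<gamma> \<le> 2"
  shows "integrable lborel (G \<gamma> \<sigma> t)"
  by (rule continuous_integrable_exp_minus_abs[where K = "G_const t t * exp (- decay_rate * \<sigma>)"])
    (use norm_G[of t t t \<sigma> \<gamma>] assms in auto)

definition J_const :: "real \<Rightarrow> real \<Rightarrow> real" where
  "J_const t\<^sub>1 t\<^sub>2 = G_const t\<^sub>1 t\<^sub>2 * (LINT x|lborel. exp (- \<bar>x\<bar>)) / pi"

lemma J_const_nonneg: "0 \<le> J_const t\<^sub>1 t\<^sub>2"
  using G_const_nonneg by (simp add: J_const_def)

lemma abs_J: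
  assumes t: "0 < t\<^sub>1" "t\<^sub>1 \<le> t" "t \<le> t\<^sub>2" and \<sigma>: "0 \<le> \<sigma>" and \<gamma>: "0 \<le> \<gamma>" "\<gamma> \<le> 2"
  shows "\<bar>J \<gamma> \<sigma> t\<bar> \<le> J_const t\<^sub>1 t\<^sub>2 * exp (- decay_rate * \<sigma>)"
proof -
  have "\<bar>Im (LINT x|lborel. G \<gamma> \<sigma> t x)\<bar> \<le> norm (LINT x|lborel. G \<gamma> \<sigma> t x)" by (rule abs_Im_le_cmod)
  also have "\<dots> \<le> (LINT x|lborel. G_const t\<^sub>1 t\<^sub>2 * exp (- decay_rate * \<sigma>) * exp (- \<bar>x\<bar>))"
    using integrable_G[of t \<sigma> \<gamma>] assms
    by (intro Bochner_Integration.integral_norm_bound_integral integrable_mult_right integrable_exp_minus_abs norm_G) auto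
  also have "\<dots> = G_const t\<^sub>1 t\<^sub>2 * exp (- decay_rate * \<sigma>) * (LINT x|lborel. exp (- \<bar>x\<bar>))" by simp
  finally have "\<bar>J \<gamma> \<sigma> t\<bar> \<le> G_const t\<^sub>1 t\<^sub>2 * exp (- decay_rate * \<sigma>) * (LINT x|lborel. exp (- \<bar>x\<bar>)) / pi"
    unfolding J_def abs_divide by (simp add: divide_right_mono)
  then show ?thesis by (simp add: J_const_def mult_ac)
qed

text \<open>Differentiating e^(ts) brings down s, which lowers \<gamma> by one. Times between t/2
  and 2t have a common dominating function.\<close>

lemma J_derivative:
  assumes t: "0 < t" and \<sigma>: "0 \<le> \<sigma>" and \<gamma>: "1 \<le> \<gamma>" "\<gamma> \<le> 2"
  shows "(J \<gamma> \<sigma> has_vector_derivative J (\<gamma> - 1) \<sigma> t) (at t)"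
proof -
  have "((\<lambda>t. LINT x|lborel. G \<gamma> \<sigma> t x) has_vector_derivative (LINT x|lborel. G (\<gamma> - 1) \<sigma> t x)) (at t)"
  proof (rule has_vector_derivative_lebesgue_integral[where U = "{t/2<..<2*t}" and D = "\<lambda>t x. G (\<gamma> - 1) \<sigma> t x"
        and w = "\<lambda>x. G_const (t/2) (2*t) * exp (- decay_rate * \<sigma>) * exp (- \<bar>x\<bar>)"])
    show "integrable lborel (G \<gamma> \<sigma> s)" if "s \<in> {t/2<..<2*t}" for s
      using that t \<sigma> \<gamma> by (intro integrable_G) auto
    show "AE x in lborel. \<forall>s\<in>{t/2<..<2*t}. ((\<lambda>s. G \<gamma> \<sigma> s x) has_vector_derivative G (\<gamma> - 1) \<sigma> s x) (at s)"
    proof (intro AE_I2 ballI)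
      fix x s :: real
      have nz: "sc (ray x) \<noteq> 0" by (rule sc_nonzero[OF ray_strip(1)])
      have "((\<lambda>u. exp (u * sc (ray x)) * F \<gamma> \<sigma> (ray x) * exp (ray x)) has_field_derivative
          sc (ray x) * exp (of_real s * sc (ray x)) * F \<gamma> \<sigma> (ray x) * exp (ray x)) (at (of_real s))"
        by (auto intro!: derivative_eq_intros)
      then have "((\<lambda>s. G \<gamma> \<sigma> s x) has_vector_derivative sc (ray x) * exp (of_real s * sc (ray x)) * F \<gamma> \<sigma> (ray x) * exp (ray x)) (at s)"
        unfolding G_def by (rule has_vector_derivative_real_field)
      moreover have "sc (ray x) * exp (- of_real \<gamma> * Ln (sc (ray x))) = exp (- of_real (\<gamma> - 1) * Ln (sc (ray x)))"
      proof -
        have "exp (- of_real (\<gamma> - 1) * Ln (sc (ray x))) = exp (Ln (sc (ray x)) + - of_real \<gamma> * Ln (sc (ray x)))"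
          by (simp add: algebra_simps)
        then show ?thesis unfolding exp_add exp_Ln[OF nz] by simp
      qed
      then have eq: "sc (ray x) * F \<gamma> \<sigma> (ray x) = F (\<gamma> - 1) \<sigma> (ray x)"
        unfolding F_def by (simp only: mult.assoc[symmetric])
      have "sc (ray x) * exp (of_real s * sc (ray x)) * F \<gamma> \<sigma> (ray x) * exp (ray x) = G (\<gamma> - 1) \<sigma> s x"
        unfolding G_def eq[symmetric] by (simp only: mult_ac)
      ultimately show "((\<lambda>s. G \<gamma> \<sigma> s x) has_vector_derivative G (\<gamma> - 1) \<sigma> s x) (at s)" by simp
    qed
    show "AE x in lborel. \<forall>s\<in>{t/2<..<2*t}. norm (G (\<gamma> - 1) \<sigma> s x) \<le> G_const (t/2) (2*t) * exp (- decay_rate * \<sigma>) * exp (- \<bar>x\<bar>)"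
      using t \<sigma> \<gamma> by (intro AE_I2 ballI norm_G) auto
    show "integrable lborel (\<lambda>x. G_const (t/2) (2*t) * exp (- decay_rate * \<sigma>) * exp (- \<bar>x\<bar>))"
      by (intro integrable_mult_right integrable_exp_minus_abs)
  qed (use t in auto)
  from bounded_linear.has_vector_derivative[OF bounded_linear_Im this]
  have "((\<lambda>t. Im (LINT x|lborel. G \<gamma> \<sigma> t x)) has_vector_derivative Im (LINT x|lborel. G (\<gamma> - 1) \<sigma> t x)) (at t)" .
  from bounded_linear.has_vector_derivative[OF bounded_linear_divide[of pi] this]
  show ?thesis unfolding J_def[abs_def] J_def .
qed

text \<open>Candidate for the density: minus the \<sigma>-derivative of \<open>J 1\<close> brings
  down f^mu(s), which is the \<mu>-integral of s^\<beta>, and each s^\<beta> lowers the order 1 to 1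
  - \<beta>.\<close>

definition P :: "real \<Rightarrow> real \<Rightarrow> real" where "P t \<sigma> = (LINT \<beta>|\<mu>. J (1 - \<beta>) \<sigma> t)"

lemma supp_order: "\<beta> \<in> {b\<^sub>0..b\<^sub>1} \<Longrightarrow> 0 \<le> 1 - \<beta> \<and> 1 - \<beta> \<le> 2" using b by auto

lemma J_1_derivative:
  assumes t: "0 < t" and \<sigma>: "0 < \<sigma>"
  shows "((\<lambda>\<sigma>. J 1 \<sigma> t) has_vector_derivative - P t \<sigma>) (at \<sigma>)"
proof -
  let ?m = "measure \<mu> (space \<mu>)"
  have ce: "cexponent (sc (ray x)) * G 1 s t x = (LINT \<beta>|\<mu>. G (1 - \<beta>) s t x)" for s x
  proof -
    have nz: "sc (ray x) \<noteq> 0" by (rule sc_nonzero[OF ray_strip(1)])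
    have "exp (of_real \<beta> * Ln (sc (ray x))) * G 1 s t x = G (1 - \<beta>) s t x" for \<beta>
    proof -
      have eq: "exp (of_real \<beta> * Ln (sc (ray x))) * exp (- of_real 1 * Ln (sc (ray x))) = exp (- of_real (1 - \<beta>) * Ln (sc (ray x)))"
        unfolding exp_add[symmetric] by (rule arg_cong[where f = exp]) (simp add: algebra_simps)
      show ?thesis unfolding G_def F_def eq[symmetric] by (simp only: mult_ac)
    qed
    then show ?thesis
      unfolding cexponent_def using integrable_cexponent[OF nz] by (simp flip: integral_mult_left_zero)
  qed
  have bnd: "norm (cexponent (sc (ray x)) * G 1 s t x) \<le> ?m * G_const t t * exp (- \<bar>x\<bar>)" if s: "0 \<le> s" for s x
  proof -
    have nG: "norm (G (1 - \<beta>) s t x) \<le> G_const t t * exp (- \<bar>x\<bar>)" if "\<beta> \<in> {b\<^sub>0..b\<^sub>1}" for \<beta>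
    proof -
      have "norm (G (1 - \<beta>) s t x) \<le> G_const t t * exp (- decay_rate * s) * exp (- \<bar>x\<bar>)"
        using supp_order[OF that] t s by (intro norm_G) auto
      also have "\<dots> \<le> G_const t t * 1 * exp (- \<bar>x\<bar>)"
        using decay_rate_pos s G_const_nonneg by (intro mult_right_mono mult_left_mono) auto
      finally show ?thesis by simp
    qed
    have "AE \<beta> in \<mu>. norm (G (1 - \<beta>) s t x) \<le> G_const t t * exp (- \<bar>x\<bar>)"
      using supp by eventually_elim (rule nG)
    then have "(LINT \<beta>|\<mu>. norm (G (1 - \<beta>) s t x)) \<le> (LINT \<beta>|\<mu>. G_const t t * exp (- \<bar>x\<bar>))"
      by (intro integral_mono_AE integrable_norm integrable_const_bound[where B = "G_const t t * exp (- \<bar>x\<bar>)"])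
        (auto intro!: mult_nonneg_nonneg G_const_nonneg)
    then show ?thesis unfolding ce
      by (intro order_trans[OF integral_norm_bound]) (simp add: mult_ac)
  qed
  have Dx: "((\<lambda>\<sigma>. LINT x|lborel. G 1 \<sigma> t x) has_vector_derivative (LINT x|lborel. - (cexponent (sc (ray x)) * G 1 \<sigma> t x))) (at \<sigma>)"
  proof (rule has_vector_derivative_lebesgue_integral[where U = "{0<..}" and D = "\<lambda>\<sigma> x. - (cexponent (sc (ray x)) * G 1 \<sigma> t x)"
        and w = "\<lambda>x. ?m * G_const t t * exp (- \<bar>x\<bar>)"])
    show "integrable lborel (G 1 s t)" if "s \<in> {0<..}" for s
      using that t by (intro integrable_G) auto
    show "AE x in lborel. \<forall>s\<in>{0<..}. ((\<lambda>s. G 1 s t x) has_vector_derivative - (cexponent (sc (ray x)) * G 1 s t x)) (at s)"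
    proof (intro AE_I2 ballI)
      fix x s :: real
      have "((\<lambda>u. exp (of_real t * sc (ray x)) * (exp (- of_real 1 * Ln (sc (ray x))) * exp (- u * cexponent (sc (ray x)))) * exp (ray x)) has_field_derivative
          - (cexponent (sc (ray x)) * (exp (of_real t * sc (ray x)) * (exp (- of_real 1 * Ln (sc (ray x))) * exp (- of_real s * cexponent (sc (ray x)))) * exp (ray x)))) (at (of_real s))"
        by (auto intro!: derivative_eq_intros)
      then show "((\<lambda>s. G 1 s t x) has_vector_derivative - (cexponent (sc (ray x)) * G 1 s t x)) (at s)"
        unfolding G_def F_def by (rule has_vector_derivative_real_field)
    qed
    show "AE x in lborel. \<forall>s\<in>{0<..}. norm (- (cexponent (sc (ray x)) * G 1 s t x)) \<le> ?m * G_const t t * exp (- \<bar>x\<bar>)"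
      using bnd by (intro AE_I2 ballI) (auto simp del: norm_mult)
    show "integrable lborel (\<lambda>x. ?m * G_const t t * exp (- \<bar>x\<bar>))"
      by (intro integrable_mult_right integrable_exp_minus_abs)
  qed (use \<sigma> in auto)
  interpret pair_sigma_finite \<mu> lborel ..
  have fub: "integrable (\<mu> \<Otimes>\<^sub>M lborel) (\<lambda>(\<beta>, x). G (1 - \<beta>) \<sigma> t x)"
  proof (rule Fubini_integrable)
    show "(\<lambda>(\<beta>, x). G (1 - \<beta>) \<sigma> t x) \<in> borel_measurable (\<mu> \<Otimes>\<^sub>M lborel)" by measurable
    show "AE \<beta> in \<mu>. integrable lborel (\<lambda>x. case (\<beta>, x) of (\<beta>, x) \<Rightarrow> G (1 - \<beta>) \<sigma> t x)"
      using supp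
    proof eventually_elim
      case (elim \<beta>)
      then show ?case using supp_order[OF elim] t \<sigma> by (auto intro!: integrable_G)
    qed
    show "integrable \<mu> (\<lambda>\<beta>. LINT x|lborel. norm (case (\<beta>, x) of (\<beta>, x) \<Rightarrow> G (1 - \<beta>) \<sigma> t x))"
    proof (rule integrable_const_bound)
      show "AE \<beta> in \<mu>. norm (LINT x|lborel. norm (case (\<beta>, x) of (\<beta>, x) \<Rightarrow> G (1 - \<beta>) \<sigma> t x))
          \<le> (LINT x|lborel. G_const t t * exp (- decay_rate * \<sigma>) * exp (- \<bar>x\<bar>))"
        using supp
      proof eventually_elim
        case (elim \<beta>)
        have "(LINT x|lborel. norm (G (1 - \<beta>) \<sigma> t x)) \<le> (LINT x|lborel. G_const t t * exp (- decay_rate * \<sigma>) * exp (- \<bar>x\<bar>))"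
          using supp_order[OF elim] t \<sigma>
          by (intro Bochner_Integration.integral_mono integrable_norm integrable_G integrable_mult_right integrable_exp_minus_abs norm_G) auto
        moreover have "0 \<le> (LINT x|lborel. norm (G (1 - \<beta>) \<sigma> t x))" by simp
        ultimately show ?case by simp
      qed
    qed measurable
  qed
  have "(LINT x|lborel. - (cexponent (sc (ray x)) * G 1 \<sigma> t x)) = - (LINT x|lborel. LINT \<beta>|\<mu>. G (1 - \<beta>) \<sigma> t x)"
    unfolding ce by simp
  also have "(LINT x|lborel. LINT \<beta>|\<mu>. G (1 - \<beta>) \<sigma> t x) = (LINT \<beta>|\<mu>. LINT x|lborel. G (1 - \<beta>) \<sigma> t x)"
    by (rule Fubini_integral[OF fub])
  finally have "((\<lambda>\<sigma>. LINT x|lborel. G 1 \<sigma> t x) has_vector_derivative - (LINT \<beta>|\<mu>. LINT x|lborel. G (1 - \<beta>) \<sigma> t x)) (at \<sigma>)"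
    using Dx by simp
  from bounded_linear.has_vector_derivative[OF bounded_linear_divide[of pi] bounded_linear.has_vector_derivative[OF bounded_linear_Im this]]
  have "((\<lambda>\<sigma>. J 1 \<sigma> t) has_vector_derivative - (Im (LINT \<beta>|\<mu>. LINT x|lborel. G (1 - \<beta>) \<sigma> t x) / pi)) (at \<sigma>)"
    by (simp add: J_def[abs_def])
  moreover have "Im (LINT \<beta>|\<mu>. LINT x|lborel. G (1 - \<beta>) \<sigma> t x) / pi = P t \<sigma>"
    using integrable_fst'[OF fub] by (simp add: P_def J_def)
  ultimately show ?thesis by simp
qed

text \<open>Fubini in time and contour parameter: the time integral of e^((s - w)t) is 1/(w - s),
  because \<open>w > 1\<close> lies to the right of the contour. What remains is the Cauchy integral
  of \<open>contour_identity\<close> with \<open>p = w - 1\<close>.\<close>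

theorem laplace_J:
  assumes \<gamma>: "1 \<le> \<gamma>" "\<gamma> \<le> 2" and \<sigma>: "0 \<le> \<sigma>" and w: "1 < w"
  shows "set_integrable lborel {0<..} (\<lambda>t. exp (- w * t) * J \<gamma> \<sigma> t)"
    and "(LINT t:{0<..}|lborel. exp (- w * t) * J \<gamma> \<sigma> t) = w powr (- \<gamma>) * exp (- \<sigma> * (LINT \<beta>|\<mu>. w powr \<beta>))"
proof -
  define p where "p = w - 1"
  have p: "0 < p" using w by (simp add: p_def)
  define c where "c = exp (- decay_rate * \<sigma>) / sector_bound\<^sup>2"
  have c: "0 \<le> c" by (simp add: c_def)
  define H where "H x t = (indicator {0<..} t * exp (- w * t)) *\<^sub>R G \<gamma> \<sigma> t x" for x t
  define z where "z x = of_real p - exp (ray x)" for x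
  have Rez: "Re (z x) = p + \<kappa> * exp x" for x by (simp add: z_def Re_exp \<kappa>_def)
  have Rez_pos: "0 < Re (z x)" for x using p \<kappa> by (simp add: Rez add_pos_pos)
  have H: "H x t = (F \<gamma> \<sigma> (ray x) * exp (ray x)) * (indicator {0<..} t *\<^sub>R exp (- z x * of_real t))" for x t
  proof -
    have "of_real (exp (- w * t)) * exp (of_real t * sc (ray x)) = exp (- z x * of_real t)"
      by (simp add: exp_of_real[symmetric] exp_add[symmetric] sc_def z_def p_def algebra_simps)
    note eq = this
    show ?thesis
      unfolding H_def G_def scaleR_conv_of_real of_real_mult eq[symmetric] by (simp only: mult_ac)
  qed
  have inner: "has_bochner_integral lborel (H x) ((F \<gamma> \<sigma> (ray x) * exp (ray x)) * (1 / z x))" for x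
    unfolding H by (intro has_bochner_integral_mult_right has_bochner_integral_cexp_half_line Rez_pos)
  have inner_eq: "(F \<gamma> \<sigma> (ray x) * exp (ray x)) * (1 / z x) = - \<Phi> \<gamma> \<sigma> p (ray x)" for x
  proof -
    have zx: "z x = - (exp (ray x) - of_real p)" by (simp add: z_def)
    show ?thesis
      unfolding zx \<Phi>_def by (simp only: divide_minus_right mult_minus_right times_divide_eq_right mult_1_right)
  qed
  have normH: "norm (H x t) = norm (F \<gamma> \<sigma> (ray x) * exp (ray x)) * (indicator {0<..} t * exp (- Re (z x) * t))" for x t
    unfolding H norm_mult by (simp add: norm_exp_eq_Re indicator_def)
  have inner_norm: "(LINT t|lborel. norm (H x t)) = norm (F \<gamma> \<sigma> (ray x) * exp (ray x)) * (1 / Re (z x))" for x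
    unfolding normH using has_bochner_integral_mult_right[OF has_bochner_integral_exp_half_line[OF Rez_pos[of x]]]
    by (rule has_bochner_integral_integral_eq)
  have [measurable]: "case_prod H \<in> borel_measurable (lborel \<Otimes>\<^sub>M lborel)"
    unfolding H_def[abs_def] by measurable
  have bound: "norm (F \<gamma> \<sigma> (ray x) * exp (ray x)) * (1 / Re (z x)) \<le> (c / \<kappa> * (1 + 1 / p)) * exp (- \<bar>x\<bar>)" for x
  proof -
    have nF: "norm (F \<gamma> \<sigma> (ray x)) \<le> c / (1 + exp x)"
      using norm_F(2)[OF ray_strip(1) \<sigma>, of \<gamma> x] \<gamma> by (simp add: c_def)
    have "\<kappa> * p \<le> 1 * p" using \<kappa> p by (intro mult_right_mono) auto
    then have d: "\<kappa> * (exp x + p) \<le> Re (z x)" by (simp add: Rez algebra_simps)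
    have "norm (F \<gamma> \<sigma> (ray x) * exp (ray x)) * (1 / Re (z x)) = norm (F \<gamma> \<sigma> (ray x)) * exp x / Re (z x)"
      by (simp add: norm_mult)
    also have "\<dots> \<le> (c / (1 + exp x)) * exp x / (\<kappa> * (exp x + p))"
      using nF d c p \<kappa> by (intro frac_le mult_right_mono) (auto intro!: divide_nonneg_nonneg mult_pos_pos add_pos_pos add_nonneg_nonneg)
    also have "\<dots> = (c / \<kappa>) * (exp x / ((1 + exp x) * (exp x + p)))" by simp
    also have "\<dots> \<le> (c / \<kappa>) * ((1 + 1 / p) * exp (- \<bar>x\<bar>))"
      using c \<kappa> by (intro mult_left_mono rational_exp_bound p) auto
    finally show ?thesis by (simp only: mult.assoc)
  qed
  have Hint: "integrable (lborel \<Otimes>\<^sub>M lborel) (case_prod H)"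
  proof (rule lborel_pair.Fubini_integrable)
    have "integrable lborel (\<lambda>x. LINT t|lborel. norm (H x t))"
    proof (rule continuous_integrable_exp_minus_abs)
      show "(\<lambda>x. LINT t|lborel. norm (H x t)) \<in> borel_measurable borel"
        using lborel.borel_measurable_lebesgue_integral[of "\<lambda>x t. norm (H x t)" lborel] by (simp add: case_prod_beta')
      show "norm (LINT t|lborel. norm (H x t)) \<le> (c / \<kappa> * (1 + 1 / p)) * exp (- \<bar>x\<bar>)" for x
        unfolding inner_norm using bound[of x] Rez_pos[of x] by simp
    qed
    then show "integrable lborel (\<lambda>x. LINT t|lborel. norm (case (x, t) of (x, t) \<Rightarrow> H x t))" by simp
    show "AE x in lborel. integrable lborel (\<lambda>t. case (x, t) of (x, t) \<Rightarrow> H x t)"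
      using inner by (intro AE_I2) (auto simp: has_bochner_integral_iff)
  qed measurable
  have inner_t: "(LINT x|lborel. H x t) = (indicator {0<..} t * exp (- w * t)) *\<^sub>R (LINT x|lborel. G \<gamma> \<sigma> t x)" for t
    unfolding H_def by (rule Bochner_Integration.integral_scaleR_right)
  have It: "integrable lborel (\<lambda>t. LINT x|lborel. H x t)" using lborel_pair.integrable_snd[OF Hint] .
  have eqI: "Im (LINT x|lborel. H x t) = pi * (indicator {0<..} t *\<^sub>R (exp (- w * t) * J \<gamma> \<sigma> t))" for t
    unfolding inner_t by (simp add: J_def)
  have "integrable lborel (\<lambda>t. Im (LINT x|lborel. H x t))" using It by simp
  then have i: "integrable lborel (\<lambda>t. pi * (indicator {0<..} t *\<^sub>R (exp (- w * t) * J \<gamma> \<sigma> t)))" unfolding eqI .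
  have "integrable lborel (\<lambda>t. (1 / pi) * (pi * (indicator {0<..} t *\<^sub>R (exp (- w * t) * J \<gamma> \<sigma> t))))"
    by (rule integrable_mult_right[OF i])
  then show "set_integrable lborel {0<..} (\<lambda>t. exp (- w * t) * J \<gamma> \<sigma> t)"
    by (simp add: set_integrable_def)
  have "pi * (LINT t:{0<..}|lborel. exp (- w * t) * J \<gamma> \<sigma> t) = (LINT t|lborel. Im (LINT x|lborel. H x t))"
    unfolding eqI set_lebesgue_integral_def by simp
  also have "\<dots> = Im (LINT t|lborel. LINT x|lborel. H x t)" using It by simp
  finally have 1: "pi * (LINT t:{0<..}|lborel. exp (- w * t) * J \<gamma> \<sigma> t) = Im (LINT t|lborel. LINT x|lborel. H x t)" .
  have 2: "(LINT t|lborel. LINT x|lborel. H x t) = (LINT x|lborel. LINT t|lborel. H x t)" by (rule lborel_pair.Fubini_integral[OF Hint])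
  have 3: "(LINT x|lborel. LINT t|lborel. H x t) = - (LINT x|lborel. \<Phi> \<gamma> \<sigma> p (ray x))"
    unfolding has_bochner_integral_integral_eq[OF inner] inner_eq by simp
  have "Im (LINT x|lborel. \<Phi> \<gamma> \<sigma> p (ray x)) = Re (of_real (Im (LINT x|lborel. \<Phi> \<gamma> \<sigma> p (ray x))))" by simp
  also have "\<dots> = - pi * Re (F \<gamma> \<sigma> (of_real (ln p)))" unfolding contour_identity[OF \<gamma> \<sigma> p] by simp
  finally have 4: "pi * (LINT t:{0<..}|lborel. exp (- w * t) * J \<gamma> \<sigma> t) = pi * Re (F \<gamma> \<sigma> (of_real (ln p)))"
    unfolding 1 2 3 by simp
  have scw: "sc (of_real (ln p)) = of_real w" using p by (simp add: sc_def exp_of_real p_def)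
  have cw: "cexponent (of_real w) = of_real (LINT \<beta>|\<mu>. w powr \<beta>)"
  proof -
    have "exp (of_real \<beta> * Ln (of_real w)) = (of_real (w powr \<beta>) :: complex)" for \<beta>
      using w by (simp add: Ln_of_real powr_def exp_of_real[symmetric])
    then show ?thesis unfolding cexponent_def by simp
  qed
  have "exp (- of_real \<gamma> * Ln (of_real w)) = (of_real (w powr (- \<gamma>)) :: complex)"
    using w by (simp add: Ln_of_real powr_def exp_of_real[symmetric])
  then have "F \<gamma> \<sigma> (of_real (ln p)) = of_real (w powr (- \<gamma>) * exp (- \<sigma> * (LINT \<beta>|\<mu>. w powr \<beta>)))"
    unfolding F_def scw cw by (simp add: exp_of_real[symmetric])
  then show "(LINT t:{0<..}|lborel. exp (- w * t) * J \<gamma> \<sigma> t) = w powr (- \<gamma>) * exp (- \<sigma> * (LINT \<beta>|\<mu>. w powr \<beta>))"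
    using 4 by simp
qed

end

section \<open>Laplace transforms of distribution functions\<close>

lemma has_bochner_integral_powr_interval:
  fixes a c :: real
  assumes "- 1 < a" "0 \<le> c"
  shows "has_bochner_integral lborel (\<lambda>x. indicator {0..c} x * x powr a) (c powr (a + 1) / (a + 1))"
proof (rule has_bochner_integral_nn_integral)
  show "(\<integral>\<^sup>+ x. ennreal (indicator {0..c} x * x powr a) \<partial>lborel) = ennreal (c powr (a + 1) / (a + 1))"
    by (rule nn_integral_has_integral_lebesgue[OF _ has_integral_powr_from_0[OF assms]]) simp
qed (use assms in auto)

lemma has_bochner_integral_fractional_kernel:
  fixes a x t :: real
  assumes "- 1 < a" "x \<le> t"
  shows "has_bochner_integral lborel (\<lambda>r. indicator {x..t} r * (t - r) powr a) ((t - x) powr (a + 1) / (a + 1))"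
proof -
  have i: "indicator {0..t - x} (t + - 1 * r) = (indicator {x..t} r :: real)" for r
    by (auto simp: indicator_def)
  have "has_bochner_integral lborel (\<lambda>r. indicator {0..t - x} (t + - 1 * r) * (t + - 1 * r) powr a)
      ((t - x) powr (a + 1) / (a + 1) /\<^sub>R \<bar>- 1\<bar>)"
    using has_bochner_integral_powr_interval[OF assms(1), of "t - x"] assms(2)
    by (subst lborel_has_bochner_integral_real_affine_iff[symmetric]) auto
  then show ?thesis unfolding i by simp
qed

lemma has_bochner_integral_Gamma:
  fixes a w :: real
  assumes a: "0 < a" and w: "0 < w"
  shows "has_bochner_integral lborel (\<lambda>t. indicator {0<..} t * (exp (- w * t) * t powr (a - 1))) (Gamma a * w powr (- a))"
proof -
  have "has_bochner_integral lborel (\<lambda>t. indicator {0..} t * (t powr (a - 1) / exp t)) (Gamma a)"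
  proof (rule has_bochner_integral_nn_integral)
    show "(\<integral>\<^sup>+ t. ennreal (indicator {0..} t * (t powr (a - 1) / exp t)) \<partial>lborel) = ennreal (Gamma a)"
      by (rule nn_integral_has_integral_lebesgue[OF _ Gamma_integral_real[OF a]]) simp
  qed (use a Gamma_real_pos[OF a] in auto)
  then have "has_bochner_integral lborel (\<lambda>t. indicator {0..} (0 + w * t) * ((0 + w * t) powr (a - 1) / exp (0 + w * t))) (Gamma a /\<^sub>R \<bar>w\<bar>)"
    using w by (subst lborel_has_bochner_integral_real_affine_iff[symmetric]) auto
  then have "has_bochner_integral lborel
      (\<lambda>t. w powr (1 - a) * (indicator {0..} (0 + w * t) * ((0 + w * t) powr (a - 1) / exp (0 + w * t)))) (w powr (1 - a) * (Gamma a /\<^sub>R \<bar>w\<bar>))"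
    by (rule has_bochner_integral_mult_right)
  note scaled = this
  have k: "w powr (1 - a) * (Gamma a /\<^sub>R \<bar>w\<bar>) = Gamma a * w powr (- a)"
  proof -
    have "w powr (1 - a) = w powr (- a) * w" using w powr_add[of w "- a" 1] by simp
    then show ?thesis using w by simp
  qed
  show ?thesis
    using scaled unfolding k
  proof (rule has_bochner_integralI_AE)
    show "AE t in lborel. w powr (1 - a) * (indicator {0..} (0 + w * t) * ((0 + w * t) powr (a - 1) / exp (0 + w * t))) =
        indicator {0<..} t * (exp (- w * t) * t powr (a - 1))"
      using AE_lborel_singleton[of "0::real"]
    proof eventually_elim
      case (elim t)
      show ?case
      proof (cases "0 < t")
        case True
        have "w powr (1 - a) * w powr (a - 1) = 1" using w by (simp add: powr_add[symmetric])
        moreover have "w powr (1 - a) * ((w * t) powr (a - 1) / exp (w * t)) = (w powr (1 - a) * w powr (a - 1)) * (t powr (a - 1) * exp (- (w * t)))"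
          using w True by (simp add: powr_mult exp_minus divide_inverse mult_ac)
        ultimately show ?thesis using True w by (simp add: mult.commute)
      next
        case False
        then have "t < 0" using elim by auto
        then show ?thesis using w by (simp add: mult_pos_neg not_le)
      qed
    qed
  qed measurable
qed

context prob_space
begin

text \<open>The expectation is the convolution of \<open>q\<close> with the law of \<open>X\<close>,
  and Laplace transforms turn convolutions into products. Shifting the half line by \<open>X\<close>
  is harmless because \<open>q\<close> vanishes at negative arguments.\<close>

lemma laplace_transform_mixture:
  fixes X :: "'a \<Rightarrow> real" and q :: "real \<Rightarrow> real"
  assumes X [measurable]: "X \<in> borel_measurable M" and X0: "AE \<omega> in M. 0 \<le> X \<omega>"
    and q: "mono q" "\<And>t. t < 0 \<Longrightarrow> q t = 0" and w: "0 < w"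
    and lap: "has_bochner_integral lborel (\<lambda>t. indicator {0<..} t * (exp (- w * t) * q t)) k"
  shows "set_integrable lborel {0<..} (\<lambda>t. exp (- w * t) * expectation (\<lambda>\<omega>. q (t - X \<omega>)))"
    and "(LINT t:{0<..}|lborel. exp (- w * t) * expectation (\<lambda>\<omega>. q (t - X \<omega>))) = k * expectation (\<lambda>\<omega>. exp (- w * X \<omega>))"
proof -
  have [measurable]: "q \<in> borel_measurable borel" using q(1) by (rule borel_measurable_mono)
  have q0: "0 \<le> q t" for t
    using q(2)[of "min (t - 1) (- 1)"] monoD[OF q(1), of "min (t - 1) (- 1)" t] by simp
  have k0: "0 \<le> k"
    using has_bochner_integral_integral_eq[OF lap] q0 by (metis (no_types, lifting) exp_ge_zero indicator_pos_le mult_nonneg_nonneg Bochner_Integration.integral_nonneg)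
  define H where "H \<omega> t = indicator {0<..} t * (exp (- w * t) * q (t - X \<omega>))" for \<omega> t
  have H0: "0 \<le> H \<omega> t" for \<omega> t using q0 by (simp add: H_def)
  have [measurable]: "case_prod H \<in> borel_measurable (M \<Otimes>\<^sub>M lborel)"
    unfolding H_def[abs_def] by measurable
  have inner: "has_bochner_integral lborel (H \<omega>) (k * exp (- w * X \<omega>))" if "0 \<le> X \<omega>" for \<omega>
  proof -
    have "has_bochner_integral lborel (\<lambda>t. indicator {0<..} (- X \<omega> + 1 * t) * (exp (- w * (- X \<omega> + 1 * t)) * q (- X \<omega> + 1 * t))) (k /\<^sub>R \<bar>1\<bar>)"
      using lap by (subst lborel_has_bochner_integral_real_affine_iff[symmetric]) auto
    then have "has_bochner_integral lborel
        (\<lambda>t. (indicator {0<..} (- X \<omega> + 1 * t) * (exp (- w * (- X \<omega> + 1 * t)) * q (- X \<omega> + 1 * t))) * exp (- w * X \<omega>)) ((k /\<^sub>R \<bar>1\<bar>) * exp (- w * X \<omega>))"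
      by (rule has_bochner_integral_mult_left)
    then have "has_bochner_integral lborel
        (\<lambda>t. (indicator {0<..} (- X \<omega> + 1 * t) * (exp (- w * (- X \<omega> + 1 * t)) * q (- X \<omega> + 1 * t))) * exp (- w * X \<omega>)) (k * exp (- w * X \<omega>))"
      by simp
    then show ?thesis
    proof (rule has_bochner_integralI_AE)
      show "H \<omega> \<in> borel_measurable lborel" unfolding H_def[abs_def] by measurable
      show "AE t in lborel. (indicator {0<..} (- X \<omega> + 1 * t) * (exp (- w * (- X \<omega> + 1 * t)) * q (- X \<omega> + 1 * t))) * exp (- w * X \<omega>) = H \<omega> t"
        using AE_lborel_singleton[of "X \<omega>"]
      proof eventually_elim
        case (elim t)
        have e: "exp (- w * (- X \<omega> + 1 * t)) * exp (- w * X \<omega>) = exp (- w * t)"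
          unfolding exp_add[symmetric] by (rule arg_cong[where f = exp]) (simp add: algebra_simps)
        show ?case
        proof (cases "X \<omega> < t")
          case True
          then have "indicator {0<..} (- X \<omega> + 1 * t) = (1::real)" "indicator {0<..} t = (1::real)" using that by auto
          then show ?thesis unfolding H_def e[symmetric] by simp
        next
          case False
          then have "t - X \<omega> < 0" using elim by auto
          then show ?thesis using q(2) by (simp add: H_def)
        qed
      qed
    qed
  qed
  interpret pair_sigma_finite M lborel ..
  have Hint: "integrable (M \<Otimes>\<^sub>M lborel) (case_prod H)"
  proof (rule Fubini_integrable)
    show "AE \<omega> in M. integrable lborel (\<lambda>t. case (\<omega>, t) of (\<omega>, t) \<Rightarrow> H \<omega> t)"
      using X0
    proof eventually_elim
      case (elim \<omega>)
      then show ?case using inner[OF elim] by (simp add: has_bochner_integral_iff)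
    qed
    show "integrable M (\<lambda>\<omega>. LINT t|lborel. norm (case (\<omega>, t) of (\<omega>, t) \<Rightarrow> H \<omega> t))"
    proof (rule integrable_const_bound)
      show "AE \<omega> in M. norm (LINT t|lborel. norm (case (\<omega>, t) of (\<omega>, t) \<Rightarrow> H \<omega> t)) \<le> k"
        using X0
      proof eventually_elim
        case (elim \<omega>)
        have "(LINT t|lborel. norm (H \<omega> t)) = k * exp (- w * X \<omega>)"
          using has_bochner_integral_integral_eq[OF inner[OF elim]] H0 by simp
        moreover have "exp (- w * X \<omega>) \<le> 1" using w elim by simp
        from mult_left_mono[OF this k0] have "k * exp (- w * X \<omega>) \<le> k" by simp
        moreover have "0 \<le> k * exp (- w * X \<omega>)" using k0 by simp
        ultimately show ?case by simp
      qed
    qed measurable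
  qed measurable
  have i: "(LINT \<omega>|M. H \<omega> t) = indicator {0<..} t *\<^sub>R (exp (- w * t) * expectation (\<lambda>\<omega>. q (t - X \<omega>)))" for t
    unfolding H_def by simp
  show "set_integrable lborel {0<..} (\<lambda>t. exp (- w * t) * expectation (\<lambda>\<omega>. q (t - X \<omega>)))"
    unfolding set_integrable_def i[symmetric] by (rule integrable_snd[OF Hint])
  have "(LINT t|lborel. LINT \<omega>|M. H \<omega> t) = (LINT \<omega>|M. LINT t|lborel. H \<omega> t)"
    by (rule Fubini_integral[OF Hint])
  moreover have "(LINT \<omega>|M. LINT t|lborel. H \<omega> t) = (LINT \<omega>|M. k * exp (- w * X \<omega>))"
  proof (rule integral_cong_AE)
    show "AE \<omega> in M. (LINT t|lborel. H \<omega> t) = k * exp (- w * X \<omega>)"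
      using X0 by eventually_elim (rule has_bochner_integral_integral_eq[OF inner])
  qed (use integrable_fst[OF Hint] in auto)
  ultimately show "(LINT t:{0<..}|lborel. exp (- w * t) * expectation (\<lambda>\<omega>. q (t - X \<omega>))) = k * expectation (\<lambda>\<omega>. exp (- w * X \<omega>))"
    unfolding set_lebesgue_integral_def i[symmetric] by simp
qed

text \<open>Right continuity is what the uniqueness theorem asks for. By monotonicity the constant
  \<open>q B\<close> dominates, where \<open>B\<close> bounds the approximating times.\<close>

lemma right_continuous_mixture:
  fixes X :: "'a \<Rightarrow> real" and q :: "real \<Rightarrow> real"
  assumes X [measurable]: "X \<in> borel_measurable M" and X0: "AE \<omega> in M. 0 \<le> X \<omega>"
    and q: "mono q" "\<And>t. t < 0 \<Longrightarrow> q t = 0" "\<And>t. (q \<longlongrightarrow> q t) (at_right t)"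
  shows "((\<lambda>t. expectation (\<lambda>\<omega>. q (t - X \<omega>))) \<longlongrightarrow> expectation (\<lambda>\<omega>. q (t - X \<omega>))) (at_right t)"
  unfolding tendsto_at_iff_sequentially
proof (intro allI impI)
  have [measurable]: "q \<in> borel_measurable borel" using q(1) by (rule borel_measurable_mono)
  have q0: "0 \<le> q t" for t
    using q(2)[of "min (t - 1) (- 1)"] monoD[OF q(1), of "min (t - 1) (- 1)" t] by simp
  fix s assume s: "\<forall>i. s i \<in> {t<..} - {t}" "s \<longlonglongrightarrow> t"
  have s': "t < s i" "s i \<noteq> t" for i using s(1) by auto
  obtain B where B: "\<And>i. s i \<le> B"
    using convergent_imp_Bseq[OF convergentI[OF s(2)]] by (metis Bseq_def abs_le_D1 real_norm_def)
  have "(\<lambda>i. expectation (\<lambda>\<omega>. q (s i - X \<omega>))) \<longlonglongrightarrow> expectation (\<lambda>\<omega>. q (t - X \<omega>))"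
  proof (rule integral_dominated_convergence[where w = "\<lambda>_. q B"])
    show "AE \<omega> in M. (\<lambda>i. q (s i - X \<omega>)) \<longlonglongrightarrow> q (t - X \<omega>)"
    proof (rule AE_I2)
      fix \<omega>
      have "filterlim (\<lambda>i. s i - X \<omega>) (at_right (t - X \<omega>)) sequentially"
        unfolding filterlim_at using s(2) s' by (auto intro!: tendsto_intros)
      then show "(\<lambda>i. q (s i - X \<omega>)) \<longlonglongrightarrow> q (t - X \<omega>)" by (rule filterlim_compose[OF q(3)])
    qed
    show "AE \<omega> in M. norm (q (s i - X \<omega>)) \<le> q B" for i
      using X0
    proof eventually_elim
      case (elim \<omega>)
      then have "s i - X \<omega> \<le> B" using B[of i] by linarith
      then show ?case using q0 monoD[OF q(1)] by simp
    qed
  qed auto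
  then show "((\<lambda>t. expectation (\<lambda>\<omega>. q (t - X \<omega>))) \<circ> s) \<longlonglongrightarrow> expectation (\<lambda>\<omega>. q (t - X \<omega>))"
    by (simp add: o_def)
qed

end

text \<open>The case \<open>\<gamma> = 1\<close> is singled out because \<open>0 powr 0 = 0\<close> would destroy right continuity at \<open>0\<close>.\<close>

definition fractional_power :: "real \<Rightarrow> real \<Rightarrow> real" where
  "fractional_power \<gamma> t = (if t < 0 then 0 else if \<gamma> = 1 then 1 else t powr (\<gamma> - 1))"

lemma fractional_power_pos: "0 < t \<Longrightarrow> fractional_power \<gamma> t = t powr (\<gamma> - 1)"
  by (simp add: fractional_power_def)

lemma mono_fractional_power: "1 \<le> \<gamma> \<Longrightarrow> mono (fractional_power \<gamma>)"
  by (rule monoI) (auto simp: fractional_power_def intro!: powr_mono2)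

lemma fractional_power_right_continuous:
  assumes "1 \<le> \<gamma>"
  shows "(fractional_power \<gamma> \<longlongrightarrow> fractional_power \<gamma> t) (at_right t)"
proof (cases "t < 0")
  case True
  have "\<forall>\<^sub>F s in at_right t. s < 0" using eventually_at_right[OF True] True by blast
  then have "\<forall>\<^sub>F s in at_right t. fractional_power \<gamma> s = 0"
    by eventually_elim (simp add: fractional_power_def)
  then show ?thesis using True by (simp add: fractional_power_def tendsto_eventually)
next
  case False
  show ?thesis
  proof (cases "\<gamma> = 1")
    case True
    have "\<forall>\<^sub>F s in at_right t. fractional_power \<gamma> s = 1"
      using eventually_at_right_less[of t] by eventually_elim (use False True in \<open>auto simp: fractional_power_def\<close>)
    then show ?thesis using False True by (simp add: fractional_power_def tendsto_eventually)
  next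
    case ne: False
    have "((\<lambda>s. s powr (\<gamma> - 1)) \<longlongrightarrow> t powr (\<gamma> - 1)) (at_right t)"
      by (rule tendsto_powr2) (use False ne assms eventually_at_right_less[of t] in \<open>auto elim: eventually_mono intro!: tendsto_intros\<close>)
    moreover have "\<forall>\<^sub>F s in at_right t. s powr (\<gamma> - 1) = fractional_power \<gamma> s"
      using eventually_at_right_less[of t] by eventually_elim (use False ne in \<open>auto simp: fractional_power_def\<close>)
    ultimately have "(fractional_power \<gamma> \<longlongrightarrow> t powr (\<gamma> - 1)) (at_right t)"
      by (rule Lim_transform_eventually)
    then show ?thesis using False ne by (simp add: fractional_power_def)
  qed
qed

lemma laplace_fractional_power:
  assumes "1 \<le> \<gamma>" "0 < w"
  shows "has_bochner_integral lborel (\<lambda>t. indicator {0<..} t * (exp (- w * t) * fractional_power \<gamma> t)) (Gamma \<gamma> * w powr (- \<gamma>))"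
proof -
  have e: "indicator {0<..} t * (exp (- w * t) * fractional_power \<gamma> t) = indicator {0<..} t * (exp (- w * t) * t powr (\<gamma> - 1))" for t
    by (simp add: indicator_def fractional_power_pos)
  show ?thesis unfolding e using assms by (intro has_bochner_integral_Gamma) auto
qed

section \<open>The inverse subordinator\<close>

locale inverse_subordinator = order_mixture \<mu> b\<^sub>0 b\<^sub>1 \<theta>
  for \<mu> :: "real measure" and b\<^sub>0 b\<^sub>1 \<theta> :: real +
  fixes M :: "'w measure" and D :: "real \<Rightarrow> 'w \<Rightarrow> real" and p :: "real \<Rightarrow> real \<Rightarrow> real"
  assumes D: "subordinator_of \<mu> M D" and p: "is_inverse_density M D p"
begin

lemma levy: "levy_process M D" and D_mono: "AE \<omega> in M. mono_on {0..} (\<lambda>t. D t \<omega>)"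
  using D by (auto simp: subordinator_of_def subordinator_def)

sublocale M: prob_space M using levy by (simp add: levy_process_def)

lemma measurable_D [measurable]: "0 \<le> \<sigma> \<Longrightarrow> D \<sigma> \<in> borel_measurable M"
  using levy by (simp add: levy_process_def)

lemma D_nonneg:
  assumes "0 \<le> \<sigma>"
  shows "AE \<omega> in M. 0 \<le> D \<sigma> \<omega>"
proof -
  have "AE \<omega> in M. D 0 \<omega> = 0" using levy by (simp add: levy_process_def)
  with D_mono show ?thesis
  proof eventually_elim
    case (elim \<omega>)
    then show ?case using assms mono_onD[OF elim(1), of 0 \<sigma>] by simp
  qed
qed

definition lexp :: "real \<Rightarrow> real" where "lexp w = (LINT \<beta>|\<mu>. w powr \<beta>)"

lemma laplace_D:
  assumes "0 \<le> \<sigma>" "0 < w"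
  shows "M.expectation (\<lambda>\<omega>. exp (- w * D \<sigma> \<omega>)) = exp (- \<sigma> * lexp w)"
proof -
  have "laplace_exponent \<mu> w = lexp w"
    unfolding laplace_exponent_def lexp_def set_lebesgue_integral_def
  proof (rule integral_cong_AE)
    show "AE \<beta> in \<mu>. indicator {0<..<1} \<beta> *\<^sub>R w powr \<beta> = w powr \<beta>"
      using supp by eventually_elim (use b in auto)
  qed measurable
  then show ?thesis using D assms by (simp add: subordinator_of_def)
qed

text \<open>Both sides are right continuous with the transform \<open>Gamma \<gamma>\<close> times
  w^(-\<gamma>) exp (-\<sigma> f^mu(w)): the left one as a mixture of powers, the right one by
  contour integration. Here the analytic functions \<open>J\<close> meet the process:
  \<open>J \<gamma> \<sigma>\<close> is the fractional integral of order \<gamma> of the law of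
  \<open>D \<sigma>\<close>.\<close>

lemma expectation_fractional_power:
  assumes \<gamma>: "1 \<le> \<gamma>" "\<gamma> \<le> 2" and \<sigma>: "0 \<le> \<sigma>" and t: "0 < t"
  shows "M.expectation (\<lambda>\<omega>. fractional_power \<gamma> (t - D \<sigma> \<omega>)) = Gamma \<gamma> * J \<gamma> \<sigma> t"
proof -
  let ?E = "\<lambda>t. M.expectation (\<lambda>\<omega>. fractional_power \<gamma> (t - D \<sigma> \<omega>))"
  note q = mono_fractional_power[OF \<gamma>(1)]
  have q0: "fractional_power \<gamma> s = 0" if "s < 0" for s using that by (simp add: fractional_power_def)
  have lapE: "set_integrable lborel {0<..} (\<lambda>t. exp (- w * t) * ?E t)"
    "(LINT t:{0<..}|lborel. exp (- w * t) * ?E t) = (Gamma \<gamma> * w powr (- \<gamma>)) * M.expectation (\<lambda>\<omega>. exp (- w * D \<sigma> \<omega>))"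
    if "1 < w" for w
    using M.laplace_transform_mixture[OF measurable_D[OF \<sigma>] D_nonneg[OF \<sigma>] q q0 _ laplace_fractional_power[OF \<gamma>(1)], of w] that by auto
  have lapJ: "set_integrable lborel {0<..} (\<lambda>t. exp (- w * t) * (Gamma \<gamma> * J \<gamma> \<sigma> t))"
    "(LINT t:{0<..}|lborel. exp (- w * t) * (Gamma \<gamma> * J \<gamma> \<sigma> t)) = Gamma \<gamma> * (w powr (- \<gamma>) * exp (- \<sigma> * lexp w))"
    if "1 < w" for w
  proof -
    have e: "exp (- w * t) * (Gamma \<gamma> * J \<gamma> \<sigma> t) = Gamma \<gamma> * (exp (- w * t) * J \<gamma> \<sigma> t)" for t by (simp only: mult_ac)
    show "set_integrable lborel {0<..} (\<lambda>t. exp (- w * t) * (Gamma \<gamma> * J \<gamma> \<sigma> t))"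
      unfolding e by (intro set_integrable_mult_right impI laplace_J \<gamma> \<sigma> that)
    show "(LINT t:{0<..}|lborel. exp (- w * t) * (Gamma \<gamma> * J \<gamma> \<sigma> t)) = Gamma \<gamma> * (w powr (- \<gamma>) * exp (- \<sigma> * lexp w))"
      unfolding e lexp_def by (subst set_integral_mult_right) (simp only: laplace_J(2)[OF \<gamma> \<sigma> that])
  qed
  have "?E t - Gamma \<gamma> * J \<gamma> \<sigma> t = 0"
  \<comment> \<open>Any abscissa above 1 would do, since the transforms are known for w > 1.\<close>
  proof (rule laplace_transform_zero_imp_zero[where \<phi> = "\<lambda>t. ?E t - Gamma \<gamma> * J \<gamma> \<sigma> t" and a = 2])
    show "set_integrable lborel {0<..} (\<lambda>t. exp (- 2 * t) * (?E t - Gamma \<gamma> * J \<gamma> \<sigma> t))"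
      unfolding right_diff_distrib using lapE(1)[of 2] lapJ(1)[of 2] by (intro set_integral_diff) auto
    show "(LINT t:{0<..}|lborel. exp (- w * t) * (?E t - Gamma \<gamma> * J \<gamma> \<sigma> t)) = 0" if "2 < w" for w
    proof -
      have w: "1 < w" "0 < w" using that by auto
      show ?thesis
        unfolding right_diff_distrib set_integral_diff(2)[OF lapE(1)[OF w(1)] lapJ(1)[OF w(1)]] lapE(2)[OF w(1)] lapJ(2)[OF w(1)]
          laplace_D[OF \<sigma> w(2)] by (simp only: mult.assoc diff_self)
    qed
    show "((\<lambda>t. ?E t - Gamma \<gamma> * J \<gamma> \<sigma> t) \<longlongrightarrow> ?E s - Gamma \<gamma> * J \<gamma> \<sigma> s) (at_right s)" if s: "0 < s" for s
    proof (intro tendsto_intros)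
      show "(?E \<longlongrightarrow> ?E s) (at_right s)"
        by (rule M.right_continuous_mixture[OF measurable_D[OF \<sigma>] D_nonneg[OF \<sigma>] q q0 fractional_power_right_continuous[OF \<gamma>(1)]])
      have "isCont (J \<gamma> \<sigma>) s"
        using J_derivative[OF s \<sigma> \<gamma>] by (rule has_vector_derivative_continuous)
      then show "(J \<gamma> \<sigma> \<longlongrightarrow> J \<gamma> \<sigma> s) (at_right s)"
        by (metis isCont_def tendsto_within_subset UNIV_I subsetI)
    qed
  qed (rule t)
  then show ?thesis by simp
qed

lemma J_1_eq_prob:
  assumes \<sigma>: "0 \<le> \<sigma>" and t: "0 < t"
  shows "J 1 \<sigma> t = measure M {\<omega> \<in> space M. D \<sigma> \<omega> \<le> t}"
proof -
  have [measurable]: "D \<sigma> \<in> borel_measurable M" by (rule measurable_D[OF \<sigma>])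
  have e: "fractional_power 1 (t - D \<sigma> \<omega>) = indicator {\<omega>. D \<sigma> \<omega> \<le> t} \<omega>" for \<omega>
    by (auto simp: fractional_power_def indicator_def)
  have "M.expectation (\<lambda>\<omega>. fractional_power 1 (t - D \<sigma> \<omega>)) = measure M ({\<omega>. D \<sigma> \<omega> \<le> t} \<inter> space M)"
    unfolding e by (rule Bochner_Integration.integral_indicator)
  also have "{\<omega>. D \<sigma> \<omega> \<le> t} \<inter> space M = {\<omega> \<in> space M. D \<sigma> \<omega> \<le> t}" by auto
  finally show ?thesis using expectation_fractional_power[of 1 \<sigma> t] \<sigma> t by simp
qed

lemma J_1_bounds:
  assumes "0 \<le> \<sigma>" "0 < t"
  shows "0 \<le> J 1 \<sigma> t" "J 1 \<sigma> t \<le> 1"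
  using assms by (simp_all add: J_1_eq_prob)

lemma J_1_mono:
  assumes "0 \<le> \<sigma>" "0 < s" "s \<le> t"
  shows "J 1 \<sigma> s \<le> J 1 \<sigma> t"
proof -
  have [measurable]: "D \<sigma> \<in> borel_measurable M" by (rule measurable_D[OF assms(1)])
  have "measure M {\<omega> \<in> space M. D \<sigma> \<omega> \<le> s} \<le> measure M {\<omega> \<in> space M. D \<sigma> \<omega> \<le> t}"
    using assms by (intro M.finite_measure_mono) auto
  then show ?thesis using assms by (simp add: J_1_eq_prob)
qed

lemma J_1_antimono:
  assumes "0 \<le> \<sigma>" "\<sigma> \<le> \<tau>" "0 < t"
  shows "J 1 \<tau> t \<le> J 1 \<sigma> t"
proof -
  have [measurable]: "D \<sigma> \<in> borel_measurable M" "D \<tau> \<in> borel_measurable M" using assms by (auto intro: measurable_D)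
  have "AE \<omega> in M. \<omega> \<in> {\<omega> \<in> space M. D \<tau> \<omega> \<le> t} \<longrightarrow> \<omega> \<in> {\<omega> \<in> space M. D \<sigma> \<omega> \<le> t}"
    using D_mono
  proof eventually_elim
    case (elim \<omega>)
    then show ?case using assms mono_onD[OF elim, of \<sigma> \<tau>] by auto
  qed
  then have "measure M {\<omega> \<in> space M. D \<tau> \<omega> \<le> t} \<le> measure M {\<omega> \<in> space M. D \<sigma> \<omega> \<le> t}"
    by (rule M.finite_measure_mono_AE) measurable
  then show ?thesis using assms by (simp add: J_1_eq_prob)
qed

text \<open>Markov's inequality for \<open>exp (- s * D \<sigma>)\<close> with a free parameter
  \<open>s\<close>; for small t it will be taken as 1/t.\<close>

lemma J_1_exp_bound:
  assumes \<sigma>: "0 \<le> \<sigma>" and t: "0 < t" and s: "0 < s"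
  shows "J 1 \<sigma> t \<le> exp (s * t) * exp (- \<sigma> * lexp s)"
proof -
  have [measurable]: "D \<sigma> \<in> borel_measurable M" by (rule measurable_D[OF \<sigma>])
  have "J 1 \<sigma> t = (LINT \<omega>|M. indicator {\<omega> \<in> space M. D \<sigma> \<omega> \<le> t} \<omega>)"
    using J_1_eq_prob[OF \<sigma> t] by (simp add: Int_absorb2)
  also have "\<dots> \<le> (LINT \<omega>|M. exp (s * t) * exp (- s * D \<sigma> \<omega>))"
  proof (rule integral_mono_AE)
    show "integrable M (\<lambda>\<omega>. exp (s * t) * exp (- s * D \<sigma> \<omega>))"
    proof (rule M.integrable_const_bound)
      show "AE \<omega> in M. norm (exp (s * t) * exp (- s * D \<sigma> \<omega>)) \<le> exp (s * t)"
        using D_nonneg[OF \<sigma>]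
      proof eventually_elim
        case (elim \<omega>)
        then have "exp (s * t) * exp (- s * D \<sigma> \<omega>) \<le> exp (s * t) * 1" using s by (intro mult_left_mono) auto
        then show ?case by simp
      qed
    qed measurable
    show "AE \<omega> in M. indicator {\<omega> \<in> space M. D \<sigma> \<omega> \<le> t} \<omega> \<le> exp (s * t) * exp (- s * D \<sigma> \<omega>)"
    proof (rule AE_I2)
      fix \<omega>
      have "1 \<le> exp (s * t + - s * D \<sigma> \<omega>)" if "D \<sigma> \<omega> \<le> t"
        using that s by (simp add: mult_left_mono)
      then show "indicator {\<omega> \<in> space M. D \<sigma> \<omega> \<le> t} \<omega> \<le> exp (s * t) * exp (- s * D \<sigma> \<omega>)"
        unfolding exp_add[symmetric] by (auto simp only: indicator_def split: if_splits) simp_all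
    qed
    show "integrable M (indicat_real {\<omega> \<in> space M. D \<sigma> \<omega> \<le> t})"
      by (intro integrable_real_indicator) (auto simp: M.emeasure_eq_measure)
  qed
  also have "\<dots> = exp (s * t) * exp (- \<sigma> * lexp s)" using laplace_D[OF \<sigma> s] by simp
  finally show ?thesis .
qed

text \<open>With \<open>J 1 \<sigma> r\<close> read as the probability of
  \<open>D \<sigma> \<le> r\<close>, Fubini leaves the elementary integral of (t - r)^(-\<beta>)
  from \<open>D \<sigma>\<close> to t, a power whose expectation is \<open>J (2 - \<beta>)\<close>
  up to constants. The functional equation of Gamma absorbs the factor 1 - \<beta>.\<close>

lemma fractional_integral_J_1:
  assumes \<beta>: "0 < \<beta>" "\<beta> < 1" and \<sigma>: "0 \<le> \<sigma>" and t: "0 < t"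
  shows "has_bochner_integral lborel (\<lambda>r. indicator {0..t} r * ((t - r) powr (- \<beta>) * J 1 \<sigma> r)) (Gamma (1 - \<beta>) * J (2 - \<beta>) \<sigma> t)"
proof -
  have [measurable]: "D \<sigma> \<in> borel_measurable M" by (rule measurable_D[OF \<sigma>])
  define k where "k r = indicator {0..t} r * (t - r) powr (- \<beta>)" for r
  have k0: "0 \<le> k r" for r by (simp add: k_def)
  have [measurable]: "k \<in> borel_measurable borel" unfolding k_def[abs_def] by measurable
  have kint: "integrable lborel k"
    using has_bochner_integral_fractional_kernel[of "- \<beta>" 0 t] \<beta> t by (simp add: k_def[abs_def] has_bochner_integral_iff)
  define H where "H \<omega> r = k r * indicator {\<omega>. D \<sigma> \<omega> \<le> r} \<omega>" for \<omega> r
  have Hk: "norm (H \<omega> r) \<le> k r" for \<omega> r using k0 by (simp add: H_def indicator_def)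
  have [measurable]: "case_prod H \<in> borel_measurable (M \<Otimes>\<^sub>M lborel)"
    unfolding H_def indicator_def mem_Collect_eq by measurable
  have [measurable]: "H \<omega> \<in> borel_measurable lborel" for \<omega>
    unfolding H_def[abs_def] indicator_def mem_Collect_eq by measurable
  have Hi: "integrable lborel (H \<omega>)" for \<omega>
    by (rule Bochner_Integration.integrable_bound[OF kint]) (use Hk k0 in auto)
  interpret pair_sigma_finite M lborel ..
  have Hint: "integrable (M \<Otimes>\<^sub>M lborel) (case_prod H)"
  proof (rule Fubini_integrable)
    show "integrable M (\<lambda>\<omega>. LINT r|lborel. norm (case (\<omega>, r) of (\<omega>, r) \<Rightarrow> H \<omega> r))"
    proof (rule M.integrable_const_bound)
      show "AE \<omega> in M. norm (LINT r|lborel. norm (case (\<omega>, r) of (\<omega>, r) \<Rightarrow> H \<omega> r)) \<le> (LINT r|lborel. k r)"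
      proof (rule AE_I2)
        fix \<omega>
        have "(LINT r|lborel. norm (H \<omega> r)) \<le> (LINT r|lborel. k r)"
          by (intro Bochner_Integration.integral_mono integrable_norm Hi kint Hk)
        moreover have "0 \<le> (LINT r|lborel. norm (H \<omega> r))" by simp
        ultimately show "norm (LINT r|lborel. norm (case (\<omega>, r) of (\<omega>, r) \<Rightarrow> H \<omega> r)) \<le> (LINT r|lborel. k r)" by simp
      qed
    qed measurable
  qed (use Hi in auto)
  have inner: "(LINT \<omega>|M. H \<omega> r) = indicator {0..t} r * ((t - r) powr (- \<beta>) * J 1 \<sigma> r)" if "r \<noteq> 0" for r
  proof (cases "0 < r")
    case True
    have "(LINT \<omega>|M. H \<omega> r) = k r * (LINT \<omega>|M. indicator {\<omega>. D \<sigma> \<omega> \<le> r} \<omega>)"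
      unfolding H_def by simp
    also have "(LINT \<omega>|M. indicator {\<omega>. D \<sigma> \<omega> \<le> r} \<omega>) = measure M ({\<omega>. D \<sigma> \<omega> \<le> r} \<inter> space M)"
      by (rule Bochner_Integration.integral_indicator)
    also have "{\<omega>. D \<sigma> \<omega> \<le> r} \<inter> space M = {\<omega> \<in> space M. D \<sigma> \<omega> \<le> r}" by auto
    finally show ?thesis by (simp add: J_1_eq_prob[OF \<sigma> True] k_def)
  next
    case False
    then show ?thesis using that by (simp add: H_def k_def)
  qed
  have outer: "(LINT r|lborel. H \<omega> r) = fractional_power (2 - \<beta>) (t - D \<sigma> \<omega>) / (1 - \<beta>)" if "0 \<le> D \<sigma> \<omega>" for \<omega>
  proof (cases "D \<sigma> \<omega> \<le> t")
    case True
    have e: "H \<omega> r = indicator {D \<sigma> \<omega>..t} r * (t - r) powr (- \<beta>)" for r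
      using that by (auto simp: H_def k_def indicator_def)
    have "(LINT r|lborel. H \<omega> r) = (t - D \<sigma> \<omega>) powr (- \<beta> + 1) / (- \<beta> + 1)"
      unfolding e by (rule has_bochner_integral_integral_eq[OF has_bochner_integral_fractional_kernel]) (use \<beta> True in auto)
    then show ?thesis using \<beta> True by (simp add: fractional_power_def)
  next
    case False
    then have "H \<omega> r = 0" for r by (auto simp: H_def k_def indicator_def)
    then show ?thesis using False by (simp add: fractional_power_def)
  qed
  have i: "integrable lborel (\<lambda>r. LINT \<omega>|M. H \<omega> r)" by (rule integrable_snd[OF Hint])
  have "(LINT r|lborel. LINT \<omega>|M. H \<omega> r) = (LINT \<omega>|M. LINT r|lborel. H \<omega> r)"
    by (rule Fubini_integral[OF Hint])
  also have "\<dots> = (LINT \<omega>|M. fractional_power (2 - \<beta>) (t - D \<sigma> \<omega>) / (1 - \<beta>))"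
  proof (rule integral_cong_AE)
    show "AE \<omega> in M. (LINT r|lborel. H \<omega> r) = fractional_power (2 - \<beta>) (t - D \<sigma> \<omega>) / (1 - \<beta>)"
      using D_nonneg[OF \<sigma>] by eventually_elim (rule outer)
    have [measurable]: "fractional_power (2 - \<beta>) \<in> borel_measurable borel"
      using \<beta> by (intro borel_measurable_mono mono_fractional_power) auto
    show "(\<lambda>\<omega>. fractional_power (2 - \<beta>) (t - D \<sigma> \<omega>) / (1 - \<beta>)) \<in> borel_measurable M" by measurable
  qed (use integrable_fst[OF Hint] in auto)
  also have "\<dots> = Gamma (2 - \<beta>) * J (2 - \<beta>) \<sigma> t / (1 - \<beta>)"
    using expectation_fractional_power[of "2 - \<beta>" \<sigma> t] \<beta> \<sigma> t by simp
  also have "Gamma (2 - \<beta>) = (1 - \<beta>) * Gamma (1 - \<beta>)"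
  proof -
    have "1 - \<beta> \<notin> \<int>\<^sub>\<le>\<^sub>0" using nonpos_Ints_nonpos[of "1 - \<beta>"] \<beta> by auto
    then show ?thesis using Gamma_plus1[of "1 - \<beta>"] by (simp add: add.commute)
  qed
  also have "(1 - \<beta>) * Gamma (1 - \<beta>) * J (2 - \<beta>) \<sigma> t / (1 - \<beta>) = Gamma (1 - \<beta>) * J (2 - \<beta>) \<sigma> t"
    using \<beta> by simp
  finally have "has_bochner_integral lborel (\<lambda>r. LINT \<omega>|M. H \<omega> r) (Gamma (1 - \<beta>) * J (2 - \<beta>) \<sigma> t)"
    using i by (simp add: has_bochner_integral_iff)
  then show ?thesis
  proof (rule has_bochner_integralI_AE)
    show "AE r in lborel. (LINT \<omega>|M. H \<omega> r) = indicator {0..t} r * ((t - r) powr (- \<beta>) * J 1 \<sigma> r)"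
      using AE_lborel_singleton[of "0::real"] by eventually_elim (rule inner)
  qed measurable
qed

lemma tendsto_J_1: "0 < t \<Longrightarrow> ((\<lambda>\<sigma>. J 1 \<sigma> t) \<longlongrightarrow> 0) at_top"
proof (rule Lim_null_comparison)
  assume t: "0 < t"
  show "\<forall>\<^sub>F \<sigma> in at_top. norm (J 1 \<sigma> t) \<le> J_const t t * exp (- decay_rate * \<sigma>)"
    using eventually_ge_at_top[of 0] by eventually_elim (use abs_J[of t t t _ 1] t in auto)
  have "filterlim (\<lambda>\<sigma>. - decay_rate * \<sigma>) at_bot at_top"
    using decay_rate_pos by (simp add: filterlim_uminus_at_bot filterlim_tendsto_pos_mult_at_top[OF tendsto_const _ filterlim_ident])
  then have "((\<lambda>\<sigma>. exp (- decay_rate * \<sigma>)) \<longlongrightarrow> 0) at_top" by (rule filterlim_compose[OF exp_at_bot])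
  from tendsto_mult_right_zero[OF this] show "((\<lambda>\<sigma>. J_const t t * exp (- decay_rate * \<sigma>)) \<longlongrightarrow> 0) at_top" .
qed

text \<open>A negative value would make \<open>J 1\<close> increase strictly to the right of
  \<sigma>, but the probability of \<open>D \<sigma> \<le> t\<close> cannot increase because the
  paths are nondecreasing.\<close>

lemma P_nonneg:
  assumes t: "0 < t" and \<sigma>: "0 < \<sigma>"
  shows "0 \<le> P t \<sigma>"
proof (rule ccontr)
  assume "\<not> 0 \<le> P t \<sigma>"
  then have "0 < - P t \<sigma>" by simp
  moreover have "((\<lambda>\<sigma>. J 1 \<sigma> t) has_real_derivative - P t \<sigma>) (at \<sigma>)"
    using J_1_derivative[OF t \<sigma>] by (simp add: has_real_derivative_iff_has_vector_derivative)
  ultimately obtain d where d: "d > 0" "\<And>h. 0 < h \<Longrightarrow> h < d \<Longrightarrow> J 1 \<sigma> t < J 1 (\<sigma> + h) t"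
    using DERIV_pos_inc_right[of "\<lambda>\<sigma>. J 1 \<sigma> t" "- P t \<sigma>" \<sigma>] by blast
  have "J 1 (\<sigma> + d / 2) t \<le> J 1 \<sigma> t" using d(1) \<sigma> t by (intro J_1_antimono) auto
  moreover have "J 1 \<sigma> t < J 1 (\<sigma> + d / 2) t" using d by auto
  ultimately show False by simp
qed

lemma measurable_P [measurable (raw)]:
  assumes [measurable]: "t \<in> borel_measurable N" "\<sigma> \<in> borel_measurable N"
  shows "(\<lambda>\<omega>. P (t \<omega>) (\<sigma> \<omega>)) \<in> borel_measurable N"
  unfolding P_def by (rule borel_measurable_lebesgue_integral) measurable

lemma density_props:
  assumes "0 < t"
  shows "distributed M lborel (first_passage D t) (\<lambda>\<tau>. ennreal (p t \<tau>))" "0 \<le> p t \<tau>" "\<tau> < 0 \<Longrightarrow> p t \<tau> = 0"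
    "p t \<in> borel_measurable borel"
proof -
  show 1: "distributed M lborel (first_passage D t) (\<lambda>\<tau>. ennreal (p t \<tau>))" and 2: "0 \<le> p t \<tau>" "\<tau> < 0 \<Longrightarrow> p t \<tau> = 0" for \<tau>
    using p assms by (auto simp: is_inverse_density_def)
  show "p t \<in> borel_measurable borel"
    using distributed_real_measurable[OF _ 1] 2 by simp
qed

text \<open>Up to null sets, the events that the passage time exceeds \<sigma> and that
  \<open>D \<sigma> \<le> t\<close> can differ only where the passage time equals \<sigma>; this has
  probability 0 because there is a density.\<close>

lemma prob_first_passage:
  assumes \<sigma>: "0 \<le> \<sigma>" and t: "0 < t"
  shows "emeasure M (first_passage D t -` {\<sigma><..} \<inter> space M) = ennreal (J 1 \<sigma> t)"
proof -
  let ?E = "first_passage D t"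
  have [measurable]: "D \<sigma> \<in> borel_measurable M" by (rule measurable_D[OF \<sigma>])
  have E [measurable]: "?E \<in> borel_measurable M"
    using density_props(1)[OF t] by (simp add: distributed_def)
  \<comment> \<open>On a path that never exceeds t, \<open>first_passage\<close> would be the
    \<open>Inf\<close> of the empty set, a meaningless real number. The decay of \<open>J 1\<close>
    in \<sigma> shows that almost every path exceeds t.\<close>
  have nonempty: "AE \<omega> in M. \<exists>n::nat. t < D (real n) \<omega>"
  proof -
    have Dn [measurable]: "D (real n) \<in> borel_measurable M" for n :: nat by (rule measurable_D) simp
    let ?N = "{\<omega> \<in> space M. \<forall>n::nat. D (real n) \<omega> \<le> t}"
    have "measure M ?N \<le> J 1 (real n) t" for n :: nat
      unfolding J_1_eq_prob[OF of_nat_0_le_iff t] by (intro M.finite_measure_mono) auto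
    moreover have "(\<lambda>n. J 1 (real n) t) \<longlonglongrightarrow> 0"
      by (rule filterlim_compose[OF tendsto_J_1[OF t] filterlim_real_sequentially])
    ultimately have "measure M ?N \<le> 0"
      by (intro tendsto_lowerbound[of "\<lambda>n. J 1 (real n) t" 0 sequentially]) auto
    then have "emeasure M ?N = 0" by (simp add: M.emeasure_eq_measure measure_le_0_iff)
    then have "AE \<omega> in M. \<not> (\<forall>n::nat. D (real n) \<omega> \<le> t)"
      by (intro AE_I[where N = ?N]) auto
    then show ?thesis by eventually_elim (auto simp: not_le)
  qed
  have upper: "\<omega> \<in> ?E -` {\<sigma><..} \<inter> space M \<Longrightarrow> D \<sigma> \<omega> \<le> t" for \<omega>
  proof (rule ccontr)
    assume a: "\<omega> \<in> ?E -` {\<sigma><..} \<inter> space M" "\<not> D \<sigma> \<omega> \<le> t"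
    have "?E \<omega> \<le> \<sigma>"
      unfolding first_passage_def using a \<sigma> by (intro cInf_lower bdd_belowI[of _ 0]) auto
    then show False using a by auto
  qed
  have lower: "AE \<omega> in M. D \<sigma> \<omega> \<le> t \<longrightarrow> \<sigma> \<le> ?E \<omega>"
    using nonempty D_mono
  proof eventually_elim
    case (elim \<omega>)
    show ?case
    proof
      assume le: "D \<sigma> \<omega> \<le> t"
      show "\<sigma> \<le> ?E \<omega>"
        unfolding first_passage_def
      proof (rule cInf_greatest)
        show "{\<tau>. 0 \<le> \<tau> \<and> t < D \<tau> \<omega>} \<noteq> {}" using elim(1) of_nat_0_le_iff by blast
        fix \<tau> assume "\<tau> \<in> {\<tau>. 0 \<le> \<tau> \<and> t < D \<tau> \<omega>}"
        then show "\<sigma> \<le> \<tau>" using le mono_onD[OF elim(2), of \<tau> \<sigma>] \<sigma> by (cases "\<sigma> \<le> \<tau>") auto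
      qed
    qed
  qed
  have "emeasure M (?E -` {\<sigma>} \<inter> space M) = (\<integral>\<^sup>+x. ennreal (p t x) * indicator {\<sigma>} x \<partial>lborel)"
    by (rule distributed_emeasure[OF density_props(1)[OF t]]) simp
  also have "\<dots> = 0"
  proof -
    have [measurable]: "p t \<in> borel_measurable borel" by (rule density_props(4)[OF t])
    have "(\<lambda>x. ennreal (p t x) * indicator {\<sigma>} x) \<in> borel_measurable lborel" by measurable
    moreover have "AE x in lborel. ennreal (p t x) * indicator {\<sigma>} x = 0"
      using AE_lborel_singleton[of \<sigma>] by eventually_elim simp
    ultimately show ?thesis by (simp add: nn_integral_0_iff_AE)
  qed
  finally have "AE \<omega> in M. ?E \<omega> \<noteq> \<sigma>"
    by (intro AE_I[where N = "?E -` {\<sigma>} \<inter> space M"]) auto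
  with lower have "AE \<omega> in M. \<omega> \<in> ?E -` {\<sigma><..} \<inter> space M \<longleftrightarrow> \<omega> \<in> {\<omega> \<in> space M. D \<sigma> \<omega> \<le> t}"
    using AE_space
  proof eventually_elim
    case (elim \<omega>)
    then show ?case using upper[of \<omega>] by auto
  qed
  then have "emeasure M (?E -` {\<sigma><..} \<inter> space M) = emeasure M {\<omega> \<in> space M. D \<sigma> \<omega> \<le> t}"
    by (rule emeasure_eq_AE) measurable
  then show ?thesis by (simp add: M.emeasure_eq_measure J_1_eq_prob[OF \<sigma> t])
qed

lemma nn_integral_p:
  assumes "0 \<le> \<sigma>" "0 < t"
  shows "(\<integral>\<^sup>+\<tau>. ennreal (p t \<tau>) * indicator {\<sigma><..} \<tau> \<partial>lborel) = ennreal (J 1 \<sigma> t)"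
  using distributed_emeasure[OF density_props(1)[OF assms(2)], of "{\<sigma><..}"] prob_first_passage[OF assms] by simp

lemma nn_integral_P:
  assumes \<sigma>: "0 < \<sigma>" and t: "0 < t"
  shows "(\<integral>\<^sup>+\<tau>. ennreal (P t \<tau>) * indicator {\<sigma><..} \<tau> \<partial>lborel) = ennreal (J 1 \<sigma> t)"
proof -
  have "(\<integral>\<^sup>+\<tau>. ennreal (P t \<tau>) * indicator {\<sigma><..} \<tau> \<partial>lborel) = (\<integral>\<^sup>+\<tau>. ennreal (P t \<tau>) * indicator {\<sigma>..} \<tau> \<partial>lborel)"
  proof (rule nn_integral_cong_AE)
    show "AE \<tau> in lborel. ennreal (P t \<tau>) * indicator {\<sigma><..} \<tau> = ennreal (P t \<tau>) * indicator {\<sigma>..} \<tau>"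
      using AE_lborel_singleton[of \<sigma>] by eventually_elim (auto simp: indicator_def)
  qed
  also have "\<dots> = ennreal (0 - (- J 1 \<sigma> t))"
  proof (rule nn_integral_FTC_atLeast)
    show "((\<lambda>\<sigma>. - J 1 \<sigma> t) has_real_derivative P t x) (at x)" if "\<sigma> \<le> x" for x
      using has_vector_derivative_minus[OF J_1_derivative[OF t, of x]] that \<sigma>
      by (simp add: has_real_derivative_iff_has_vector_derivative)
    show "((\<lambda>\<sigma>. - J 1 \<sigma> t) \<longlongrightarrow> 0) at_top" using tendsto_minus[OF tendsto_J_1[OF t]] by simp
  qed (use \<sigma> t P_nonneg in auto)
  finally show ?thesis by simp
qed

text \<open>Both functions have the tails \<open>J 1\<close>, and tails determine a finite measure;
  densities then agree only almost everywhere. The mass of \<open>P t\<close> on the whole half line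
  is reached as a limit over 1/(n + 1), since the \<sigma>-derivative is available for positive
  \<sigma>.\<close>

lemma p_eq_P:
  assumes t: "0 < t"
  shows "AE \<tau> in lborel. 0 < \<tau> \<longrightarrow> p t \<tau> = P t \<tau>"
proof -
  have [measurable]: "p t \<in> borel_measurable borel" by (rule density_props(4)[OF t])
  let ?f = "\<lambda>g \<tau>. ennreal (g \<tau>) * indicator {0<..} (\<tau> :: real)"
  let ?M = "density lborel (?f (p t))" and ?N = "density lborel (?f (P t))"
  have pos: "emeasure ?M {x<..} = ennreal (J 1 x t)" "emeasure ?N {x<..} = ennreal (J 1 x t)" if x: "0 < x" for x
  proof -
    have "g * indicator {0<..} \<tau> * indicator {x<..} \<tau> = g * indicator {x<..} \<tau>" for g :: ennreal and \<tau>
      using x by (auto simp: indicator_def)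
    then show "emeasure ?M {x<..} = ennreal (J 1 x t)" "emeasure ?N {x<..} = ennreal (J 1 x t)"
      using nn_integral_p[of x t] nn_integral_P[of x t] x t by (simp_all add: emeasure_density)
  qed
  have UN: "(\<Union>n::nat. {1 / real (Suc n)<..}) = {0<..}"
  proof -
    have "\<exists>n::nat. 1 / real (Suc n) < x" if "0 < x" for x :: real
      using reals_Archimedean[OF that] by (auto simp: inverse_eq_divide)
    moreover have "0 < x" if "1 / real (Suc n) < x" for x :: real and n :: nat
      using that by (rule less_trans[rotated]) simp
    ultimately show ?thesis by (auto simp del: of_nat_Suc)
  qed
  have inc: "incseq (\<lambda>n::nat. {1 / real (Suc n)<..})"
  proof (intro monoI subsetI)
    fix m n :: nat and x :: real assume "m \<le> n" "x \<in> {1 / real (Suc m)<..}"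
    moreover have "1 / real (Suc n) \<le> 1 / real (Suc m)" using \<open>m \<le> n\<close> by (intro divide_left_mono) auto
    ultimately show "x \<in> {1 / real (Suc n)<..}" by auto
  qed
  have lim: "(\<lambda>n. emeasure ?M {1 / real (Suc n)<..}) \<longlonglongrightarrow> emeasure ?M {0<..}"
    "(\<lambda>n. emeasure ?N {1 / real (Suc n)<..}) \<longlonglongrightarrow> emeasure ?N {0<..}"
  proof -
    have "range (\<lambda>n::nat. {1 / real (Suc n)<..}) \<subseteq> sets (density lborel f)" for f :: "real \<Rightarrow> ennreal" by auto
    from Lim_emeasure_incseq[OF this inc]
    show "(\<lambda>n. emeasure ?M {1 / real (Suc n)<..}) \<longlonglongrightarrow> emeasure ?M {0<..}"
      "(\<lambda>n. emeasure ?N {1 / real (Suc n)<..}) \<longlonglongrightarrow> emeasure ?N {0<..}"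
      unfolding UN by blast+
  qed
  have "emeasure ?M {1 / real (Suc n)<..} = emeasure ?N {1 / real (Suc n)<..}" for n :: nat
    using pos[of "1 / real (Suc n)"] by simp
  then have zero: "emeasure ?M {0<..} = emeasure ?N {0<..}"
    using lim by (intro LIMSEQ_unique[OF lim(1)]) simp
  have zeroM: "emeasure ?M {0<..} = ennreal (J 1 0 t)"
  proof -
    have "g * indicator {0<..} \<tau> * indicator {0<..} \<tau> = g * indicator {0<..} \<tau>" for g :: ennreal and \<tau> :: real
      by (auto simp: indicator_def)
    then show ?thesis using nn_integral_p[of 0 t] t by (simp add: emeasure_density)
  qed
  have neg: "emeasure ?M {x<..} = emeasure ?M {0<..}" "emeasure ?N {x<..} = emeasure ?N {0<..}" if "x \<le> 0" for x
  proof -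
    have e: "?f g \<tau> * indicator {x<..} \<tau> = ?f g \<tau> * indicator {0<..} \<tau>" for g and \<tau> :: real
      using that by (auto simp: indicator_def)
    show "emeasure ?M {x<..} = emeasure ?M {0<..}" "emeasure ?N {x<..} = emeasure ?N {0<..}"
      by (simp_all add: emeasure_density e)
  qed
  have "?M = ?N"
  proof (rule measure_eqI_lessThan)
    show "emeasure ?M {x<..} < \<infinity>" for x
      using pos[of x] neg[of x] zeroM by (cases "0 < x") (auto simp: not_less)
    show "emeasure ?M {x<..} = emeasure ?N {x<..}" for x
      using pos[of x] neg[of x] zero by (cases "0 < x") (auto simp: not_less)
  qed auto
  then have "AE \<tau> in lborel. ?f (p t) \<tau> = ?f (P t) \<tau>"
    by (subst (asm) sigma_finite_measure.density_unique_iff[OF lborel.sigma_finite_measure_axioms]) measurable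
  then show ?thesis
  proof eventually_elim
    case (elim \<tau>)
    show ?case
    proof
      assume "0 < \<tau>"
      then show "p t \<tau> = P t \<tau>" using elim density_props(2)[OF t, of \<tau>] P_nonneg[OF t, of \<tau>] by simp
    qed
  qed
qed

lemma p_tail:
  assumes "0 \<le> \<sigma>" "0 < t"
  shows "has_bochner_integral lborel (\<lambda>\<tau>. indicator {\<sigma><..} \<tau> * p t \<tau>) (J 1 \<sigma> t)"
proof (rule has_bochner_integral_nn_integral)
  have [measurable]: "p t \<in> borel_measurable borel" by (rule density_props(4)[OF assms(2)])
  show "(\<lambda>\<tau>. indicator {\<sigma><..} \<tau> * p t \<tau>) \<in> borel_measurable lborel" by measurable
  have e: "ennreal (indicator {\<sigma><..} \<tau> * p t \<tau>) = ennreal (p t \<tau>) * indicator {\<sigma><..} \<tau>" for \<tau>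
    by (auto simp: indicator_def)
  show "(\<integral>\<^sup>+\<tau>. ennreal (indicator {\<sigma><..} \<tau> * p t \<tau>) \<partial>lborel) = ennreal (J 1 \<sigma> t)"
    unfolding e by (rule nn_integral_p[OF assms])
qed (use J_1_bounds[OF assms] density_props(2)[OF assms(2)] in auto)

lemma J_1_0:
  assumes "0 < t"
  shows "J 1 0 t = 1"
proof -
  have [measurable]: "D 0 \<in> borel_measurable M" by (rule measurable_D) simp
  have "AE \<omega> in M. D 0 \<omega> \<le> t"
    using levy assms by (auto simp: levy_process_def elim: eventually_mono)
  then show ?thesis unfolding J_1_eq_prob[OF order_refl assms] by (subst M.prob_Collect_eq_1) auto
qed

text \<open>This growth of the exponent at infinity turns into the rate of convergence at time
  0.\<close>

lemma lexp_lower: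
  assumes "1 \<le> s"
  shows "s powr b\<^sub>0 * measure \<mu> (space \<mu>) \<le> lexp s"
proof -
  have "(LINT \<beta>|\<mu>. s powr b\<^sub>0) \<le> lexp s"
    unfolding lexp_def
  proof (rule integral_mono_AE)
    show "integrable \<mu> (\<lambda>\<beta>. s powr \<beta>)"
    proof (rule integrable_const_bound)
      show "AE \<beta> in \<mu>. norm (s powr \<beta>) \<le> max 1 s"
        using supp by eventually_elim (use powr_bound[of s] assms in auto)
    qed measurable
    show "AE \<beta> in \<mu>. s powr b\<^sub>0 \<le> s powr \<beta>"
      using supp by eventually_elim (use assms in \<open>auto intro!: powr_mono\<close>)
  qed simp
  then show ?thesis by (simp add: mult.commute)
qed

end

section \<open>The time-changed semigroup\<close>

lemma bounded_linear_apply_c0: "bounded_linear (\<lambda>\<phi>. apply_c0 \<phi> x)"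
  by (rule bounded_linear_intro[where K = 1]) (auto intro: apply_c0_le_norm)

locale time_changed_semigroup = contraction_semigroup T + inverse_subordinator \<mu> b\<^sub>0 b\<^sub>1 \<theta> M D p
  for T :: "real \<Rightarrow> 'a::euclidean_space c0fun \<Rightarrow> 'a c0fun" and \<mu> b\<^sub>0 b\<^sub>1 \<theta>
    and M :: "'w measure" and D :: "real \<Rightarrow> 'w \<Rightarrow> real" and p +
  fixes f\<^sub>0 :: "'a c0fun"
  assumes f\<^sub>0: "f\<^sub>0 \<in> gen_dom T"
begin

text \<open>The operators \<open>T \<sigma>\<close> are unspecified for \<open>\<sigma> < 0\<close>, hence the indicator.\<close>

definition orbit :: "'a c0fun \<Rightarrow> real \<Rightarrow> 'a c0fun" where
  "orbit \<phi> \<sigma> = indicator {0<..} \<sigma> *\<^sub>R T \<sigma> \<phi>"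

abbreviation "g \<equiv> gen T f\<^sub>0"

lemma measurable_orbit [measurable]: "orbit \<phi> \<in> borel_measurable borel"
  unfolding orbit_def[abs_def]
  by (intro borel_measurable_continuous_on_indicator continuous_on_subset[OF continuous]) auto

lemma norm_orbit: "norm (orbit \<phi> \<sigma>) \<le> indicator {0<..} \<sigma> * norm \<phi>"
  using contraction[of \<sigma> \<phi>] by (auto simp: orbit_def indicator_def)

lemma norm_scaleR_orbit: "norm (c *\<^sub>R orbit \<phi> \<sigma>) \<le> norm \<phi> * \<bar>indicator {0<..} \<sigma> * c\<bar>"
  using mult_left_mono[OF norm_orbit[of \<phi> \<sigma>], of "\<bar>c\<bar>"] by (simp add: abs_mult mult_ac)

lemma integrable_orbit:
  assumes k: "integrable lborel (\<lambda>\<sigma>. indicator {0<..} \<sigma> * k \<sigma>)"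
  shows "integrable lborel (\<lambda>\<sigma>. k \<sigma> *\<^sub>R orbit \<phi> \<sigma>)"
    and "norm (LINT \<sigma>|lborel. k \<sigma> *\<^sub>R orbit \<phi> \<sigma>) \<le> norm \<phi> * (LINT \<sigma>|lborel. \<bar>indicator {0<..} \<sigma> * k \<sigma>\<bar>)"
proof -
  have e: "k \<sigma> *\<^sub>R orbit \<phi> \<sigma> = (indicator {0<..} \<sigma> * k \<sigma>) *\<^sub>R orbit \<phi> \<sigma>" for \<sigma>
    by (simp add: orbit_def indicator_def)
  have [measurable]: "(\<lambda>\<sigma>. indicator {0<..} \<sigma> * k \<sigma>) \<in> borel_measurable lborel" using k by simp
  have m: "(\<lambda>\<sigma>. k \<sigma> *\<^sub>R orbit \<phi> \<sigma>) \<in> borel_measurable lborel" unfolding e by measurable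
  have w: "integrable lborel (\<lambda>\<sigma>. norm \<phi> * \<bar>indicator {0<..} \<sigma> * k \<sigma>\<bar>)"
    using k by (intro integrable_mult_right integrable_abs)
  show "integrable lborel (\<lambda>\<sigma>. k \<sigma> *\<^sub>R orbit \<phi> \<sigma>)"
  proof (rule Bochner_Integration.integrable_bound[OF w m], rule AE_I2)
    show "norm (k \<sigma> *\<^sub>R orbit \<phi> \<sigma>) \<le> norm (norm \<phi> * \<bar>indicator {0<..} \<sigma> * k \<sigma>\<bar>)" for \<sigma>
      by (rule order_trans[OF norm_scaleR_orbit]) simp
  qed
  then have "norm (LINT \<sigma>|lborel. k \<sigma> *\<^sub>R orbit \<phi> \<sigma>) \<le> (LINT \<sigma>|lborel. norm \<phi> * \<bar>indicator {0<..} \<sigma> * k \<sigma>\<bar>)"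
    using w norm_scaleR_orbit by (rule Bochner_Integration.integral_norm_bound_integral)
  then show "norm (LINT \<sigma>|lborel. k \<sigma> *\<^sub>R orbit \<phi> \<sigma>) \<le> norm \<phi> * (LINT \<sigma>|lborel. \<bar>indicator {0<..} \<sigma> * k \<sigma>\<bar>)"
    by simp
qed

lemma integrable_decay: "integrable lborel (\<lambda>\<sigma>. indicator {0<..} \<sigma> * (K * exp (- decay_rate * \<sigma>)))"
proof -
  have "integrable lborel (\<lambda>\<sigma>. K * (indicator {0<..} \<sigma> * exp (- decay_rate * \<sigma>)))"
    using has_bochner_integral_exp_half_line[OF decay_rate_pos] by (simp add: has_bochner_integral_iff)
  then show ?thesis by (simp only: mult.left_commute)
qed

lemma integrable_J:
  assumes "0 < t" "0 \<le> \<gamma>" "\<gamma> \<le> 2"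
  shows "integrable lborel (\<lambda>\<sigma>. indicator {0<..} \<sigma> * J \<gamma> \<sigma> t)"
proof (rule Bochner_Integration.integrable_bound[OF integrable_decay[of "J_const t t"]])
  show "AE \<sigma> in lborel. norm (indicator {0<..} \<sigma> * J \<gamma> \<sigma> t) \<le> norm (indicator {0<..} \<sigma> * (J_const t t * exp (- decay_rate * \<sigma>)))"
  proof (rule AE_I2)
    fix \<sigma> :: real
    show "norm (indicator {0<..} \<sigma> * J \<gamma> \<sigma> t) \<le> norm (indicator {0<..} \<sigma> * (J_const t t * exp (- decay_rate * \<sigma>)))"
      using abs_J[of t t t \<sigma> \<gamma>] assms J_const_nonneg[of t t] by (auto simp: indicator_def)
  qed
qed measurable

lemma density_mass:
  assumes t: "0 < t"
  shows "has_bochner_integral lborel (\<lambda>\<tau>. indicator {0<..} \<tau> * p t \<tau>) 1"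
  using p_tail[of 0 t] J_1_0[OF t] t by simp

text \<open>The density describes positive times only, so the initial value is put in by hand;
  \<open>u_initial\<close> shows that it fits.\<close>

definition u :: "real \<Rightarrow> 'a c0fun" where
  "u t = (if t \<le> 0 then f\<^sub>0 else LINT \<tau>|lborel. p t \<tau> *\<^sub>R orbit f\<^sub>0 \<tau>)"

lemma norm_u: "norm (u t) \<le> norm f\<^sub>0"
proof (cases "t \<le> 0")
  case False
  then have t: "0 < t" by simp
  have "(LINT \<tau>|lborel. \<bar>indicator {0<..} \<tau> * p t \<tau>\<bar>) = (LINT \<tau>|lborel. indicator {0<..} \<tau> * p t \<tau>)"
    using density_props(2)[OF t] by simp
  then show ?thesis
    using integrable_orbit(2)[of "p t" f\<^sub>0] density_mass[OF t] t by (simp add: u_def has_bochner_integral_iff)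
qed (simp add: u_def)

text \<open>Evaluation at a point is bounded and linear, which reduces the claim to the fundamental
  theorem for real functions.\<close>

lemma fundamental_theorem:
  assumes \<tau>: "0 \<le> \<tau>"
  shows "(LINT \<sigma>|lborel. indicator {..<\<tau>} \<sigma> *\<^sub>R orbit g \<sigma>) = T \<tau> f\<^sub>0 - f\<^sub>0"
proof (rule c0fun_eqI)
  fix x
  have "integrable lborel (\<lambda>\<sigma>::real. indicator {0<..<\<tau>} \<sigma> :: real)" using \<tau> by simp
  moreover have "indicator {0<..<\<tau>} \<sigma> = indicator {0<..} \<sigma> * (indicator {..<\<tau>} \<sigma> :: real)" for \<sigma> by (auto simp: indicator_def)
  ultimately have "integrable lborel (\<lambda>\<sigma>. indicator {0<..} \<sigma> * (indicator {..<\<tau>} \<sigma> :: real))" by simp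
  note i = integrable_orbit(1)[OF this, of g]
  have "apply_c0 (LINT \<sigma>|lborel. indicator {..<\<tau>} \<sigma> *\<^sub>R orbit g \<sigma>) x = (LINT \<sigma>|lborel. apply_c0 (indicator {..<\<tau>} \<sigma> *\<^sub>R orbit g \<sigma>) x)"
    by (rule integral_bounded_linear[OF bounded_linear_apply_c0 i, symmetric])
  moreover have "has_bochner_integral lborel (\<lambda>\<sigma>. indicator {0..\<tau>} \<sigma> *\<^sub>R apply_c0 (T \<sigma> g) x) (apply_c0 (T \<tau> f\<^sub>0) x - apply_c0 (T 0 f\<^sub>0) x)"
  proof (rule has_bochner_integral_FTC_Icc[OF \<tau>])
    show "((\<lambda>\<sigma>. apply_c0 (T \<sigma> f\<^sub>0) x) has_vector_derivative apply_c0 (T s g) x) (at s within {0..\<tau>})" if "0 \<le> s" for s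
      by (rule bounded_linear.has_vector_derivative[OF bounded_linear_apply_c0 has_vector_derivative_within_subset[OF derivative[OF f\<^sub>0 that]]]) auto
    show "continuous_on {0..\<tau>} (\<lambda>\<sigma>. apply_c0 (T \<sigma> g) x)"
      by (intro bounded_linear.continuous_on[OF bounded_linear_apply_c0] continuous_on_subset[OF continuous]) auto
  qed
  then have "has_bochner_integral lborel (\<lambda>\<sigma>. apply_c0 (indicator {..<\<tau>} \<sigma> *\<^sub>R orbit g \<sigma>) x) (apply_c0 (T \<tau> f\<^sub>0) x - apply_c0 (T 0 f\<^sub>0) x)"
  proof (rule has_bochner_integralI_AE)
    show "AE \<sigma> in lborel. indicator {0..\<tau>} \<sigma> *\<^sub>R apply_c0 (T \<sigma> g) x = apply_c0 (indicator {..<\<tau>} \<sigma> *\<^sub>R orbit g \<sigma>) x"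
      using AE_lborel_singleton[of "0::real"] AE_lborel_singleton[of \<tau>]
      by eventually_elim (auto simp: orbit_def indicator_def)
    show "(\<lambda>\<sigma>. apply_c0 (indicator {..<\<tau>} \<sigma> *\<^sub>R orbit g \<sigma>) x) \<in> borel_measurable lborel"
      using integrable_bounded_linear[OF bounded_linear_apply_c0 i] by (rule borel_measurable_integrable)
  qed
  ultimately show "apply_c0 (LINT \<sigma>|lborel. indicator {..<\<tau>} \<sigma> *\<^sub>R orbit g \<sigma>) x = apply_c0 (T \<tau> f\<^sub>0 - f\<^sub>0) x"
    by (simp add: has_bochner_integral_iff)
qed

text \<open>As \<open>p t\<close> has mass 1, \<open>u t - f\<^sub>0\<close> is the integral of
  \<open>p t\<close> against \<open>T \<tau> f\<^sub>0 - f\<^sub>0\<close>, itself the integral of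
  the orbit of \<open>g\<close> up to \<tau>. Exchanging the integrations turns \<open>p t\<close>
  into its tails.\<close>

lemma u_eq:
  assumes t: "0 < t"
  shows "u t = f\<^sub>0 + (LINT \<sigma>|lborel. J 1 \<sigma> t *\<^sub>R orbit g \<sigma>)"
proof -
  have [measurable]: "p t \<in> borel_measurable borel" by (rule density_props(4)[OF t])
  define H where "H \<sigma> \<tau> = (indicator {\<sigma><..} \<tau> * p t \<tau>) *\<^sub>R orbit g \<sigma>" for \<sigma> \<tau>
  have mi: "(\<lambda>x::real \<times> real. indicator {fst x<..} (snd x) :: real) \<in> borel_measurable (lborel \<Otimes>\<^sub>M lborel)"
  proof -
    have "(\<lambda>x::real \<times> real. indicator {fst x<..} (snd x) :: real) = (\<lambda>x. if fst x < snd x then 1 else 0)"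
      by (auto simp: indicator_def fun_eq_iff)
    then show ?thesis by simp
  qed
  have Hm: "case_prod H \<in> borel_measurable (lborel \<Otimes>\<^sub>M lborel)"
    unfolding H_def case_prod_beta' by (intro borel_measurable_scaleR borel_measurable_times mi) measurable
  have tail: "integrable lborel (\<lambda>\<tau>. indicator {\<sigma><..} \<tau> * p t \<tau>)" "(LINT \<tau>|lborel. indicator {\<sigma><..} \<tau> * p t \<tau>) = J 1 \<sigma> t"
    if "0 \<le> \<sigma>" for \<sigma>
    using p_tail[OF that t] by (simp_all add: has_bochner_integral_iff)
  have inner: "integrable lborel (H \<sigma>)" "(LINT \<tau>|lborel. H \<sigma> \<tau>) = J 1 \<sigma> t *\<^sub>R orbit g \<sigma>"
    "(LINT \<tau>|lborel. norm (H \<sigma> \<tau>)) = J 1 \<sigma> t * norm (orbit g \<sigma>)" for \<sigma>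
  proof -
    have "integrable lborel (H \<sigma>) \<and> (LINT \<tau>|lborel. H \<sigma> \<tau>) = J 1 \<sigma> t *\<^sub>R orbit g \<sigma> \<and> (LINT \<tau>|lborel. norm (H \<sigma> \<tau>)) = J 1 \<sigma> t * norm (orbit g \<sigma>)"
    proof (cases "0 \<le> \<sigma>")
      case True
      have n: "norm (H \<sigma> \<tau>) = (indicator {\<sigma><..} \<tau> * p t \<tau>) * norm (orbit g \<sigma>)" for \<tau>
        using density_props(2)[OF t] by (simp add: H_def)
      show ?thesis
        unfolding n unfolding H_def using tail[OF True] by simp
    next
      case False
      then have "H \<sigma> = (\<lambda>_. 0)" by (auto simp: H_def orbit_def)
      then show ?thesis using False by (simp add: orbit_def)
    qed
    then show "integrable lborel (H \<sigma>)" "(LINT \<tau>|lborel. H \<sigma> \<tau>) = J 1 \<sigma> t *\<^sub>R orbit g \<sigma>"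
      "(LINT \<tau>|lborel. norm (H \<sigma> \<tau>)) = J 1 \<sigma> t * norm (orbit g \<sigma>)" by auto
  qed
  have Hint: "integrable (lborel \<Otimes>\<^sub>M lborel) (case_prod H)"
  proof (rule lborel_pair.Fubini_integrable[OF Hm])
    show "AE \<sigma> in lborel. integrable lborel (\<lambda>\<tau>. case (\<sigma>, \<tau>) of (\<sigma>, \<tau>) \<Rightarrow> H \<sigma> \<tau>)"
      using inner(1) by simp
    have "integrable lborel (\<lambda>\<sigma>. J 1 \<sigma> t *\<^sub>R orbit g \<sigma>)"
      by (rule integrable_orbit(1)[OF integrable_J]) (use t in auto)
    then have "integrable lborel (\<lambda>\<sigma>. norm (J 1 \<sigma> t *\<^sub>R orbit g \<sigma>))" by (rule integrable_norm)
    moreover have "norm (J 1 \<sigma> t *\<^sub>R orbit g \<sigma>) = J 1 \<sigma> t * norm (orbit g \<sigma>)" for \<sigma>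
      using J_1_bounds(1)[of \<sigma> t] t by (cases "0 \<le> \<sigma>") (auto simp: orbit_def)
    ultimately show "integrable lborel (\<lambda>\<sigma>. LINT \<tau>|lborel. norm (case (\<sigma>, \<tau>) of (\<sigma>, \<tau>) \<Rightarrow> H \<sigma> \<tau>))"
      by (simp only: case_prod_conv inner(3))
  qed
  have inner2: "(LINT \<sigma>|lborel. H \<sigma> \<tau>) = (indicator {0<..} \<tau> * p t \<tau>) *\<^sub>R (T \<tau> f\<^sub>0 - f\<^sub>0)" if "\<tau> \<noteq> 0" for \<tau>
  proof (cases "0 < \<tau>")
    case True
    have h: "H \<sigma> \<tau> = p t \<tau> *\<^sub>R (indicator {..<\<tau>} \<sigma> *\<^sub>R orbit g \<sigma>)" for \<sigma>
      by (auto simp: H_def indicator_def)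
    show ?thesis
      unfolding h Bochner_Integration.integral_scaleR_right fundamental_theorem[OF less_imp_le[OF True]] using True by simp
  next
    case False
    then have "H \<sigma> \<tau> = 0" for \<sigma> by (auto simp: H_def indicator_def orbit_def)
    then show ?thesis using False by simp
  qed
  have i1: "integrable lborel (\<lambda>\<tau>. p t \<tau> *\<^sub>R orbit f\<^sub>0 \<tau>)"
    by (rule integrable_orbit(1)) (use density_mass[OF t] in \<open>simp add: has_bochner_integral_iff\<close>)
  have i2: "integrable lborel (\<lambda>\<tau>. (indicator {0<..} \<tau> * p t \<tau>) *\<^sub>R f\<^sub>0)" "(LINT \<tau>|lborel. (indicator {0<..} \<tau> * p t \<tau>) *\<^sub>R f\<^sub>0) = f\<^sub>0"
    using density_mass[OF t] by (simp_all add: has_bochner_integral_iff)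
  have "u t - f\<^sub>0 = (LINT \<tau>|lborel. p t \<tau> *\<^sub>R orbit f\<^sub>0 \<tau>) - (LINT \<tau>|lborel. (indicator {0<..} \<tau> * p t \<tau>) *\<^sub>R f\<^sub>0)"
    unfolding i2(2) using t by (simp add: u_def)
  also have "\<dots> = (LINT \<tau>|lborel. p t \<tau> *\<^sub>R orbit f\<^sub>0 \<tau> - (indicator {0<..} \<tau> * p t \<tau>) *\<^sub>R f\<^sub>0)"
    by (rule Bochner_Integration.integral_diff[OF i1 i2(1), symmetric])
  also have "\<dots> = (LINT \<tau>|lborel. LINT \<sigma>|lborel. H \<sigma> \<tau>)"
  proof (rule integral_cong_AE)
    show "AE \<tau> in lborel. p t \<tau> *\<^sub>R orbit f\<^sub>0 \<tau> - (indicator {0<..} \<tau> * p t \<tau>) *\<^sub>R f\<^sub>0 = (LINT \<sigma>|lborel. H \<sigma> \<tau>)"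
      using AE_lborel_singleton[of "0::real"]
    proof eventually_elim
      case (elim \<tau>)
      show ?case unfolding inner2[OF elim] by (simp add: orbit_def indicator_def scaleR_diff_right)
    qed
    show "(\<lambda>\<tau>. LINT \<sigma>|lborel. H \<sigma> \<tau>) \<in> borel_measurable lborel"
      using lborel_pair.integrable_snd[OF Hint] by (rule borel_measurable_integrable)
  qed measurable
  also have "\<dots> = (LINT \<sigma>|lborel. LINT \<tau>|lborel. H \<sigma> \<tau>)" by (rule lborel_pair.Fubini_integral[OF Hint])
  finally show ?thesis unfolding inner(2) by (simp add: algebra_simps)
qed

text \<open>\<open>T h\<close> commutes with the orbit and with the integral, so the difference
  quotient of \<open>u t\<close> is an average over orbits of the difference quotient of
  \<open>f\<^sub>0\<close>. Contractivity and mass 1 bound its error by the one for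
  \<open>f\<^sub>0\<close>.\<close>

lemma gen_u:
  assumes t: "0 < t"
  shows "u t \<in> gen_dom T" "gen T (u t) = (LINT \<tau>|lborel. p t \<tau> *\<^sub>R orbit g \<tau>)"
proof -
  have k: "integrable lborel (\<lambda>\<tau>. indicator {0<..} \<tau> * p t \<tau>)" "(LINT \<tau>|lborel. \<bar>indicator {0<..} \<tau> * p t \<tau>\<bar>) = 1"
    using density_mass[OF t] density_props(2)[OF t] by (simp_all add: has_bochner_integral_iff)
  note i = integrable_orbit(1)[OF k(1)]
  have ut: "u t = (LINT \<tau>|lborel. p t \<tau> *\<^sub>R orbit f\<^sub>0 \<tau>)" using t by (simp add: u_def)
  have quotient: "(T h (u t) - u t) /\<^sub>R h = (LINT \<tau>|lborel. p t \<tau> *\<^sub>R orbit ((T h f\<^sub>0 - f\<^sub>0) /\<^sub>R h) \<tau>)" if h: "0 < h" for h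
  proof -
    interpret h: bounded_linear "T h" using h by (intro linear) simp
    have Th: "T h (u t) = (LINT \<tau>|lborel. T h (p t \<tau> *\<^sub>R orbit f\<^sub>0 \<tau>))" "integrable lborel (\<lambda>\<tau>. T h (p t \<tau> *\<^sub>R orbit f\<^sub>0 \<tau>))"
      unfolding ut using integral_bounded_linear[OF h.bounded_linear_axioms i] integrable_bounded_linear[OF h.bounded_linear_axioms i] by auto
    have e: "p t \<tau> *\<^sub>R orbit ((T h f\<^sub>0 - f\<^sub>0) /\<^sub>R h) \<tau> = (T h (p t \<tau> *\<^sub>R orbit f\<^sub>0 \<tau>) - p t \<tau> *\<^sub>R orbit f\<^sub>0 \<tau>) /\<^sub>R h" for \<tau>
    proof (cases "0 < \<tau>")
      case True
      have "T \<tau> (T h f\<^sub>0) = T h (T \<tau> f\<^sub>0)" using T_add[of \<tau> h f\<^sub>0] T_add[of h \<tau> f\<^sub>0] True h by (simp add: add.commute)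
      then show ?thesis using True h by (simp add: orbit_def h.scaleR T_scale T_diff scaleR_diff_right mult.commute)
    next
      case False
      then show ?thesis by (simp add: orbit_def h.zero)
    qed
    show ?thesis unfolding e Th(1) unfolding ut using Th(2) i[of f\<^sub>0] by simp
  qed
  have "((\<lambda>h. (T h (u t) - u t) /\<^sub>R h) \<longlongrightarrow> (LINT \<tau>|lborel. p t \<tau> *\<^sub>R orbit g \<tau>)) (at_right 0)"
  proof (rule Lim_null[THEN iffD2], rule Lim_null_comparison)
    show "\<forall>\<^sub>F h in at_right 0. norm ((T h (u t) - u t) /\<^sub>R h - (LINT \<tau>|lborel. p t \<tau> *\<^sub>R orbit g \<tau>)) \<le> norm ((T h f\<^sub>0 - f\<^sub>0) /\<^sub>R h - g)"
      using eventually_at_right_less[of 0]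
    proof eventually_elim
      case (elim h)
      have e: "p t \<tau> *\<^sub>R orbit ((T h f\<^sub>0 - f\<^sub>0) /\<^sub>R h) \<tau> - p t \<tau> *\<^sub>R orbit g \<tau> = p t \<tau> *\<^sub>R orbit ((T h f\<^sub>0 - f\<^sub>0) /\<^sub>R h - g) \<tau>" for \<tau>
        by (simp add: orbit_def T_diff scaleR_diff_right indicator_def)
      have "(T h (u t) - u t) /\<^sub>R h - (LINT \<tau>|lborel. p t \<tau> *\<^sub>R orbit g \<tau>) = (LINT \<tau>|lborel. p t \<tau> *\<^sub>R orbit ((T h f\<^sub>0 - f\<^sub>0) /\<^sub>R h - g) \<tau>)"
        unfolding quotient[OF elim] e[symmetric] by (rule Bochner_Integration.integral_diff[OF i i, symmetric])
      then show ?case using integrable_orbit(2)[OF k(1), of "(T h f\<^sub>0 - f\<^sub>0) /\<^sub>R h - g"] k(2) by simp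
    qed
    have "((\<lambda>h. (T h f\<^sub>0 - f\<^sub>0) /\<^sub>R h - g) \<longlongrightarrow> 0) (at_right 0)"
      using Lim_null[THEN iffD1, OF gen_tendsto[OF f\<^sub>0]] .
    then show "((\<lambda>h. norm ((T h f\<^sub>0 - f\<^sub>0) /\<^sub>R h - g)) \<longlongrightarrow> 0) (at_right 0)" by (rule tendsto_norm_zero)
  qed
  from gen_domI[of T "u t", OF this] show "u t \<in> gen_dom T" "gen T (u t) = (LINT \<tau>|lborel. p t \<tau> *\<^sub>R orbit g \<tau>)" .
qed

text \<open>The contour bounds blow up at time 0. Markov's inequality with parameter 1/t bounds the
  \<sigma>-integral of \<open>J 1\<close> by \<open>exp 1\<close> divided by f^mu(1/t), and
  f^mu(1/t) is at least a multiple of \<open>t powr (- b\<^sub>0)\<close>.\<close>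

lemma u_initial: "(u \<longlongrightarrow> f\<^sub>0) (at_right 0)"
proof (rule Lim_null[THEN iffD2], rule Lim_null_comparison)
  let ?m = "measure \<mu> (space \<mu>)"
  have m: "0 < ?m" using \<mu>_nonzero by (simp add: emeasure_eq_measure zero_less_measure_iff)
  show "\<forall>\<^sub>F t in at_right 0. norm (u t - f\<^sub>0) \<le> norm g * (exp 1 / ?m * t powr b\<^sub>0)"
    using eventually_at_right_less[of 0] eventually_at_right_real[OF zero_less_one]
  proof eventually_elim
    case (elim t)
    then have t: "0 < t" "t \<le> 1" by auto
    define L where "L = lexp (1 / t)"
    have "(1 / t) powr b\<^sub>0 * ?m \<le> L" unfolding L_def using t by (intro lexp_lower) simp
    moreover have "(1 / t) powr b\<^sub>0 = 1 / t powr b\<^sub>0" using t by (simp add: powr_divide)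
    ultimately have L: "?m / t powr b\<^sub>0 \<le> L" by simp
    have Lpos: "0 < ?m / t powr b\<^sub>0" using m t by simp
    then have L0: "0 < L" using L by linarith
    have b: "has_bochner_integral lborel (\<lambda>\<sigma>. exp 1 * (indicator {0<..} \<sigma> * exp (- L * \<sigma>))) (exp 1 * (1 / L))"
      by (intro has_bochner_integral_mult_right has_bochner_integral_exp_half_line L0)
    have iJ: "integrable lborel (\<lambda>\<sigma>. indicator {0<..} \<sigma> * J 1 \<sigma> t)" using t by (intro integrable_J) auto
    have "(LINT \<sigma>|lborel. \<bar>indicator {0<..} \<sigma> * J 1 \<sigma> t\<bar>) \<le> (LINT \<sigma>|lborel. exp 1 * (indicator {0<..} \<sigma> * exp (- L * \<sigma>)))"
    proof (rule Bochner_Integration.integral_mono)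
      show "integrable lborel (\<lambda>\<sigma>. \<bar>indicator {0<..} \<sigma> * J 1 \<sigma> t\<bar>)" using iJ by (rule integrable_abs)
      show "integrable lborel (\<lambda>\<sigma>. exp 1 * (indicator {0<..} \<sigma> * exp (- L * \<sigma>)))" using b by (simp add: has_bochner_integral_iff)
      show "\<bar>indicator {0<..} \<sigma> * J 1 \<sigma> t\<bar> \<le> exp 1 * (indicator {0<..} \<sigma> * exp (- L * \<sigma>))" for \<sigma>
      proof (cases "0 < \<sigma>")
        case True
        have "J 1 \<sigma> t \<le> exp (1 / t * t) * exp (- \<sigma> * lexp (1 / t))" using True t by (intro J_1_exp_bound) auto
        then show ?thesis using True t J_1_bounds(1)[of \<sigma> t] by (simp add: L_def mult.commute)
      qed simp
    qed
    also have "\<dots> = exp 1 * (1 / L)" by (rule has_bochner_integral_integral_eq[OF b])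
    also have "\<dots> \<le> exp 1 * (1 / (?m / t powr b\<^sub>0))" using L Lpos by (intro mult_left_mono divide_left_mono mult_pos_pos L0) auto
    also have "\<dots> = exp 1 / ?m * t powr b\<^sub>0" by simp
    finally have "(LINT \<sigma>|lborel. \<bar>indicator {0<..} \<sigma> * J 1 \<sigma> t\<bar>) \<le> exp 1 / ?m * t powr b\<^sub>0" .
    then have "norm g * (LINT \<sigma>|lborel. \<bar>indicator {0<..} \<sigma> * J 1 \<sigma> t\<bar>) \<le> norm g * (exp 1 / ?m * t powr b\<^sub>0)"
      by (rule mult_left_mono) simp
    then show ?case using integrable_orbit(2)[OF iJ, of g] u_eq[OF t(1)] by simp
  qed
  have "\<forall>\<^sub>F t::real in at_right 0. 0 \<le> t"
    using eventually_at_right_less[of "0::real"] by eventually_elim simp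
  from tendsto_powr2[OF tendsto_ident_at tendsto_const this b(1)]
  have "((\<lambda>t. t powr b\<^sub>0) \<longlongrightarrow> 0 powr b\<^sub>0) (at_right 0)" .
  then have "((\<lambda>t. norm g * (exp 1 / ?m * t powr b\<^sub>0)) \<longlongrightarrow> norm g * (exp 1 / ?m * 0 powr b\<^sub>0)) (at_right 0)"
    by (intro tendsto_mult tendsto_const)
  then show "((\<lambda>t. norm g * (exp 1 / ?m * t powr b\<^sub>0)) \<longlongrightarrow> 0) (at_right 0)" by simp
qed

text \<open>Joint measurability of \<open>p\<close> in both arguments is not at hand; measurability
  in time is taken from the representation through \<open>J\<close>, which is jointly
  measurable.\<close>

lemma measurable_u [measurable]: "u \<in> borel_measurable borel"
proof -
  have "(\<lambda>t. LINT \<sigma>|lborel. J 1 \<sigma> t *\<^sub>R orbit g \<sigma>) \<in> borel_measurable borel"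
    by (rule lborel.borel_measurable_lebesgue_integral) measurable
  then have "(\<lambda>t. if t \<le> 0 then f\<^sub>0 else f\<^sub>0 + (LINT \<sigma>|lborel. J 1 \<sigma> t *\<^sub>R orbit g \<sigma>)) \<in> borel_measurable borel"
    by measurable
  moreover have "u = (\<lambda>t. if t \<le> 0 then f\<^sub>0 else f\<^sub>0 + (LINT \<sigma>|lborel. J 1 \<sigma> t *\<^sub>R orbit g \<sigma>))"
    by (rule ext) (use u_eq in \<open>auto simp: u_def[where t = "t" for t]\<close>)
  ultimately show ?thesis by simp
qed

text \<open>Fubini reduces the orbit part to \<open>fractional_integral_J_1\<close>, while the
  constant \<open>f\<^sub>0\<close> gives a power of s. The representation of \<open>u\<close> fails
  only at r = 0, a null set.\<close>

lemma RL_integral_u: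
  assumes \<beta>: "0 < \<beta>" "\<beta> < 1" and s: "0 < s"
  shows "set_integrable lborel {0..s} (\<lambda>r. (1 / (s - r) powr \<beta>) *\<^sub>R u r)"
    and "RL_integral \<beta> u s = (s powr (1 - \<beta>) / ((1 - \<beta>) * Gamma (1 - \<beta>))) *\<^sub>R f\<^sub>0 + (LINT \<sigma>|lborel. J (2 - \<beta>) \<sigma> s *\<^sub>R orbit g \<sigma>)"
proof -
  define k where "k r = indicator {0..s} r * (s - r) powr (- \<beta>)" for r
  have k0: "0 \<le> k r" for r by (simp add: k_def)
  have [measurable]: "k \<in> borel_measurable borel" unfolding k_def[abs_def] by measurable
  have kint: "integrable lborel k" "(LINT r|lborel. k r) = s powr (1 - \<beta>) / (1 - \<beta>)"
    using has_bochner_integral_fractional_kernel[of "- \<beta>" 0 s] \<beta> s by (simp_all add: k_def[abs_def] has_bochner_integral_iff)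
  have ku: "indicator {0..s} r *\<^sub>R ((1 / (s - r) powr \<beta>) *\<^sub>R u r) = k r *\<^sub>R u r" for r
    by (simp add: k_def powr_minus divide_inverse)
  have "integrable lborel (\<lambda>r. k r * norm f\<^sub>0)" using kint(1) by simp
  then have kuint: "integrable lborel (\<lambda>r. k r *\<^sub>R u r)"
    by (rule Bochner_Integration.integrable_bound) (use k0 norm_u in \<open>auto intro!: mult_left_mono\<close>)
  then show "set_integrable lborel {0..s} (\<lambda>r. (1 / (s - r) powr \<beta>) *\<^sub>R u r)"
    unfolding set_integrable_def ku .
  define H where "H \<sigma> r = (indicator {0<..} r * k r * J 1 \<sigma> r) *\<^sub>R orbit g \<sigma>" for \<sigma> r
  have Hm: "case_prod H \<in> borel_measurable (lborel \<Otimes>\<^sub>M lborel)" unfolding H_def by measurable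
  have frac: "has_bochner_integral lborel (\<lambda>r. indicator {0<..} r * k r * J 1 \<sigma> r) (Gamma (1 - \<beta>) * J (2 - \<beta>) \<sigma> s)" if "0 \<le> \<sigma>" for \<sigma>
  proof (rule has_bochner_integralI_AE[OF fractional_integral_J_1[OF \<beta> that s]])
    show "AE r in lborel. indicator {0..s} r * ((s - r) powr - \<beta> * J 1 \<sigma> r) = indicator {0<..} r * k r * J 1 \<sigma> r"
      using AE_lborel_singleton[of "0::real"] by eventually_elim (auto simp: k_def indicator_def)
  qed measurable
  have inner: "integrable lborel (H \<sigma>)" "(LINT r|lborel. H \<sigma> r) = (Gamma (1 - \<beta>) * J (2 - \<beta>) \<sigma> s) *\<^sub>R orbit g \<sigma>"
    "(LINT r|lborel. norm (H \<sigma> r)) = norm ((Gamma (1 - \<beta>) * J (2 - \<beta>) \<sigma> s) *\<^sub>R orbit g \<sigma>)" for \<sigma>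
  proof -
    have "integrable lborel (H \<sigma>) \<and> (LINT r|lborel. H \<sigma> r) = (Gamma (1 - \<beta>) * J (2 - \<beta>) \<sigma> s) *\<^sub>R orbit g \<sigma> \<and>
      (LINT r|lborel. norm (H \<sigma> r)) = norm ((Gamma (1 - \<beta>) * J (2 - \<beta>) \<sigma> s) *\<^sub>R orbit g \<sigma>)"
    proof (cases "0 \<le> \<sigma>")
      case True
      have pos: "0 \<le> indicator {0<..} r * k r * J 1 \<sigma> r" for r
        using J_1_bounds(1)[OF True, of r] k0[of r] by (auto simp: indicator_def)
      then have n: "norm (H \<sigma> r) = (indicator {0<..} r * k r * J 1 \<sigma> r) * norm (orbit g \<sigma>)" for r
        unfolding H_def norm_scaleR by (simp only: abs_of_nonneg)
      have "0 \<le> Gamma (1 - \<beta>) * J (2 - \<beta>) \<sigma> s"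
        unfolding has_bochner_integral_integral_eq[OF frac[OF True], symmetric] by (intro Bochner_Integration.integral_nonneg pos)
      then have c: "norm ((Gamma (1 - \<beta>) * J (2 - \<beta>) \<sigma> s) *\<^sub>R orbit g \<sigma>) = (Gamma (1 - \<beta>) * J (2 - \<beta>) \<sigma> s) * norm (orbit g \<sigma>)"
        unfolding norm_scaleR by (simp only: abs_of_nonneg)
      have f: "integrable lborel (\<lambda>r. indicator {0<..} r * k r * J 1 \<sigma> r)" "(LINT r|lborel. indicator {0<..} r * k r * J 1 \<sigma> r) = Gamma (1 - \<beta>) * J (2 - \<beta>) \<sigma> s"
        using frac[OF True] by (simp_all add: has_bochner_integral_iff)
      show ?thesis
      proof (intro conjI)
        show "integrable lborel (H \<sigma>)" unfolding H_def using f(1) by simp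
        show "(LINT r|lborel. H \<sigma> r) = (Gamma (1 - \<beta>) * J (2 - \<beta>) \<sigma> s) *\<^sub>R orbit g \<sigma>"
          unfolding H_def f(2)[symmetric] using f(1) by (intro integral_scaleR_left) auto
        show "(LINT r|lborel. norm (H \<sigma> r)) = norm ((Gamma (1 - \<beta>) * J (2 - \<beta>) \<sigma> s) *\<^sub>R orbit g \<sigma>)"
        proof -
          have "(LINT r|lborel. norm (H \<sigma> r)) = (LINT r|lborel. indicator {0<..} r * k r * J 1 \<sigma> r) * norm (orbit g \<sigma>)"
            unfolding n using f(1) by (intro Bochner_Integration.integral_mult_left) auto
          then show ?thesis unfolding c f(2) .
        qed
      qed
    next
      case False
      then have "H \<sigma> = (\<lambda>_. 0)" by (auto simp: H_def orbit_def)
      then show ?thesis using False by (simp add: orbit_def)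
    qed
    then show "integrable lborel (H \<sigma>)" "(LINT r|lborel. H \<sigma> r) = (Gamma (1 - \<beta>) * J (2 - \<beta>) \<sigma> s) *\<^sub>R orbit g \<sigma>"
      "(LINT r|lborel. norm (H \<sigma> r)) = norm ((Gamma (1 - \<beta>) * J (2 - \<beta>) \<sigma> s) *\<^sub>R orbit g \<sigma>)" by auto
  qed
  have iJ: "integrable lborel (\<lambda>\<sigma>. J (2 - \<beta>) \<sigma> s *\<^sub>R orbit g \<sigma>)"
    using s \<beta> by (intro integrable_orbit(1) integrable_J) auto
  have iGJ: "integrable lborel (\<lambda>\<sigma>. (Gamma (1 - \<beta>) * J (2 - \<beta>) \<sigma> s) *\<^sub>R orbit g \<sigma>)"
    unfolding scaleR_scaleR[symmetric] by (rule Bochner_Integration.integrable_scaleR_right) (rule iJ)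
  have Hint: "integrable (lborel \<Otimes>\<^sub>M lborel) (case_prod H)"
  proof (rule lborel_pair.Fubini_integrable[OF Hm])
    show "integrable lborel (\<lambda>\<sigma>. LINT r|lborel. norm (case (\<sigma>, r) of (\<sigma>, r) \<Rightarrow> H \<sigma> r))"
      unfolding case_prod_conv inner(3) using iGJ by (rule integrable_norm)
  qed (use inner(1) in simp)
  have inner2: "(LINT \<sigma>|lborel. H \<sigma> r) = k r *\<^sub>R u r - k r *\<^sub>R f\<^sub>0" if "r \<noteq> 0" for r
  proof (cases "0 < r")
    case True
    have h: "H \<sigma> r = k r *\<^sub>R (J 1 \<sigma> r *\<^sub>R orbit g \<sigma>)" for \<sigma> using True by (simp add: H_def)
    show ?thesis unfolding h Bochner_Integration.integral_scaleR_right u_eq[OF True] by (simp only: scaleR_add_right add_diff_cancel_left')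
  next
    case False
    then show ?thesis using that by (simp add: H_def k_def)
  qed
  have kf: "integrable lborel (\<lambda>r. k r *\<^sub>R f\<^sub>0)" "(LINT r|lborel. k r *\<^sub>R f\<^sub>0) = (s powr (1 - \<beta>) / (1 - \<beta>)) *\<^sub>R f\<^sub>0"
    using kint by simp_all
  have "(LINT r|lborel. k r *\<^sub>R u r) - (LINT r|lborel. k r *\<^sub>R f\<^sub>0) = (LINT r|lborel. k r *\<^sub>R u r - k r *\<^sub>R f\<^sub>0)"
    by (rule Bochner_Integration.integral_diff[OF kuint kf(1), symmetric])
  also have "\<dots> = (LINT r|lborel. LINT \<sigma>|lborel. H \<sigma> r)"
  proof (rule integral_cong_AE)
    show "AE r in lborel. k r *\<^sub>R u r - k r *\<^sub>R f\<^sub>0 = (LINT \<sigma>|lborel. H \<sigma> r)"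
      using AE_lborel_singleton[of "0::real"] by eventually_elim (rule inner2[symmetric])
    show "(\<lambda>r. LINT \<sigma>|lborel. H \<sigma> r) \<in> borel_measurable lborel"
      using lborel_pair.integrable_snd[OF Hint] by (rule borel_measurable_integrable)
  qed measurable
  also have "\<dots> = (LINT \<sigma>|lborel. LINT r|lborel. H \<sigma> r)" by (rule lborel_pair.Fubini_integral[OF Hint])
  also have "\<dots> = Gamma (1 - \<beta>) *\<^sub>R (LINT \<sigma>|lborel. J (2 - \<beta>) \<sigma> s *\<^sub>R orbit g \<sigma>)"
    unfolding inner(2) scaleR_scaleR[symmetric] by (rule Bochner_Integration.integral_scaleR_right)
  finally have "(LINT r|lborel. k r *\<^sub>R u r) = (s powr (1 - \<beta>) / (1 - \<beta>)) *\<^sub>R f\<^sub>0 + Gamma (1 - \<beta>) *\<^sub>R (LINT \<sigma>|lborel. J (2 - \<beta>) \<sigma> s *\<^sub>R orbit g \<sigma>)"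
    unfolding kf(2) by (simp add: algebra_simps)
  moreover have "0 < Gamma (1 - \<beta>)" using \<beta> by (intro Gamma_real_pos) simp
  then have "Gamma (1 - \<beta>) \<noteq> 0" by (rule less_imp_neq[THEN not_sym])
  ultimately show "RL_integral \<beta> u s = (s powr (1 - \<beta>) / ((1 - \<beta>) * Gamma (1 - \<beta>))) *\<^sub>R f\<^sub>0 + (LINT \<sigma>|lborel. J (2 - \<beta>) \<sigma> s *\<^sub>R orbit g \<sigma>)"
    unfolding RL_integral_def set_lebesgue_integral_def ku by (simp add: scaleR_add_right)
qed

text \<open>One time derivative lowers 2 - \<beta> to 1 - \<beta> under the integral and turns the
  power of s into exactly the term that the Caputo correction subtracts.\<close>

lemma RL_derivative_u:
  assumes \<beta>: "0 < \<beta>" "\<beta> < 1" and t: "0 < t"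
  shows "has_RL_derivative \<beta> u t ((t powr (- \<beta>) / Gamma (1 - \<beta>)) *\<^sub>R f\<^sub>0 + (LINT \<sigma>|lborel. J (1 - \<beta>) \<sigma> t *\<^sub>R orbit g \<sigma>))"
  unfolding has_RL_derivative_def
proof
  have "\<forall>\<^sub>F s in nhds t. s \<in> {0<..}" using t by (intro eventually_nhds_in_open) auto
  then show "\<forall>\<^sub>F s in nhds t. set_integrable lborel {0..s} (\<lambda>r. (1 / (s - r) powr \<beta>) *\<^sub>R u r)"
    by eventually_elim (use RL_integral_u(1)[OF \<beta>] in simp)
  have 1: "((\<lambda>s. s powr (1 - \<beta>) / ((1 - \<beta>) * Gamma (1 - \<beta>))) has_vector_derivative t powr (- \<beta>) / Gamma (1 - \<beta>)) (at t)"
  proof -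
    have "((\<lambda>s. s powr (1 - \<beta>)) has_real_derivative (1 - \<beta>) * t powr (1 - \<beta> - 1)) (at t)"
      by (rule has_real_derivative_powr[OF t])
    from DERIV_cdivide[OF this, of "(1 - \<beta>) * Gamma (1 - \<beta>)"] show ?thesis
      using \<beta> by (simp add: has_real_derivative_iff_has_vector_derivative)
  qed
  have 2: "((\<lambda>s. LINT \<sigma>|lborel. J (2 - \<beta>) \<sigma> s *\<^sub>R orbit g \<sigma>) has_vector_derivative (LINT \<sigma>|lborel. J (1 - \<beta>) \<sigma> t *\<^sub>R orbit g \<sigma>)) (at t)"
  proof (rule has_vector_derivative_lebesgue_integral[where U = "{t/2<..<2*t}" and D = "\<lambda>s \<sigma>. J (1 - \<beta>) \<sigma> s *\<^sub>R orbit g \<sigma>"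
        and w = "\<lambda>\<sigma>. norm g * (indicator {0<..} \<sigma> * (J_const (t/2) (2*t) * exp (- decay_rate * \<sigma>)))"])
    show "integrable lborel (\<lambda>\<sigma>. J (2 - \<beta>) \<sigma> s *\<^sub>R orbit g \<sigma>)" if "s \<in> {t/2<..<2*t}" for s
      using that t \<beta> by (intro integrable_orbit(1) integrable_J) auto
    show "AE \<sigma> in lborel. \<forall>s\<in>{t/2<..<2*t}. ((\<lambda>s. J (2 - \<beta>) \<sigma> s *\<^sub>R orbit g \<sigma>) has_vector_derivative J (1 - \<beta>) \<sigma> s *\<^sub>R orbit g \<sigma>) (at s)"
    proof (intro AE_I2 ballI)
      fix \<sigma> s :: real assume s: "s \<in> {t/2<..<2*t}"
      show "((\<lambda>s. J (2 - \<beta>) \<sigma> s *\<^sub>R orbit g \<sigma>) has_vector_derivative J (1 - \<beta>) \<sigma> s *\<^sub>R orbit g \<sigma>) (at s)"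
      proof (cases "0 < \<sigma>")
        case True
        have "(J (2 - \<beta>) \<sigma> has_vector_derivative J (2 - \<beta> - 1) \<sigma> s) (at s)"
          using True s t \<beta> by (intro J_derivative) auto
        then have "(J (2 - \<beta>) \<sigma> has_vector_derivative J (1 - \<beta>) \<sigma> s) (at s)" by simp
        then show ?thesis by (rule bounded_linear.has_vector_derivative[OF bounded_linear_scaleR_left])
      qed (simp add: orbit_def)
    qed
    show "AE \<sigma> in lborel. \<forall>s\<in>{t/2<..<2*t}. norm (J (1 - \<beta>) \<sigma> s *\<^sub>R orbit g \<sigma>) \<le> norm g * (indicator {0<..} \<sigma> * (J_const (t/2) (2*t) * exp (- decay_rate * \<sigma>)))"
    proof (intro AE_I2 ballI)
      fix \<sigma> s :: real assume s: "s \<in> {t/2<..<2*t}"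
      have "\<bar>indicator {0<..} \<sigma> * J (1 - \<beta>) \<sigma> s\<bar> \<le> indicator {0<..} \<sigma> * (J_const (t/2) (2*t) * exp (- decay_rate * \<sigma>))"
        using abs_J[of "t/2" s "2*t" \<sigma> "1 - \<beta>"] s t \<beta> by (auto simp: indicator_def)
      then have "norm g * \<bar>indicator {0<..} \<sigma> * J (1 - \<beta>) \<sigma> s\<bar> \<le> norm g * (indicator {0<..} \<sigma> * (J_const (t/2) (2*t) * exp (- decay_rate * \<sigma>)))"
        by (rule mult_left_mono) simp
      then show "norm (J (1 - \<beta>) \<sigma> s *\<^sub>R orbit g \<sigma>) \<le> norm g * (indicator {0<..} \<sigma> * (J_const (t/2) (2*t) * exp (- decay_rate * \<sigma>)))"
        by (rule order_trans[OF norm_scaleR_orbit])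
    qed
    show "integrable lborel (\<lambda>\<sigma>. norm g * (indicator {0<..} \<sigma> * (J_const (t/2) (2*t) * exp (- decay_rate * \<sigma>))))"
      by (rule integrable_mult_right[OF integrable_decay])
  qed (use t in auto)
  have "((\<lambda>s. (s powr (1 - \<beta>) / ((1 - \<beta>) * Gamma (1 - \<beta>))) *\<^sub>R f\<^sub>0 + (LINT \<sigma>|lborel. J (2 - \<beta>) \<sigma> s *\<^sub>R orbit g \<sigma>)) has_vector_derivative
      (t powr (- \<beta>) / Gamma (1 - \<beta>)) *\<^sub>R f\<^sub>0 + (LINT \<sigma>|lborel. J (1 - \<beta>) \<sigma> t *\<^sub>R orbit g \<sigma>)) (at t)"
    by (intro has_vector_derivative_add bounded_linear.has_vector_derivative[OF bounded_linear_scaleR_left] 1 2)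
  then show "(RL_integral \<beta> u has_vector_derivative (t powr (- \<beta>) / Gamma (1 - \<beta>)) *\<^sub>R f\<^sub>0 + (LINT \<sigma>|lborel. J (1 - \<beta>) \<sigma> t *\<^sub>R orbit g \<sigma>)) (at t)"
    by (rule has_vector_derivative_transform_within_open[where S = "{0<..}"]) (use t RL_integral_u(2)[OF \<beta>] in auto)
qed

text \<open>After the Caputo correction only the integral with \<open>J (1 - \<beta>)\<close> is
  left. Fubini moves the \<mu>-integral inside, where it forms \<open>P t \<sigma>\<close>; for
  almost every positive \<sigma> this is \<open>p t \<sigma>\<close>, and the result is the formula
  of \<open>gen_u\<close>.\<close>

lemma distributed_derivative_u:
  assumes t: "0 < t"
  shows "has_distributed_derivative \<mu> u t (gen T (u t))"
proof -
  define H where "H \<beta> \<sigma> = J (1 - \<beta>) \<sigma> t *\<^sub>R orbit g \<sigma>" for \<beta> \<sigma>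
  define w where "w \<beta> = (t powr (- \<beta>) / Gamma (1 - \<beta>)) *\<^sub>R f\<^sub>0 + (LINT \<sigma>|lborel. H \<beta> \<sigma>)" for \<beta>
  have [measurable]: "p t \<in> borel_measurable borel" by (rule density_props(4)[OF t])
  interpret \<mu>l: pair_sigma_finite \<mu> lborel ..
  have Hm: "case_prod H \<in> borel_measurable (\<mu> \<Otimes>\<^sub>M lborel)" unfolding H_def by measurable
  let ?K = "\<lambda>\<sigma>. norm g * (indicator {0<..} \<sigma> * (J_const t t * exp (- decay_rate * \<sigma>)))"
  have bound: "norm (H \<beta> \<sigma>) \<le> ?K \<sigma>" if "\<beta> \<in> {b\<^sub>0..b\<^sub>1}" for \<beta> \<sigma>
  proof -
    have "\<bar>indicator {0<..} \<sigma> * J (1 - \<beta>) \<sigma> t\<bar> \<le> indicator {0<..} \<sigma> * (J_const t t * exp (- decay_rate * \<sigma>))"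
      using abs_J[of t t t \<sigma> "1 - \<beta>"] t supp_order[OF that] by (auto simp: indicator_def)
    then have "norm g * \<bar>indicator {0<..} \<sigma> * J (1 - \<beta>) \<sigma> t\<bar> \<le> ?K \<sigma>" by (rule mult_left_mono) simp
    then show ?thesis unfolding H_def by (rule order_trans[OF norm_scaleR_orbit])
  qed
  have Kint: "integrable lborel ?K" by (rule integrable_mult_right[OF integrable_decay])
  have i\<beta>: "integrable lborel (H \<beta>)" if "\<beta> \<in> {b\<^sub>0..b\<^sub>1}" for \<beta>
    unfolding H_def using t supp_order[OF that] by (intro integrable_orbit(1) integrable_J) auto
  have Hint: "integrable (\<mu> \<Otimes>\<^sub>M lborel) (case_prod H)"
  proof (rule \<mu>l.Fubini_integrable[OF Hm])
    show "AE \<beta> in \<mu>. integrable lborel (\<lambda>\<sigma>. case (\<beta>, \<sigma>) of (\<beta>, \<sigma>) \<Rightarrow> H \<beta> \<sigma>)"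
      using supp by eventually_elim (use i\<beta> in simp)
    show "integrable \<mu> (\<lambda>\<beta>. LINT \<sigma>|lborel. norm (case (\<beta>, \<sigma>) of (\<beta>, \<sigma>) \<Rightarrow> H \<beta> \<sigma>))"
    proof (rule integrable_const_bound)
      show "AE \<beta> in \<mu>. norm (LINT \<sigma>|lborel. norm (case (\<beta>, \<sigma>) of (\<beta>, \<sigma>) \<Rightarrow> H \<beta> \<sigma>)) \<le> (LINT \<sigma>|lborel. ?K \<sigma>)"
        using supp
      proof eventually_elim
        case (elim \<beta>)
        have "(LINT \<sigma>|lborel. norm (H \<beta> \<sigma>)) \<le> (LINT \<sigma>|lborel. ?K \<sigma>)"
          by (intro Bochner_Integration.integral_mono integrable_norm i\<beta> elim Kint bound)
        moreover have "0 \<le> (LINT \<sigma>|lborel. norm (H \<beta> \<sigma>))" by simp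
        ultimately show ?case by simp
      qed
      have nm: "(\<lambda>x. norm (case_prod H x)) \<in> borel_measurable (\<mu> \<Otimes>\<^sub>M lborel)" using Hm by measurable
      show "(\<lambda>\<beta>. LINT \<sigma>|lborel. norm (case (\<beta>, \<sigma>) of (\<beta>, \<sigma>) \<Rightarrow> H \<beta> \<sigma>)) \<in> borel_measurable \<mu>"
        using nm by (intro lborel.borel_measurable_lebesgue_integral) (simp add: case_prod_beta')
    qed
  qed
  have diff: "w \<beta> - (t powr (- \<beta>) / Gamma (1 - \<beta>)) *\<^sub>R u 0 = (LINT \<sigma>|lborel. H \<beta> \<sigma>)" for \<beta>
    by (simp add: w_def u_def)
  have i1: "integrable \<mu> (\<lambda>\<beta>. LINT \<sigma>|lborel. H \<beta> \<sigma>)" by (rule \<mu>l.integrable_fst[OF Hint])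
  have m1 [measurable]: "(\<lambda>\<beta>. LINT \<sigma>|lborel. H \<beta> \<sigma>) \<in> borel_measurable \<mu>" using i1 by (rule borel_measurable_integrable)
  have m2 [measurable]: "(\<lambda>\<beta>. indicator {0<..<1} \<beta> *\<^sub>R (LINT \<sigma>|lborel. H \<beta> \<sigma>)) \<in> borel_measurable \<mu>" by measurable
  have ind: "AE \<beta> in \<mu>. (LINT \<sigma>|lborel. H \<beta> \<sigma>) = indicator {0<..<1} \<beta> *\<^sub>R (LINT \<sigma>|lborel. H \<beta> \<sigma>)"
    using supp by eventually_elim (use b in auto)
  have si: "set_integrable \<mu> {0<..<1} (\<lambda>\<beta>. LINT \<sigma>|lborel. H \<beta> \<sigma>)"
    unfolding set_integrable_def using integrable_cong_AE[OF m1 m2 ind] i1 by simp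
  have "(LINT \<beta>:{0<..<1}|\<mu>. LINT \<sigma>|lborel. H \<beta> \<sigma>) = (LINT \<beta>|\<mu>. LINT \<sigma>|lborel. H \<beta> \<sigma>)"
    unfolding set_lebesgue_integral_def by (rule integral_cong_AE[OF m1 m2 ind, symmetric])
  also have "\<dots> = (LINT \<sigma>|lborel. LINT \<beta>|\<mu>. H \<beta> \<sigma>)" by (rule \<mu>l.Fubini_integral[OF Hint, symmetric])
  also have "\<dots> = (LINT \<sigma>|lborel. p t \<sigma> *\<^sub>R orbit g \<sigma>)"
  proof (rule integral_cong_AE)
    show "(\<lambda>\<sigma>. LINT \<beta>|\<mu>. H \<beta> \<sigma>) \<in> borel_measurable lborel"
      using \<mu>l.integrable_snd[OF Hint] by (rule borel_measurable_integrable)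
    have inner: "(LINT \<beta>|\<mu>. H \<beta> \<sigma>) = P t \<sigma> *\<^sub>R orbit g \<sigma>" if "0 < \<sigma>" for \<sigma>
    proof -
      have "integrable \<mu> (\<lambda>\<beta>. J (1 - \<beta>) \<sigma> t)"
      proof (rule integrable_const_bound)
        show "AE \<beta> in \<mu>. norm (J (1 - \<beta>) \<sigma> t) \<le> J_const t t * exp (- decay_rate * \<sigma>)"
          using supp by eventually_elim (use abs_J[of t t t \<sigma>] supp_order t that in auto)
      qed measurable
      then show ?thesis unfolding H_def P_def by (intro integral_scaleR_left) auto
    qed
    show "AE \<sigma> in lborel. (LINT \<beta>|\<mu>. H \<beta> \<sigma>) = p t \<sigma> *\<^sub>R orbit g \<sigma>"
      using p_eq_P[OF t]
    proof eventually_elim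
      case (elim \<sigma>)
      show ?case
      proof (cases "0 < \<sigma>")
        case True
        then show ?thesis using elim inner[OF True] by simp
      next
        case False
        then show ?thesis by (simp add: H_def orbit_def)
      qed
    qed
  qed measurable
  also have "\<dots> = gen T (u t)" by (rule gen_u(2)[OF t, symmetric])
  finally have val: "(LINT \<beta>:{0<..<1}|\<mu>. LINT \<sigma>|lborel. H \<beta> \<sigma>) = gen T (u t)" .
  have "AE \<beta> in \<mu>. \<beta> \<in> {0<..<1} \<longrightarrow> has_RL_derivative \<beta> u t (w \<beta>)"
    using RL_derivative_u[OF _ _ t] by (auto simp: w_def H_def)
  then show ?thesis
    unfolding has_distributed_derivative_def using si val by (intro exI[of _ w]) (simp add: diff)
qed

theorem solves_cauchy: "solves_distributed_cauchy \<mu> T f\<^sub>0 u"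
  unfolding solves_distributed_cauchy_def
  using u_initial gen_u(1) distributed_derivative_u by (simp add: u_def)

text \<open>Split at \<open>S\<close>: up to \<open>S\<close> the two functions of \<tau> differ by
  at most \<open>e\<close> and the density has mass 1; beyond \<open>S\<close> both are bounded by
  the norm of \<open>f\<^sub>0\<close>, and the remaining mass is \<open>J 1 S t\<close>.\<close>

lemma approximation_error:
  fixes a :: "real \<Rightarrow> real"
  assumes a: "(\<lambda>\<tau>. indicator {0<..} \<tau> * a \<tau>) \<in> borel_measurable borel" "\<And>\<tau>. 0 < \<tau> \<Longrightarrow> \<bar>a \<tau>\<bar> \<le> norm f\<^sub>0"
    and close: "\<And>\<tau>. 0 < \<tau> \<Longrightarrow> \<tau> \<le> S \<Longrightarrow> \<bar>a \<tau> - apply_c0 (T \<tau> f\<^sub>0) x\<bar> \<le> e" and S: "0 < S" and e: "0 \<le> e" and t: "0 < t"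
  shows "\<bar>(LINT \<tau>|lborel. indicator {0<..} \<tau> * a \<tau> * p t \<tau>) - apply_c0 (u t) x\<bar> \<le> e + 2 * norm f\<^sub>0 * J 1 S t"
proof -
  have [measurable]: "p t \<in> borel_measurable borel" by (rule density_props(4)[OF t])
  note p0 = density_props(2)[OF t]
  have k: "integrable lborel (\<lambda>\<tau>. indicator {0<..} \<tau> * p t \<tau>)" "(LINT \<tau>|lborel. indicator {0<..} \<tau> * p t \<tau>) = 1"
    using density_mass[OF t] by (simp_all add: has_bochner_integral_iff)
  have kS: "integrable lborel (\<lambda>\<tau>. indicator {S<..} \<tau> * p t \<tau>)" "(LINT \<tau>|lborel. indicator {S<..} \<tau> * p t \<tau>) = J 1 S t"
    using p_tail[of S t] S t by (simp_all add: has_bochner_integral_iff)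
  note i = integrable_orbit(1)[OF k(1), of f\<^sub>0]
  have ia: "integrable lborel (\<lambda>\<tau>. indicator {0<..} \<tau> * a \<tau> * p t \<tau>)"
  proof (rule Bochner_Integration.integrable_bound[OF integrable_mult_right[OF k(1), of "norm f\<^sub>0"]])
    show "AE \<tau> in lborel. norm (indicator {0<..} \<tau> * a \<tau> * p t \<tau>) \<le> norm (norm f\<^sub>0 * (indicator {0<..} \<tau> * p t \<tau>))"
      using a(2) p0 by (intro AE_I2) (auto simp: indicator_def abs_mult intro!: mult_right_mono)
  qed (use a(1) in measurable)
  have iu: "integrable lborel (\<lambda>\<tau>. apply_c0 (p t \<tau> *\<^sub>R orbit f\<^sub>0 \<tau>) x)" "apply_c0 (u t) x = (LINT \<tau>|lborel. apply_c0 (p t \<tau> *\<^sub>R orbit f\<^sub>0 \<tau>) x)"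
    using integrable_bounded_linear[OF bounded_linear_apply_c0 i] integral_bounded_linear[OF bounded_linear_apply_c0 i] t by (simp_all add: u_def)
  have "\<bar>(LINT \<tau>|lborel. indicator {0<..} \<tau> * a \<tau> * p t \<tau>) - apply_c0 (u t) x\<bar> =
      norm (LINT \<tau>|lborel. indicator {0<..} \<tau> * a \<tau> * p t \<tau> - apply_c0 (p t \<tau> *\<^sub>R orbit f\<^sub>0 \<tau>) x)"
    unfolding iu(2) Bochner_Integration.integral_diff[OF ia iu(1)] real_norm_def ..
  also have "\<dots> \<le> (LINT \<tau>|lborel. e * (indicator {0<..} \<tau> * p t \<tau>) + (2 * norm f\<^sub>0) * (indicator {S<..} \<tau> * p t \<tau>))"
  proof (rule Bochner_Integration.integral_norm_bound_integral)
    show "integrable lborel (\<lambda>\<tau>. indicator {0<..} \<tau> * a \<tau> * p t \<tau> - apply_c0 (p t \<tau> *\<^sub>R orbit f\<^sub>0 \<tau>) x)"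
      by (rule Bochner_Integration.integrable_diff[OF ia iu(1)])
    show "integrable lborel (\<lambda>\<tau>. e * (indicator {0<..} \<tau> * p t \<tau>) + (2 * norm f\<^sub>0) * (indicator {S<..} \<tau> * p t \<tau>))"
      by (intro Bochner_Integration.integrable_add integrable_mult_right k kS)
    show "norm (indicator {0<..} \<tau> * a \<tau> * p t \<tau> - apply_c0 (p t \<tau> *\<^sub>R orbit f\<^sub>0 \<tau>) x)
        \<le> e * (indicator {0<..} \<tau> * p t \<tau>) + (2 * norm f\<^sub>0) * (indicator {S<..} \<tau> * p t \<tau>)" for \<tau>
    proof (cases "0 < \<tau>")
      case True
      have eq: "indicator {0<..} \<tau> * a \<tau> * p t \<tau> - apply_c0 (p t \<tau> *\<^sub>R orbit f\<^sub>0 \<tau>) x = (a \<tau> - apply_c0 (T \<tau> f\<^sub>0) x) * p t \<tau>"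
        using True by (simp add: orbit_def algebra_simps)
      have "\<bar>a \<tau> - apply_c0 (T \<tau> f\<^sub>0) x\<bar> \<le> e + 2 * norm f\<^sub>0 * indicator {S<..} \<tau>"
      proof (cases "\<tau> \<le> S")
        case True
        then show ?thesis using close[of \<tau>] \<open>0 < \<tau>\<close> by simp
      next
        case False
        have "\<bar>apply_c0 (T \<tau> f\<^sub>0) x\<bar> \<le> norm f\<^sub>0"
          using apply_c0_le_norm[of "T \<tau> f\<^sub>0" x] contraction[of \<tau> f\<^sub>0] True by linarith
        then show ?thesis using a(2)[OF True] False e by simp
      qed
      then have "\<bar>a \<tau> - apply_c0 (T \<tau> f\<^sub>0) x\<bar> * p t \<tau> \<le> (e + 2 * norm f\<^sub>0 * indicator {S<..} \<tau>) * p t \<tau>"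
        using p0 by (rule mult_right_mono)
      moreover have "norm ((a \<tau> - apply_c0 (T \<tau> f\<^sub>0) x) * p t \<tau>) = \<bar>a \<tau> - apply_c0 (T \<tau> f\<^sub>0) x\<bar> * p t \<tau>"
        unfolding real_norm_def abs_mult using p0[of \<tau>] by simp
      ultimately show ?thesis unfolding eq using True by (simp add: distrib_right mult.assoc)
    next
      case False
      then show ?thesis using S by (simp add: orbit_def)
    qed
  qed
  also have "\<dots> = e * (LINT \<tau>|lborel. indicator {0<..} \<tau> * p t \<tau>) + (2 * norm f\<^sub>0) * (LINT \<tau>|lborel. indicator {S<..} \<tau> * p t \<tau>)"
    by (subst Bochner_Integration.integral_add) (use k(1) kS(1) in auto)
  finally show ?thesis unfolding k(2) kS(2) by simp
qed

end

section \<open>Choice of the contour angle and conclusion\<close>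

lemma emeasure_Compl_measure_support:
  fixes \<mu> :: "'a::second_countable_topology measure"
  assumes "sets \<mu> = sets borel"
  shows "emeasure \<mu> (- measure_support \<mu>) = 0" "open (- measure_support \<mu>)"
proof -
  let ?F = "{U. open U \<and> emeasure \<mu> U = 0}"
  have F: "- measure_support \<mu> = \<Union>?F"
    unfolding measure_support_def by (auto simp: not_less)
  \<comment> \<open>By Lindeloef's theorem countably many of the open null sets already cover the
    complement of the support.\<close>
  obtain F' where F': "F' \<subseteq> ?F" "countable F'" "\<Union>F' = \<Union>?F"
    by (rule Lindelof[of ?F]) auto
  have "(\<Union>U\<in>F'. U) \<in> null_sets \<mu>"
    using F'(1) assms by (intro null_sets_UN' F'(2)) (auto simp: null_sets_def)
  then show "emeasure \<mu> (- measure_support \<mu>) = 0" unfolding F F'(3)[symmetric] by (simp add: null_sets_def)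
  show "open (- measure_support \<mu>)" unfolding F by blast
qed

text \<open>The support is compact and not empty, so its extreme points \<open>b\<^sub>0\<close> and
  \<open>b\<^sub>1\<close> lie in the open unit interval. Since \<open>b\<^sub>1 < 1\<close>, there
  is room for \<theta> above pi/2 and below both pi and \<open>pi / (2 * b\<^sub>1)\<close>.\<close>

lemma order_mixture_exists:
  assumes \<mu>: "finite_measure \<mu>" "sets \<mu> = sets borel" "emeasure \<mu> (space \<mu>) \<noteq> 0" "measure_support \<mu> \<subseteq> {0<..<1}"
  obtains b\<^sub>0 b\<^sub>1 \<theta> where "order_mixture \<mu> b\<^sub>0 b\<^sub>1 \<theta>"
proof -
  let ?S = "measure_support \<mu>"
  note compl = emeasure_Compl_measure_support[OF \<mu>(2)]
  have space: "space \<mu> = UNIV" using sets_eq_imp_space_eq[OF \<mu>(2)] by simp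
  have ne: "?S \<noteq> {}" using compl(1) \<mu>(3) space by auto
  have "closed ?S" using compl(2) by (simp add: closed_def)
  moreover have "\<forall>\<beta>\<in>?S. norm \<beta> \<le> 1" using \<mu>(4) by auto
  then have "bounded ?S" unfolding bounded_iff by blast
  ultimately have "compact ?S" by (simp add: compact_eq_bounded_closed)
  then obtain b\<^sub>0 b\<^sub>1 where b: "b\<^sub>0 \<in> ?S" "b\<^sub>1 \<in> ?S" "\<And>\<beta>. \<beta> \<in> ?S \<Longrightarrow> b\<^sub>0 \<le> \<beta>" "\<And>\<beta>. \<beta> \<in> ?S \<Longrightarrow> \<beta> \<le> b\<^sub>1"
    using compact_attains_inf[OF _ ne] compact_attains_sup[OF _ ne] by metis
  then have b01: "0 < b\<^sub>0" "b\<^sub>0 \<le> b\<^sub>1" "b\<^sub>1 < 1" using \<mu>(4) by auto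
  have "pi / 2 < min pi (pi / (2 * b\<^sub>1))" using b01 by (simp add: field_simps)
  then obtain \<theta> where \<theta>: "pi / 2 < \<theta>" "\<theta> < min pi (pi / (2 * b\<^sub>1))" using dense by blast
  then have \<theta>': "\<theta> < pi" "b\<^sub>1 * \<theta> < pi / 2" using b01 by (simp_all add: field_simps)
  have ae: "AE \<beta> in \<mu>. \<beta> \<in> {b\<^sub>0..b\<^sub>1}"
  proof (rule AE_I[OF _ compl(1)])
    show "{\<beta> \<in> space \<mu>. \<beta> \<notin> {b\<^sub>0..b\<^sub>1}} \<subseteq> - ?S" using b(3,4) by auto
    show "- ?S \<in> sets \<mu>" using compl(2) \<mu>(2) by simp
  qed
  show thesis
    by (rule that) (rule order_mixture.intro[OF \<mu>(1-3) b01 ae \<theta>(1) \<theta>'])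
qed

context diffusion_coefficients
begin

text \<open>The two integrands can differ only at \<tau> = 0, where the Gaussian density
  degenerates; for measurability the value at that point is split off.\<close>

lemma feynman_approx_eq:
  assumes n: "0 < n" and [measurable]: "p t \<in> borel_measurable borel"
  shows "feynman_approx A B C p (apply_c0 \<phi>) n t x\<^sub>0 =
    (LINT \<tau>|lborel. indicator {0<..} \<tau> * apply_c0 ((gauss_step (\<tau> / real n) ^^ n) \<phi>) x\<^sub>0 * p t \<tau>)"
proof -
  let ?I = "\<lambda>\<tau>. LINT x|(\<Pi>\<^sub>M j\<in>{1..n}. lborel). path_integrand A B C (apply_c0 \<phi>) n \<tau> (x(0 := x\<^sub>0)) * p t \<tau>"
  have e: "indicator {0..} \<tau> *\<^sub>R ?I \<tau> = indicator {0<..} \<tau> * apply_c0 ((gauss_step (\<tau> / real n) ^^ n) \<phi>) x\<^sub>0 * p t \<tau>"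
    if "\<tau> \<noteq> 0" for \<tau>
    using integral_path_integrand[of \<tau> n \<phi> x\<^sub>0 "p t \<tau>"] that n by (cases "0 < \<tau>") (simp_all del: fun_upd_apply)
  have "(\<lambda>\<tau>. indicator {0..} \<tau> *\<^sub>R ?I \<tau>) =
      (\<lambda>\<tau>. if \<tau> = 0 then ?I 0 else indicator {0<..} \<tau> * apply_c0 ((gauss_step (\<tau> / real n) ^^ n) \<phi>) x\<^sub>0 * p t \<tau>)"
  proof
    fix \<tau> :: real
    show "indicator {0..} \<tau> *\<^sub>R ?I \<tau> =
      (if \<tau> = 0 then ?I 0 else indicator {0<..} \<tau> * apply_c0 ((gauss_step (\<tau> / real n) ^^ n) \<phi>) x\<^sub>0 * p t \<tau>)"
    proof (cases "\<tau> = 0")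
      case True
      then show ?thesis by (simp del: fun_upd_apply)
    next
      case False
      then show ?thesis using e[OF False] by (simp only: if_False)
    qed
  qed
  moreover note [measurable] = measurable_gauss_step_iterate[of n \<phi> x\<^sub>0]
  have "(\<lambda>\<tau>. if \<tau> = 0 then ?I 0 else indicator {0<..} \<tau> * apply_c0 ((gauss_step (\<tau> / real n) ^^ n) \<phi>) x\<^sub>0 * p t \<tau>) \<in> borel_measurable lborel"
    by measurable
  ultimately have m: "(\<lambda>\<tau>. indicator {0..} \<tau> *\<^sub>R ?I \<tau>) \<in> borel_measurable lborel" by simp
  have ae: "AE \<tau> in lborel. indicator {0..} \<tau> *\<^sub>R ?I \<tau> = indicator {0<..} \<tau> * apply_c0 ((gauss_step (\<tau> / real n) ^^ n) \<phi>) x\<^sub>0 * p t \<tau>"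
    using AE_lborel_singleton[of "0::real"] by eventually_elim (rule e)
  show ?thesis
    unfolding feynman_approx_def set_lebesgue_integral_def by (rule integral_cong_AE[OF m _ ae]) measurable
qed

end

theorem proposition4p2:
  fixes T :: "real \<Rightarrow> (real^'d::finite) c0fun \<Rightarrow> (real^'d) c0fun"
    and A :: "real^'d \<Rightarrow> real^'d^'d"
    and B :: "real^'d \<Rightarrow> real^'d"
    and C :: "real^'d \<Rightarrow> real"
    and a\<^sub>0 A\<^sub>0 \<alpha> :: real
    and f\<^sub>0 :: "(real^'d) c0fun"
    and \<mu> :: "real measure"
    and M :: "'w measure"
    and D :: "real \<Rightarrow> 'w \<Rightarrow> real"
    and p :: "real \<Rightarrow> real \<Rightarrow> real"
  assumes feller: "feller_semigroup T"
    and generator: "\<And>\<phi>. \<phi> \<in> C0_2 \<Longrightarrow>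
          \<phi> \<in> gen_dom T \<and> (\<forall>x. apply_c0 (gen T \<phi>) x = diff_op A B C (apply_c0 \<phi>) x)"
    and C_nonneg: "\<And>x. C x \<ge> 0"
    and A_symmetric: "\<And>x. transpose (A x) = A x"
    and bounded_coeffs: "bounded (range A)" "bounded (range B)" "bounded (range C)"
    and continuous_coeffs: "continuous_on UNIV A" "continuous_on UNIV B" "continuous_on UNIV C"
    and elliptic: "0 < a\<^sub>0" "a\<^sub>0 \<le> A\<^sub>0"
          "\<And>x z. a\<^sub>0 * (norm z)\<^sup>2 \<le> z \<bullet> (A x *v z) \<and> z \<bullet> (A x *v z) \<le> A\<^sub>0 * (norm z)\<^sup>2"
    and core: "0 < \<alpha>" "\<alpha> < 1" "is_core (Cc_2_Hoelder \<alpha>) T"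
    and f0_dom: "f\<^sub>0 \<in> gen_dom T"
    and \<mu>: "finite_measure \<mu>" "sets \<mu> = sets borel" "emeasure \<mu> (space \<mu>) \<noteq> 0"
          "measure_support \<mu> \<subseteq> {0<..<1}"
    and D: "subordinator_of \<mu> M D"
    and p: "is_inverse_density M D p"
  shows "\<exists>u :: real \<Rightarrow> (real^'d) c0fun.
     (\<forall>t>0. \<forall>x\<^sub>0. (\<lambda>n. feynman_approx A B C p (apply_c0 f\<^sub>0) n t x\<^sub>0) \<longlonglongrightarrow> apply_c0 (u t) x\<^sub>0) \<and>
     solves_distributed_cauchy \<mu> T f\<^sub>0 u \<and>
     (\<forall>tmax>0. uniform_limit ({0<..tmax} \<times> UNIV)
        (\<lambda>n (t, x\<^sub>0). feynman_approx A B C p (apply_c0 f\<^sub>0) n t x\<^sub>0)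
        (\<lambda>(t, x\<^sub>0). apply_c0 (u t) x\<^sub>0) sequentially)"
proof -
  interpret dc: diffusion_coefficients A B C a\<^sub>0 A\<^sub>0
    using C_nonneg A_symmetric bounded_coeffs continuous_coeffs elliptic by unfold_locales
  interpret contraction_semigroup T by (rule feller_contraction[OF feller])
  interpret ch: chernoff T dc.gauss_step "Cc_2_Hoelder \<alpha>"
  proof (rule chernoff.intro[OF contraction_semigroup_axioms chernoff_axioms.intro])
    show "contraction_step (dc.gauss_step h) h" if "0 < h" for h
      using that by (rule dc.contraction_gauss_step)
    show "((\<lambda>h. (dc.gauss_step h \<phi> - \<phi>) /\<^sub>R h) \<longlongrightarrow> gen T \<phi>) (at_right 0)" if "\<phi> \<in> Cc_2_Hoelder \<alpha>" for \<phi>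
      using generator[of \<phi>] that Cc_2_Hoelder_subset_C0_2[of \<alpha>]
      by (intro dc.gauss_step_consistent[OF that core(1,2)]) blast
  qed (rule core(3))
  obtain b\<^sub>0 b\<^sub>1 \<theta> where "order_mixture \<mu> b\<^sub>0 b\<^sub>1 \<theta>"
    by (rule order_mixture_exists[OF \<mu>])
  then interpret om: order_mixture \<mu> b\<^sub>0 b\<^sub>1 \<theta> .
  interpret tc: time_changed_semigroup T \<mu> b\<^sub>0 b\<^sub>1 \<theta> M D p f\<^sub>0
    using D p f0_dom by unfold_locales
  let ?approx = "feynman_approx A B C p (apply_c0 f\<^sub>0)"
  have unif: "uniform_limit ({0<..tmax} \<times> UNIV) (\<lambda>n (t, x\<^sub>0). ?approx n t x\<^sub>0) (\<lambda>(t, x\<^sub>0). apply_c0 (tc.u t) x\<^sub>0) sequentially"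
    if tmax: "0 < tmax" for tmax
    unfolding uniform_limit_iff
  proof (intro allI impI)
    fix e :: real assume e: "0 < e"
    \<comment> \<open>The added 1 permits the division by \<open>K\<close> also for
      \<open>f\<^sub>0 = 0\<close>.\<close>
    define K where "K = norm f\<^sub>0 + 1"
    have K: "0 < K" "norm f\<^sub>0 \<le> K" by (auto simp: K_def add_nonneg_pos)
    \<comment> \<open>The cut-off is chosen for the largest time only; monotonicity of the tails in
      t makes it serve all smaller times.\<close>
    have "\<forall>\<^sub>F S in at_top. 0 < S \<and> om.J 1 S tmax < e / (4 * K)"
      using eventually_conj[OF eventually_gt_at_top[of 0] order_tendstoD(2)[OF tc.tendsto_J_1[OF tmax], of "e / (4 * K)"]] e K by simp
    then obtain S where S: "0 < S" "om.J 1 S tmax < e / (4 * K)"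
      using eventually_happens'[OF trivial_limit_at_top_linorder] by blast
    have tail: "2 * norm f\<^sub>0 * om.J 1 S t \<le> e / 2" if "0 < t" "t \<le> tmax" for t
    proof -
      have "om.J 1 S t \<le> e / (4 * K)" using tc.J_1_mono[of S t tmax] S that by simp
      then have "2 * norm f\<^sub>0 * om.J 1 S t \<le> 2 * K * (e / (4 * K))"
        using tc.J_1_bounds(1)[of S t] S(1) that K by (intro mult_mono) auto
      then show ?thesis using K by simp
    qed
    obtain N where N: "N > 0" "\<And>n \<tau>. n \<ge> N \<Longrightarrow> \<tau> \<in> {0<..S} \<Longrightarrow> norm ((dc.gauss_step (\<tau> / real n) ^^ n) f\<^sub>0 - T \<tau> f\<^sub>0) \<le> e / 4"
      using ch.convergence[OF f0_dom _ S(1), of "e / 4"] e by auto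
    show "\<forall>\<^sub>F n in sequentially. \<forall>z\<in>{0<..tmax} \<times> UNIV. dist (case z of (t, x\<^sub>0) \<Rightarrow> ?approx n t x\<^sub>0) (case z of (t, x\<^sub>0) \<Rightarrow> apply_c0 (tc.u t) x\<^sub>0) < e"
      using eventually_ge_at_top[of N]
    proof eventually_elim
      case (elim n)
      then have n: "0 < n" using N(1) by simp
      have "\<bar>?approx n t x - apply_c0 (tc.u t) x\<bar> < e" if t: "0 < t" "t \<le> tmax" for t x
      proof -
        have "\<bar>?approx n t x - apply_c0 (tc.u t) x\<bar> \<le> e / 4 + 2 * norm f\<^sub>0 * om.J 1 S t"
          unfolding dc.feynman_approx_eq[of n p t, OF n tc.density_props(4)[OF t(1)]]
        proof (rule tc.approximation_error[OF dc.measurable_gauss_step_iterate])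
          fix \<tau> :: real assume \<tau>: "0 < \<tau>"
          interpret contraction_step "dc.gauss_step (\<tau> / real n)" "\<tau> / real n"
            using \<tau> n by (intro dc.contraction_gauss_step) simp
          show "\<bar>apply_c0 ((dc.gauss_step (\<tau> / real n) ^^ n) f\<^sub>0) x\<bar> \<le> norm f\<^sub>0"
            by (rule order_trans[OF apply_c0_le_norm pow_contraction])
          show "\<bar>apply_c0 ((dc.gauss_step (\<tau> / real n) ^^ n) f\<^sub>0) x - apply_c0 (T \<tau> f\<^sub>0) x\<bar> \<le> e / 4" if "\<tau> \<le> S"
            using N(2)[OF elim, of \<tau>] \<tau> that apply_c0_le_norm[of "(dc.gauss_step (\<tau> / real n) ^^ n) f\<^sub>0 - T \<tau> f\<^sub>0" x] by simp
        qed (use S(1) e t(1) in auto)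
        then show ?thesis using tail[OF t] e by linarith
      qed
      then show ?case by (auto simp: dist_real_def)
    qed
  qed
  \<comment> \<open>Pointwise convergence at time t is read off from uniform convergence up to
    t.\<close>
  have "(\<lambda>n. ?approx n t x\<^sub>0) \<longlonglongrightarrow> apply_c0 (tc.u t) x\<^sub>0" if "0 < t" for t x\<^sub>0
    using tendsto_uniform_limitI[OF unif[OF that], of "(t, x\<^sub>0)"] that by simp
  with unif tc.solves_cauchy show ?thesis by (intro exI[of _ tc.u]) auto
qed

end
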